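(* Let $\mathcal G$ be a graph-of-groups and let $H:\mathcal G\to\mathcal G$ be a partial Dehn twist relative to a subset $\mathcal V$ of vertices of $\mathcal G$. Assume for some $v\in\mathcal V$ that the vertex group $G_v$ is free and that $H_v:G_v\to G_v$ is a Dehn twist automorphism. If there is an edge $e$ of $\mathcal G$ (with $\tau(e)=v$) with correction term $\delta_e=\delta(e)\in G_v$ that is not $H_v$-zero, then the automorphism $H_*:\pi_1\mathcal G\to\pi_1\mathcal G$ has at least quadratic growth.
   Context: Graphs-of-groups. Graphs are finite, non-empty, connected, in the sense of Serre; each edge $e$ has an inverse $\bar e$, terminal vertex $\tau(e)$ and initial vertex $\tau(\bar e)$. A graph-of-groups $\mathcal G$ consists of a graph $\Gamma$, vertex groups $G_v$, edge groups $G_e=G_{\bar e}$ and injective homomorphisms $f_e:G_e\to G_{\tau(e)}$. All vertex and edge groups are assumed finitely generated. The path group $\Pi(\mathcal G)$ is generated by all $G_v$ and stable letters $t_e$ subject to the relations of the $G_v$, $t_{\bar e}=t_e^{-1}$ and $f_{\bar e}(g)=t_ef_e(g)t_e^{-1}$ for $g\in G_e$. A word $r_0t_{e_1}r_1\cdots t_{e_q}r_q$ (each $r_i$ in the free product of the vertex groups) has path length $q$; it is reduced if for $q=0$ it is non-trivial and for $q>0$, whenever $t_{e_i}=t_{e_{i+1}}^{-1}$, $r_i\notin f_{e_i}(G_{e_i})$. The path length $\|w\|_{\mathcal G}$ of $w\in\Pi(\mathcal G)$ is that of any reduced word representing $w$ ($0$ if $w=1$). A word is connected if $r_0\in G_{\tau(\bar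 e_1)}$, $r_i\in G_{\tau(e_i)}$ and $\tau(e_i)=\tau(\bar e_{i+1})$ for all relevant $i$; $\pi_1(\mathcal G,v_0)\subset\Pi(\mathcal G)$ consists of the elements given by closed connected words issued at $v_0$, and one writes $\pi_1\mathcal G$ when the base vertex $v_0$ is immaterial. Isomorphisms. An automorphism $H$ of $\mathcal G$ consists of a graph automorphism $H_\Gamma$, group isomorphisms $H_v:G_v\to G_{H_\Gamma(v)}$ and $H_e=H_{\bar e}:G_e\to G_{H_\Gamma(e)}$, and correction terms $\delta(e)\in G_{\tau(H_\Gamma(e))}$ with $H_{\tau(e)}f_e=\mathrm{ad}_{\delta(e)}f_{H_\Gamma(e)}H_e$, where $\mathrm{ad}_g(x)=gxg^{-1}$. It induces $H_*:\Pi(\mathcal G)\to\Pi(\mathcal G)$ by $H_*(g)=H_v(g)$ for $g\in G_v$ and $H_*(t_e)=\delta(\bar e)t_{H_\Gamma(e)}\delta(e)^{-1}$; if $H_\Gamma=\mathrm{id}$ it restricts to automorphisms $H_{*v_0}$ of $\pi_1(\mathcal G,v_0)$, also written $H_*:\pi_1\mathcal G\to\pi_1\mathcal G$. An element $w\in\Pi(\mathcal G)$ is $H$-zero if $\min\{\|g\,w\,H_*(g)^{-1}\|_{\mathcal G}: g\in\Pi(\mathcal G)\}=0$. Partial Dehn twists. $H:\mathcal G\to\mathcal G$ is a partial Dehn twist relative to a set $\mathcal V$ of vertices if: $G_e$ is trivial for every edge $e$ with $\tau(e)\in\mathcal V$; $H_\Gamma=\mathrm{id}$; $H_v=\mathrm{id}$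 for all $v\notin\mathcal V$; $H_e=\mathrm{id}$ for all $e$; and $\delta(e)$ lies in the centralizer of $f_e(G_e)$ in $G_{\tau(e)}$ for every $e$ (no restriction on $H_v$ for $v\in\mathcal V$). Dehn twists. A (classical) Dehn twist $D$ of a graph-of-groups is an automorphism with $D_\Gamma=\mathrm{id}$, all $D_v=\mathrm{id}$, all $D_e=\mathrm{id}$, and $\delta(e)=f_e(\gamma_e)$ with $\gamma_e\in Z(G_e)$ (the center). Its twistors are $z_e=\gamma_{\bar e}\gamma_e^{-1}$. A group automorphism $\phi:G\to G$ is a Dehn twist automorphism if $\phi=\theta^{-1}\circ D_{*u}\circ\theta$ for some Dehn twist $D:\mathcal H\to\mathcal H$, some vertex $u$ of $\mathcal H$ and some isomorphism $\theta:G\to\pi_1(\mathcal H,u)$. A Dehn twist $D$ of a graph-of-groups with free fundamental group of finite rank $\ge2$ is efficient if: (1) for each valence-one vertex $v=\tau(e)$, $f_e$ is not surjective; (2) there is no valence-two vertex $v=\tau(e_1)=\tau(e_2)$, $e_1\ne e_2$, with both $f_{e_1},f_{e_2}$ surjective; (3) for every $e$, $r^p\in f_e(G_e)$ with $p\ne0$ implies $r\in f_e(G_e)$; (4) $z_e\ne1$ for every $e$; (5) no two distinct edges $e_1,e_2$ with common terminal vertex $v$ are positively bonded, i.e. there are no $n_1,n_2\ge1$ with $f_{e_1}(z_{e_1}^{n_1})$ and $f_{e_2}(z_{e_2}^{n_2})$ conjugate in $G_v$. Convention: a Dehn twist automorphism $\phi:G\to G$ of a free group $G$ (of finite rank $\ge2$)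 given without a specified representative is always assumed to be represented by an efficient Dehn twist $D:\mathcal H\to\mathcal H$, meaning that $\phi=\theta^{-1}\circ D_{*u}\circ\theta$ for some vertex $u$ of $\mathcal H$ and some isomorphism $\theta:G\to\pi_1(\mathcal H,u)$; an element $w$ is then $\phi$-zero if $\theta(w)$ is $D$-zero for some such efficient representative (this is independent of the choice). "$H_v$-zero" is meant in this sense. Growth. An automorphism $\phi$ of a finitely generated group has at least quadratic growth if for some element $g$ the word length $|\phi^n(g)|$ (with respect to any finite generating set) is bounded below, as a function of $n\in\mathbb N$, by a polynomial of degree $2$ in $n$ with positive leading coefficient.
   Formalization: Proved with δ(e)^{-1} (not δ(e)) assumed not H_v-zero: with the stated conventions the printed form is false. Growth is shown at base vertex τ(ē) and at each base vertex where some element of π_1 needs e; it can fail at others. Efficient representatives are taken with carriers in ℕ. *)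

theory Defs
  imports
    "HOL-Algebra.Generated_Groups"
    "HOL-Computational_Algebra.Polynomial"
    "Graph_Theory.Bidirected_Digraph"
    "Graph_Theory.Digraph_Component"
begin

section \<open>Words, finite generation, free groups, growth\<close>

text \<open>A letter \<open>(x, True)\<close> stands for \<open>x\<close> and \<open>(x, False)\<close> for its inverse.\<close>

definition word_value :: "('a, 'm) monoid_scheme \<Rightarrow> ('a \<times> bool) list \<Rightarrow> 'a" where
  "word_value G w =
     foldr (\<lambda>(x, b) y. (if b then x else inv\<^bsub>G\<^esub> x) \<otimes>\<^bsub>G\<^esub> y) w \<one>\<^bsub>G\<^esub>"

definition freely_reduced :: "('a \<times> bool) list \<Rightarrow> bool" where
  "freely_reduced w \<longleftrightarrow> successively (\<lambda>s t. fst s = fst t \<longrightarrow> snd s = snd t) w"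

definition generating_set :: "('a, 'm) monoid_scheme \<Rightarrow> 'a set \<Rightarrow> bool" where
  "generating_set G S \<longleftrightarrow> S \<subseteq> carrier G \<and> generate G S = carrier G"

definition finitely_generated :: "('a, 'm) monoid_scheme \<Rightarrow> bool" where
  "finitely_generated G \<longleftrightarrow> (\<exists>S. finite S \<and> generating_set G S)"

definition free_basis :: "('a, 'm) monoid_scheme \<Rightarrow> 'a set \<Rightarrow> bool" where
  "free_basis G X \<longleftrightarrow> generating_set G X \<and>
     (\<forall>w. w \<noteq> [] \<and> fst ` set w \<subseteq> X \<and> freely_reduced w \<longrightarrow> word_value G w \<noteq> \<one>\<^bsub>G\<^esub>)"

definition free_group :: "('a, 'm) monoid_scheme \<Rightarrow> bool" where
  "free_group G \<longleftrightarrow> group G \<and> (\<exists>X. free_basis G X)"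

definition free_group_finite_rank_ge2 :: "('a, 'm) monoid_scheme \<Rightarrow> bool" where
  "free_group_finite_rank_ge2 G \<longleftrightarrow>
     group G \<and> (\<exists>X. free_basis G X \<and> finite X \<and> card X \<ge> 2)"

definition center :: "('a, 'm) monoid_scheme \<Rightarrow> 'a set" where
  "center G = {x \<in> carrier G. \<forall>y \<in> carrier G. x \<otimes>\<^bsub>G\<^esub> y = y \<otimes>\<^bsub>G\<^esub> x}"

definition centralizer :: "('a, 'm) monoid_scheme \<Rightarrow> 'a set \<Rightarrow> 'a set" where
  "centralizer G S = {x \<in> carrier G. \<forall>y \<in> S. x \<otimes>\<^bsub>G\<^esub> y = y \<otimes>\<^bsub>G\<^esub> x}"

definition ad :: "('a, 'm) monoid_scheme \<Rightarrow> 'a \<Rightarrow> 'a \<Rightarrow> 'a" where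
  "ad G g x = g \<otimes>\<^bsub>G\<^esub> x \<otimes>\<^bsub>G\<^esub> inv\<^bsub>G\<^esub> g"

definition word_length :: "('a, 'm) monoid_scheme \<Rightarrow> 'a set \<Rightarrow> 'a \<Rightarrow> nat" where
  "word_length G S g = (LEAST n. \<exists>w. length w = n \<and> fst ` set w \<subseteq> S \<and> word_value G w = g)"

definition at_least_quadratic_growth :: "('a, 'm) monoid_scheme \<Rightarrow> ('a \<Rightarrow> 'a) \<Rightarrow> bool" where
  "at_least_quadratic_growth G \<phi> \<longleftrightarrow> finitely_generated G \<and>
     (\<exists>g \<in> carrier G. \<forall>S. finite S \<and> generating_set G S \<longrightarrow>
        (\<exists>p :: real poly. degree p = 2 \<and> lead_coeff p > 0 \<and>
           (\<forall>n. poly p (real n) \<le> real (word_length G S ((\<phi> ^^ n) g)))))"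


section \<open>Monoid presentations\<close>

inductive_set word_cong :: "'x set \<Rightarrow> ('x list \<times> 'x list) set \<Rightarrow> ('x list \<times> 'x list) set"
  for A R where
  rel: "\<lbrakk>(u, w) \<in> R; x \<in> lists A; y \<in> lists A\<rbrakk> \<Longrightarrow> (x @ u @ y, x @ w @ y) \<in> word_cong A R"
| refl: "x \<in> lists A \<Longrightarrow> (x, x) \<in> word_cong A R"
| sym: "(x, y) \<in> word_cong A R \<Longrightarrow> (y, x) \<in> word_cong A R"
| trans: "\<lbrakk>(x, y) \<in> word_cong A R; (y, z) \<in> word_cong A R\<rbrakk> \<Longrightarrow> (x, z) \<in> word_cong A R"

definition presented_monoid :: "'x set \<Rightarrow> ('x list \<times> 'x list) set \<Rightarrow> 'x list set monoid" where
  "presented_monoid A R =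
     \<lparr>carrier = lists A // word_cong A R,
      monoid.mult = (\<lambda>X Y. \<Union>x \<in> X. \<Union>y \<in> Y. word_cong A R `` {x @ y}),
      one = word_cong A R `` {[]}\<rparr>"


section \<open>Graphs of groups\<close>

text \<open>
  Serre graphs are bidirected digraphs: \<open>ebar\<close> is the inversion of edges, and the
  terminal (initial) vertex of an edge is its \<^const>\<open>head\<close> (\<^const>\<open>tail\<close>).
\<close>

record ('v, 'e, 'a, 'b) gog =
  graph :: "('v, 'e) pre_digraph"
  ebar :: "'e \<Rightarrow> 'e"
  vgrp :: "'v \<Rightarrow> 'a monoid"
  egrp :: "'e \<Rightarrow> 'b monoid"
  emap :: "'e \<Rightarrow> 'b \<Rightarrow> 'a"

abbreviation gverts :: "('v, 'e, 'a, 'b) gog \<Rightarrow> 'v set" where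
  "gverts \<GG> \<equiv> verts (graph \<GG>)"
abbreviation gedges :: "('v, 'e, 'a, 'b) gog \<Rightarrow> 'e set" where
  "gedges \<GG> \<equiv> arcs (graph \<GG>)"
abbreviation tau :: "('v, 'e, 'a, 'b) gog \<Rightarrow> 'e \<Rightarrow> 'v" where
  "tau \<GG> \<equiv> head (graph \<GG>)"

text \<open>Edges come with their inverses, so strong connectedness is connectedness.\<close>

definition graph_of_groups :: "('v, 'e, 'a, 'b) gog \<Rightarrow> bool" where
  "graph_of_groups \<GG> \<longleftrightarrow>
     fin_digraph (graph \<GG>) \<and> bidirected_digraph (graph \<GG>) (ebar \<GG>) \<and>
     strongly_connected (graph \<GG>) \<and>
     (\<forall>v \<in> gverts \<GG>. group (vgrp \<GG> v) \<and> finitely_generated (vgrp \<GG> v)) \<and>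
     (\<forall>e \<in> gedges \<GG>.
        group (egrp \<GG> e) \<and> finitely_generated (egrp \<GG> e) \<and>
        egrp \<GG> (ebar \<GG> e) = egrp \<GG> e \<and>
        emap \<GG> e \<in> mon (egrp \<GG> e) (vgrp \<GG> (tau \<GG> e)))"

datatype ('v, 'e, 'a) letter = Elt 'v 'a | Stable 'e

definition vletters :: "('v, 'e, 'a, 'b) gog \<Rightarrow> ('v, 'e, 'a) letter set" where
  "vletters \<GG> = {Elt v g | v g. v \<in> gverts \<GG> \<and> g \<in> carrier (vgrp \<GG> v)}"

definition letters :: "('v, 'e, 'a, 'b) gog \<Rightarrow> ('v, 'e, 'a) letter set" where
  "letters \<GG> = vletters \<GG> \<union> Stable ` gedges \<GG>"

definition vrels ::
  "('v, 'e, 'a, 'b) gog \<Rightarrow> (('v, 'e, 'a) letter list \<times> ('v, 'e, 'a) letter list) set" where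
  "vrels \<GG> =
     {([Elt v \<one>\<^bsub>vgrp \<GG> v\<^esub>], []) | v. v \<in> gverts \<GG>} \<union>
     {([Elt v g, Elt v h], [Elt v (g \<otimes>\<^bsub>vgrp \<GG> v\<^esub> h)]) | v g h.
        v \<in> gverts \<GG> \<and> g \<in> carrier (vgrp \<GG> v) \<and> h \<in> carrier (vgrp \<GG> v)}"

definition erels ::
  "('v, 'e, 'a, 'b) gog \<Rightarrow> (('v, 'e, 'a) letter list \<times> ('v, 'e, 'a) letter list) set" where
  "erels \<GG> =
     {([Stable e, Stable (ebar \<GG> e)], []) | e. e \<in> gedges \<GG>} \<union>
     {([Stable e, Elt (tau \<GG> e) (emap \<GG> e g), Stable (ebar \<GG> e)],
       [Elt (tau \<GG> (ebar \<GG> e)) (emap \<GG> (ebar \<GG> e) g)]) | e g.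
        e \<in> gedges \<GG> \<and> g \<in> carrier (egrp \<GG> e)}"

text \<open>Equality in the free product of the vertex groups.\<close>

definition free_product_cong ::
  "('v, 'e, 'a, 'b) gog \<Rightarrow> (('v, 'e, 'a) letter list \<times> ('v, 'e, 'a) letter list) set" where
  "free_product_cong \<GG> = word_cong (vletters \<GG>) (vrels \<GG>)"

definition path_cong ::
  "('v, 'e, 'a, 'b) gog \<Rightarrow> (('v, 'e, 'a) letter list \<times> ('v, 'e, 'a) letter list) set" where
  "path_cong \<GG> = word_cong (letters \<GG>) (vrels \<GG> \<union> erels \<GG>)"

definition path_group :: "('v, 'e, 'a, 'b) gog \<Rightarrow> ('v, 'e, 'a) letter list set monoid" where
  "path_group \<GG> = presented_monoid (letters \<GG>) (vrels \<GG> \<union> erels \<GG>)"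

text \<open>
  The words \<open>r\<^sub>0 t\<^sub>1 r\<^sub>1 \<dots> t\<^sub>q r\<^sub>q\<close> are kept flat: each \<open>r\<^sub>i\<close> is a
  maximal block of letters from vertex groups.
\<close>

definition word_path_length :: "('v, 'e, 'a) letter list \<Rightarrow> nat" where
  "word_path_length w = length (filter (\<lambda>l. l \<in> range Stable) w)"

definition reduced_word :: "('v, 'e, 'a, 'b) gog \<Rightarrow> ('v, 'e, 'a) letter list \<Rightarrow> bool" where
  "reduced_word \<GG> w \<longleftrightarrow> w \<in> lists (letters \<GG>) \<and>
     (word_path_length w = 0 \<longrightarrow> (w, []) \<notin> free_product_cong \<GG>) \<and>
     (\<forall>x e r y. w = x @ Stable e # r @ Stable (ebar \<GG> e) # y \<and> r \<in> lists (vletters \<GG>) \<longrightarrow>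
        (\<forall>g \<in> carrier (egrp \<GG> e).
           (r, [Elt (tau \<GG> e) (emap \<GG> e g)]) \<notin> free_product_cong \<GG>))"

definition path_length :: "('v, 'e, 'a, 'b) gog \<Rightarrow> ('v, 'e, 'a) letter list set \<Rightarrow> nat" where
  "path_length \<GG> X =
     (if X = \<one>\<^bsub>path_group \<GG>\<^esub> then 0
      else (THE q. \<exists>w \<in> X. reduced_word \<GG> w \<and> word_path_length w = q))"

fun path_word ::
  "('v, 'e, 'a, 'b) gog \<Rightarrow> 'v \<Rightarrow> ('v, 'e, 'a) letter list \<Rightarrow> 'v \<Rightarrow> bool" where
  "path_word \<GG> u [] v \<longleftrightarrow> u = v"
| "path_word \<GG> u (Elt x g # w) v \<longleftrightarrow> x = u \<and> path_word \<GG> u w v"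
| "path_word \<GG> u (Stable e # w) v \<longleftrightarrow> tau \<GG> (ebar \<GG> e) = u \<and> path_word \<GG> (tau \<GG> e) w v"

definition loop_words :: "('v, 'e, 'a, 'b) gog \<Rightarrow> 'v \<Rightarrow> ('v, 'e, 'a) letter list set" where
  "loop_words \<GG> u = {w \<in> lists (letters \<GG>). path_word \<GG> u w u}"

definition pi1 :: "('v, 'e, 'a, 'b) gog \<Rightarrow> 'v \<Rightarrow> ('v, 'e, 'a) letter list set monoid" where
  "pi1 \<GG> u = (path_group \<GG>)\<lparr>carrier := (\<lambda>w. path_cong \<GG> `` {w}) ` loop_words \<GG> u\<rparr>"

text \<open>The stable letter of \<open>e\<close> or its inverse occurs in every loop at \<open>u\<close> representing \<open>X\<close>.\<close>

definition traverses :: "('v, 'e, 'a, 'b) gog \<Rightarrow> 'v \<Rightarrow> 'e \<Rightarrow> ('v, 'e, 'a) letter list set \<Rightarrow> bool" where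
  "traverses \<GG> u e X \<longleftrightarrow>
     (\<forall>w \<in> X \<inter> loop_words \<GG> u. Stable e \<in> set w \<or> Stable (ebar \<GG> e) \<in> set w)"


section \<open>Automorphisms of graphs of groups\<close>

record ('v, 'e, 'a, 'b) gog_aut =
  vmap :: "'v \<Rightarrow> 'v"
  edgemap :: "'e \<Rightarrow> 'e"
  vhom :: "'v \<Rightarrow> 'a \<Rightarrow> 'a"
  ehom :: "'e \<Rightarrow> 'b \<Rightarrow> 'b"
  corr :: "'e \<Rightarrow> 'a"

definition gog_automorphism ::
  "('v, 'e, 'a, 'b) gog \<Rightarrow> ('v, 'e, 'a, 'b) gog_aut \<Rightarrow> bool" where
  "gog_automorphism \<GG> H \<longleftrightarrow>
     graph_of_groups \<GG> \<and>
     bij_betw (vmap H) (gverts \<GG>) (gverts \<GG>) \<and>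
     bij_betw (edgemap H) (gedges \<GG>) (gedges \<GG>) \<and>
     (\<forall>v \<in> gverts \<GG>. vhom H v \<in> iso (vgrp \<GG> v) (vgrp \<GG> (vmap H v))) \<and>
     (\<forall>e \<in> gedges \<GG>.
        tau \<GG> (edgemap H e) = vmap H (tau \<GG> e) \<and>
        edgemap H (ebar \<GG> e) = ebar \<GG> (edgemap H e) \<and>
        ehom H e \<in> iso (egrp \<GG> e) (egrp \<GG> (edgemap H e)) \<and>
        corr H e \<in> carrier (vgrp \<GG> (tau \<GG> (edgemap H e))) \<and>
        (\<forall>g \<in> carrier (egrp \<GG> e).
           ehom H (ebar \<GG> e) g = ehom H e g \<and>
           vhom H (tau \<GG> e) (emap \<GG> e g) =
             ad (vgrp \<GG> (tau \<GG> (edgemap H e))) (corr H e)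
                (emap \<GG> (edgemap H e) (ehom H e g))))"

fun letter_image ::
  "('v, 'e, 'a, 'b) gog \<Rightarrow> ('v, 'e, 'a, 'b) gog_aut \<Rightarrow> ('v, 'e, 'a) letter \<Rightarrow>
   ('v, 'e, 'a) letter list" where
  "letter_image \<GG> H (Elt v g) = [Elt (vmap H v) (vhom H v g)]"
| "letter_image \<GG> H (Stable e) =
     [Elt (tau \<GG> (edgemap H (ebar \<GG> e))) (corr H (ebar \<GG> e)),
      Stable (edgemap H e),
      Elt (tau \<GG> (edgemap H e)) (inv\<^bsub>vgrp \<GG> (tau \<GG> (edgemap H e))\<^esub> (corr H e))]"

definition induced ::
  "('v, 'e, 'a, 'b) gog \<Rightarrow> ('v, 'e, 'a, 'b) gog_aut \<Rightarrow>
   ('v, 'e, 'a) letter list set \<Rightarrow> ('v, 'e, 'a) letter list set" where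
  "induced \<GG> H X = (\<Union>w \<in> X. path_cong \<GG> `` {concat (map (letter_image \<GG> H) w)})"

definition zero_element ::
  "('v, 'e, 'a, 'b) gog \<Rightarrow> ('v, 'e, 'a, 'b) gog_aut \<Rightarrow> ('v, 'e, 'a) letter list set \<Rightarrow> bool" where
  "zero_element \<GG> H w \<longleftrightarrow>
     (LEAST n. \<exists>g \<in> carrier (path_group \<GG>).
        n = path_length \<GG>
              (g \<otimes>\<^bsub>path_group \<GG>\<^esub> w \<otimes>\<^bsub>path_group \<GG>\<^esub> inv\<^bsub>path_group \<GG>\<^esub> (induced \<GG> H g))) = 0"

definition identity_on_graph ::
  "('v, 'e, 'a, 'b) gog \<Rightarrow> ('v, 'e, 'a, 'b) gog_aut \<Rightarrow> bool" where
  "identity_on_graph \<GG> H \<longleftrightarrow>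
     (\<forall>v \<in> gverts \<GG>. vmap H v = v) \<and> (\<forall>e \<in> gedges \<GG>. edgemap H e = e)"

definition partial_dehn_twist ::
  "('v, 'e, 'a, 'b) gog \<Rightarrow> ('v, 'e, 'a, 'b) gog_aut \<Rightarrow> 'v set \<Rightarrow> bool" where
  "partial_dehn_twist \<GG> H V \<longleftrightarrow>
     gog_automorphism \<GG> H \<and> V \<subseteq> gverts \<GG> \<and> identity_on_graph \<GG> H \<and>
     (\<forall>e \<in> gedges \<GG>. tau \<GG> e \<in> V \<longrightarrow> carrier (egrp \<GG> e) = {\<one>\<^bsub>egrp \<GG> e\<^esub>}) \<and>
     (\<forall>v \<in> gverts \<GG> - V. \<forall>g \<in> carrier (vgrp \<GG> v). vhom H v g = g) \<and>
     (\<forall>e \<in> gedges \<GG>.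
        (\<forall>g \<in> carrier (egrp \<GG> e). ehom H e g = g) \<and>
        corr H e \<in> centralizer (vgrp \<GG> (tau \<GG> e)) (emap \<GG> e ` carrier (egrp \<GG> e)))"

definition dehn_twist ::
  "('v, 'e, 'a, 'b) gog \<Rightarrow> ('v, 'e, 'a, 'b) gog_aut \<Rightarrow> bool" where
  "dehn_twist \<GG> D \<longleftrightarrow>
     gog_automorphism \<GG> D \<and> identity_on_graph \<GG> D \<and>
     (\<forall>v \<in> gverts \<GG>. \<forall>g \<in> carrier (vgrp \<GG> v). vhom D v g = g) \<and>
     (\<forall>e \<in> gedges \<GG>.
        (\<forall>g \<in> carrier (egrp \<GG> e). ehom D e g = g) \<and>
        corr D e \<in> emap \<GG> e ` center (egrp \<GG> e))"

text \<open>\<open>gam\<close> is well defined because the edge maps are injective.\<close>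

definition gam :: "('v, 'e, 'a, 'b) gog \<Rightarrow> ('v, 'e, 'a, 'b) gog_aut \<Rightarrow> 'e \<Rightarrow> 'b" where
  "gam \<GG> D e = inv_into (carrier (egrp \<GG> e)) (emap \<GG> e) (corr D e)"

definition twistor :: "('v, 'e, 'a, 'b) gog \<Rightarrow> ('v, 'e, 'a, 'b) gog_aut \<Rightarrow> 'e \<Rightarrow> 'b" where
  "twistor \<GG> D e = gam \<GG> D (ebar \<GG> e) \<otimes>\<^bsub>egrp \<GG> e\<^esub> inv\<^bsub>egrp \<GG> e\<^esub> (gam \<GG> D e)"

definition positively_bonded ::
  "('v, 'e, 'a, 'b) gog \<Rightarrow> ('v, 'e, 'a, 'b) gog_aut \<Rightarrow> 'e \<Rightarrow> 'e \<Rightarrow> bool" where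
  "positively_bonded \<GG> D e1 e2 \<longleftrightarrow> tau \<GG> e1 = tau \<GG> e2 \<and>
     (\<exists>(n1 :: nat) (n2 :: nat). n1 \<ge> 1 \<and> n2 \<ge> 1 \<and>
        (\<exists>h \<in> carrier (vgrp \<GG> (tau \<GG> e1)).
           ad (vgrp \<GG> (tau \<GG> e1)) h (emap \<GG> e1 (twistor \<GG> D e1 [^]\<^bsub>egrp \<GG> e1\<^esub> n1)) =
           emap \<GG> e2 (twistor \<GG> D e2 [^]\<^bsub>egrp \<GG> e2\<^esub> n2)))"

abbreviation edge_surj :: "('v, 'e, 'a, 'b) gog \<Rightarrow> 'e \<Rightarrow> bool" where
  "edge_surj \<GG> e \<equiv> emap \<GG> e ` carrier (egrp \<GG> e) = carrier (vgrp \<GG> (tau \<GG> e))"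

text \<open>The valence of a vertex counts oriented edges ending there, so a loop counts twice.\<close>

definition efficient ::
  "('v, 'e, 'a, 'b) gog \<Rightarrow> ('v, 'e, 'a, 'b) gog_aut \<Rightarrow> bool" where
  "efficient \<GG> D \<longleftrightarrow>
     dehn_twist \<GG> D \<and>
     (\<forall>u \<in> gverts \<GG>. free_group_finite_rank_ge2 (pi1 \<GG> u)) \<and>
     (\<forall>e \<in> gedges \<GG>. in_degree (graph \<GG>) (tau \<GG> e) = 1 \<longrightarrow> \<not> edge_surj \<GG> e) \<and>
     (\<forall>e1 \<in> gedges \<GG>. \<forall>e2 \<in> gedges \<GG>.
        e1 \<noteq> e2 \<and> tau \<GG> e1 = tau \<GG> e2 \<and> in_degree (graph \<GG>) (tau \<GG> e1) = 2 \<longrightarrow>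
        \<not> (edge_surj \<GG> e1 \<and> edge_surj \<GG> e2)) \<and>
     (\<forall>e \<in> gedges \<GG>. \<forall>r \<in> carrier (vgrp \<GG> (tau \<GG> e)). \<forall>p :: int.
        p \<noteq> 0 \<and> r [^]\<^bsub>vgrp \<GG> (tau \<GG> e)\<^esub> p \<in> emap \<GG> e ` carrier (egrp \<GG> e) \<longrightarrow>
        r \<in> emap \<GG> e ` carrier (egrp \<GG> e)) \<and>
     (\<forall>e \<in> gedges \<GG>. twistor \<GG> D e \<noteq> \<one>\<^bsub>egrp \<GG> e\<^esub>) \<and>
     (\<forall>e1 \<in> gedges \<GG>. \<forall>e2 \<in> gedges \<GG>. e1 \<noteq> e2 \<longrightarrow> \<not> positively_bonded \<GG> D e1 e2)"


section \<open>Dehn twist automorphisms of a group\<close>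

definition represents ::
  "('v, 'e, 'a, 'b) gog \<Rightarrow> ('v, 'e, 'a, 'b) gog_aut \<Rightarrow> 'v \<Rightarrow>
   ('g \<Rightarrow> ('v, 'e, 'a) letter list set) \<Rightarrow> 'g monoid \<Rightarrow> ('g \<Rightarrow> 'g) \<Rightarrow> bool" where
  "represents \<HH> D u \<theta> G \<phi> \<longleftrightarrow>
     dehn_twist \<HH> D \<and> u \<in> gverts \<HH> \<and> \<theta> \<in> iso G (pi1 \<HH> u) \<and>
     (\<forall>x \<in> carrier G. \<phi> x = inv_into (carrier G) \<theta> (induced \<HH> D (\<theta> x)))"

text \<open>
  HOL cannot quantify over types.  A graph of groups has a finite graph and finitely generated,
  hence countable, vertex and edge groups, so up to isomorphism every one is a \<open>nat_gog\<close>.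
\<close>

type_synonym nat_gog = "(nat, nat, nat, nat) gog"
type_synonym nat_gog_aut = "(nat, nat, nat, nat) gog_aut"

definition dehn_twist_automorphism :: "'g monoid \<Rightarrow> ('g \<Rightarrow> 'g) \<Rightarrow> bool" where
  "dehn_twist_automorphism G \<phi> \<longleftrightarrow>
     (\<exists>(\<HH> :: nat_gog) (D :: nat_gog_aut) u \<theta>. represents \<HH> D u \<theta> G \<phi>)"

definition efficiently_represented :: "'g monoid \<Rightarrow> ('g \<Rightarrow> 'g) \<Rightarrow> bool" where
  "efficiently_represented G \<phi> \<longleftrightarrow>
     (\<exists>(\<HH> :: nat_gog) (D :: nat_gog_aut) u \<theta>. efficient \<HH> D \<and> represents \<HH> D u \<theta> G \<phi>)"

text \<open>
  A pitfall: being zero is not invariant under inversion.  Replacing a stable letter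
  \<open>t\<^sub>e\<close> by \<open>t\<^sub>e g\<^sup>-\<^sup>1\<close> changes the factor \<open>w = \<delta>(e)\<^sup>-\<^sup>1\<close> in
  \<open>t\<^sub>e \<mapsto> \<delta>(e') t\<^sub>e \<delta>(e)\<^sup>-\<^sup>1\<close> (with \<open>e'\<close> the inverse edge) to
  \<open>g w H(g)\<^sup>-\<^sup>1\<close>.  So for this twisted conjugation the element attached to \<open>e\<close>
  is \<open>\<delta>(e)\<^sup>-\<^sup>1\<close>.  In the free group on \<open>a, t\<close> with
  \<open>\<phi>(a) = a\<close>, \<open>\<phi>(t) = t a\<close> and \<open>g = t\<^sup>3\<close>, the element
  \<open>g\<^sup>-\<^sup>1 \<phi>(g)\<close> is zero for \<open>\<phi>\<close> and its inverse is not.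
\<close>

definition aut_zero :: "'g monoid \<Rightarrow> ('g \<Rightarrow> 'g) \<Rightarrow> 'g \<Rightarrow> bool" where
  "aut_zero G \<phi> w \<longleftrightarrow>
     (\<exists>(\<HH> :: nat_gog) (D :: nat_gog_aut) u \<theta>.
        efficient \<HH> D \<and> represents \<HH> D u \<theta> G \<phi> \<and> zero_element \<HH> D (\<theta> w))"

end

theory Submission
  imports Defs
begin

text \<open>
  Write \<open>\<delta>\<close> for the inverse of the correction term of \<open>e\<close>.  A path that crosses \<open>e\<close>, reads \<open>y \<in> G\<^sub>v\<close> and
  returns is mapped by the \<open>n\<close>-th power of the twist to one that reads
  \<open>\<psi>\<^sub>n = \<delta>\<^sub>n H\<^sub>v\<^sup>n(y) \<delta>\<^sub>n\<^sup>-\<^sup>1\<close>, where \<open>\<delta>\<^sub>n = \<delta> H\<^sub>v(\<delta>) \<dots> H\<^sub>v\<^sup>n\<^sup>-\<^sup>1(\<delta>)\<close>.  Since the edge groups at \<open>v\<close>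
  are trivial, \<open>G\<^sub>v\<close> is a free factor, and the syllable \<open>\<psi>\<^sub>n\<close> can be read off from every word for the image
  by an automaton; its length is thus a lower bound for word length.  In an efficient representative of \<open>H\<^sub>v\<close>
  the element \<open>\<delta>\<close> can be twisted-conjugated to a cyclically reduced loop of positive path length.  Then \<open>\<delta>\<^sub>n\<close>
  is a reduced path of \<open>n\<close> periods, in whose \<open>i\<close>-th period the edges carry \<open>i\<close>-th powers of their twistors.
  Consecutive twists either are incommensurable or, as no two edges are positively bonded, have the same sign,
  so little cancels, and \<open>\<delta>\<^sub>n\<close> has length of order \<open>n\<^sup>2\<close>.
\<close>

section \<open>Length functions of tree type\<close>

text \<open>Reduced expressions are not unique: an edge group element may be pushed across every
  stable letter, so a large twist at one syllable can be hidden by shifting it to the next. The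
  bound therefore has to hold for all reduced expressions at once, and one integer per edge records
  the shift. Where the twistors of consecutive edges are commensurable, a shift is passed on with
  its sign at the price of a constant factor; where they are not, it cannot be passed on and is paid
  for in length. A hyperbolic loop has such a blocking syllable in every period, so the shift hiding
  the twist of one period must be built up within that period. A path is not yet an element of a
  fundamental group, and \<delta>_n could cancel against its inverse in \<psi>_n. Hence y is chosen
  so that the path can turn back on it, which needs a vertex element outside the image of the edge
  group. Growth of elements depends on the base vertex, so two automata are used, according to how
  the initial vertex of e can be reached.\<close>

lemma (in group) conj_int_pow:
  assumes "h \<in> carrier G" "c \<in> carrier G"
  shows "(h \<otimes> c \<otimes> inv h) [^] (a::int) = h \<otimes> c [^] a \<otimes> inv h"
proof -
  have "inv h \<otimes> (h \<otimes> z) = z" if "z \<in> carrier G" for z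
    using that assms by (simp add: m_assoc[symmetric])
  then have "(\<lambda>x. h \<otimes> x \<otimes> inv h) \<in> hom G G" using assms by (auto simp: hom_def m_assoc)
  then have "group_hom G G (\<lambda>x. h \<otimes> x \<otimes> inv h)"
    by (simp add: group_hom_def group_hom_axioms_def is_group)
  from group_hom.hom_int_pow[OF this assms(2), of a] show ?thesis by simp
qed

text \<open>Lyndon's length functions: \<open>ultra\<close> is 0-hyperbolicity of the tree, stated
  for twice the Gromov products so that all values are integers, and \<open>len_sq\<close> says that
  a non-trivial element translates along an axis. \<open>finite_ball\<close> serves the pigeonhole
  arguments.\<close>

locale tree_length = group G for G (structure) +
  fixes len :: "'a \<Rightarrow> int"
  assumes len_one [simp]: "len \<one> = 0"
    and len_nonneg: "x \<in> carrier G \<Longrightarrow> 0 \<le> len x"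
    and len_inv [simp]: "x \<in> carrier G \<Longrightarrow> len (inv x) = len x"
    and gp_nonneg: "\<lbrakk>x \<in> carrier G; y \<in> carrier G\<rbrakk> \<Longrightarrow> len (inv x \<otimes> y) \<le> len x + len y"
    and ultra: "\<lbrakk>x \<in> carrier G; y \<in> carrier G; z \<in> carrier G\<rbrakk> \<Longrightarrow>
       min (len x + len y - len (inv x \<otimes> y)) (len y + len z - len (inv y \<otimes> z))
         \<le> len x + len z - len (inv x \<otimes> z)"
    and finite_ball: "finite {x \<in> carrier G. len x \<le> n}"
    and len_sq: "\<lbrakk>x \<in> carrier G; x \<noteq> \<one>\<rbrakk> \<Longrightarrow> len x < len (x \<otimes> x)"
begin

text \<open>Twice the Gromov product of \<open>x\<close> and \<open>y\<close> based at \<open>\<one>\<close>.\<close>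

definition gp :: "'a \<Rightarrow> 'a \<Rightarrow> int" where
  "gp x y = len x + len y - len (inv x \<otimes> y)"

lemma gp_ultra:
  "\<lbrakk>x \<in> carrier G; y \<in> carrier G; z \<in> carrier G\<rbrakk> \<Longrightarrow> min (gp x y) (gp y z) \<le> gp x z"
  unfolding gp_def using ultra by blast

lemma gp_sym:
  assumes "x \<in> carrier G" "y \<in> carrier G"
  shows "gp x y = gp y x"
proof -
  have "inv (inv x \<otimes> y) = inv y \<otimes> x" using assms by (simp add: inv_mult_group)
  then have "len (inv x \<otimes> y) = len (inv y \<otimes> x)"
    using len_inv[of "inv x \<otimes> y"] assms by simp
  then show ?thesis by (simp add: gp_def)
qed

text \<open>In an ultrametric triangle the smallest product occurs twice.\<close>

lemma gp_isosceles:
  assumes "x \<in> carrier G" "y \<in> carrier G" "z \<in> carrier G" "gp x y < gp y z"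
  shows "gp x z = gp x y"
  using gp_ultra[of x y z] gp_ultra[of x z y] gp_sym[of y z] gp_sym[of x z] gp_sym[of x y] assms by auto

lemma len_mult_le:
  assumes "x \<in> carrier G" "y \<in> carrier G"
  shows "len (x \<otimes> y) \<le> len x + len y"
  using gp_nonneg[of "inv x" y] assms by simp

lemma len_mult_ge:
  assumes "x \<in> carrier G" "y \<in> carrier G"
  shows "len x - len y \<le> len (x \<otimes> y)"
proof -
  have "x = (x \<otimes> y) \<otimes> inv y" using assms by (simp add: m_assoc)
  then have "len x \<le> len (x \<otimes> y) + len (inv y)" by (metis assms inv_closed len_mult_le m_closed)
  then show ?thesis using assms by simp
qed

lemma len_mult_ge2:
  assumes "x \<in> carrier G" "y \<in> carrier G"
  shows "len y - len x \<le> len (x \<otimes> y)"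
proof -
  have "y = inv x \<otimes> (x \<otimes> y)" using assms by (simp add: m_assoc[symmetric])
  then have "len y \<le> len (inv x) + len (x \<otimes> y)" by (metis assms inv_closed len_mult_le m_closed)
  then show ?thesis using assms by simp
qed

text \<open>The translation length. In a free group it is the length of the cyclically reduced core
  of \<open>c\<close>, and \<open>len c - tlen c\<close> is twice the distance from the base point
  to the axis.\<close>

definition tlen :: "'a \<Rightarrow> int" where "tlen c = len (c \<otimes> c) - len c"

lemma tlen_pos: "\<lbrakk>c \<in> carrier G; c \<noteq> \<one>\<rbrakk> \<Longrightarrow> 0 < tlen c"
  using len_sq by (simp add: tlen_def)

text \<open>The product of \<open>c\<close> with a higher power exceeds that of \<open>inv c\<close>
  with \<open>c\<close>. Hence \<open>inv c\<close> leaves the power as early as it leaves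
  \<open>c\<close>, and each further factor adds exactly \<open>tlen c\<close>. Two consecutive
  exponents are carried through the induction because the first product is computed from both
  lengths.\<close>

lemma len_Suc_pow:
  assumes c: "c \<in> carrier G" "c \<noteq> \<one>"
  shows "len (c [^] Suc n) = len c + int n * tlen c"
proof -
  have "len (c [^] Suc n) = len c + int n * tlen c \<and> len (c [^] Suc (Suc n)) = len c + int (Suc n) * tlen c"
  proof (induction n)
    case 0
    then show ?case using c by (simp add: tlen_def)
  next
    case (Suc n)
    let ?p = "c [^] Suc (Suc n)"
    have p: "?p \<in> carrier G" using c by simp
    have ic: "inv c \<in> carrier G" using c by simp
    have "inv c \<otimes> ?p = c [^] Suc n"
      using c by (metis nat_pow_closed nat_pow_Suc2 inv_solve_left')
    then have "gp c ?p = len c + tlen c" using Suc c by (simp add: gp_def algebra_simps)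
    moreover have "gp (inv c) c = len c - tlen c" using c by (simp add: gp_def tlen_def)
    ultimately have "gp (inv c) ?p = gp (inv c) c"
      using gp_isosceles[of "inv c" c ?p] c tlen_pos[OF c] p by auto
    then have "len (inv (inv c) \<otimes> ?p) = len ?p + tlen c"
      using \<open>gp (inv c) c = len c - tlen c\<close> c by (simp add: gp_def)
    moreover have "inv (inv c) \<otimes> ?p = c [^] Suc (Suc (Suc n))"
      using c by (metis inv_inv nat_pow_Suc2)
    ultimately show ?case using Suc c by (simp add: algebra_simps)
  qed
  then show ?thesis by simp
qed

lemma len_nat_pow:
  assumes c: "c \<in> carrier G" "c \<noteq> \<one>" and n: "n > 0"
  shows "len (c [^] (n::nat)) = int n * tlen c + (len c - tlen c)"
proof -
  obtain m where m: "n = Suc m" using n gr0_conv_Suc by auto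
  show ?thesis unfolding m len_Suc_pow[OF c] by (simp add: algebra_simps)
qed

lemma len_int_pow:
  assumes c: "c \<in> carrier G" "c \<noteq> \<one>" and a: "a \<noteq> 0"
  shows "len (c [^] (a::int)) = \<bar>a\<bar> * tlen c + (len c - tlen c)"
proof (cases a rule: int_cases2)
  case (nonneg n)
  then show ?thesis using len_nat_pow[OF c, of n] a by (simp add: int_pow_int)
next
  case (nonpos n)
  then show ?thesis using len_nat_pow[OF c, of n] a c by (simp add: int_pow_neg_int)
qed

lemma tlen_le_len:
  assumes "c \<in> carrier G" shows "tlen c \<le> len c"
  using len_mult_le[OF assms assms] by (simp add: tlen_def)

lemma abs_le_len_int_pow:
  assumes c: "c \<in> carrier G" "c \<noteq> \<one>"
  shows "\<bar>a\<bar> \<le> len (c [^] (a::int))"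
proof (cases "a = 0")
  case False
  have "\<bar>a\<bar> * 1 \<le> \<bar>a\<bar> * tlen c" using tlen_pos[OF c] by (intro mult_left_mono) auto
  then show ?thesis using len_int_pow[OF c False] tlen_le_len[OF c(1)] by simp
qed simp

lemma int_pow_eq_one_iff:
  assumes c: "c \<in> carrier G" "c \<noteq> \<one>"
  shows "c [^] (a::int) = \<one> \<longleftrightarrow> a = 0"
  using abs_le_len_int_pow[OF c, of a] by auto

lemma int_pow_inject:
  assumes c: "c \<in> carrier G" "c \<noteq> \<one>" and "c [^] (a::int) = c [^] b"
  shows "a = b"
proof -
  have "c [^] (a - b) = \<one>" using assms by (simp add: int_pow_diff)
  then show ?thesis using int_pow_eq_one_iff[OF c] by simp
qed

text \<open>Passing to \<open>n\<close>-th powers multiplies the discrepancy of the two lengths by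
  \<open>n\<close>, whereas conjugation by \<open>h\<close> changes a length by at most
  \<open>2 * len h\<close>.\<close>

lemma conj_pow_abs_eq:
  assumes h: "h \<in> carrier G" and c: "c \<in> carrier G" "c \<noteq> \<one>"
    and eq: "h \<otimes> c [^] (a::int) \<otimes> inv h = c [^] b"
  shows "\<bar>a\<bar> = \<bar>b\<bar>"
proof (rule ccontr)
  assume ne: "\<bar>a\<bar> \<noteq> \<bar>b\<bar>"
  \<comment> \<open>Positive, and larger than the error \<open>2 * len h + len c\<close> that
    remains in \<open>bd\<close>.\<close>
  define n :: int where "n = 2 * len h + 2 * len c + 1"
  have n: "n > 0" using len_nonneg[OF h] len_nonneg[OF c(1)] by (simp add: n_def)
  have "c [^] (b * n) = (c [^] b) [^] n" using c by (simp add: int_pow_pow)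
  also have "\<dots> = h \<otimes> c [^] (a * n) \<otimes> inv h"
    unfolding eq[symmetric] using conj_int_pow[OF h, of "c [^] a" n] c by (simp add: int_pow_pow)
  finally have e: "c [^] (b * n) = h \<otimes> c [^] (a * n) \<otimes> inv h" .
  have up: "len (c [^] (b * n)) \<le> 2 * len h + len (c [^] (a * n))"
    unfolding e using len_mult_le[of "h \<otimes> c [^] (a * n)" "inv h"] len_mult_le[of h "c [^] (a * n)"] h c by simp
  have lo: "len (c [^] (a * n)) - 2 * len h \<le> len (c [^] (b * n))"
    unfolding e using len_mult_ge[of "h \<otimes> c [^] (a * n)" "inv h"] len_mult_ge2[of h "c [^] (a * n)"] h c by simp
  have range: "\<bar>x\<bar> * n * tlen c \<le> len (c [^] (x * n)) \<and> len (c [^] (x * n)) \<le> \<bar>x\<bar> * n * tlen c + len c" for x :: int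
  proof (cases "x = 0")
    case False
    then have "x * n \<noteq> 0" using n by auto
    then show ?thesis using len_int_pow[OF c, of "x * n"] n tlen_pos[OF c] tlen_le_len[OF c(1)]
      by (simp add: abs_mult)
  qed (use len_nonneg[OF c(1)] in simp)
  have bd: "\<bar>(\<bar>a\<bar> - \<bar>b\<bar>) * n * tlen c\<bar> \<le> 2 * len h + len c"
    using up lo range[of a] range[of b] by (simp add: left_diff_distrib abs_le_iff)
  have "1 * n * 1 \<le> \<bar>\<bar>a\<bar> - \<bar>b\<bar>\<bar> * n * tlen c"
    using ne n tlen_pos[OF c] by (intro mult_mono) auto
  also have "\<dots> = \<bar>(\<bar>a\<bar> - \<bar>b\<bar>) * n * tlen c\<bar>" using n tlen_pos[OF c] by (simp add: abs_mult)
  also note bd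
  finally show False using len_nonneg[OF h] len_nonneg[OF c(1)] by (simp add: n_def)
qed



end

section \<open>Commensurability and the overlap of axes\<close>

context tree_length begin

text \<open>The element of the coset of \<open>\<langle>z\<rangle>\<close> containing \<open>x\<close> that is nearest to \<open>\<one>\<close> is short:
  otherwise it would sit far from the axis of \<open>z\<close> and could not be translated along it.\<close>

lemma commuting_near_power:
  assumes x: "x \<in> carrier G" and z: "z \<in> carrier G" "z \<noteq> \<one>" and comm: "x \<otimes> z = z \<otimes> x"
  shows "\<exists>i::int. len (z [^] i \<otimes> x) \<le> len z"
proof -
  define f where "f i = nat (len (z [^] i \<otimes> x))" for i :: int
  obtain i where i: "\<And>j. f i \<le> f j"
    using ex_has_least_nat[of "\<lambda>_. True" undefined f] by auto
  define y where "y = z [^] i \<otimes> x"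
  have y: "y \<in> carrier G" using x z by (simp add: y_def)
  have min: "len y \<le> len (z [^] k \<otimes> y)" for k :: int
  proof -
    have "z [^] k \<otimes> y = z [^] (k + i) \<otimes> x"
      using x z by (simp add: y_def int_pow_mult m_assoc)
    then show ?thesis using i[of "k + i"] len_nonneg[of "z [^] (k + i) \<otimes> x"] x z
      by (auto simp: f_def y_def)
  qed
  have cx: "x \<otimes> z [^] (k::int) = z [^] k \<otimes> x" for k
  proof -
    have "x \<otimes> z \<otimes> inv x = z" using comm x z by (simp add: m_assoc inv_solve_right')
    then have "x \<otimes> z [^] k \<otimes> inv x = z [^] k" using conj_int_pow[OF x z(1), of k] by simp
    then show ?thesis using x z by (metis int_pow_closed inv_solve_right' m_closed)
  qed
  have cy: "y \<otimes> z [^] (k::int) = z [^] k \<otimes> y" for k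
  proof -
    have "y \<otimes> z [^] k = z [^] i \<otimes> (z [^] k \<otimes> x)" using x z by (simp add: y_def m_assoc cx)
    also have "\<dots> = z [^] k \<otimes> y"
      using x z by (simp add: y_def m_assoc[symmetric] int_pow_mult[symmetric] add.commute)
    finally show ?thesis .
  qed
  have gle: "gp (z [^] (k::int)) y \<le> len (z [^] k)" for k
  proof -
    have "len y \<le> len (inv (z [^] k) \<otimes> y)" using min[of "-k"] z by (simp add: int_pow_neg)
    then show ?thesis by (simp add: gp_def)
  qed
  \<comment> \<open>Large enough for \<open>bigZ\<close>: the power \<open>z [^] k\<close> is at
    least as long as \<open>z\<close> and \<open>y\<close> together.\<close>
  define k :: nat where "k = Suc (nat (len z) + nat (len y))"
  have z1: "z [^] (1::int) = z" using z by (metis int_pow_1)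
  \<comment> \<open>Minimality of \<open>y\<close> bounds its product with \<open>b\<close>. The
    powers of \<open>b\<close> follow \<open>b\<close> for longer than that, so all of them inherit
    the bound.\<close>
  have side: "gp (b [^] Suc n) y \<le> len z" if b: "b = z \<or> b = inv z" for b n
  proof -
    have "inv z \<noteq> \<one>" using z by (metis inv_inv inv_one)
    then have "b \<noteq> \<one>" using b z(2) by metis
    moreover have "b \<in> carrier G" using b z by auto
    ultimately have bc: "b \<in> carrier G" "b \<noteq> \<one>" by simp_all
    have lb: "len b = len z" using b z by auto
    have "gp b y \<le> len z"
      using b gle[of 1] gle[of "-1"] z by (auto simp: int_pow_neg)
    moreover have "len b < gp b (b [^] Suc n)"
    proof (cases n)
      case 0
      then show ?thesis using bc tlen_pos[OF bc] tlen_le_len[OF bc(1)] by (simp add: gp_def)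
    next
      case (Suc m)
      have "inv b \<otimes> b [^] Suc n = b [^] n" using bc by (metis nat_pow_closed nat_pow_Suc2 inv_solve_left')
      then show ?thesis using len_Suc_pow[OF bc, of n] len_Suc_pow[OF bc, of m] Suc tlen_pos[OF bc]
        by (simp add: gp_def algebra_simps)
    qed
    ultimately have "gp y b < gp b (b [^] Suc n)" using gp_sym[OF y bc(1)] lb by linarith
    then have "gp y (b [^] Suc n) = gp y b" using gp_isosceles[of y b "b [^] Suc n"] y bc by simp
    then show ?thesis using \<open>gp b y \<le> len z\<close> gp_sym[OF y bc(1)] gp_sym[of y "b [^] Suc n"] y bc by simp
  qed
  let ?Z = "z [^] k"
  have Z: "?Z \<in> carrier G" using z by simp
  have lenZ: "len ?Z = len z + int (nat (len z) + nat (len y)) * tlen z"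
    unfolding k_def by (rule len_Suc_pow[OF z])
  then have bigZ: "len z + len y < len ?Z + 1"
  proof -
    have "int (nat (len z) + nat (len y)) * 1 \<le> int (nat (len z) + nat (len y)) * tlen z"
      using tlen_pos[OF z] by (intro mult_left_mono) auto
    then show ?thesis using lenZ len_nonneg[OF z(1)] len_nonneg[OF y] by simp
  qed
  have yZ: "y \<otimes> ?Z = ?Z \<otimes> y" using cy[of "int k"] by (simp add: int_pow_int)
  have p1: "gp ?Z y \<le> len z" using side[of z "nat (len z) + nat (len y)"] by (simp add: k_def)
  have p2: "gp (inv ?Z) y \<le> len z"
  proof -
    have "gp (inv z [^] k) y \<le> len z" unfolding k_def by (rule side) simp
    then show ?thesis using nat_pow_inv[OF z(1), of k] by simp
  qed
  \<comment> \<open>As \<open>?Z\<close> and \<open>y\<close> commute, \<open>?q\<close> starts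
    along \<open>?Z\<close> and also along \<open>y\<close>. The product of \<open>?Z\<close> and
    \<open>y\<close> is small, so the ultrametric inequality through \<open>?q\<close> forces one of
    them to be short, and \<open>?Z\<close> is long.\<close>
  let ?q = "?Z \<otimes> y"
  have q: "?q \<in> carrier G" using Z y by simp
  have lq: "len ?q \<ge> len ?Z + len y - len z" using p2 Z y by (simp add: gp_def)
  have "inv ?q \<otimes> ?Z = inv y" using Z y by (simp add: inv_mult_group m_assoc)
  then have a1: "gp ?Z ?q \<ge> 2 * len ?Z - len z"
    using gp_sym[OF Z q] lq y by (simp add: gp_def)
  have "inv ?q \<otimes> y = inv ?Z" 
    using Z y yZ by (metis inv_mult_group inv_closed m_assoc l_inv r_one)
  then have a2: "gp ?q y \<ge> 2 * len y - len z" using lq Z y by (simp add: gp_def)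
  have "min (2 * len ?Z - len z) (2 * len y - len z) \<le> len z"
    using gp_ultra[OF Z q y] a1 a2 p1 by linarith
  then have "len y \<le> len z" using bigZ len_nonneg[OF y] len_nonneg[OF z(1)] by linarith
  then show ?thesis by (auto simp: y_def)
qed

lemma pow_near_pow_imp_eq:
  fixes a b :: "nat \<Rightarrow> int"
  assumes inf: "infinite I" and bd: "\<And>m. m \<in> I \<Longrightarrow> f m \<in> carrier G \<and> len (f m) \<le> K"
  shows "\<exists>m\<in>I. \<exists>m'\<in>I. m < m' \<and> f m = f (m'::nat)"
proof -
  have "finite (f ` I)" using finite_ball[of K] bd by (auto elim: finite_subset[rotated])
  then have "\<not> inj_on f I" using inf finite_imageD by blast
  then obtain m m' where "m \<in> I" "m' \<in> I" "m \<noteq> m'" "f m = f m'" by (auto simp: inj_on_def)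
  then show ?thesis by (metis linorder_neqE_nat)
qed

text \<open>Every power of \<open>x\<close> is a power of \<open>z\<close> up to a remainder in a
  fixed ball. Two of these remainders agree, and their exponents differ by the required
  \<open>p\<close>.\<close>

lemma commuting_commensurable:
  assumes x: "x \<in> carrier G" and z: "z \<in> carrier G" "z \<noteq> \<one>" and comm: "x \<otimes> z = z \<otimes> x"
  shows "\<exists>(p::int) (q::int). p > 0 \<and> x [^] p = z [^] q"
proof -
  have "\<exists>i::int. len (z [^] i \<otimes> x [^] m) \<le> len z" for m :: nat
  proof (rule commuting_near_power)
    show "x [^] m \<otimes> z = z \<otimes> x [^] m" using comm x z by (metis group_commutes_pow)
  qed (use x z in auto)
  then obtain i :: "nat \<Rightarrow> int" where i: "\<And>m. len (z [^] i m \<otimes> x [^] m) \<le> len z" by metis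
  obtain m m' where m: "m < m'" "z [^] i m \<otimes> x [^] m = z [^] i m' \<otimes> x [^] m'"
    using pow_near_pow_imp_eq[of UNIV "\<lambda>m. z [^] i m \<otimes> x [^] m" "len z"] i x z by auto
  have "x [^] m' = x [^] (m' - m) \<otimes> x [^] m" using m x by (simp add: nat_pow_mult)
  then have "z [^] i m \<otimes> x [^] m = z [^] i m' \<otimes> x [^] (m' - m) \<otimes> x [^] m"
    using m x z by (simp add: m_assoc)
  then have "z [^] i m = z [^] i m' \<otimes> x [^] (m' - m)" using x z by simp
  then have "x [^] (m' - m) = inv (z [^] i m') \<otimes> z [^] i m" using x z
    by (simp add: m_assoc[symmetric])
  also have "\<dots> = z [^] (- i m' + i m)" using z by (simp only: int_pow_mult int_pow_neg)
  finally have "x [^] int (m' - m) = z [^] (- i m' + i m)" by (simp only: int_pow_int)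
  moreover have "int (m' - m) > 0" using m by simp
  ultimately show ?thesis by blast
qed


lemma gp_pow_pow_ge:
  assumes c: "c \<in> carrier G" "c \<noteq> \<one>" and m: "0 < m" "m \<le> i"
  shows "2 * int m * tlen c + (len c - tlen c) \<le> gp (c [^] (m::nat)) (c [^] (i::nat))"
proof (cases "m = i")
  case True
  then show ?thesis using m c len_nat_pow[OF c m(1)] tlen_le_len[OF c(1)] by (simp add: gp_def)
next
  case False
  have "c [^] i = c [^] m \<otimes> c [^] (i - m)" using m c by (simp add: nat_pow_mult)
  then have "inv (c [^] m) \<otimes> c [^] i = c [^] (i - m)"
    using c by (simp add: m_assoc[symmetric])
  then show ?thesis using m False len_nat_pow[OF c, of m] len_nat_pow[OF c, of i] len_nat_pow[OF c, of "i - m"]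
    by (simp add: gp_def algebra_simps of_nat_diff)
qed

text \<open>If the axes had arbitrarily long overlap, every power of \<open>c\<close> would stay
  within bounded distance of some power of \<open>d\<close>. Two of the bounded quotients agree, and
  this makes a non-trivial power of \<open>c\<close> equal to one of \<open>d\<close>.\<close>

lemma incommensurable_gp_bounded_nat:
  assumes c: "c \<in> carrier G" "c \<noteq> \<one>" and d: "d \<in> carrier G" "d \<noteq> \<one>"
    and ne: "\<And>(a::int) (b::int). \<lbrakk>a \<noteq> 0; b \<noteq> 0\<rbrakk> \<Longrightarrow> c [^] a \<noteq> d [^] b"
  shows "\<exists>K. \<forall>i j. 0 < i \<longrightarrow> 0 < j \<longrightarrow> gp (c [^] (i::nat)) (d [^] (j::nat)) \<le> K"
proof (rule ccontr)
  assume "\<not> ?thesis"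
  then have unb: "\<exists>i j. 0 < i \<and> 0 < j \<and> K < gp (c [^] (i::nat)) (d [^] (j::nat))" for K
    by (metis linorder_not_le)
  define p q l l' where "p = len c - tlen c" and "q = len d - tlen d" and "l = tlen c" and "l' = tlen d"
  have pos: "0 < l" "0 < l'" "0 \<le> p" "0 \<le> q"
    using tlen_pos[OF c] tlen_pos[OF d] tlen_le_len c d by (simp_all add: p_def q_def l_def l'_def)
  have near: "\<exists>n::nat. len (inv (c [^] m) \<otimes> d [^] n) \<le> p + q + l'" if m: "m > 0" for m :: nat
  proof -
    \<comment> \<open>The first multiple of \<open>l'\<close> beyond \<open>m * l\<close>: both
      powers then translate by the same amount up to \<open>l'\<close>.\<close>
    define n where "n = nat ((int m * l) div l') + 1"
    have nn: "int n = (int m * l) div l' + 1" using pos by (simp add: n_def pos_imp_zdiv_nonneg_iff)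
    define Q R where "Q = (int m * l) div l'" and "R = (int m * l) mod l'"
    have QR: "int m * l = l' * Q + R" "0 \<le> R" "R < l'" using pos by (simp_all add: Q_def R_def)
    have "int n * l' = l' * Q + l'" unfolding nn Q_def[symmetric] by (simp add: algebra_simps)
    then have nl: "int m * l < int n * l'" "int n * l' \<le> int m * l + l'" using QR by linarith+
    have ml: "0 \<le> int m * l" using pos by simp
    have n0: "n > 0" by (simp add: n_def)
    \<comment> \<open>Twice the lengths of \<open>c [^] m\<close> and \<open>d [^] n\<close>
      together. An overlap exceeding \<open>N\<close> forces \<open>m \<le> i\<close> and
      \<open>n \<le> j\<close>, so that the chain \<open>c [^] m\<close>, \<open>c [^] i\<close>,
      \<open>d [^] j\<close>, \<open>d [^] n\<close> can be compared.\<close>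
    define N where "N = 2 * (int m * l + p) + 2 * (int n * l' + q)"
    obtain i j where ij: "0 < i" "0 < j" "N < gp (c [^] (i::nat)) (d [^] (j::nat))" using unb by blast
    have arith: "M < I" if "g \<le> 2 * (I + p')" "2 * (M + p') + 2 * (M' + q') < g" "0 \<le> M'" "0 \<le> q'"
      for g I M M' p' q' :: int using that by (simp add: distrib_left)
    have cl: "c [^] i \<in> carrier G" "d [^] j \<in> carrier G" "c [^] m \<in> carrier G" "d [^] n \<in> carrier G"
      using c d by auto
    have li: "len (c [^] i) = int i * l + p" "len (d [^] j) = int j * l' + q"
      "len (c [^] m) = int m * l + p" "len (d [^] n) = int n * l' + q"
      using len_nat_pow[OF c] len_nat_pow[OF d] ij m n0 by (simp_all add: p_def q_def l_def l'_def)
    have le: "gp (c [^] i) (d [^] j) \<le> 2 * len (c [^] i)"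
      using len_mult_ge2[of "inv (c [^] i)" "d [^] j"] cl by (simp add: gp_def)
    have "int m * l < int i * l"
      by (rule arith[where g = "gp (c [^] i) (d [^] j)" and p' = p and M' = "int n * l'" and q' = q]) (use le ij(3) li pos ml nl in \<open>simp_all add: N_def\<close>)
    then have "int m < int i" by (rule mult_right_less_imp_less) (use pos in simp)
    then have mi: "m \<le> i" by simp
    have le: "gp (c [^] i) (d [^] j) \<le> 2 * len (d [^] j)"
      using len_mult_ge[of "inv (c [^] i)" "d [^] j"] cl by (simp add: gp_def)
    have "int n * l' < int j * l'"
      by (rule arith[where g = "gp (c [^] i) (d [^] j)" and p' = q and M' = "int m * l" and q' = p]) (use le ij(3) li pos ml nl in \<open>simp_all add: N_def\<close>)
    then have "int n < int j" by (rule mult_right_less_imp_less) (use pos in simp)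
    then have nj: "n \<le> j" by simp
    have g1: "2 * (int m * l) + p \<le> gp (c [^] m) (c [^] i)"
      using gp_pow_pow_ge[OF c m mi] by (simp add: l_def p_def mult.assoc)
    have g2: "2 * (int n * l') + q \<le> gp (d [^] j) (d [^] n)"
      using gp_pow_pow_ge[OF d n0 nj] gp_sym[OF cl(2,4)] by (simp add: l'_def q_def mult.assoc)
    have "2 * (int m * l) \<le> min (gp (c [^] m) (c [^] i)) (gp (c [^] i) (d [^] j))"
    proof -
      have "N = 2 * (int m * l) + 2 * p + 2 * (int n * l') + 2 * q" by (simp add: N_def)
      then show ?thesis using g1 ij(3) ml nl pos by linarith
    qed
    then have "2 * (int m * l) \<le> gp (c [^] m) (d [^] j)" using gp_ultra[OF cl(3,1,2)] by linarith
    then have "2 * (int m * l) \<le> gp (c [^] m) (d [^] n)" using gp_ultra[OF cl(3,2,4)] g2 nl pos by linarith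
    then have "len (inv (c [^] m) \<otimes> d [^] n) \<le> p + q + l'" using li nl unfolding gp_def by linarith
    then show ?thesis by blast
  qed
  then obtain n :: "nat \<Rightarrow> nat" where n: "\<And>m. m > 0 \<Longrightarrow> len (inv (c [^] m) \<otimes> d [^] n m) \<le> p + q + l'"
    by metis
  have "infinite {0::nat<..}" by (simp add: infinite_Ioi)
  then obtain m m' where m: "m < m'" "inv (c [^] m) \<otimes> d [^] n m = inv (c [^] m') \<otimes> d [^] n m'"
    using pow_near_pow_imp_eq[of "{0<..}" "\<lambda>m. inv (c [^] m) \<otimes> d [^] n m" "p + q + l'"] n c d by auto
  have "c [^] m' \<otimes> inv (c [^] m) = c [^] m' \<otimes> (inv (c [^] m) \<otimes> d [^] n m) \<otimes> inv (d [^] n m)"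
    using c d by (simp add: m_assoc)
  also have "\<dots> = d [^] n m' \<otimes> inv (d [^] n m)"
    unfolding m(2) using c d by (simp add: m_assoc[symmetric])
  finally have "c [^] (int m' - int m) = d [^] (int (n m') - int (n m))"
    using c d by (simp add: int_pow_diff int_pow_int)
  moreover have "int m' - int m \<noteq> 0" using m by simp
  ultimately show False using ne int_pow_eq_one_iff[OF c] by (metis int_pow_0)
qed

text \<open>The cancellation in \<open>c [^] a \<otimes> d [^] b\<close> is the Gromov product of
  \<open>c [^] (- a)\<close> and \<open>d [^] b\<close>, which is bounded for each of the four
  choices of signs; without cancellation a power is at least as long as its exponent.\<close>

lemma incommensurable_len_ge:
  assumes c: "c \<in> carrier G" "c \<noteq> \<one>" and d: "d \<in> carrier G" "d \<noteq> \<one>"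
    and ne: "\<And>(a::int) (b::int). \<lbrakk>a \<noteq> 0; b \<noteq> 0\<rbrakk> \<Longrightarrow> c [^] a \<noteq> d [^] b"
  shows "\<exists>K. \<forall>(a::int) (b::int). \<bar>a\<bar> + \<bar>b\<bar> - K \<le> len (c [^] a \<otimes> d [^] b)"
proof -
  have ic: "inv c \<in> carrier G" "inv c \<noteq> \<one>" and idd: "inv d \<in> carrier G" "inv d \<noteq> \<one>"
    using c d by (simp_all add: inv_eq_1_iff)
  have ipow: "inv x [^] (a::int) = x [^] (- a)" if "x \<in> carrier G" for x a
    using that by (simp add: int_pow_inv int_pow_neg)
  have e1: "\<exists>K. \<forall>i j. 0 < i \<longrightarrow> 0 < j \<longrightarrow> gp (x [^] (i::nat)) (y [^] (j::nat)) \<le> K"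
    if "x = c \<or> x = inv c" "y = d \<or> y = inv d" for x y
  proof (rule incommensurable_gp_bounded_nat)
    fix a b :: int assume ab: "a \<noteq> 0" "b \<noteq> 0"
    show "x [^] a \<noteq> y [^] b"
      using that ne[of a b] ne[of "- a" b] ne[of a "- b"] ne[of "- a" "- b"] ab ipow c d by auto
  qed (use that c d ic idd in \<open>metis+\<close>)
  obtain K1 where K1: "\<And>i j. 0 < i \<Longrightarrow> 0 < j \<Longrightarrow> gp (c [^] (i::nat)) (d [^] (j::nat)) \<le> K1"
    using e1[of c d] by auto
  obtain K2 where K2: "\<And>i j. 0 < i \<Longrightarrow> 0 < j \<Longrightarrow> gp (inv c [^] (i::nat)) (d [^] (j::nat)) \<le> K2"
    using e1[of "inv c" d] by auto
  obtain K3 where K3: "\<And>i j. 0 < i \<Longrightarrow> 0 < j \<Longrightarrow> gp (c [^] (i::nat)) (inv d [^] (j::nat)) \<le> K3"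
    using e1[of c "inv d"] by auto
  obtain K4 where K4: "\<And>i j. 0 < i \<Longrightarrow> 0 < j \<Longrightarrow> gp (inv c [^] (i::nat)) (inv d [^] (j::nat)) \<le> K4"
    using e1[of "inv c" "inv d"] by auto
  define K where "K = \<bar>K1\<bar> + \<bar>K2\<bar> + \<bar>K3\<bar> + \<bar>K4\<bar>"
  have gpK: "gp (c [^] a) (d [^] b) \<le> K" if "a \<noteq> 0" "b \<noteq> 0" for a b :: int
  proof -
    obtain x i where x: "x = c \<or> x = inv c" "c [^] a = x [^] (i::nat)" "0 < i"
      using \<open>a \<noteq> 0\<close> c by (cases a rule: int_cases2)
        (auto simp: int_pow_int int_pow_neg_int nat_pow_inv[symmetric])
    obtain y j where y: "y = d \<or> y = inv d" "d [^] b = y [^] (j::nat)" "0 < j"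
      using \<open>b \<noteq> 0\<close> d by (cases b rule: int_cases2)
        (auto simp: int_pow_int int_pow_neg_int nat_pow_inv[symmetric])
    show ?thesis using x y K1[of i j] K2[of i j] K3[of i j] K4[of i j] by (auto simp: K_def)
  qed
  have "\<bar>a\<bar> + \<bar>b\<bar> - K \<le> len (c [^] a \<otimes> d [^] b)" for a b :: int
  proof (cases "a = 0 \<or> b = 0")
    case True
    then show ?thesis using abs_le_len_int_pow[OF c, of a] abs_le_len_int_pow[OF d, of b] c d
      by (auto simp: K_def)
  next
    case False
    then have "len (c [^] (- a)) + len (d [^] b) - len (inv (c [^] (- a)) \<otimes> d [^] b) \<le> K"
      using gpK[of "-a" b] by (simp add: gp_def)
    then show ?thesis
      using abs_le_len_int_pow[OF c, of a] abs_le_len_int_pow[OF d, of b] c by (simp add: int_pow_neg)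
  qed
  then show ?thesis by blast
qed

end

section \<open>Word length in a free group\<close>

definition winv :: "('a \<times> bool) list \<Rightarrow> ('a \<times> bool) list" where
  "winv w = rev (map (\<lambda>(x, b). (x, \<not> b)) w)"

lemma winv_Cons: "winv (s # w) = winv w @ [(fst s, \<not> snd s)]"
  by (simp add: winv_def case_prod_beta)

lemma length_winv [simp]: "length (winv w) = length w"
  by (simp add: winv_def)

lemma fst_set_winv [simp]: "fst ` set (winv w) = fst ` set w"
  by (induction w) (auto simp: winv_def)

lemma winv_winv [simp]: "winv (winv w) = w"
  by (simp add: winv_def rev_map case_prod_beta comp_def)

lemma freely_reduced_winv [simp]: "freely_reduced (winv w) = freely_reduced w"
proof -
  have "freely_reduced w \<Longrightarrow> freely_reduced (winv w)" for w :: "('a \<times> bool) list"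
    unfolding freely_reduced_def winv_def successively_rev successively_map
    by (erule successively_mono) (auto simp: case_prod_beta)
  from this[of w] this[of "winv w"] show ?thesis by auto
qed

lemma freely_reduced_appendD:
  "freely_reduced (u @ w) \<Longrightarrow> freely_reduced u \<and> freely_reduced w"
  by (simp add: freely_reduced_def successively_append_iff)

lemma freely_reduced_winv_append:
  assumes "freely_reduced u" "freely_reduced w" "u \<noteq> [] \<Longrightarrow> w \<noteq> [] \<Longrightarrow> hd u \<noteq> hd w"
  shows "freely_reduced (winv u @ w)"
proof (cases "u = [] \<or> w = []")
  case False
  then have l: "winv u \<noteq> []" "last (winv u) = (fst (hd u), \<not> snd (hd u))"
    by (cases u; auto simp: winv_Cons)+
  then show ?thesis
    using assms False freely_reduced_winv[of u]
    by (auto simp: freely_reduced_def successively_append_iff prod_eq_iff)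
qed (use assms freely_reduced_winv[of u] in \<open>auto simp: winv_def[of "[]"]\<close>)

section \<open>Values of words\<close>

context group
begin

lemma word_value_Nil [simp]: "word_value G [] = \<one>"
  by (simp add: word_value_def)

lemma word_value_Cons:
  "word_value G (s # w) = (if snd s then fst s else inv fst s) \<otimes> word_value G w"
  by (simp add: word_value_def case_prod_beta)

lemma word_value_closed [simp]:
  "fst ` set w \<subseteq> carrier G \<Longrightarrow> word_value G w \<in> carrier G"
  by (induction w) (auto simp: word_value_Cons)

lemma word_value_append:
  "\<lbrakk>fst ` set u \<subseteq> carrier G; fst ` set w \<subseteq> carrier G\<rbrakk> \<Longrightarrow>
    word_value G (u @ w) = word_value G u \<otimes> word_value G w"
  by (induction u) (auto simp: word_value_Cons m_assoc)

lemma word_value_winv: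
  "fst ` set w \<subseteq> carrier G \<Longrightarrow> word_value G (winv w) = inv (word_value G w)"
proof (induction w)
  case (Cons s w)
  then show ?case
    by (auto simp: winv_Cons word_value_append word_value_Cons inv_mult_group)
qed (simp add: winv_def)

lemma generate_word_value:
  assumes "S \<subseteq> carrier G" "g \<in> generate G S"
  shows "\<exists>w. fst ` set w \<subseteq> S \<and> word_value G w = g"
  using assms(2)
proof induction
  case one
  then show ?case by (intro exI[of _ "[]"]) simp
next
  case (incl h)
  then show ?case using assms(1) by (intro exI[of _ "[(h, True)]"]) (auto simp: word_value_Cons)
next
  case (inv h)
  then show ?case using assms(1) by (intro exI[of _ "[(h, False)]"]) (auto simp: word_value_Cons)
next
  case (eng h1 h2)
  then obtain w1 w2 where "fst ` set w1 \<subseteq> S" "word_value G w1 = h1" "fst ` set w2 \<subseteq> S" "word_value G w2 = h2"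
    by auto
  then show ?case using assms(1)
    by (intro exI[of _ "w1 @ w2"]) (auto simp: word_value_append image_Un)
qed

lemma ex_freely_reduced:
  assumes "fst ` set w \<subseteq> carrier G"
  shows "\<exists>w'. fst ` set w' \<subseteq> fst ` set w \<and> freely_reduced w' \<and> word_value G w' = word_value G w"
  using assms
proof (induction w)
  case Nil
  then show ?case by (intro exI[of _ "[]"]) (simp add: freely_reduced_def)
next
  case (Cons s w)
  then obtain w' where w': "fst ` set w' \<subseteq> fst ` set w" "freely_reduced w'" "word_value G w' = word_value G w"
    by auto
  show ?case
  proof (cases "w' \<noteq> [] \<and> fst (hd w') = fst s \<and> snd (hd w') \<noteq> snd s")
    case True
    then obtain t w'' where t: "w' = t # w''" "fst t = fst s" "snd t \<noteq> snd s" by (cases w') auto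
    have cl: "word_value G w'' \<in> carrier G" "fst s \<in> carrier G"
      using Cons.prems w'(1) t(1) by auto
    have "word_value G (s # w) = word_value G w''"
      using w'(3)[symmetric] t cl by (auto simp: word_value_Cons m_assoc[symmetric])
    then show ?thesis using w' t by (intro exI[of _ w'']) (auto simp: freely_reduced_def successively_Cons)
  next
    case False
    then have "freely_reduced (s # w')" using w'(2)
      by (cases w') (auto simp: freely_reduced_def)
    then show ?thesis using w' by (intro exI[of _ "s # w'"]) (auto simp: word_value_Cons)
  qed
qed

end

section \<open>Reduced words in a basis and their common prefixes\<close>

locale free_grp = group G for G (structure) +
  fixes X :: "'a set"
  assumes basis: "free_basis G X" and finX: "finite X"
begin

lemma X_carrier: "X \<subseteq> carrier G"
  using basis by (simp add: free_basis_def generating_set_def)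

lemma split_common_prefix:
  "\<exists>p a b. u = p @ a \<and> w = p @ b \<and> (a \<noteq> [] \<longrightarrow> b \<noteq> [] \<longrightarrow> hd a \<noteq> hd b)"
  using longest_common_prefix[of u w] by (metis list.collapse)

definition nfw :: "'a \<Rightarrow> ('a \<times> bool) list" where
  "nfw g = (SOME w. fst ` set w \<subseteq> X \<and> freely_reduced w \<and> word_value G w = g)"

lemma nfw:
  assumes "g \<in> carrier G"
  shows "fst ` set (nfw g) \<subseteq> X" "freely_reduced (nfw g)" "word_value G (nfw g) = g"
proof -
  have "g \<in> generate G X" using assms basis by (simp add: free_basis_def generating_set_def)
  then obtain w where "fst ` set w \<subseteq> X" "word_value G w = g"
    using generate_word_value X_carrier by blast
  then obtain w' where "fst ` set w' \<subseteq> X \<and> freely_reduced w' \<and> word_value G w' = g"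
    using ex_freely_reduced[of w] X_carrier by (metis order_trans)
  then have "fst ` set (nfw g) \<subseteq> X \<and> freely_reduced (nfw g) \<and> word_value G (nfw g) = g"
    unfolding nfw_def by (rule someI)
  then show "fst ` set (nfw g) \<subseteq> X" "freely_reduced (nfw g)" "word_value G (nfw g) = g" by auto
qed

lemma reduced_value_one:
  "\<lbrakk>fst ` set w \<subseteq> X; freely_reduced w; word_value G w = \<one>\<rbrakk> \<Longrightarrow> w = []"
  using basis by (auto simp: free_basis_def)

lemma reduced_unique:
  assumes "fst ` set u \<subseteq> X" "freely_reduced u" "fst ` set w \<subseteq> X" "freely_reduced w"
    and eq: "word_value G u = word_value G w"
  shows "u = w"
proof -
  obtain p a b where p: "u = p @ a" "w = p @ b" "a \<noteq> [] \<longrightarrow> b \<noteq> [] \<longrightarrow> hd a \<noteq> hd b"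
    using split_common_prefix by blast
  have c: "fst ` set p \<subseteq> carrier G" "fst ` set a \<subseteq> carrier G" "fst ` set b \<subseteq> carrier G"
    using assms X_carrier p by auto
  then have "word_value G a = word_value G b" using eq p by (simp add: word_value_append)
  then have "word_value G (winv a @ b) = \<one>" using c by (simp add: word_value_append word_value_winv)
  moreover have "freely_reduced (winv a @ b)"
    using assms p freely_reduced_appendD[of p a] freely_reduced_appendD[of p b]
    by (intro freely_reduced_winv_append) auto
  moreover have "fst ` set (winv a @ b) \<subseteq> X" using assms p by (auto simp: image_Un)
  ultimately have "winv a @ b = []" by (intro reduced_value_one) auto
  then show ?thesis using p by (simp add: winv_def)
qed

lemma nfw_eq:
  assumes "fst ` set w \<subseteq> X" "freely_reduced w"
  shows "nfw (word_value G w) = w"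
proof -
  have "word_value G w \<in> carrier G" using assms X_carrier by (meson order_trans word_value_closed)
  then show ?thesis using nfw reduced_unique assms by metis
qed

definition flen :: "'a \<Rightarrow> int" where "flen g = int (length (nfw g))"

definition lcp :: "'a \<Rightarrow> 'a \<Rightarrow> nat" where
  "lcp x y = (GREATEST n. n \<le> length (nfw x) \<and> n \<le> length (nfw y) \<and> take n (nfw x) = take n (nfw y))"

lemma lcp_ge:
  assumes "n \<le> length (nfw x)" "n \<le> length (nfw y)" "take n (nfw x) = take n (nfw y)"
  shows "n \<le> lcp x y"
  unfolding lcp_def by (rule Greatest_le_nat[where b = "length (nfw x)"]) (use assms in auto)

lemma lcp_props:
  "lcp x y \<le> length (nfw x) \<and> lcp x y \<le> length (nfw y) \<and> take (lcp x y) (nfw x) = take (lcp x y) (nfw y)"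
  unfolding lcp_def by (rule GreatestI_nat[where k = 0 and b = "length (nfw x)"]) auto

lemma lcp_ultra: "min (lcp x y) (lcp y z) \<le> lcp x z"
proof (rule lcp_ge)
  let ?n = "min (lcp x y) (lcp y z)"
  show "?n \<le> length (nfw x)" "?n \<le> length (nfw z)" using lcp_props[of x y] lcp_props[of y z] by auto
  have "take ?n (nfw x) = take ?n (take (lcp x y) (nfw x))" by (simp add: min_def)
  also have "\<dots> = take ?n (nfw y)" using lcp_props[of x y] by (simp add: min_def)
  also have "\<dots> = take ?n (take (lcp y z) (nfw y))" by (simp add: min_def)
  also have "\<dots> = take ?n (nfw z)" using lcp_props[of y z] by (simp add: min_def)
  finally show "take ?n (nfw x) = take ?n (nfw z)" .
qed

text \<open>Precisely the common prefix cancels. Gromov products thereby become lengths of common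
  prefixes, for which the ultrametric inequality is evident.\<close>

lemma flen_inv_mult:
  assumes "x \<in> carrier G" "y \<in> carrier G"
  shows "flen (inv x \<otimes> y) = flen x + flen y - 2 * int (lcp x y)"
proof -
  define p a b where "p = take (lcp x y) (nfw x)" "a = drop (lcp x y) (nfw x)" "b = drop (lcp x y) (nfw y)"
  have xa: "nfw x = p @ a" and yb: "nfw y = p @ b"
    using lcp_props[of x y] by (simp_all add: p_a_b_def) (metis append_take_drop_id)
  have lp: "length p = lcp x y" using lcp_props[of x y] by (simp add: p_a_b_def)
  have hd: "hd a \<noteq> hd b" if ab: "a \<noteq> []" "b \<noteq> []"
  proof
    assume e: "hd a = hd b"
    obtain s a' where "a = s # a'" using ab by (cases a) auto
    moreover obtain t b' where "b = t # b'" using ab by (cases b) auto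
    ultimately have "a = s # a'" "b = s # b'" using e by auto
    then have "Suc (lcp x y) \<le> lcp x y" using xa yb lp by (intro lcp_ge) auto
    then show False by simp
  qed
  have c: "fst ` set p \<subseteq> carrier G" "fst ` set a \<subseteq> carrier G" "fst ` set b \<subseteq> carrier G"
    and cX: "fst ` set a \<subseteq> X" "fst ` set b \<subseteq> X"
    using nfw(1)[OF assms(1)] nfw(1)[OF assms(2)] X_carrier xa yb by auto
  have "inv x \<otimes> y = inv (word_value G p \<otimes> word_value G a) \<otimes> (word_value G p \<otimes> word_value G b)"
    using nfw(3)[OF assms(1)] nfw(3)[OF assms(2)] xa yb c by (simp add: word_value_append)
  also have "\<dots> = inv (word_value G a) \<otimes> word_value G b"
  proof -
    have "inv P \<otimes> (P \<otimes> B) = B" if "P \<in> carrier G" "B \<in> carrier G" for P B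
      using that by (simp add: m_assoc[symmetric])
    then show ?thesis using word_value_closed[OF c(1)] word_value_closed[OF c(2)] word_value_closed[OF c(3)]
      by (simp add: inv_mult_group m_assoc)
  qed
  also have "\<dots> = word_value G (winv a @ b)" using c by (simp add: word_value_append word_value_winv)
  finally have "inv x \<otimes> y = word_value G (winv a @ b)" .
  moreover have "freely_reduced (winv a @ b)"
    using nfw(2)[OF assms(1)] nfw(2)[OF assms(2)] xa yb hd freely_reduced_appendD[of p a] freely_reduced_appendD[of p b]
    by (intro freely_reduced_winv_append) auto
  ultimately have "nfw (inv x \<otimes> y) = winv a @ b"
    using cX nfw_eq[of "winv a @ b"] by (simp add: image_Un)
  then show ?thesis using xa yb lp by (simp add: flen_def)
qed

lemma nfw_inv:
  assumes "x \<in> carrier G" shows "nfw (inv x) = winv (nfw x)"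
proof -
  have "word_value G (winv (nfw x)) = inv x"
    using word_value_winv[of "nfw x"] nfw[OF assms] X_carrier by auto
  then show ?thesis using nfw_eq[of "winv (nfw x)"] nfw[OF assms] by simp
qed

text \<open>If a reduced word agreed with its inverse on half of its length, either its two middle
  letters would cancel or its middle letter would be its own inverse. This is what
  \<open>len_sq\<close> amounts to.\<close>

lemma lcp_inv_self:
  assumes "x \<in> carrier G" "x \<noteq> \<one>"
  shows "2 * lcp (inv x) x < length (nfw x)"
proof (rule ccontr)
  define w where "w = nfw x"
  define n where "n = lcp (inv x) x"
  define L where "L = length w"
  assume "\<not> ?thesis"
  then have big: "L \<le> 2 * n" by (simp add: w_def L_def n_def)
  have nL: "n \<le> L" using lcp_props[of "inv x" x] by (simp add: n_def w_def L_def)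
  have tk: "take n (winv w) = take n w"
    using lcp_props[of "inv x" x] nfw_inv[OF assms(1)] by (simp add: n_def w_def)
  have red: "freely_reduced w" using nfw(2)[OF assms(1)] by (simp add: w_def)
  have "w \<noteq> []" using nfw(3)[OF assms(1)] assms(2) by (auto simp: w_def)
  then have L0: "L > 0" by (simp add: L_def)
  have wi: "w ! i = (fst (w ! (L - Suc i)), \<not> snd (w ! (L - Suc i)))" if "i < n" for i
  proof -
    have "w ! i = take n (winv w) ! i" using that tk by simp
    also have "\<dots> = winv w ! i" using that by simp
    also have "\<dots> = (\<lambda>(x, b). (x, \<not> b)) (w ! (L - Suc i))"
      using that nL unfolding winv_def by (simp add: rev_nth L_def)
    finally show ?thesis by (simp add: case_prod_beta)
  qed
  show False
  proof (cases "even L")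
    case True
    then obtain m where m: "L = 2 * m" by blast
    then have "w ! (m - 1) = (fst (w ! m), \<not> snd (w ! m))"
      using wi[of "m - 1"] big L0 by (simp add: m)
    moreover have "Suc (m - 1) < length w" "Suc (m - 1) = m" using m L0 by (auto simp: L_def)
    ultimately show False using red unfolding freely_reduced_def successively_conv_nth
      by (metis fst_conv snd_conv)
  next
    case False
    then obtain m where m: "L = 2 * m + 1" by (elim oddE)
    then have "w ! m = (fst (w ! m), \<not> snd (w ! m))" using wi[of m] big by simp
    then show False by (metis snd_conv)
  qed
qed

sublocale tree_length G flen
proof
  show "flen \<one> = 0"
    using nfw_eq[of "[]"] by (simp add: flen_def freely_reduced_def)
  fix x y z assume x: "x \<in> carrier G"
  show "0 \<le> flen x" by (simp add: flen_def)
  show "flen (inv x) = flen x" using x by (simp add: flen_def nfw_inv)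
  show "flen x < flen (x \<otimes> x)" if "x \<noteq> \<one>"
  proof -
    have "flen (x \<otimes> x) = 2 * flen x - 2 * int (lcp (inv x) x)"
      using flen_inv_mult[of "inv x" x] x by (simp add: flen_def nfw_inv)
    then show ?thesis using lcp_inv_self[OF x that] by (simp add: flen_def)
  qed
  assume y: "y \<in> carrier G"
  show "flen (inv x \<otimes> y) \<le> flen x + flen y" using flen_inv_mult[OF x y] by simp
  assume z: "z \<in> carrier G"
  show "min (flen x + flen y - flen (inv x \<otimes> y)) (flen y + flen z - flen (inv y \<otimes> z))
      \<le> flen x + flen z - flen (inv x \<otimes> z)"
    using lcp_ultra[of x y z] flen_inv_mult[OF x y] flen_inv_mult[OF y z] flen_inv_mult[OF x z] by auto
next
  fix n :: int
  have "finite {w. set w \<subseteq> X \<times> (UNIV :: bool set) \<and> length w \<le> nat n}"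
    by (rule finite_lists_length_le) (use finX in auto)
  moreover have "{x \<in> carrier G. flen x \<le> n} \<subseteq> word_value G ` {w. set w \<subseteq> X \<times> (UNIV :: bool set) \<and> length w \<le> nat n}"
  proof
    fix x assume "x \<in> {x \<in> carrier G. flen x \<le> n}"
    then have x: "x \<in> carrier G" "flen x \<le> n" by auto
    have "set (nfw x) \<subseteq> X \<times> UNIV" using nfw(1)[OF x(1)] by auto
    then show "x \<in> word_value G ` {w. set w \<subseteq> X \<times> (UNIV :: bool set) \<and> length w \<le> nat n}"
      using nfw(3)[OF x(1)] x(2) by (intro image_eqI[of _ _ "nfw x"]) (auto simp: flen_def)
  qed
  ultimately show "finite {x \<in> carrier G. flen x \<le> n}" by (meson finite_imageI finite_subset)
qed

end

section \<open>The path group\<close>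

lemma (in group) inv_cancel_left [simp]:
  "\<lbrakk>x \<in> carrier G; y \<in> carrier G\<rbrakk> \<Longrightarrow> inv x \<otimes> (x \<otimes> y) = y"
  "\<lbrakk>x \<in> carrier G; y \<in> carrier G\<rbrakk> \<Longrightarrow> x \<otimes> (inv x \<otimes> y) = y"
  by (simp_all add: m_assoc[symmetric])

lemma word_cong_lists:
  assumes "(x, y) \<in> word_cong A R" "R \<subseteq> lists A \<times> lists A"
  shows "x \<in> lists A \<and> y \<in> lists A"
  using assms by induction (auto simp: subset_iff)

lemma word_cong_context:
  assumes "(x, y) \<in> word_cong A R" "p \<in> lists A" "q \<in> lists A"
  shows "(p @ x @ q, p @ y @ q) \<in> word_cong A R"
  using assms
proof induction
  case (rel u w x y)
  then show ?case using word_cong.rel[of u w R "p @ x" A "y @ q"] by simp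
next
  case (refl x)
  then show ?case by (intro word_cong.refl) simp
qed (blast intro: word_cong.sym word_cong.trans)+

lemma word_cong_relI: "(u, w) \<in> R \<Longrightarrow> (u, w) \<in> word_cong A R"
  using word_cong.rel[of u w R "[]" A "[]"] by simp

lemma word_cong_append:
  assumes "(x, y) \<in> word_cong A R" "(u, w) \<in> word_cong A R" "R \<subseteq> lists A \<times> lists A"
  shows "(x @ u, y @ w) \<in> word_cong A R"
proof -
  have l: "x \<in> lists A" "y \<in> lists A" "u \<in> lists A" "w \<in> lists A"
    using word_cong_lists assms by blast+
  have "(x @ u, y @ u) \<in> word_cong A R" using word_cong_context[OF assms(1), of "[]" u] l by simp
  moreover have "(y @ u, y @ w) \<in> word_cong A R" using word_cong_context[OF assms(2), of y "[]"] l by simp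
  ultimately show ?thesis by (rule word_cong.trans)
qed

lemma word_cong_invariant:
  assumes "(x, y) \<in> word_cong A R"
    and "\<And>u w p q. \<lbrakk>(u, w) \<in> R; p \<in> lists A; q \<in> lists A\<rbrakk> \<Longrightarrow> f (p @ u @ q) = f (p @ w @ q)"
  shows "f x = f y"
  using assms(1) by induction (auto simp: assms(2))

lemma word_cong_mono:
  assumes "(x, y) \<in> word_cong A R" "A \<subseteq> B" "R \<subseteq> S"
  shows "(x, y) \<in> word_cong B S"
  using assms(1)
proof induction
  case (rel u w x y)
  then show ?case using assms by (intro word_cong.rel) (auto simp: lists_mono[THEN subsetD])
next
  case (refl x)
  then show ?case using assms by (intro word_cong.refl) (auto simp: lists_mono[THEN subsetD])
qed (auto intro: word_cong.sym word_cong.trans)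

lemma word_cong_equiv:
  assumes "R \<subseteq> lists A \<times> lists A"
  shows "equiv (lists A) (word_cong A R)"
proof (rule equivI)
  show "word_cong A R \<subseteq> lists A \<times> lists A" using word_cong_lists assms by fast
  show "refl_on (lists A) (word_cong A R)"
    by (rule refl_onI) (rule word_cong.refl)
  show "sym (word_cong A R)" by (auto intro: symI word_cong.sym)
  show "trans (word_cong A R)" by (auto intro: transI word_cong.trans)
qed

text \<open>A monoid presentation in which every letter has a left inverse letter defines a group.
  This applies both to the path group and to the free product of the vertex groups.\<close>

locale presentation =
  fixes A :: "'x set" and R :: "('x list \<times> 'x list) set" and lv :: "'x \<Rightarrow> 'x"
  assumes R_lists: "R \<subseteq> lists A \<times> lists A"
    and lv_closed: "a \<in> A \<Longrightarrow> lv a \<in> A"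
    and lv_inv: "a \<in> A \<Longrightarrow> ([lv a, a], []) \<in> word_cong A R"
begin

abbreviation "cl w \<equiv> word_cong A R `` {w}"
abbreviation "PM \<equiv> presented_monoid A R"

lemma cl_eq_iff: "\<lbrakk>x \<in> lists A; y \<in> lists A\<rbrakk> \<Longrightarrow> cl x = cl y \<longleftrightarrow> (x, y) \<in> word_cong A R"
  using eq_equiv_class_iff[OF word_cong_equiv[OF R_lists]] by auto

lemma PM_mult:
  assumes "x \<in> lists A" "y \<in> lists A"
  shows "cl x \<otimes>\<^bsub>PM\<^esub> cl y = cl (x @ y)"
proof -
  have "cl (x' @ y') = cl (x @ y)" if "x' \<in> cl x" "y' \<in> cl y" for x' y'
  proof -
    have h: "(x, x') \<in> word_cong A R" "(y, y') \<in> word_cong A R" using that by auto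
    then have "(x @ y, x' @ y') \<in> word_cong A R" by (rule word_cong_append[OF _ _ R_lists])
    then show ?thesis by (metis equiv_class_eq word_cong_equiv[OF R_lists])
  qed
  then have "(\<Union>x'\<in>cl x. \<Union>y'\<in>cl y. cl (x' @ y')) = (\<Union>x'\<in>cl x. \<Union>y'\<in>cl y. cl (x @ y))"
    by (intro SUP_cong HOL.refl)
  moreover have "x \<in> cl x" "y \<in> cl y" using assms by (auto intro: word_cong.refl)
  then have "cl x \<noteq> {}" "cl y \<noteq> {}" by blast+
  ultimately have "(\<Union>x'\<in>cl x. \<Union>y'\<in>cl y. cl (x' @ y')) = cl (x @ y)"
    by (simp only: UN_constant if_False)
  then show ?thesis by (simp only: presented_monoid_def monoid.simps)
qed

lemma PM_carrier: "carrier PM = cl ` lists A"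
  by (auto simp: presented_monoid_def quotient_def)

lemma PM_one: "\<one>\<^bsub>PM\<^esub> = cl []"
  by (simp add: presented_monoid_def)

definition iw :: "'x list \<Rightarrow> 'x list" where "iw w = rev (map lv w)"

lemma iw_lists: "w \<in> lists A \<Longrightarrow> iw w \<in> lists A"
  by (auto simp: iw_def lv_closed)

lemma iw_simps [simp]: "iw [] = []" "iw (a # w) = iw w @ [lv a]" "iw (u @ w) = iw w @ iw u"
  by (simp_all add: iw_def)

lemma iw_left: "w \<in> lists A \<Longrightarrow> (iw w @ w, []) \<in> word_cong A R"
proof (induction w)
  case Nil
  then show ?case by (simp add: word_cong.refl)
next
  case (Cons a w)
  then have "(iw w @ [lv a, a] @ w, iw w @ [] @ w) \<in> word_cong A R"
    by (intro word_cong_context lv_inv iw_lists) auto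
  then show ?case using Cons by (auto intro: word_cong.trans)
qed

lemma PM_group: "group PM"
proof (rule groupI)
  show "\<one>\<^bsub>PM\<^esub> \<in> carrier PM" by (auto simp: PM_carrier PM_one)
  fix x assume "x \<in> carrier PM"
  then obtain a where a: "a \<in> lists A" "x = cl a" by (auto simp: PM_carrier)
  show "\<one>\<^bsub>PM\<^esub> \<otimes>\<^bsub>PM\<^esub> x = x" using a PM_mult[of "[]" a] by (simp add: PM_one)
  show "\<exists>y\<in>carrier PM. y \<otimes>\<^bsub>PM\<^esub> x = \<one>\<^bsub>PM\<^esub>"
  proof
    show "cl (iw a) \<in> carrier PM" using iw_lists[OF a(1)] by (auto simp: PM_carrier)
    show "cl (iw a) \<otimes>\<^bsub>PM\<^esub> x = \<one>\<^bsub>PM\<^esub>"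
      using PM_mult[OF iw_lists[OF a(1)] a(1)] iw_left[OF a(1)] cl_eq_iff[of "iw a @ a" "[]"] a iw_lists[OF a(1)]
      by (simp add: PM_one)
  qed
  fix y assume "y \<in> carrier PM"
  then obtain b where b: "b \<in> lists A" "y = cl b" by (auto simp: PM_carrier)
  show "x \<otimes>\<^bsub>PM\<^esub> y \<in> carrier PM" using a b by (auto simp: PM_carrier PM_mult)
  fix z assume "z \<in> carrier PM"
  then obtain c where c: "c \<in> lists A" "z = cl c" by (auto simp: PM_carrier)
  show "x \<otimes>\<^bsub>PM\<^esub> y \<otimes>\<^bsub>PM\<^esub> z = x \<otimes>\<^bsub>PM\<^esub> (y \<otimes>\<^bsub>PM\<^esub> z)"
    using a b c by (simp add: PM_mult)
qed

lemma PM_inv: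
  assumes "w \<in> lists A" shows "inv\<^bsub>PM\<^esub> cl w = cl (iw w)"
proof -
  have "cl (iw w) \<otimes>\<^bsub>PM\<^esub> cl w = \<one>\<^bsub>PM\<^esub>"
    using PM_mult[OF iw_lists[OF assms] assms] iw_left[OF assms] cl_eq_iff[of "iw w @ w" "[]"] assms iw_lists[OF assms]
    by (simp add: PM_one)
  then show ?thesis
    using group.inv_equality[OF PM_group] assms iw_lists[OF assms] by (auto simp: PM_carrier)
qed

end

section \<open>The path group and its groupoid of paths\<close>

locale gog =
  fixes \<GG> :: "('v, 'e, 'a, 'b) gog"
  assumes gog: "graph_of_groups \<GG>"
begin

abbreviation "V \<equiv> gverts \<GG>"
abbreviation "E \<equiv> gedges \<GG>"
abbreviation "bar \<equiv> ebar \<GG>"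
abbreviation "\<tau> \<equiv> tau \<GG>"
abbreviation "VG \<equiv> vgrp \<GG>"
abbreviation "EG \<equiv> egrp \<GG>"
abbreviation "f \<equiv> emap \<GG>"
abbreviation "L \<equiv> letters \<GG>"

lemma bidirected: "bidirected_digraph (graph \<GG>) bar" and fin: "fin_digraph (graph \<GG>)"
  using gog by (auto simp: graph_of_groups_def)

lemma bar_closed [simp]: "e \<in> E \<Longrightarrow> bar e \<in> E"
  by (rule bidirected_digraph.arev_in_arcs[OF bidirected])

lemma bar_bar [simp]: "bar (bar e) = e"
  by (rule bidirected_digraph.arev_arev[OF bidirected])

lemma bar_neq [simp]: "e \<in> E \<Longrightarrow> bar e \<noteq> e" "e \<in> E \<Longrightarrow> e \<noteq> bar e"
  using bidirected_digraph.arev_neq[OF bidirected] by metis+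

lemma \<tau>_closed [simp]: "e \<in> E \<Longrightarrow> \<tau> e \<in> V"
  using wf_digraph.head_in_verts[OF fin_digraph.axioms(1)[OF fin]] .

lemma \<tau>_bar: "e \<in> E \<Longrightarrow> \<tau> (bar e) = tail (graph \<GG>) e"
  by (rule bidirected_digraph.head_arev[OF bidirected])

lemma finite_V: "finite V" and finite_E: "finite E"
  using fin by (auto simp: fin_digraph_def fin_digraph_axioms_def)

lemma VG_group [simp]: "x \<in> V \<Longrightarrow> group (VG x)"
  using gog by (auto simp: graph_of_groups_def)

lemma EG_group [simp]: "e \<in> E \<Longrightarrow> group (EG e)"
  using gog by (auto simp: graph_of_groups_def)

lemma EG_bar [simp]: "e \<in> E \<Longrightarrow> EG (bar e) = EG e"
  using gog by (auto simp: graph_of_groups_def)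

lemma VG_monoid [simp]: "x \<in> V \<Longrightarrow> monoid (VG x)" and EG_monoid [simp]: "e \<in> E \<Longrightarrow> monoid (EG e)"
  using VG_group EG_group group.is_monoid by blast+

lemma f_mon: "e \<in> E \<Longrightarrow> f e \<in> mon (EG e) (VG (\<tau> e))"
  using gog by (auto simp: graph_of_groups_def)

lemma f_hom: "e \<in> E \<Longrightarrow> group_hom (EG e) (VG (\<tau> e)) (f e)"
  using f_mon[of e] by (simp add: group_hom_def group_hom_axioms_def mon_def)

lemma f_closed [simp]: "e \<in> E \<Longrightarrow> g \<in> carrier (EG e) \<Longrightarrow> f e g \<in> carrier (VG (\<tau> e))"
  using group_hom.hom_closed[OF f_hom] .

lemma f_mult: "\<lbrakk>e \<in> E; g \<in> carrier (EG e); h \<in> carrier (EG e)\<rbrakk> \<Longrightarrow>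
    f e (g \<otimes>\<^bsub>EG e\<^esub> h) = f e g \<otimes>\<^bsub>VG (\<tau> e)\<^esub> f e h"
  using group_hom.hom_mult[OF f_hom] .

lemma f_one [simp]: "e \<in> E \<Longrightarrow> f e \<one>\<^bsub>EG e\<^esub> = \<one>\<^bsub>VG (\<tau> e)\<^esub>"
  using group_hom.hom_one[OF f_hom] .

lemma f_inv: "e \<in> E \<Longrightarrow> g \<in> carrier (EG e) \<Longrightarrow> f e (inv\<^bsub>EG e\<^esub> g) = inv\<^bsub>VG (\<tau> e)\<^esub> f e g"
  using group_hom.hom_inv[OF f_hom] .

lemma f_inj: "\<lbrakk>e \<in> E; g \<in> carrier (EG e); h \<in> carrier (EG e); f e g = f e h\<rbrakk> \<Longrightarrow> g = h"
  using f_mon[of e] by (auto simp: mon_def inj_on_def)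

lemma Elt_letter [simp]: "Elt x g \<in> L \<longleftrightarrow> x \<in> V \<and> g \<in> carrier (VG x)"
  by (auto simp: letters_def vletters_def)

lemma Elt_vletter [simp]: "Elt x g \<in> vletters \<GG> \<longleftrightarrow> x \<in> V \<and> g \<in> carrier (VG x)"
  by (auto simp: vletters_def)

lemma Stable_letter [simp]: "Stable e \<in> L \<longleftrightarrow> e \<in> E"
  by (auto simp: letters_def vletters_def)

lemma Stable_vletter [simp]: "Stable e \<notin> vletters \<GG>"
  by (auto simp: vletters_def)

lemma vletters_sub: "vletters \<GG> \<subseteq> L"
  by (auto simp: letters_def)

fun lv :: "('v, 'e, 'a) letter \<Rightarrow> ('v, 'e, 'a) letter" where
  "lv (Elt x g) = Elt x (inv\<^bsub>VG x\<^esub> g)"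
| "lv (Stable e) = Stable (bar e)"

lemma vrels_lists: "vrels \<GG> \<subseteq> lists (vletters \<GG>) \<times> lists (vletters \<GG>)"
  by (auto simp: vrels_def intro!: monoid.m_closed monoid.one_closed)

lemma rels_lists: "vrels \<GG> \<union> erels \<GG> \<subseteq> lists L \<times> lists L"
proof
  fix p assume "p \<in> vrels \<GG> \<union> erels \<GG>"
  then show "p \<in> lists L \<times> lists L"
  proof
    assume "p \<in> vrels \<GG>"
    then show ?thesis using vrels_lists lists_mono[OF vletters_sub] by blast
  next
    assume "p \<in> erels \<GG>"
    then show ?thesis by (auto simp: erels_def)
  qed
qed

lemma vrels_inv:
  assumes "x \<in> V" "g \<in> carrier (VG x)"
  shows "([Elt x (inv\<^bsub>VG x\<^esub> g), Elt x g], []) \<in> word_cong (vletters \<GG>) (vrels \<GG>)"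
proof -
  interpret group "VG x" using assms by simp
  have "([Elt x (inv\<^bsub>VG x\<^esub> g), Elt x g], [Elt x (inv\<^bsub>VG x\<^esub> g \<otimes>\<^bsub>VG x\<^esub> g)]) \<in> vrels \<GG>"
    using assms by (auto simp: vrels_def)
  then have "([Elt x (inv\<^bsub>VG x\<^esub> g), Elt x g], [Elt x \<one>\<^bsub>VG x\<^esub>]) \<in> word_cong (vletters \<GG>) (vrels \<GG>)"
    using word_cong_relI l_inv[OF assms(2)] by metis
  moreover have "([Elt x \<one>\<^bsub>VG x\<^esub>], []) \<in> word_cong (vletters \<GG>) (vrels \<GG>)"
    by (rule word_cong_relI) (use assms in \<open>auto simp: vrels_def\<close>)
  ultimately show ?thesis by (rule word_cong.trans)
qed

text \<open>\<open>B\<close> presents the free product of the vertex groups, \<open>P\<close> the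
  path group. The former is the base group for the normal forms of the latter.\<close>

sublocale B: presentation "vletters \<GG>" "vrels \<GG>" lv
proof
  fix a assume a: "a \<in> vletters \<GG>"
  then obtain x g where "a = Elt x g" "x \<in> V" "g \<in> carrier (VG x)" by (auto simp: vletters_def)
  then show "lv a \<in> vletters \<GG>" "([lv a, a], []) \<in> word_cong (vletters \<GG>) (vrels \<GG>)"
    using vrels_inv by auto
qed (rule vrels_lists)

sublocale P: presentation L "vrels \<GG> \<union> erels \<GG>" lv
proof
  fix a assume a: "a \<in> L"
  show "lv a \<in> L" using a by (cases a) auto
  show "([lv a, a], []) \<in> word_cong L (vrels \<GG> \<union> erels \<GG>)"
  proof (cases a)
    case (Elt x g)
    then show ?thesis using vrels_inv[of x g] a vletters_sub by (auto intro: word_cong_mono)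
  next
    case (Stable e)
    then have e: "e \<in> E" using a by simp
    have "([Stable (bar e), Stable (bar (bar e))], []) \<in> erels \<GG>"
      unfolding erels_def using bar_closed[OF e] by blast
    then have "([Stable (bar e), Stable e], []) \<in> word_cong L (vrels \<GG> \<union> erels \<GG>)"
      by (intro word_cong_relI) simp
    then show ?thesis using Stable by simp
  qed
qed (rule rels_lists)

abbreviation "iw \<equiv> P.iw"
abbreviation cls :: "('v, 'e, 'a) letter list \<Rightarrow> ('v, 'e, 'a) letter list set" where
  "cls w \<equiv> path_cong \<GG> `` {w}"
abbreviation "PG \<equiv> path_group \<GG>"
abbreviation eqv (infix \<open>\<approx>\<close> 50) where "x \<approx> y \<equiv> (x, y) \<in> path_cong \<GG>"

sublocale PG: group PG
  using P.PM_group by (simp add: path_group_def)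

lemma cls_eq_iff: "\<lbrakk>x \<in> lists L; y \<in> lists L\<rbrakk> \<Longrightarrow> cls x = cls y \<longleftrightarrow> x \<approx> y"
  using P.cl_eq_iff by (simp add: path_cong_def)

lemma cls_append: "\<lbrakk>x \<in> lists L; y \<in> lists L\<rbrakk> \<Longrightarrow> cls (x @ y) = cls x \<otimes>\<^bsub>PG\<^esub> cls y"
  using P.PM_mult by (simp add: path_cong_def path_group_def)

lemma cls_Nil: "cls [] = \<one>\<^bsub>PG\<^esub>"
  using P.PM_one by (simp add: path_cong_def path_group_def)

lemma carrier_PG: "carrier PG = cls ` lists L"
  using P.PM_carrier by (simp add: path_cong_def path_group_def)

lemma cls_closed [simp]: "w \<in> lists L \<Longrightarrow> cls w \<in> carrier PG"
  by (auto simp: carrier_PG)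

lemma cls_iw: "w \<in> lists L \<Longrightarrow> cls (iw w) = inv\<^bsub>PG\<^esub> cls w"
  using P.PM_inv by (simp add: path_cong_def path_group_def)

lemma path_cong_lists: "x \<approx> y \<Longrightarrow> x \<in> lists L \<and> y \<in> lists L"
  unfolding path_cong_def by (erule word_cong_lists[OF _ rels_lists])

lemma rel_eqv: "(u, w) \<in> vrels \<GG> \<union> erels \<GG> \<Longrightarrow> u \<approx> w"
  unfolding path_cong_def by (rule word_cong_relI)

definition El :: "'v \<Rightarrow> 'a \<Rightarrow> ('v, 'e, 'a) letter list set" where "El x g = cls [Elt x g]"
definition St :: "'e \<Rightarrow> ('v, 'e, 'a) letter list set" where "St e = cls [Stable e]"

lemma El_closed [simp]: "\<lbrakk>x \<in> V; g \<in> carrier (VG x)\<rbrakk> \<Longrightarrow> El x g \<in> carrier PG"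
  by (simp add: El_def)

lemma St_closed [simp]: "e \<in> E \<Longrightarrow> St e \<in> carrier PG"
  by (simp add: St_def)

lemma cls_Cons:
  "\<lbrakk>a \<in> L; w \<in> lists L\<rbrakk> \<Longrightarrow> cls (a # w) = cls [a] \<otimes>\<^bsub>PG\<^esub> cls w"
  using cls_append[of "[a]" w] by simp

lemma cls_Elt: "\<lbrakk>Elt x g \<in> L; w \<in> lists L\<rbrakk> \<Longrightarrow> cls (Elt x g # w) = El x g \<otimes>\<^bsub>PG\<^esub> cls w"
  by (simp only: cls_Cons[of "Elt x g"] El_def)

lemma cls_Stable: "\<lbrakk>e \<in> E; w \<in> lists L\<rbrakk> \<Longrightarrow> cls (Stable e # w) = St e \<otimes>\<^bsub>PG\<^esub> cls w"
  using cls_Cons[of "Stable e" w] by (simp only: Stable_letter St_def)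

lemma El_mult:
  assumes "x \<in> V" "g \<in> carrier (VG x)" "h \<in> carrier (VG x)"
  shows "El x g \<otimes>\<^bsub>PG\<^esub> El x h = El x (g \<otimes>\<^bsub>VG x\<^esub> h)"
proof -
  have "([Elt x g, Elt x h], [Elt x (g \<otimes>\<^bsub>VG x\<^esub> h)]) \<in> vrels \<GG> \<union> erels \<GG>"
    using assms by (auto simp: vrels_def)
  from rel_eqv[OF this] have "cls [Elt x g, Elt x h] = El x (g \<otimes>\<^bsub>VG x\<^esub> h)"
    using cls_eq_iff path_cong_lists unfolding El_def by blast
  then show ?thesis using cls_append[of "[Elt x g]" "[Elt x h]"] assms by (simp add: El_def)
qed

lemma El_one: "x \<in> V \<Longrightarrow> El x \<one>\<^bsub>VG x\<^esub> = \<one>\<^bsub>PG\<^esub>"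
proof -
  assume "x \<in> V"
  then have "([Elt x \<one>\<^bsub>VG x\<^esub>], []) \<in> vrels \<GG> \<union> erels \<GG>" by (auto simp: vrels_def)
  from rel_eqv[OF this] show ?thesis
    using cls_eq_iff path_cong_lists cls_Nil unfolding El_def by metis
qed

lemma El_hom: "x \<in> V \<Longrightarrow> group_hom (VG x) PG (El x)"
  by (auto simp: group_hom_def group_hom_axioms_def PG.is_group hom_def El_mult)

lemma El_inv: "\<lbrakk>x \<in> V; g \<in> carrier (VG x)\<rbrakk> \<Longrightarrow> El x (inv\<^bsub>VG x\<^esub> g) = inv\<^bsub>PG\<^esub> El x g"
  using group_hom.hom_inv[OF El_hom] .

lemma El_pow: "\<lbrakk>x \<in> V; g \<in> carrier (VG x)\<rbrakk> \<Longrightarrow>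
    El x (g [^]\<^bsub>VG x\<^esub> (n::int)) = El x g [^]\<^bsub>PG\<^esub> n"
  using group_hom.hom_int_pow[OF El_hom] by blast

lemma St_bar: "e \<in> E \<Longrightarrow> St (bar e) = inv\<^bsub>PG\<^esub> St e"
  using cls_iw[of "[Stable e]"] by (simp add: St_def)

lemma St_rel:
  assumes "e \<in> E" "g \<in> carrier (EG e)"
  shows "St e \<otimes>\<^bsub>PG\<^esub> El (\<tau> e) (f e g) = El (\<tau> (bar e)) (f (bar e) g) \<otimes>\<^bsub>PG\<^esub> St e"
proof -
  have "([Stable e, Elt (\<tau> e) (f e g), Stable (bar e)], [Elt (\<tau> (bar e)) (f (bar e) g)]) \<in> vrels \<GG> \<union> erels \<GG>"
    using assms by (auto simp: erels_def)
  from rel_eqv[OF this]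
  have "cls [Stable e, Elt (\<tau> e) (f e g), Stable (bar e)] = El (\<tau> (bar e)) (f (bar e) g)"
    using cls_eq_iff path_cong_lists unfolding El_def by blast
  moreover have "cls [Stable e, Elt (\<tau> e) (f e g), Stable (bar e)] =
      St e \<otimes>\<^bsub>PG\<^esub> El (\<tau> e) (f e g) \<otimes>\<^bsub>PG\<^esub> inv\<^bsub>PG\<^esub> St e"
    using assms by (simp add: cls_Stable cls_Elt cls_Nil PG.m_assoc St_bar[symmetric])
  ultimately show ?thesis using assms PG.inv_solve_right[of "El (\<tau> (bar e)) (f (bar e) g)"
      "St e \<otimes>\<^bsub>PG\<^esub> El (\<tau> e) (f e g)" "St e"] by simp
qed

text \<open>The morphisms of the fundamental groupoid, inside the path group; the fundamental group
  at \<open>u\<close> is \<open>paths u u\<close>. Keeping both end points makes it easy to change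
  the base vertex.\<close>

definition paths :: "'v \<Rightarrow> 'v \<Rightarrow> ('v, 'e, 'a) letter list set set" where
  "paths x y = cls ` {w \<in> lists L. path_word \<GG> x w y}"

lemma path_word_append:
  "path_word \<GG> x (u @ w) z \<longleftrightarrow> (\<exists>y. path_word \<GG> x u y \<and> path_word \<GG> y w z)"
proof (induction u arbitrary: x)
  case (Cons a u)
  then show ?case by (cases a) auto
qed simp

lemma path_word_iw: "w \<in> lists L \<Longrightarrow> path_word \<GG> x w y \<Longrightarrow> path_word \<GG> y (iw w) x"
proof (induction w arbitrary: x)
  case (Cons a w)
  then show ?case by (cases a) (auto simp: path_word_append)
qed auto

lemma paths_closed: "p \<in> paths x y \<Longrightarrow> p \<in> carrier PG"
  unfolding paths_def using cls_closed by blast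

lemma paths_one: "\<one>\<^bsub>PG\<^esub> \<in> paths x x"
  using cls_Nil by (auto simp: paths_def intro!: image_eqI[of _ _ "[]"])

lemma paths_mult: "\<lbrakk>p \<in> paths x y; q \<in> paths y z\<rbrakk> \<Longrightarrow> p \<otimes>\<^bsub>PG\<^esub> q \<in> paths x z"
proof -
  assume "p \<in> paths x y" "q \<in> paths y z"
  then obtain u w where uw: "u \<in> lists L" "path_word \<GG> x u y" "p = cls u" "w \<in> lists L" "path_word \<GG> y w z" "q = cls w"
    by (auto simp: paths_def)
  then have "p \<otimes>\<^bsub>PG\<^esub> q = cls (u @ w)" by (simp add: cls_append)
  then show ?thesis using uw path_word_append by (auto simp: paths_def intro!: image_eqI[of _ _ "u @ w"])
qed

lemma paths_inv: "p \<in> paths x y \<Longrightarrow> inv\<^bsub>PG\<^esub> p \<in> paths y x"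
proof -
  assume "p \<in> paths x y"
  then obtain u where u: "u \<in> lists L" "path_word \<GG> x u y" "p = cls u" by (auto simp: paths_def)
  then show ?thesis using path_word_iw[OF u(1,2)] P.iw_lists[OF u(1)] cls_iw[OF u(1)]
    by (auto simp: paths_def intro!: image_eqI[of _ _ "iw u"])
qed

lemma El_paths: "\<lbrakk>x \<in> V; g \<in> carrier (VG x)\<rbrakk> \<Longrightarrow> El x g \<in> paths x x"
  by (auto simp: paths_def El_def)

lemma St_paths: "e \<in> E \<Longrightarrow> St e \<in> paths (\<tau> (bar e)) (\<tau> e)"
  by (auto simp: paths_def St_def)

lemma pi1_carrier: "carrier (pi1 \<GG> u) = paths u u"
  by (auto simp: pi1_def paths_def loop_words_def)

lemma pi1_mult [simp]: "x \<otimes>\<^bsub>pi1 \<GG> u\<^esub> y = x \<otimes>\<^bsub>PG\<^esub> y" and pi1_one [simp]: "\<one>\<^bsub>pi1 \<GG> u\<^esub> = \<one>\<^bsub>PG\<^esub>"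
  by (simp_all add: pi1_def)

lemma pi1_subgroup: "subgroup (paths u u) PG"
proof (rule PG.subgroupI)
  show "paths u u \<noteq> {}" using paths_one by blast
qed (use paths_closed paths_mult paths_inv in blast)+

lemma pi1_eq: "pi1 \<GG> u = PG\<lparr>carrier := paths u u\<rparr>"
  unfolding pi1_def paths_def loop_words_def by (metis (no_types) Collect_cong)

lemma pi1_group: "group (pi1 \<GG> u)"
  unfolding pi1_eq by (rule subgroup.subgroup_is_group[OF pi1_subgroup PG.is_group])

lemma pi1_inv: "x \<in> paths u u \<Longrightarrow> inv\<^bsub>pi1 \<GG> u\<^esub> x = inv\<^bsub>PG\<^esub> x"
  unfolding pi1_eq using PG.m_inv_consistent[OF pi1_subgroup] by simp

lemma pi1_int_pow: "x \<in> paths u u \<Longrightarrow> x [^]\<^bsub>pi1 \<GG> u\<^esub> (n::int) = x [^]\<^bsub>PG\<^esub> n"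
  unfolding pi1_eq using PG.int_pow_consistent[OF pi1_subgroup] by simp

lemma ex_path:
  assumes "x \<in> V" "y \<in> V" shows "\<exists>p. p \<in> paths x y"
proof -
  have "reachable (graph \<GG>) x y"
    using gog assms by (auto simp: graph_of_groups_def strongly_connected_def)
  interpret wf_digraph "graph \<GG>" using fin by (rule fin_digraph.axioms(1))
  from \<open>reachable (graph \<GG>) x y\<close> show ?thesis
  proof (induction rule: reachable_induct)
    case base
    then show ?case using paths_one by blast
  next
    case (step y z)
    then obtain p where p: "p \<in> paths x y" by blast
    obtain e where e: "e \<in> E" "tail (graph \<GG>) e = y" "head (graph \<GG>) e = z"
      using step by (auto simp: arcs_ends_def arc_to_ends_def)
    then have "p \<otimes>\<^bsub>PG\<^esub> St e \<in> paths x z" using St_paths[OF e(1)] paths_mult[OF p] \<tau>_bar by simp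
    then show ?case by blast
  qed
qed

end

section \<open>Automorphisms that fix the graph\<close>

locale gog_id_aut = gog \<GG> for \<GG> :: "('v, 'e, 'a, 'b) gog" +
  fixes H :: "('v, 'e, 'a, 'b) gog_aut"
  assumes aut: "gog_automorphism \<GG> H" and idg: "identity_on_graph \<GG> H"
begin

lemma vmap_id [simp]: "x \<in> V \<Longrightarrow> vmap H x = x" and edgemap_id [simp]: "e \<in> E \<Longrightarrow> edgemap H e = e"
  using idg by (auto simp: identity_on_graph_def)

lemma vhom_iso: "x \<in> V \<Longrightarrow> vhom H x \<in> iso (VG x) (VG x)"
  using aut by (auto simp: gog_automorphism_def)

lemma vhom_hom: "x \<in> V \<Longrightarrow> group_hom (VG x) (VG x) (vhom H x)"
  using vhom_iso by (simp add: group_hom_def group_hom_axioms_def iso_def)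

lemma vhom_closed [simp]: "\<lbrakk>x \<in> V; g \<in> carrier (VG x)\<rbrakk> \<Longrightarrow> vhom H x g \<in> carrier (VG x)"
  using group_hom.hom_closed[OF vhom_hom] .

lemma corr_closed [simp]: "e \<in> E \<Longrightarrow> corr H e \<in> carrier (VG (\<tau> e))"
  using aut by (auto simp: gog_automorphism_def)

lemma ehom_closed [simp]: "\<lbrakk>e \<in> E; g \<in> carrier (EG e)\<rbrakk> \<Longrightarrow> ehom H e g \<in> carrier (EG e)"
  using aut unfolding gog_automorphism_def iso_def hom_def by fastforce

lemma ehom_bar: "\<lbrakk>e \<in> E; g \<in> carrier (EG e)\<rbrakk> \<Longrightarrow> ehom H (bar e) g = ehom H e g"
  using aut by (auto simp: gog_automorphism_def)

lemma vhom_f: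
  "\<lbrakk>e \<in> E; g \<in> carrier (EG e)\<rbrakk> \<Longrightarrow> vhom H (\<tau> e) (f e g) =
    corr H e \<otimes>\<^bsub>VG (\<tau> e)\<^esub> f e (ehom H e g) \<otimes>\<^bsub>VG (\<tau> e)\<^esub> inv\<^bsub>VG (\<tau> e)\<^esub> corr H e"
  using aut by (auto simp: gog_automorphism_def ad_def)

definition Hw :: "('v, 'e, 'a) letter list \<Rightarrow> ('v, 'e, 'a) letter list" where
  "Hw w = concat (map (letter_image \<GG> H) w)"

lemma Hw_simps [simp]: "Hw [] = []" "Hw (a # w) = letter_image \<GG> H a @ Hw w" "Hw (u @ w) = Hw u @ Hw w"
  by (simp_all add: Hw_def)

lemma letter_image_lists: "a \<in> L \<Longrightarrow> letter_image \<GG> H a \<in> lists L"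
  by (cases a) (auto simp: group.inv_closed)

lemma Hw_lists: "w \<in> lists L \<Longrightarrow> Hw w \<in> lists L"
  using letter_image_lists by (induction w) auto

lemma cls_Hw_Stable:
  assumes "e \<in> E"
  shows "cls (letter_image \<GG> H (Stable e)) =
    El (\<tau> (bar e)) (corr H (bar e)) \<otimes>\<^bsub>PG\<^esub> St e \<otimes>\<^bsub>PG\<^esub> inv\<^bsub>PG\<^esub> El (\<tau> e) (corr H e)"
  using assms by (simp add: cls_Elt cls_Stable cls_Nil group.inv_closed El_inv PG.m_assoc)

text \<open>In the image of the edge relation the correction term at the terminal vertex cancels
  against the one that relates the vertex and edge homomorphisms. What remains is the same relation,
  conjugated by the correction term at the other end.\<close>

lemma Hw_rel:
  assumes "(u, w) \<in> vrels \<GG> \<union> erels \<GG>"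
  shows "cls (Hw u) = cls (Hw w)"
proof -
  consider (one) x where "x \<in> V" "u = [Elt x \<one>\<^bsub>VG x\<^esub>]" "w = []"
    | (mul) x g h where "x \<in> V" "g \<in> carrier (VG x)" "h \<in> carrier (VG x)" "u = [Elt x g, Elt x h]" "w = [Elt x (g \<otimes>\<^bsub>VG x\<^esub> h)]"
    | (st) e where "e \<in> E" "u = [Stable e, Stable (bar e)]" "w = []"
    | (mv) e g where "e \<in> E" "g \<in> carrier (EG e)" "u = [Stable e, Elt (\<tau> e) (f e g), Stable (bar e)]"
        "w = [Elt (\<tau> (bar e)) (f (bar e) g)]"
    using assms unfolding vrels_def erels_def by blast
  then show ?thesis
  proof cases
    case one
    then show ?thesis using group_hom.hom_one[OF vhom_hom[OF one(1)]] El_one[OF one(1)] cls_Nil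
      by (simp add: El_def)
  next
    case mul
    then show ?thesis
      using El_mult[of x "vhom H x g" "vhom H x h"] group_hom.hom_mult[OF vhom_hom[OF mul(1)] mul(2,3)]
      by (simp add: cls_Elt cls_Nil El_def[symmetric] monoid.m_closed)
  next
    case st
    have "cls (Hw u) = cls (letter_image \<GG> H (Stable e)) \<otimes>\<^bsub>PG\<^esub> cls (letter_image \<GG> H (Stable (bar e)))"
      using cls_append[OF letter_image_lists letter_image_lists, of "Stable e" "Stable (bar e)"] st by simp
    also have "\<dots> = \<one>\<^bsub>PG\<^esub>" unfolding cls_Hw_Stable[OF st(1)] cls_Hw_Stable[OF bar_closed[OF st(1)]]
      using st(1) by (simp add: PG.m_assoc St_bar)
    finally show ?thesis using st cls_Nil by simp
  next
    case mv
    let ?a = "El (\<tau> (bar e)) (corr H (bar e))" and ?b = "El (\<tau> e) (corr H e)"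
    have "cls (Hw u) = cls (letter_image \<GG> H (Stable e)) \<otimes>\<^bsub>PG\<^esub> (El (\<tau> e) (vhom H (\<tau> e) (f e g)) \<otimes>\<^bsub>PG\<^esub> cls (letter_image \<GG> H (Stable (bar e))))"
    proof -
      let ?m = "[Elt (\<tau> e) (vhom H (\<tau> e) (f e g))]"
      have l: "letter_image \<GG> H (Stable e) \<in> lists L" "?m \<in> lists L" "letter_image \<GG> H (Stable (bar e)) \<in> lists L"
        using mv letter_image_lists[of "Stable e"] letter_image_lists[of "Stable (bar e)"] by simp_all
      then have "?m @ letter_image \<GG> H (Stable (bar e)) \<in> lists L" by (simp only: append_in_lists_conv simp_thms)
      moreover have "Hw u = letter_image \<GG> H (Stable e) @ (?m @ letter_image \<GG> H (Stable (bar e)))"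
        using mv by simp
      ultimately show ?thesis using l by (simp only: cls_append El_def)
    qed
    also have "El (\<tau> e) (vhom H (\<tau> e) (f e g)) = ?b \<otimes>\<^bsub>PG\<^esub> El (\<tau> e) (f e (ehom H e g)) \<otimes>\<^bsub>PG\<^esub> inv\<^bsub>PG\<^esub> ?b"
      using mv vhom_f[of e g] by (simp add: El_mult El_inv[symmetric] group.inv_closed monoid.m_closed)
    also have "cls (letter_image \<GG> H (Stable e)) \<otimes>\<^bsub>PG\<^esub> (\<dots> \<otimes>\<^bsub>PG\<^esub> cls (letter_image \<GG> H (Stable (bar e))))
      = ?a \<otimes>\<^bsub>PG\<^esub> (St e \<otimes>\<^bsub>PG\<^esub> El (\<tau> e) (f e (ehom H e g))) \<otimes>\<^bsub>PG\<^esub> inv\<^bsub>PG\<^esub> St e \<otimes>\<^bsub>PG\<^esub> inv\<^bsub>PG\<^esub> ?a"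
      unfolding cls_Hw_Stable[OF mv(1)] cls_Hw_Stable[OF bar_closed[OF mv(1)]]
      using mv by (simp add: PG.m_assoc St_bar)
    also have "\<dots> = ?a \<otimes>\<^bsub>PG\<^esub> El (\<tau> (bar e)) (f (bar e) (ehom H e g)) \<otimes>\<^bsub>PG\<^esub> inv\<^bsub>PG\<^esub> ?a"
      using mv by (simp add: St_rel PG.m_assoc)
    also have "\<dots> = El (\<tau> (bar e)) (vhom H (\<tau> (bar e)) (f (bar e) g))"
      using mv vhom_f[of "bar e" g] by (simp add: ehom_bar El_mult El_inv[symmetric] group.inv_closed monoid.m_closed)
    also have "\<dots> = cls (Hw w)" using mv by (simp add: El_def)
    finally show ?thesis .
  qed
qed

lemma Hw_cong: "x \<approx> y \<Longrightarrow> cls (Hw x) = cls (Hw y)"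
  unfolding path_cong_def
proof (erule word_cong_invariant[where f = "\<lambda>w. word_cong L (vrels \<GG> \<union> erels \<GG>) `` {Hw w}"])
  fix u w p q assume h: "(u, w) \<in> vrels \<GG> \<union> erels \<GG>" "p \<in> lists L" "q \<in> lists L"
  have l: "Hw u \<in> lists L" "Hw w \<in> lists L" "Hw p \<in> lists L" "Hw q \<in> lists L"
    using h rels_lists Hw_lists by blast+
  have "cls (Hw (p @ u @ q)) = cls (Hw (p @ w @ q))"
    using Hw_rel[OF h(1)] l by (simp add: cls_append)
  then show "word_cong L (vrels \<GG> \<union> erels \<GG>) `` {Hw (p @ u @ q)} = word_cong L (vrels \<GG> \<union> erels \<GG>) `` {Hw (p @ w @ q)}"
    by (simp add: path_cong_def)
qed

abbreviation "ind \<equiv> induced \<GG> H"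

lemma ind_cls: "w \<in> lists L \<Longrightarrow> ind (cls w) = cls (Hw w)"
proof -
  assume w: "w \<in> lists L"
  have "w \<in> cls w" using w by (simp add: path_cong_def word_cong.refl)
  moreover have "cls (Hw y) = cls (Hw w)" if "y \<in> cls w" for y using Hw_cong that by blast
  ultimately show ?thesis unfolding induced_def Hw_def by blast
qed

lemma ind_hom: "group_hom PG PG ind"
proof -
  have "ind (x \<otimes>\<^bsub>PG\<^esub> y) = ind x \<otimes>\<^bsub>PG\<^esub> ind y" if xy: "x \<in> carrier PG" "y \<in> carrier PG" for x y
  proof -
    obtain u w where uw: "u \<in> lists L" "w \<in> lists L" "x = cls u" "y = cls w" using xy unfolding carrier_PG by blast
    then have "u @ w \<in> lists L" by simp
    then show ?thesis using ind_cls[of "u @ w"] ind_cls[of u] ind_cls[of w] Hw_lists[OF uw(1)] Hw_lists[OF uw(2)] uw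
        cls_append[OF uw(1,2)] cls_append[of "Hw u" "Hw w"] by simp
  qed
  moreover have "ind x \<in> carrier PG" if "x \<in> carrier PG" for x
    using that Hw_lists ind_cls unfolding carrier_PG by blast
  ultimately show ?thesis by (auto simp: group_hom_def group_hom_axioms_def PG.is_group hom_def)
qed

lemmas ind_closed [simp] = group_hom.hom_closed[OF ind_hom]
lemmas ind_mult = group_hom.hom_mult[OF ind_hom]
lemmas ind_inv = group_hom.hom_inv[OF ind_hom]
lemmas ind_one [simp] = group_hom.hom_one[OF ind_hom]

lemma ind_El: "\<lbrakk>x \<in> V; g \<in> carrier (VG x)\<rbrakk> \<Longrightarrow> ind (El x g) = El x (vhom H x g)"
  using ind_cls[of "[Elt x g]"] by (simp add: El_def)

lemma ind_St: "e \<in> E \<Longrightarrow> ind (St e) =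
    El (\<tau> (bar e)) (corr H (bar e)) \<otimes>\<^bsub>PG\<^esub> St e \<otimes>\<^bsub>PG\<^esub> inv\<^bsub>PG\<^esub> El (\<tau> e) (corr H e)"
  using ind_cls[of "[Stable e]"] cls_Hw_Stable[of e] by (simp add: St_def)

lemma path_word_Hw: "w \<in> lists L \<Longrightarrow> path_word \<GG> x w y \<Longrightarrow> path_word \<GG> x (Hw w) y"
proof (induction w arbitrary: x)
  case (Cons a w)
  then show ?case by (cases a) auto
qed simp

lemma ind_paths: "p \<in> paths x y \<Longrightarrow> ind p \<in> paths x y"
  unfolding paths_def using path_word_Hw Hw_lists ind_cls by blast

end

section \<open>Normal forms\<close>

context gog
begin

abbreviation "BG \<equiv> presented_monoid (vletters \<GG>) (vrels \<GG>)"

sublocale BG: group BG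
  by (rule B.PM_group)

definition bE :: "'v \<Rightarrow> 'a \<Rightarrow> ('v, 'e, 'a) letter list set" where "bE x g = B.cl [Elt x g]"

text \<open>The path group is a multiple HNN extension of \<open>BG\<close>; the ranges of
  \<open>F e\<close> and \<open>F (bar e)\<close> are the subgroups that the stable letter of
  \<open>e\<close> identifies.\<close>

definition F :: "'e \<Rightarrow> 'b \<Rightarrow> ('v, 'e, 'a) letter list set" where "F e g = bE (\<tau> e) (f e g)"

lemma bcl_closed [simp]: "w \<in> lists (vletters \<GG>) \<Longrightarrow> B.cl w \<in> carrier BG"
  using B.PM_carrier by blast

lemma bE_closed [simp]: "\<lbrakk>x \<in> V; g \<in> carrier (VG x)\<rbrakk> \<Longrightarrow> bE x g \<in> carrier BG"
  by (simp add: bE_def)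

lemma bE_mult:
  assumes "x \<in> V" "g \<in> carrier (VG x)" "h \<in> carrier (VG x)"
  shows "bE x (g \<otimes>\<^bsub>VG x\<^esub> h) = bE x g \<otimes>\<^bsub>BG\<^esub> bE x h"
proof -
  have l: "[Elt x g] \<in> lists (vletters \<GG>)" "[Elt x h] \<in> lists (vletters \<GG>)"
    "[Elt x (g \<otimes>\<^bsub>VG x\<^esub> h)] \<in> lists (vletters \<GG>)" "[Elt x g] @ [Elt x h] \<in> lists (vletters \<GG>)"
    using assms by (auto intro: monoid.m_closed)
  have "([Elt x g] @ [Elt x h], [Elt x (g \<otimes>\<^bsub>VG x\<^esub> h)]) \<in> vrels \<GG>"
    using assms by (auto simp: vrels_def)
  then have "B.cl ([Elt x g] @ [Elt x h]) = bE x (g \<otimes>\<^bsub>VG x\<^esub> h)"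
    unfolding bE_def using B.cl_eq_iff[OF l(4,3)] word_cong_relI by metis
  then show ?thesis using B.PM_mult[OF l(1,2)] by (simp only: bE_def)
qed

lemma bE_hom: "x \<in> V \<Longrightarrow> group_hom (VG x) BG (bE x)"
  by (auto simp: group_hom_def group_hom_axioms_def BG.is_group hom_def bE_mult)

lemma bE_one: "x \<in> V \<Longrightarrow> bE x \<one>\<^bsub>VG x\<^esub> = \<one>\<^bsub>BG\<^esub>"
  using group_hom.hom_one[OF bE_hom] .

lemma F_closed [simp]: "\<lbrakk>e \<in> E; g \<in> carrier (EG e)\<rbrakk> \<Longrightarrow> F e g \<in> carrier BG"
  by (simp add: F_def)

lemma F_mult: "\<lbrakk>e \<in> E; g \<in> carrier (EG e); h \<in> carrier (EG e)\<rbrakk> \<Longrightarrow>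
    F e (g \<otimes>\<^bsub>EG e\<^esub> h) = F e g \<otimes>\<^bsub>BG\<^esub> F e h"
  by (simp add: F_def f_mult bE_mult)

lemma F_one [simp]: "e \<in> E \<Longrightarrow> F e \<one>\<^bsub>EG e\<^esub> = \<one>\<^bsub>BG\<^esub>"
  by (simp add: F_def bE_one)

lemma F_hom: "e \<in> E \<Longrightarrow> group_hom (EG e) BG (F e)"
  by (auto simp: group_hom_def group_hom_axioms_def BG.is_group hom_def F_mult)

lemma F_inv: "\<lbrakk>e \<in> E; g \<in> carrier (EG e)\<rbrakk> \<Longrightarrow> F e (inv\<^bsub>EG e\<^esub> g) = inv\<^bsub>BG\<^esub> F e g"
  using group_hom.hom_inv[OF F_hom] .

text \<open>The retraction of the free product onto one of its factors. It shows that the vertex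
  groups embed in \<open>BG\<close>.\<close>

fun evl :: "'v \<Rightarrow> ('v, 'e, 'a) letter list \<Rightarrow> 'a" where
  "evl x [] = \<one>\<^bsub>VG x\<^esub>"
| "evl x (Elt y g # w) = (if y = x then g \<otimes>\<^bsub>VG x\<^esub> evl x w else evl x w)"
| "evl x (Stable e # w) = evl x w"

lemma evl_closed: "x \<in> V \<Longrightarrow> w \<in> lists (vletters \<GG>) \<Longrightarrow> evl x w \<in> carrier (VG x)"
proof (induction w)
  case (Cons a w)
  then show ?case by (cases a) (auto intro: monoid.m_closed)
qed (simp add: monoid.one_closed)

lemma evl_append:
  "x \<in> V \<Longrightarrow> u \<in> lists (vletters \<GG>) \<Longrightarrow> w \<in> lists (vletters \<GG>) \<Longrightarrow>
    evl x (u @ w) = evl x u \<otimes>\<^bsub>VG x\<^esub> evl x w"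
proof (induction u)
  case Nil
  then show ?case using evl_closed by (simp add: monoid.l_one)
next
  case (Cons a u)
  then show ?case using evl_closed[of x u] evl_closed[of x w] by (cases a) (auto simp: monoid.m_assoc)
qed

lemma evl_cong:
  assumes x: "x \<in> V" and eq: "(u, w) \<in> word_cong (vletters \<GG>) (vrels \<GG>)"
  shows "evl x u = evl x w"
  using eq
proof (rule word_cong_invariant)
  fix u w p q
  assume h: "(u, w) \<in> vrels \<GG>" "p \<in> lists (vletters \<GG>)" "q \<in> lists (vletters \<GG>)"
  have l: "u \<in> lists (vletters \<GG>)" "w \<in> lists (vletters \<GG>)" using h vrels_lists by auto
  have "evl x u = evl x w"
    using h(1) x by (auto simp: vrels_def monoid.l_one monoid.r_one monoid.m_closed monoid.one_closed)
  then show "evl x (p @ u @ q) = evl x (p @ w @ q)"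
    using x h l by (simp only: evl_append append_in_lists_conv simp_thms)
qed

lemma bE_inject:
  assumes "x \<in> V" "g \<in> carrier (VG x)" "h \<in> carrier (VG x)" "bE x g = bE x h"
  shows "g = h"
proof -
  have "[Elt x g] \<in> lists (vletters \<GG>)" "[Elt x h] \<in> lists (vletters \<GG>)" using assms by auto
  then have "([Elt x g], [Elt x h]) \<in> word_cong (vletters \<GG>) (vrels \<GG>)"
    using B.cl_eq_iff assms(4) unfolding bE_def by blast
  from evl_cong[OF assms(1) this] show ?thesis using assms by (simp add: monoid.r_one)
qed

lemma F_inject:
  assumes "e \<in> E" "g \<in> carrier (EG e)" "h \<in> carrier (EG e)" "F e g = F e h"
  shows "g = h"
  using assms bE_inject[of "\<tau> e" "f e g" "f e h"] f_inj[of e g h] by (simp add: F_def)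

definition coset :: "'e \<Rightarrow> ('v, 'e, 'a) letter list set \<Rightarrow> ('v, 'e, 'a) letter list set set" where
  "coset e b = (\<lambda>g. F e g \<otimes>\<^bsub>BG\<^esub> b) ` carrier (EG e)"

text \<open>The trivial coset is represented by \<open>\<one>\<close>, so that the representative
  tells whether two stable letters cancel.\<close>

definition rep :: "'e \<Rightarrow> ('v, 'e, 'a) letter list set \<Rightarrow> ('v, 'e, 'a) letter list set" where
  "rep e b = (if \<one>\<^bsub>BG\<^esub> \<in> coset e b then \<one>\<^bsub>BG\<^esub> else SOME c. c \<in> coset e b)"

definition dec :: "'e \<Rightarrow> ('v, 'e, 'a) letter list set \<Rightarrow> 'b" where
  "dec e b = (SOME g. g \<in> carrier (EG e) \<and> b = F e g \<otimes>\<^bsub>BG\<^esub> rep e b)"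

lemma dec_rep:
  assumes e: "e \<in> E" and b: "b \<in> carrier BG"
  shows "dec e b \<in> carrier (EG e)" "F e (dec e b) \<otimes>\<^bsub>BG\<^esub> rep e b = b" "rep e b \<in> carrier BG"
proof -
  interpret EG: group "EG e" using e by simp
  have "b \<in> coset e b" using e b by (auto simp: coset_def intro!: image_eqI[of _ _ "\<one>\<^bsub>EG e\<^esub>"])
  then have "rep e b \<in> coset e b" by (auto simp: rep_def intro: someI)
  then obtain g where g: "g \<in> carrier (EG e)" "rep e b = F e g \<otimes>\<^bsub>BG\<^esub> b" by (auto simp: coset_def)
  then show "rep e b \<in> carrier BG" using e b by simp
  have "inv\<^bsub>EG e\<^esub> g \<in> carrier (EG e) \<and> b = F e (inv\<^bsub>EG e\<^esub> g) \<otimes>\<^bsub>BG\<^esub> rep e b"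
    using g e b by (simp add: F_inv)
  then have "dec e b \<in> carrier (EG e) \<and> b = F e (dec e b) \<otimes>\<^bsub>BG\<^esub> rep e b"
    unfolding dec_def by (rule someI)
  then show "dec e b \<in> carrier (EG e)" "F e (dec e b) \<otimes>\<^bsub>BG\<^esub> rep e b = b" by auto
qed

lemma coset_shift:
  assumes e: "e \<in> E" and g: "g \<in> carrier (EG e)" and b: "b \<in> carrier BG"
  shows "coset e (F e g \<otimes>\<^bsub>BG\<^esub> b) = coset e b"
proof -
  interpret EG: group "EG e" using e by simp
  have 1: "F e h \<otimes>\<^bsub>BG\<^esub> (F e g \<otimes>\<^bsub>BG\<^esub> b) = F e (h \<otimes>\<^bsub>EG e\<^esub> g) \<otimes>\<^bsub>BG\<^esub> b" if "h \<in> carrier (EG e)" for h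
    using that e g b by (simp add: F_mult BG.m_assoc)
  have 2: "F e h \<otimes>\<^bsub>BG\<^esub> b = F e (h \<otimes>\<^bsub>EG e\<^esub> inv\<^bsub>EG e\<^esub> g) \<otimes>\<^bsub>BG\<^esub> (F e g \<otimes>\<^bsub>BG\<^esub> b)" if "h \<in> carrier (EG e)" for h
    using that e g b by (simp add: F_mult F_inv BG.m_assoc)
  show ?thesis
  proof (rule equalityI; rule subsetI)
    fix c assume "c \<in> coset e (F e g \<otimes>\<^bsub>BG\<^esub> b)"
    then obtain h where "h \<in> carrier (EG e)" "c = F e h \<otimes>\<^bsub>BG\<^esub> (F e g \<otimes>\<^bsub>BG\<^esub> b)" by (auto simp: coset_def)
    then show "c \<in> coset e b" 
      unfolding coset_def using 1 g by (intro image_eqI[of _ _ "h \<otimes>\<^bsub>EG e\<^esub> g"]) simp_all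
  next
    fix c assume "c \<in> coset e b"
    then obtain h where h: "h \<in> carrier (EG e)" "c = F e h \<otimes>\<^bsub>BG\<^esub> b" by (auto simp: coset_def)
    have "c = F e (h \<otimes>\<^bsub>EG e\<^esub> inv\<^bsub>EG e\<^esub> g) \<otimes>\<^bsub>BG\<^esub> (F e g \<otimes>\<^bsub>BG\<^esub> b)"
      unfolding h(2) by (rule 2[OF h(1)])
    then show "c \<in> coset e (F e g \<otimes>\<^bsub>BG\<^esub> b)"
      unfolding coset_def by (rule image_eqI) (use h g in simp)
  qed
qed

lemma rep_shift:
  assumes "e \<in> E" "g \<in> carrier (EG e)" "b \<in> carrier BG"
  shows "rep e (F e g \<otimes>\<^bsub>BG\<^esub> b) = rep e b"
  using coset_shift[OF assms] by (simp add: rep_def)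

lemma dec_eqI:
  assumes "e \<in> E" "g \<in> carrier (EG e)" "b \<in> carrier BG" "F e g \<otimes>\<^bsub>BG\<^esub> rep e b = b"
  shows "dec e b = g"
proof -
  have "F e (dec e b) \<otimes>\<^bsub>BG\<^esub> rep e b = F e g \<otimes>\<^bsub>BG\<^esub> rep e b" using assms dec_rep[of e b] by simp
  then have "F e (dec e b) = F e g"
    using BG.right_cancel[OF dec_rep(3)[OF assms(1,3)] F_closed[OF assms(1) dec_rep(1)[OF assms(1,3)]]
        F_closed[OF assms(1,2)]] by blast
  then show ?thesis using F_inject assms dec_rep[of e b] by metis
qed

lemma dec_shift:
  assumes "e \<in> E" "g \<in> carrier (EG e)" "b \<in> carrier BG"
  shows "dec e (F e g \<otimes>\<^bsub>BG\<^esub> b) = g \<otimes>\<^bsub>EG e\<^esub> dec e b"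
proof (rule dec_eqI)
  show "F e (g \<otimes>\<^bsub>EG e\<^esub> dec e b) \<otimes>\<^bsub>BG\<^esub> rep e (F e g \<otimes>\<^bsub>BG\<^esub> b) = F e g \<otimes>\<^bsub>BG\<^esub> b"
    using assms dec_rep[of e b] by (simp add: rep_shift F_mult BG.m_assoc)
qed (use assms dec_rep[of e b] in \<open>auto intro: monoid.m_closed\<close>)

lemma rep_eq_one_iff:
  assumes "e \<in> E" "b \<in> carrier BG"
  shows "rep e b = \<one>\<^bsub>BG\<^esub> \<longleftrightarrow> b \<in> F e ` carrier (EG e)"
proof
  assume "rep e b = \<one>\<^bsub>BG\<^esub>"
  then have "b = F e (dec e b)" using dec_rep[OF assms] assms by simp
  then show "b \<in> F e ` carrier (EG e)" using dec_rep[OF assms] by blast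
next
  assume "b \<in> F e ` carrier (EG e)"
  then obtain g where g: "g \<in> carrier (EG e)" "b = F e g" by blast
  interpret EG: group "EG e" using assms by simp
  have "\<one>\<^bsub>BG\<^esub> \<in> coset e b"
    using g assms by (auto simp: coset_def F_inv intro!: image_eqI[of _ _ "inv\<^bsub>EG e\<^esub> g"])
  then show "rep e b = \<one>\<^bsub>BG\<^esub>" by (simp add: rep_def)
qed

lemma rep_rep:
  assumes "e \<in> E" "b \<in> carrier BG"
  shows "rep e (rep e b) = rep e b"
  using rep_shift[OF assms(1) dec_rep(1)[OF assms] dec_rep(3)[OF assms]] dec_rep(2)[OF assms] by simp

text \<open>A state \<open>(b, [(e1, r1), (e2, r2), ...])\<close> stands for the product
  \<open>b t1 r1 t2 r2 ...\<close>, where \<open>ti\<close> is the stable letter of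
  \<open>ei\<close> and, in a valid state, \<open>ri\<close> is a coset representative.\<close>

type_synonym (in -) ('x, 'y, 'z) nfstate = "('x, 'y, 'z) letter list set \<times> ('y \<times> ('x, 'y, 'z) letter list set) list"

text \<open>Van der Waerden's method: the letters act on normal forms, whence these are unique.\<close>

fun act :: "('v, 'e, 'a) letter \<Rightarrow> ('v, 'e, 'a) nfstate \<Rightarrow> ('v, 'e, 'a) nfstate" where
  "act (Elt x g) (b, S) = (bE x g \<otimes>\<^bsub>BG\<^esub> b, S)"
| "act (Stable e) (b, S) =
    (if S \<noteq> [] \<and> fst (hd S) = bar e \<and> rep e b = \<one>\<^bsub>BG\<^esub>
     then (F (bar e) (dec e b) \<otimes>\<^bsub>BG\<^esub> snd (hd S), List.tl S)
     else (F (bar e) (dec e b), (e, rep e b) # S))"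

definition valid :: "('v, 'e, 'a) nfstate \<Rightarrow> bool" where
  "valid s \<longleftrightarrow> fst s \<in> carrier BG \<and>
    (\<forall>(e, r) \<in> set (snd s). e \<in> E \<and> r \<in> carrier BG \<and> rep e r = r) \<and>
    successively (\<lambda>(e, r) (e', r'). \<not> (e' = bar e \<and> r = \<one>\<^bsub>BG\<^esub>)) (snd s)"

lemma valid_act:
  assumes "a \<in> L" "valid s"
  shows "valid (act a s)"
proof -
  obtain b S where s: "s = (b, S)" by force
  have b: "b \<in> carrier BG" using assms s by (simp add: valid_def)
  show ?thesis
  proof (cases a)
    case (Elt x g)
    then show ?thesis using assms b by (simp add: valid_def s)
  next
    case (Stable e)
    then have e: "e \<in> E" using assms by simp
    have "dec e b \<in> carrier (EG (bar e))" using dec_rep[OF e b] e by simp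
    then have F: "F (bar e) (dec e b) \<in> carrier BG" using e by simp
    show ?thesis
    proof (cases S)
      case Nil
      then show ?thesis using F dec_rep[OF e b] rep_rep[OF e b] e by (simp add: valid_def s Stable)
    next
      case (Cons t S')
      then show ?thesis using F dec_rep[OF e b] rep_rep[OF e b] e assms(2)
        by (cases t) (auto simp: valid_def s Stable successively_Cons)
    qed
  qed
qed

lemma valid_foldr: "w \<in> lists L \<Longrightarrow> valid s \<Longrightarrow> valid (foldr act w s)"
  using valid_act by (induction w) auto

lemma act_Stable_shift:
  assumes "e \<in> E" "g \<in> carrier (EG e)" "valid (b, S)"
  shows "act (Stable e) (F e g \<otimes>\<^bsub>BG\<^esub> b, S) =
    (F (bar e) g \<otimes>\<^bsub>BG\<^esub> fst (act (Stable e) (b, S)), snd (act (Stable e) (b, S)))"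
proof -
  have b: "b \<in> carrier BG" using assms by (simp add: valid_def)
  have d: "dec e b \<in> carrier (EG e)" using dec_rep[OF assms(1) b] by simp
  have "snd (hd S) \<in> carrier BG" if "S \<noteq> []" using assms(3) that by (cases S) (auto simp: valid_def)
  moreover have "F (bar e) (g \<otimes>\<^bsub>EG e\<^esub> dec e b) = F (bar e) g \<otimes>\<^bsub>BG\<^esub> F (bar e) (dec e b)"
    using F_mult[of "bar e" g "dec e b"] assms d by simp
  moreover have "F (bar e) g \<in> carrier BG" "F (bar e) (dec e b) \<in> carrier BG" using assms d by simp_all
  ultimately show ?thesis using assms b d by (simp add: rep_shift dec_shift BG.m_assoc)
qed

text \<open>Either the inner letter cancels the head of the stack and the outer one restores it, or
  the inner letter is pushed and the outer one removes it. In the first case validity prevents the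
  outer letter from cancelling the next entry instead.\<close>

lemma act_Stable_bar:
  assumes e: "e \<in> E" and v: "valid (b, S)"
  shows "act (Stable e) (act (Stable (bar e)) (b, S)) = (b, S)"
proof -
  have b: "b \<in> carrier BG" using v by (simp add: valid_def)
  define g where "g = dec (bar e) b"
  have g: "g \<in> carrier (EG e)" using dec_rep[OF bar_closed[OF e] b] e by (simp add: g_def)
  have gb: "F (bar e) g \<otimes>\<^bsub>BG\<^esub> rep (bar e) b = b" using dec_rep[OF bar_closed[OF e] b] by (simp add: g_def)
  show ?thesis
  proof (cases "S \<noteq> [] \<and> fst (hd S) = e \<and> rep (bar e) b = \<one>\<^bsub>BG\<^esub>")
    case True
    then obtain r S' where S: "S = (e, r) # S'" by (cases S) auto
    have r: "r \<in> carrier BG" "rep e r = r" using v by (auto simp: valid_def S)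
    have d: "dec e r = \<one>\<^bsub>EG e\<^esub>" by (rule dec_eqI) (use e r in \<open>auto intro: monoid.one_closed\<close>)
    have 1: "act (Stable (bar e)) (b, S) = (F e g \<otimes>\<^bsub>BG\<^esub> r, S')"
      using True e by (simp add: S g_def)
    have nc: "\<not> (S' \<noteq> [] \<and> fst (hd S') = bar e \<and> r = \<one>\<^bsub>BG\<^esub>)"
      using v by (cases S') (auto simp: valid_def S)
    have "rep e (F e g \<otimes>\<^bsub>BG\<^esub> r) = r" "dec e (F e g \<otimes>\<^bsub>BG\<^esub> r) = g"
      using rep_shift[OF e g r(1)] dec_shift[OF e g r(1)] r d g e by (simp_all add: monoid.r_one)
    then have "act (Stable e) (F e g \<otimes>\<^bsub>BG\<^esub> r, S') = (F (bar e) g, (e, r) # S')"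
      using nc by auto
    then have "act (Stable e) (act (Stable (bar e)) (b, S)) = (F (bar e) g, (e, r) # S')" unfolding 1 .
    moreover have "F (bar e) g = b" using gb True g e by simp
    ultimately show ?thesis by (simp only: S)
  next
    case False
    then have 1: "act (Stable (bar e)) (b, S) = (F e g, (bar e, rep (bar e) b) # S)"
      using e by (auto simp: g_def)
    have "rep e (F e g) = \<one>\<^bsub>BG\<^esub>" using rep_eq_one_iff[OF e, of "F e g"] e g by simp
    moreover from this have "dec e (F e g) = g" using e g by (intro dec_eqI) auto
    ultimately show ?thesis unfolding 1 using gb by simp
  qed
qed

lemma foldr_act_rel:
  assumes "(u, w) \<in> vrels \<GG> \<union> erels \<GG>" "valid s"
  shows "foldr act u s = foldr act w s"
proof -
  obtain b S where s: "s = (b, S)" by force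
  have b: "b \<in> carrier BG" using assms s by (simp add: valid_def)
  consider (one) x where "x \<in> V" "u = [Elt x \<one>\<^bsub>VG x\<^esub>]" "w = []"
    | (mul) x g h where "x \<in> V" "g \<in> carrier (VG x)" "h \<in> carrier (VG x)" "u = [Elt x g, Elt x h]" "w = [Elt x (g \<otimes>\<^bsub>VG x\<^esub> h)]"
    | (st) e where "e \<in> E" "u = [Stable e, Stable (bar e)]" "w = []"
    | (mv) e g where "e \<in> E" "g \<in> carrier (EG e)" "u = [Stable e, Elt (\<tau> e) (f e g), Stable (bar e)]"
        "w = [Elt (\<tau> (bar e)) (f (bar e) g)]"
    using assms unfolding vrels_def erels_def by blast
  then show ?thesis
  proof cases
    case one
    then show ?thesis using b by (simp add: s bE_one)
  next
    case mul
    then show ?thesis using b by (simp add: s bE_mult BG.m_assoc)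
  next
    case st
    then show ?thesis using act_Stable_bar[of e b S] assms(2) by (simp add: s del: act.simps)
  next
    case mv
    obtain b' S' where s': "act (Stable (bar e)) (b, S) = (b', S')" by force
    have v': "valid (b', S')" using valid_act[of "Stable (bar e)" s] assms(2) mv s s' by simp
    have "foldr act u s = act (Stable e) (F e g \<otimes>\<^bsub>BG\<^esub> b', S')"
      using s' mv by (simp add: s F_def del: act.simps(2))
    also have "\<dots> = (F (bar e) g \<otimes>\<^bsub>BG\<^esub> b, S)"
      using act_Stable_shift[OF mv(1,2) v'] act_Stable_bar[of e b S] mv assms(2) s s'
      by (simp del: act.simps)
    also have "\<dots> = foldr act w s" using mv by (simp add: s F_def)
    finally show ?thesis .
  qed
qed

definition nf :: "('v, 'e, 'a) letter list \<Rightarrow> ('v, 'e, 'a) nfstate" where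
  "nf w = foldr act w (\<one>\<^bsub>BG\<^esub>, [])"

lemma valid_nf: "w \<in> lists L \<Longrightarrow> valid (nf w)"
  unfolding nf_def by (rule valid_foldr) (auto simp: valid_def)

lemma nf_closed: "w \<in> lists L \<Longrightarrow> fst (nf w) \<in> carrier BG"
  using valid_nf by (auto simp: valid_def)

lemma nf_Cons: "nf (a # w) = act a (nf w)"
  by (simp add: nf_def)

lemma nf_Nil: "nf [] = (\<one>\<^bsub>BG\<^esub>, [])"
  by (simp add: nf_def)

lemma nf_cong:
  assumes "x \<approx> y" shows "nf x = nf y"
  using assms unfolding path_cong_def
proof (rule word_cong_invariant)
  fix u w p q assume "(u, w) \<in> vrels \<GG> \<union> erels \<GG>" "p \<in> lists L" "q \<in> lists L"
  then show "nf (p @ u @ q) = nf (p @ w @ q)"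
    using foldr_act_rel[of u w "nf q"] valid_nf by (simp add: nf_def)
qed

lemma nf_Elt: "nf (Elt x g # w) = (bE x g \<otimes>\<^bsub>BG\<^esub> fst (nf w), snd (nf w))"
  by (cases "nf w") (simp add: nf_Cons)

lemma El_inject:
  assumes "x \<in> V" "g \<in> carrier (VG x)" "h \<in> carrier (VG x)" "El x g = El x h"
  shows "g = h"
proof -
  have "[Elt x g] \<approx> [Elt x h]" using assms cls_eq_iff[of "[Elt x g]" "[Elt x h]"] by (simp add: El_def)
  then have "nf [Elt x g] = nf [Elt x h]" by (rule nf_cong)
  then show ?thesis using assms bE_inject[of x g h] by (simp add: nf_Elt nf_Nil)
qed

section \<open>Reduced words and path length\<close>

definition unpinched :: "('v, 'e, 'a) letter list \<Rightarrow> bool" where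
  "unpinched w \<longleftrightarrow> (\<forall>x e r y. w = x @ Stable e # r @ Stable (bar e) # y \<and> r \<in> lists (vletters \<GG>) \<longrightarrow>
     (\<forall>g \<in> carrier (EG e). (r, [Elt (\<tau> e) (f e g)]) \<notin> free_product_cong \<GG>))"

lemma wpl_simps [simp]:
  "word_path_length [] = 0" "word_path_length (Elt x g # w) = word_path_length w"
  "word_path_length (Stable e # w) = Suc (word_path_length w)"
  by (auto simp: word_path_length_def)

text \<open>No stable letter of an unpinched word cancels, so the stack has one entry for each of
  them. To exclude a cancellation in the next step the induction has to know the base part too: it
  is the first block \<open>r\<close> times an edge group element that was carried out of the first
  stable letter.\<close>

lemma nf_unpinched:
  assumes "w \<in> lists L" "unpinched w"
  shows "\<exists>r y. w = r @ y \<and> r \<in> lists (vletters \<GG>) \<and>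
    ((y = [] \<and> nf w = (B.cl r, []) \<and> word_path_length w = 0) \<or>
     (\<exists>e y' g S \<rho>. y = Stable e # y' \<and> e \<in> E \<and> g \<in> carrier (EG e) \<and>
        nf w = (B.cl r \<otimes>\<^bsub>BG\<^esub> F (bar e) g, (e, \<rho>) # S) \<and> Suc (length S) = word_path_length w))"
  using assms
proof (induction w rule: list.induct)
  case Nil
  then show ?case by (intro exI[of _ "[]"]) (simp add: nf_Nil B.PM_one)
next
  case (Cons a w)
  have w: "w \<in> lists L" using Cons.prems by simp
  have "unpinched w" unfolding unpinched_def
  proof (intro allI impI, elim conjE)
    fix x e r y assume "w = x @ Stable e # r @ Stable (bar e) # y" "r \<in> lists (vletters \<GG>)"
    then show "\<forall>g \<in> carrier (EG e). (r, [Elt (\<tau> e) (f e g)]) \<notin> free_product_cong \<GG>"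
      using Cons.prems(2) unfolding unpinched_def by (metis append_Cons)
  qed
  then obtain r y where r: "w = r @ y" "r \<in> lists (vletters \<GG>)" and
    y: "(y = [] \<and> nf w = (B.cl r, []) \<and> word_path_length w = 0) \<or>
     (\<exists>e y' g S \<rho>. y = Stable e # y' \<and> e \<in> E \<and> g \<in> carrier (EG e) \<and>
        nf w = (B.cl r \<otimes>\<^bsub>BG\<^esub> F (bar e) g, (e, \<rho>) # S) \<and> Suc (length S) = word_path_length w)"
    using Cons.IH[OF w] by blast
  show ?case
  proof (cases a)
    case (Elt x g0)
    then have a: "[a] \<in> lists (vletters \<GG>)" "bE x g0 = B.cl [a]" "bE x g0 \<in> carrier BG"
      using Cons.prems by (auto simp: bE_def)
    have c: "bE x g0 \<otimes>\<^bsub>BG\<^esub> B.cl r = B.cl (a # r)"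
      unfolding a(2) using B.PM_mult[OF a(1) r(2)] by simp
    have c2: "bE x g0 \<otimes>\<^bsub>BG\<^esub> (B.cl r \<otimes>\<^bsub>BG\<^esub> z) = B.cl (a # r) \<otimes>\<^bsub>BG\<^esub> z" if "z \<in> carrier BG" for z
      unfolding c[symmetric] using that a(3) bcl_closed[OF r(2)] by (simp add: BG.m_assoc)
    have ar: "a # w = (a # r) @ y" "a # r \<in> lists (vletters \<GG>)" using r a(1) by simp_all
    show ?thesis
    proof (intro exI conjI)
      show "a # w = (a # r) @ y" "a # r \<in> lists (vletters \<GG>)" by (fact ar)+
      from y show "(y = [] \<and> nf (a # w) = (B.cl (a # r), []) \<and> word_path_length (a # w) = 0) \<or>
         (\<exists>e y' g S \<rho>. y = Stable e # y' \<and> e \<in> E \<and> g \<in> carrier (EG e) \<and>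
        nf (a # w) = (B.cl (a # r) \<otimes>\<^bsub>BG\<^esub> F (bar e) g, (e, \<rho>) # S) \<and> Suc (length S) = word_path_length (a # w))"
      proof (elim disjE exE conjE)
        assume "y = []" "nf w = (B.cl r, [])" "word_path_length w = 0"
        then show ?thesis by (intro disjI1) (simp add: Elt nf_Elt c[unfolded Elt])
      next
        fix e y' g S \<rho> assume "y = Stable e # y'" "e \<in> E" "g \<in> carrier (EG e)"
          "nf w = (B.cl r \<otimes>\<^bsub>BG\<^esub> F (bar e) g, (e, \<rho>) # S)" "Suc (length S) = word_path_length w"
        then show ?thesis
          by (intro disjI2 exI[of _ e] exI[of _ y'] exI[of _ g] exI[of _ S] exI[of _ \<rho>])
            (simp add: Elt nf_Elt c2[unfolded Elt])
      qed
    qed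
  next
    case (Stable e0)
    then have e0: "e0 \<in> E" using Cons.prems by simp
    have b: "fst (nf w) \<in> carrier BG" using nf_closed[OF w] .
    have d: "dec e0 (fst (nf w)) \<in> carrier (EG e0)" using dec_rep[OF e0 b] by simp
    have nc: "\<not> (snd (nf w) \<noteq> [] \<and> fst (hd (snd (nf w))) = bar e0 \<and> rep e0 (fst (nf w)) = \<one>\<^bsub>BG\<^esub>)"
    proof
      assume A: "snd (nf w) \<noteq> [] \<and> fst (hd (snd (nf w))) = bar e0 \<and> rep e0 (fst (nf w)) = \<one>\<^bsub>BG\<^esub>"
      then obtain e y' g S \<rho> where yy: "y = Stable e # y'" "e \<in> E" "g \<in> carrier (EG e)"
        "nf w = (B.cl r \<otimes>\<^bsub>BG\<^esub> F (bar e) g, (e, \<rho>) # S)" using y by auto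
      then have ee: "e = bar e0" using A by simp
      then have g: "g \<in> carrier (EG e0)" and bb: "fst (nf w) = B.cl r \<otimes>\<^bsub>BG\<^esub> F e0 g" using yy e0 by simp_all
      obtain h where h: "h \<in> carrier (EG e0)" "B.cl r \<otimes>\<^bsub>BG\<^esub> F e0 g = F e0 h"
        using A rep_eq_one_iff[OF e0 b] bb by auto
      interpret EG: group "EG e0" using e0 by simp
      have "B.cl r = F e0 h \<otimes>\<^bsub>BG\<^esub> inv\<^bsub>BG\<^esub> F e0 g"
        using h e0 g bcl_closed[OF r(2)] by (metis BG.inv_solve_right F_closed)
      also have "\<dots> = F e0 (h \<otimes>\<^bsub>EG e0\<^esub> inv\<^bsub>EG e0\<^esub> g)" using h g e0 by (simp add: F_mult F_inv)
      finally have "B.cl r = B.cl [Elt (\<tau> e0) (f e0 (h \<otimes>\<^bsub>EG e0\<^esub> inv\<^bsub>EG e0\<^esub> g))]" by (simp add: F_def bE_def)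
      moreover have k: "h \<otimes>\<^bsub>EG e0\<^esub> inv\<^bsub>EG e0\<^esub> g \<in> carrier (EG e0)" using h g by simp
      moreover have "[Elt (\<tau> e0) (f e0 (h \<otimes>\<^bsub>EG e0\<^esub> inv\<^bsub>EG e0\<^esub> g))] \<in> lists (vletters \<GG>)" using k e0 by simp
      ultimately have "(r, [Elt (\<tau> e0) (f e0 (h \<otimes>\<^bsub>EG e0\<^esub> inv\<^bsub>EG e0\<^esub> g))]) \<in> free_product_cong \<GG>"
        using B.cl_eq_iff r(2) unfolding free_product_cong_def by blast
      moreover have "a # w = [] @ Stable e0 # r @ Stable (bar e0) # y'" using r yy ee Stable by simp
      ultimately show False using Cons.prems(2) r(2) k unfolding unpinched_def by blast
    qed
    have n: "nf (a # w) = (F (bar e0) (dec e0 (fst (nf w))), (e0, rep e0 (fst (nf w))) # snd (nf w))"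
      using nc by (cases "nf w") (auto simp: nf_Cons Stable)
    have len: "length (snd (nf w)) = word_path_length w" using y by auto
    have cF: "B.cl [] \<otimes>\<^bsub>BG\<^esub> F (bar e0) (dec e0 (fst (nf w))) = F (bar e0) (dec e0 (fst (nf w)))"
      using d e0 by (simp add: B.PM_one[symmetric])
    show ?thesis
    proof (intro exI conjI)
      show "a # w = [] @ (a # w)" "[] \<in> lists (vletters \<GG>)" by simp_all
      show "(a # w = [] \<and> nf (a # w) = (B.cl [], []) \<and> word_path_length (a # w) = 0) \<or>
         (\<exists>e y' g S \<rho>. a # w = Stable e # y' \<and> e \<in> E \<and> g \<in> carrier (EG e) \<and>
        nf (a # w) = (B.cl [] \<otimes>\<^bsub>BG\<^esub> F (bar e) g, (e, \<rho>) # S) \<and> Suc (length S) = word_path_length (a # w))"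
        using e0 d n len cF
        by (intro disjI2 exI[of _ e0] exI[of _ w] exI[of _ "dec e0 (fst (nf w))"] exI[of _ "snd (nf w)"]
            exI[of _ "rep e0 (fst (nf w))"]) (simp add: Stable)
    qed
  qed
qed

text \<open>The definite description in \<open>path_length\<close> demands that no reduced word for
  this element contains a stable letter. The fact is what later excludes that a non-zero element has
  a twisted conjugate in a vertex group.\<close>

lemma path_length_El:
  assumes "x \<in> V" "g \<in> carrier (VG x)"
  shows "path_length \<GG> (El x g) = 0"
proof (cases "El x g = \<one>\<^bsub>PG\<^esub>")
  case True
  then show ?thesis by (simp add: path_length_def)
next
  case False
  have w: "[Elt x g] \<in> lists L" using assms by simp
  have red: "reduced_word \<GG> [Elt x g]"
    unfolding reduced_word_def
  proof (intro conjI impI allI)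
    show "[Elt x g] \<in> lists L" by (fact w)
    show "([Elt x g], []) \<notin> free_product_cong \<GG>"
    proof
      assume "([Elt x g], []) \<in> free_product_cong \<GG>"
      then have "[Elt x g] \<approx> []" unfolding path_cong_def free_product_cong_def
        by (rule word_cong_mono) (use vletters_sub in auto)
      then have "El x g = \<one>\<^bsub>PG\<^esub>" using cls_eq_iff[of "[Elt x g]" "[]"] w cls_Nil by (simp add: El_def)
      then show False using False by simp
    qed
  next
    fix y e r z assume "[Elt x g] = y @ Stable e # r @ Stable (bar e) # z \<and> r \<in> lists (vletters \<GG>)"
    then show "\<forall>g \<in> carrier (EG e). (r, [Elt (\<tau> e) (f e g)]) \<notin> free_product_cong \<GG>"
      by (cases y) auto
  qed
  have uniq: "word_path_length w' = 0" if w': "w' \<in> El x g" "reduced_word \<GG> w'" for w'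
  proof -
    have "[Elt x g] \<approx> w'" using w' by (simp add: El_def)
    then have "nf w' = nf [Elt x g]" by (simp add: nf_cong)
    then have "snd (nf w') = []" by (simp add: nf_Elt nf_Nil)
    moreover have "w' \<in> lists L" "unpinched w'" using w'(2) unfolding reduced_word_def unpinched_def by blast+
    ultimately show ?thesis using nf_unpinched[of w'] by auto
  qed
  have "(THE q. \<exists>w \<in> El x g. reduced_word \<GG> w \<and> word_path_length w = q) = 0"
  proof (rule the_equality)
    have "[Elt x g] \<in> El x g" using w by (simp add: El_def path_cong_def word_cong.refl)
    then show "\<exists>w \<in> El x g. reduced_word \<GG> w \<and> word_path_length w = 0" using red by (intro bexI[of _ "[Elt x g]"]) auto
  next
    fix q assume "\<exists>w \<in> El x g. reduced_word \<GG> w \<and> word_path_length w = q"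
    then obtain w where w: "w \<in> El x g" "reduced_word \<GG> w" "word_path_length w = q"
      by (elim bexE conjE)
    show "q = 0" using uniq[OF w(1,2)] w(3) by simp
  qed
  then show ?thesis using False by (simp add: path_length_def)
qed

section \<open>Edge paths and reduced expressions\<close>

fun ep :: "'v \<Rightarrow> ('e \<times> 'a) list \<Rightarrow> 'v \<Rightarrow> bool" where
  "ep x [] y \<longleftrightarrow> x = y"
| "ep x ((e, r) # xs) y \<longleftrightarrow> e \<in> E \<and> \<tau> (bar e) = x \<and> r \<in> carrier (VG (\<tau> e)) \<and> ep (\<tau> e) xs y"

definition red :: "('e \<times> 'a) list \<Rightarrow> bool" where
  "red xs \<longleftrightarrow> successively (\<lambda>(e, r) (e', r'). \<not> (e' = bar e \<and> r \<in> f e ` carrier (EG e))) xs"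

text \<open>Each stable letter is paired with the vertex element that follows it. The vertex element
  before the first edge is not part of the list and is supplied separately as a factor
  \<open>El x r0\<close>; thus lists can be concatenated and cut at will.\<close>

fun wd :: "('e \<times> 'a) list \<Rightarrow> ('v, 'e, 'a) letter list" where
  "wd [] = []"
| "wd ((e, r) # xs) = Stable e # Elt (\<tau> e) r # wd xs"

definition val :: "('e \<times> 'a) list \<Rightarrow> ('v, 'e, 'a) letter list set" where
  "val xs = cls (wd xs)"

lemma wd_append: "wd (xs @ ys) = wd xs @ wd ys"
  by (induction xs rule: wd.induct) auto

lemma ep_append: "ep x (xs @ ys) z \<longleftrightarrow> (\<exists>y. ep x xs y \<and> ep y ys z)"
  by (induction x xs z rule: ep.induct) auto

lemma wd_lists: "ep x xs y \<Longrightarrow> wd xs \<in> lists L"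
  by (induction x xs y rule: ep.induct) auto

lemma val_Nil: "val [] = \<one>\<^bsub>PG\<^esub>"
  by (simp add: val_def cls_Nil)

lemma val_Cons:
  assumes "ep x ((e, r) # xs) y"
  shows "val ((e, r) # xs) = St e \<otimes>\<^bsub>PG\<^esub> (El (\<tau> e) r \<otimes>\<^bsub>PG\<^esub> val xs)"
  using assms wd_lists[of "\<tau> e" xs y] by (simp add: val_def cls_Stable cls_Elt)

lemma val_append: "\<lbrakk>ep x xs y; ep y ys z\<rbrakk> \<Longrightarrow> val (xs @ ys) = val xs \<otimes>\<^bsub>PG\<^esub> val ys"
  using cls_append[OF wd_lists wd_lists] by (simp add: val_def wd_append)

lemma val_closed: "ep x xs y \<Longrightarrow> val xs \<in> carrier PG"
  using wd_lists by (auto simp: val_def)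

lemma val_paths: "ep x xs y \<Longrightarrow> val xs \<in> paths x y"
proof (induction x xs y rule: ep.induct)
  case (2 x e r xs y)
  then have "St e \<in> paths x (\<tau> e)" "El (\<tau> e) r \<in> paths (\<tau> e) (\<tau> e)" using St_paths El_paths by auto
  then show ?case using 2 val_Cons[of x e r xs y] paths_mult by auto
qed (auto simp: val_Nil paths_one)

lemma red_Cons: "red (p # xs) \<Longrightarrow> red xs"
  by (cases xs) (auto simp: red_def)

lemma nf_wd_Cons:
  assumes ep: "ep x ((e, r) # xs) y" and r: "red ((e, r) # xs)"
  defines "c \<equiv> bE (\<tau> e) r \<otimes>\<^bsub>BG\<^esub> fst (nf (wd xs))"
  shows "nf (wd ((e, r) # xs)) = (F (bar e) (dec e c), (e, rep e c) # snd (nf (wd xs)))"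
    and "map fst (snd (nf (wd ((e, r) # xs)))) = map fst ((e, r) # xs)"
proof -
  have *: "nf (wd ((e, r) # xs)) =
      (F (bar e) (dec e (bE (\<tau> e) r \<otimes>\<^bsub>BG\<^esub> fst (nf (wd xs)))),
        (e, rep e (bE (\<tau> e) r \<otimes>\<^bsub>BG\<^esub> fst (nf (wd xs)))) # snd (nf (wd xs))) \<and>
    map fst (snd (nf (wd ((e, r) # xs)))) = map fst ((e, r) # xs)"
    using ep r
  proof (induction xs arbitrary: x e r)
    case Nil
    then show ?case by (simp add: nf_Cons nf_Nil)
  next
    case (Cons p xs)
    obtain e' r' where p: "p = (e', r')" by force
    have ep': "ep (\<tau> e) ((e', r') # xs) y" and e: "e \<in> E" "r \<in> carrier (VG (\<tau> e))" using Cons.prems p by auto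
    have red': "red ((e', r') # xs)" using Cons.prems p red_Cons by blast
    define c' where "c' = bE (\<tau> e') r' \<otimes>\<^bsub>BG\<^esub> fst (nf (wd xs))"
    note IH = Cons.IH[OF ep' red', folded c'_def]
    have e': "e' \<in> E" "\<tau> (bar e') = \<tau> e" "r' \<in> carrier (VG (\<tau> e'))" using ep' by auto
    have wxs: "wd xs \<in> lists L" using ep' wd_lists by auto
    have c': "c' \<in> carrier BG" using e' nf_closed[OF wxs] by (simp add: c'_def)
    define g where "g = dec e' c'"
    have g: "g \<in> carrier (EG e')" using dec_rep[OF e'(1) c'] by (simp add: g_def)
    have n: "nf (wd (p # xs)) = (F (bar e') g, (e', rep e' c') # snd (nf (wd xs)))" using IH p by (simp add: g_def)
    define b where "b = bE (\<tau> e) r \<otimes>\<^bsub>BG\<^esub> F (bar e') g"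
    have b: "b \<in> carrier BG" using e e' g by (simp add: b_def)
    have "\<not> (e' = bar e \<and> rep e b = \<one>\<^bsub>BG\<^esub>)"
    proof
      assume A: "e' = bar e \<and> rep e b = \<one>\<^bsub>BG\<^esub>"
      then obtain h where h: "h \<in> carrier (EG e)" "b = F e h" using rep_eq_one_iff[OF e(1) b] by auto
      have g': "g \<in> carrier (EG e)" and bb: "bE (\<tau> e) r \<otimes>\<^bsub>BG\<^esub> F e g = F e h" using g A e h by (simp_all add: b_def)
      interpret EG: group "EG e" using e by simp
      have "bE (\<tau> e) r = F e h \<otimes>\<^bsub>BG\<^esub> inv\<^bsub>BG\<^esub> F e g"
        using h e g' bb by (metis BG.inv_solve_right F_closed \<tau>_closed bE_closed)
      also have "\<dots> = F e (h \<otimes>\<^bsub>EG e\<^esub> inv\<^bsub>EG e\<^esub> g)" using h g' e by (simp add: F_mult F_inv)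
      finally have "bE (\<tau> e) r = bE (\<tau> e) (f e (h \<otimes>\<^bsub>EG e\<^esub> inv\<^bsub>EG e\<^esub> g))" by (simp add: F_def)
      moreover have k: "h \<otimes>\<^bsub>EG e\<^esub> inv\<^bsub>EG e\<^esub> g \<in> carrier (EG e)" using h g' by simp
      ultimately have "r = f e (h \<otimes>\<^bsub>EG e\<^esub> inv\<^bsub>EG e\<^esub> g)" using e by (intro bE_inject[of "\<tau> e"]) auto
      then have "r \<in> f e ` carrier (EG e)" using k by blast
      then show False using Cons.prems(2) A p by (auto simp: red_def)
    qed
    then have N: "nf (wd ((e, r) # p # xs)) = (F (bar e) (dec e b), (e, rep e b) # snd (nf (wd (p # xs))))"
      using n by (auto simp: nf_Cons b_def)
    have bb: "b = bE (\<tau> e) r \<otimes>\<^bsub>BG\<^esub> fst (nf (wd (p # xs)))" using n by (simp add: b_def)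
    have m: "map fst (snd (nf (wd (p # xs)))) = map fst (p # xs)"
      unfolding p by (rule conjunct2[OF IH])
    show ?case by (simp only: bb[symmetric] N m list.map fst_conv snd_conv simp_thms)
  qed
  show "nf (wd ((e, r) # xs)) = (F (bar e) (dec e c), (e, rep e c) # snd (nf (wd xs)))"
    unfolding c_def by (rule conjunct1[OF *])
  show "map fst (snd (nf (wd ((e, r) # xs)))) = map fst ((e, r) # xs)"
    by (rule conjunct2[OF *])
qed

lemma map_fst_nf: "ep x xs y \<Longrightarrow> red xs \<Longrightarrow> map fst (snd (nf (wd xs))) = map fst xs"
  using nf_wd_Cons(2) by (cases xs) (auto simp: nf_Nil)

lemma ep_drop: "ep x xs y \<Longrightarrow> \<exists>x'. ep x' (drop j xs) y"
  by (metis append_take_drop_id ep_append)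

lemma red_drop: "red xs \<Longrightarrow> red (drop j xs)"
proof (induction j arbitrary: xs)
  case (Suc j)
  then show ?case using red_Cons by (cases xs) auto
qed simp

lemma nf_drop: "ep x xs y \<Longrightarrow> red xs \<Longrightarrow> snd (nf (wd (drop j xs))) = drop j (snd (nf (wd xs)))"
proof (induction j arbitrary: x xs)
  case (Suc j)
  show ?case
  proof (cases xs)
    case (Cons p xs')
    obtain e r where p: "p = (e, r)" by force
    have ep': "ep x ((e, r) # xs') y" "red ((e, r) # xs')" "ep (\<tau> e) xs' y" "red xs'"
      using Suc.prems Cons p red_Cons[of p xs'] by auto
    have "drop (Suc j) (snd (nf (wd xs))) = drop j (snd (nf (wd xs')))"
      unfolding Cons p nf_wd_Cons(1)[OF ep'(1,2)] by simp
    moreover have "drop (Suc j) xs = drop j xs'" by (simp add: Cons)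
    ultimately show ?thesis using Suc.IH[OF ep'(3,4)] by (simp only:)
  qed (simp add: nf_Nil)
qed simp

text \<open>Both expressions have the same normal form, hence the same edges and the same coset
  representatives. They can differ only in the edge group elements that were carried across the
  stable letters.\<close>

theorem expr_unique:
  assumes xs: "ep x xs y" "red xs" and ys: "ep x ys y'" "red ys"
    and r0: "x \<in> V" "r0 \<in> carrier (VG x)" "s0 \<in> carrier (VG x)"
    and eq: "El x r0 \<otimes>\<^bsub>PG\<^esub> val xs = El x s0 \<otimes>\<^bsub>PG\<^esub> val ys"
  shows "map fst ys = map fst xs \<and> (\<exists>h. (\<forall>j < length xs. h j \<in> carrier (EG (fst (xs ! j)))) \<and>
    (\<forall>j. Suc j < length xs \<longrightarrow> snd (ys ! j) =
       inv\<^bsub>VG (\<tau> (fst (xs ! j)))\<^esub> f (fst (xs ! j)) (h j) \<otimes>\<^bsub>VG (\<tau> (fst (xs ! j)))\<^esub> snd (xs ! j)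
         \<otimes>\<^bsub>VG (\<tau> (fst (xs ! j)))\<^esub> f (bar (fst (xs ! Suc j))) (h (Suc j))))"
proof -
  have l: "wd xs \<in> lists L" "wd ys \<in> lists L" using xs ys wd_lists by auto
  have "Elt x r0 # wd xs \<approx> Elt x s0 # wd ys"
    using eq r0 l cls_eq_iff[of "Elt x r0 # wd xs" "Elt x s0 # wd ys"] by (simp add: val_def cls_Elt)
  then have "nf (Elt x r0 # wd xs) = nf (Elt x s0 # wd ys)" by (rule nf_cong)
  then have S: "snd (nf (wd xs)) = snd (nf (wd ys))" by (simp add: nf_Elt)
  then have es: "map fst ys = map fst xs" using map_fst_nf xs ys by metis
  then have len: "length ys = length xs" by (metis length_map)
  define b where "b zs j = fst (nf (wd (drop j zs)))" for zs :: "('e \<times> 'a) list" and j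
  define c where "c zs j = bE (\<tau> (fst (zs ! j))) (snd (zs ! j)) \<otimes>\<^bsub>BG\<^esub> b zs (Suc j)" for zs :: "('e \<times> 'a) list" and j
  define d where "d zs j = dec (fst (zs ! j)) (c zs j)" for zs :: "('e \<times> 'a) list" and j
  define \<rho> where "\<rho> zs j = rep (fst (zs ! j)) (c zs j)" for zs :: "('e \<times> 'a) list" and j
  have step: "b zs j = F (bar (fst (zs ! j))) (d zs j) \<and>
      snd (nf (wd zs)) ! j = (fst (zs ! j), \<rho> zs j) \<and> d zs j \<in> carrier (EG (fst (zs ! j))) \<and>
      F (fst (zs ! j)) (d zs j) \<otimes>\<^bsub>BG\<^esub> \<rho> zs j = c zs j \<and> \<rho> zs j \<in> carrier BG \<and>
      fst (zs ! j) \<in> E \<and> snd (zs ! j) \<in> carrier (VG (\<tau> (fst (zs ! j))))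
      \<and> (Suc j < length zs \<longrightarrow> \<tau> (bar (fst (zs ! Suc j))) = \<tau> (fst (zs ! j)))"
    if z: "ep x zs z" "red zs" "j < length zs" for zs z j
  proof -
    obtain e r where er: "zs ! j = (e, r)" by force
    have dr: "drop j zs = (e, r) # drop (Suc j) zs" using z(3) er Cons_nth_drop_Suc by metis
    obtain x' where x': "ep x' (drop j zs) z" using ep_drop z(1) by blast
    have rd: "red (drop j zs)" using red_drop z(2) by blast
    have e: "e \<in> E" "r \<in> carrier (VG (\<tau> e))" "ep (\<tau> e) (drop (Suc j) zs) z" using x' dr by auto
    have cc: "c zs j \<in> carrier BG" using e nf_closed[OF wd_lists[OF e(3)]] by (simp add: c_def b_def er)
    have n: "nf (wd (drop j zs)) = (F (bar e) (d zs j), (e, \<rho> zs j) # snd (nf (wd (drop (Suc j) zs))))"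
      using nf_wd_Cons(1)[of x' e r "drop (Suc j) zs" z] x' rd dr by (simp add: d_def \<rho>_def c_def b_def er)
    have "snd (nf (wd (drop j zs))) = drop j (snd (nf (wd zs)))" using nf_drop z by blast
    moreover have "length (snd (nf (wd zs))) = length zs" using map_fst_nf[OF z(1,2)] by (metis length_map)
    ultimately have "snd (nf (wd zs)) ! j = (e, \<rho> zs j)" using n z(3) by (metis hd_drop_conv_nth list.sel(1) snd_conv)
    moreover have "\<tau> (bar (fst (zs ! Suc j))) = \<tau> e" if "Suc j < length zs"
    proof -
      have "drop (Suc j) zs = zs ! Suc j # drop (Suc (Suc j)) zs" using that Cons_nth_drop_Suc by metis
      then show ?thesis using e(3) by (cases "zs ! Suc j") auto
    qed
    ultimately show ?thesis using n dec_rep[OF e(1) cc] e er by (simp add: b_def d_def \<rho>_def)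
  qed
  have xy: "fst (ys ! j) = fst (xs ! j)" if "j < length xs" for j
    using es that len by (metis nth_map)
  \<comment> \<open>\<open>d xs j\<close> and \<open>d ys j\<close> are the edge group elements
    carried back across the \<open>j\<close>-th stable letter by either expression;
    \<open>h j\<close> measures their difference.\<close>
  define h where "h j = d xs j \<otimes>\<^bsub>EG (fst (xs ! j))\<^esub> inv\<^bsub>EG (fst (xs ! j))\<^esub> d ys j" for j
  have h: "h j \<in> carrier (EG (fst (xs ! j)))" if "j < length xs" for j
  proof -
    have "d ys j \<in> carrier (EG (fst (xs ! j)))" using step[OF ys, of j] xy[OF that] that len by simp
    then show ?thesis using step[OF xs that] unfolding h_def
      by (meson EG_group group.inv_closed group.is_monoid monoid.m_closed)
  qed
  have "snd (ys ! j) =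
       inv\<^bsub>VG (\<tau> (fst (xs ! j)))\<^esub> f (fst (xs ! j)) (h j) \<otimes>\<^bsub>VG (\<tau> (fst (xs ! j)))\<^esub> snd (xs ! j)
         \<otimes>\<^bsub>VG (\<tau> (fst (xs ! j)))\<^esub> f (bar (fst (xs ! Suc j))) (h (Suc j))" if j: "Suc j < length xs" for j
  proof -
    define e e' where "e = fst (xs ! j)" and "e' = fst (xs ! Suc j)"
    have j0: "j < length xs" using j by simp
    note sx = step[OF xs j0, folded e_def] and sx' = step[OF xs j, folded e'_def]
    have sy: "F e (d ys j) \<otimes>\<^bsub>BG\<^esub> \<rho> ys j = c ys j" "d ys j \<in> carrier (EG e)"
      "snd (ys ! j) \<in> carrier (VG (\<tau> e))" "snd (nf (wd ys)) ! j = (e, \<rho> ys j)"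
      using step[OF ys, of j] xy[OF j0] j0 len by (simp_all add: e_def)
    have sy': "b ys (Suc j) = F (bar e') (d ys (Suc j))" "d ys (Suc j) \<in> carrier (EG e')"
      using step[OF ys, of "Suc j"] xy[OF j] j len by (simp_all add: e'_def)
    have e: "e \<in> E" "e' \<in> E" "\<tau> (bar e') = \<tau> e" using sx sx' j by (simp_all add: e'_def)
    have dd: "d xs j \<in> carrier (EG e)" "d xs (Suc j) \<in> carrier (EG e')" "snd (xs ! j) \<in> carrier (VG (\<tau> e))"
      using sx sx' by auto
    have \<rho>: "\<rho> ys j = \<rho> xs j" "\<rho> xs j \<in> carrier BG" using S sx sy by auto
    interpret Ge: group "EG e" using e by simp
    interpret Ge': group "EG e'" using e by simp
    interpret Gv: group "VG (\<tau> e)" using e by simp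
    have Fc: "F e (d xs j) \<in> carrier BG" "F e (d ys j) \<in> carrier BG"
      "F (bar e') (d xs (Suc j)) \<in> carrier BG" "F (bar e') (d ys (Suc j)) \<in> carrier BG"
      using dd sy sy' e by simp_all
    have bc: "bE (\<tau> e) (snd (xs ! j)) \<in> carrier BG" "bE (\<tau> e) (snd (ys ! j)) \<in> carrier BG"
      using dd sy e by simp_all
    have cx: "F e (d xs j) \<otimes>\<^bsub>BG\<^esub> \<rho> xs j = bE (\<tau> e) (snd (xs ! j)) \<otimes>\<^bsub>BG\<^esub> F (bar e') (d xs (Suc j))"
      using sx sx' by (simp add: c_def e_def)
    have cy: "F e (d ys j) \<otimes>\<^bsub>BG\<^esub> \<rho> xs j = bE (\<tau> e) (snd (ys ! j)) \<otimes>\<^bsub>BG\<^esub> F (bar e') (d ys (Suc j))"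
      using sy sy' \<rho> xy[OF j0] by (simp add: c_def e_def)
    have hh: "h j \<in> carrier (EG e)" "h (Suc j) \<in> carrier (EG e')" using h j0 j by (auto simp: e_def e'_def)
    have Fh: "F e (inv\<^bsub>EG e\<^esub> h j) = F e (d ys j) \<otimes>\<^bsub>BG\<^esub> inv\<^bsub>BG\<^esub> F e (d xs j)"
      using e dd sy by (simp add: h_def e_def[symmetric] Ge.inv_mult_group F_mult F_inv)
    have Fh': "F (bar e') (h (Suc j)) = F (bar e') (d xs (Suc j)) \<otimes>\<^bsub>BG\<^esub> inv\<^bsub>BG\<^esub> F (bar e') (d ys (Suc j))"
      using e dd sy' F_mult[of "bar e'" "d xs (Suc j)" "inv\<^bsub>EG e'\<^esub> d ys (Suc j)"] F_inv[of "bar e'" "d ys (Suc j)"]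
      by (simp add: h_def e'_def[symmetric])
    have "bE (\<tau> e) (snd (ys ! j)) = F e (d ys j) \<otimes>\<^bsub>BG\<^esub> \<rho> xs j \<otimes>\<^bsub>BG\<^esub> inv\<^bsub>BG\<^esub> F (bar e') (d ys (Suc j))"
      unfolding cy using Fc bc by (simp add: BG.m_assoc)
    also have "\<rho> xs j = inv\<^bsub>BG\<^esub> F e (d xs j) \<otimes>\<^bsub>BG\<^esub> (bE (\<tau> e) (snd (xs ! j)) \<otimes>\<^bsub>BG\<^esub> F (bar e') (d xs (Suc j)))"
      unfolding cx[symmetric] using Fc \<rho> by simp
    finally have "bE (\<tau> e) (snd (ys ! j)) = F e (inv\<^bsub>EG e\<^esub> h j) \<otimes>\<^bsub>BG\<^esub> bE (\<tau> e) (snd (xs ! j)) \<otimes>\<^bsub>BG\<^esub> F (bar e') (h (Suc j))"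
      unfolding Fh Fh' using Fc bc by (simp add: BG.m_assoc)
    also have "\<dots> = bE (\<tau> e) (f e (inv\<^bsub>EG e\<^esub> h j) \<otimes>\<^bsub>VG (\<tau> e)\<^esub> snd (xs ! j) \<otimes>\<^bsub>VG (\<tau> e)\<^esub> f (bar e') (h (Suc j)))"
    proof -
      have "f (bar e') (h (Suc j)) \<in> carrier (VG (\<tau> e))" using f_closed[of "bar e'" "h (Suc j)"] hh e by simp
      then show ?thesis using e hh dd by (simp add: F_def bE_mult)
    qed
    finally have "snd (ys ! j) = f e (inv\<^bsub>EG e\<^esub> h j) \<otimes>\<^bsub>VG (\<tau> e)\<^esub> snd (xs ! j) \<otimes>\<^bsub>VG (\<tau> e)\<^esub> f (bar e') (h (Suc j))"
      using bE_inject[of "\<tau> e"] e hh dd sy f_closed[of "bar e'" "h (Suc j)"] by simp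
    then show ?thesis using e hh by (simp add: f_inv e_def[symmetric] e'_def[symmetric])
  qed
  then show ?thesis using es h by blast
qed

end

section \<open>Lengths in an efficient Dehn twist\<close>

locale eff_dehn = gog_id_aut \<GG> H for \<GG> :: "('v, 'e, 'a, 'b) gog" and H +
  fixes u :: 'v and X :: "('v, 'e, 'a) letter list set set"
  assumes eff: "efficient \<GG> H" and u: "u \<in> V"
    and bas: "free_basis (pi1 \<GG> u) X" and finX: "finite X"
begin

sublocale FG: free_grp "pi1 \<GG> u" X
  using pi1_group bas finX by (simp add: free_grp_def free_grp_axioms_def)

abbreviation "C \<equiv> paths u u"
abbreviation "fl \<equiv> FG.flen"
abbreviation mul (infixl \<open>\<cdot>\<close> 70) where "a \<cdot> b \<equiv> a \<otimes>\<^bsub>PG\<^esub> b"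
abbreviation iv where "iv a \<equiv> inv\<^bsub>PG\<^esub> a"
abbreviation ipow (infixr \<open>\<up>\<close> 75) where "a \<up> (n::int) \<equiv> a [^]\<^bsub>PG\<^esub> n"

lemma C_PG: "a \<in> C \<Longrightarrow> a \<in> carrier PG" by (rule paths_closed)
lemma C_mult: "\<lbrakk>a \<in> C; b \<in> C\<rbrakk> \<Longrightarrow> a \<cdot> b \<in> C" by (rule paths_mult)
lemma C_inv: "a \<in> C \<Longrightarrow> iv a \<in> C" by (rule paths_inv)
lemma C_pow: "a \<in> C \<Longrightarrow> a \<up> n \<in> C"
  using pi1_int_pow[of a u n] group.int_pow_closed[OF pi1_group[of u], of a n] by (simp add: pi1_carrier)

lemma fl_nonneg: "a \<in> C \<Longrightarrow> 0 \<le> fl a" using FG.len_nonneg by (simp add: pi1_carrier)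
lemma fl_one: "fl \<one>\<^bsub>PG\<^esub> = 0" using FG.len_one by simp
lemma fl_mult: "\<lbrakk>a \<in> C; b \<in> C\<rbrakk> \<Longrightarrow> fl (a \<cdot> b) \<le> fl a + fl b"
  using FG.len_mult_le[of a b] by (simp add: pi1_carrier)
lemma fl_mult_ge2: "\<lbrakk>a \<in> C; b \<in> C\<rbrakk> \<Longrightarrow> fl b - fl a \<le> fl (a \<cdot> b)"
  using FG.len_mult_ge2[of a b] by (simp add: pi1_carrier)
lemma fl_inv: "a \<in> C \<Longrightarrow> fl (iv a) = fl a"
  using FG.len_inv[of a] by (simp add: pi1_carrier pi1_inv)
lemma fl_near: "\<lbrakk>x \<in> C; z \<in> C; z \<noteq> \<one>\<^bsub>PG\<^esub>; x \<cdot> z = z \<cdot> x\<rbrakk> \<Longrightarrow> \<exists>i. fl (z \<up> i \<cdot> x) \<le> fl z"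
  using FG.commuting_near_power[of x z] by (simp add: pi1_carrier pi1_int_pow)
lemma fl_commens: "\<lbrakk>x \<in> C; z \<in> C; z \<noteq> \<one>\<^bsub>PG\<^esub>; x \<cdot> z = z \<cdot> x\<rbrakk> \<Longrightarrow> \<exists>p q. p > 0 \<and> x \<up> p = z \<up> q"
  using FG.commuting_commensurable[of x z] by (simp add: pi1_carrier pi1_int_pow)
lemma fl_conj_abs: "\<lbrakk>h \<in> C; c \<in> C; c \<noteq> \<one>\<^bsub>PG\<^esub>; h \<cdot> c \<up> a \<cdot> iv h = c \<up> b\<rbrakk> \<Longrightarrow> \<bar>a\<bar> = \<bar>b\<bar>"
  using FG.conj_pow_abs_eq[of h c a b] by (simp add: pi1_carrier pi1_int_pow pi1_inv)
lemma fl_pow_ge: "\<lbrakk>c \<in> C; c \<noteq> \<one>\<^bsub>PG\<^esub>\<rbrakk> \<Longrightarrow> \<bar>a\<bar> \<le> fl (c \<up> a)"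
  using FG.abs_le_len_int_pow[of c a] by (simp add: pi1_carrier pi1_int_pow)
lemma fl_pow_inj: "\<lbrakk>c \<in> C; c \<noteq> \<one>\<^bsub>PG\<^esub>; c \<up> a = c \<up> b\<rbrakk> \<Longrightarrow> a = b"
  using FG.int_pow_inject[of c a b] by (simp add: pi1_carrier pi1_int_pow)
lemma fl_incomm: "\<lbrakk>c \<in> C; c \<noteq> \<one>\<^bsub>PG\<^esub>; d \<in> C; d \<noteq> \<one>\<^bsub>PG\<^esub>; \<And>a b. a \<noteq> 0 \<Longrightarrow> b \<noteq> 0 \<Longrightarrow> c \<up> a \<noteq> d \<up> b\<rbrakk>
   \<Longrightarrow> \<exists>K. \<forall>a b. \<bar>a\<bar> + \<bar>b\<bar> - K \<le> fl (c \<up> a \<cdot> d \<up> b)"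
  using FG.incommensurable_len_ge[of c d] by (simp add: pi1_carrier pi1_int_pow)

section \<open>Closing paths to loops at the base vertex\<close>

definition pp :: "'v \<Rightarrow> ('v, 'e, 'a) letter list set" where "pp y = (SOME p. p \<in> paths u y)"

lemma pp: "y \<in> V \<Longrightarrow> pp y \<in> paths u y"
  unfolding pp_def using ex_path[OF u] by (rule someI_ex)

lemma pp_PG: "y \<in> V \<Longrightarrow> pp y \<in> carrier PG" using pp paths_closed by blast

text \<open>A functor from the groupoid of paths to the group at \<open>u\<close>. It lets elements
  of all vertex groups be measured by the word length of one free group.\<close>

definition hat :: "'v \<Rightarrow> 'v \<Rightarrow> ('v, 'e, 'a) letter list set \<Rightarrow> ('v, 'e, 'a) letter list set" where
  "hat y y' W = pp y \<cdot> W \<cdot> iv (pp y')"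

lemma hat_C: "\<lbrakk>y \<in> V; y' \<in> V; W \<in> paths y y'\<rbrakk> \<Longrightarrow> hat y y' W \<in> C"
  unfolding hat_def by (rule paths_mult[OF paths_mult[OF pp] paths_inv[OF pp]])

lemma hat_mult:
  "\<lbrakk>y \<in> V; y' \<in> V; y'' \<in> V; W \<in> paths y y'; W' \<in> paths y' y''\<rbrakk> \<Longrightarrow>
    hat y y'' (W \<cdot> W') = hat y y' W \<cdot> hat y' y'' W'"
  unfolding hat_def using pp_PG paths_closed by (simp add: PG.m_assoc)

lemma hat_one: "y \<in> V \<Longrightarrow> hat y y \<one>\<^bsub>PG\<^esub> = \<one>\<^bsub>PG\<^esub>"
  unfolding hat_def using pp_PG by simp

lemma hat_inv: "\<lbrakk>y \<in> V; y' \<in> V; W \<in> paths y y'\<rbrakk> \<Longrightarrow> hat y' y (iv W) = iv (hat y y' W)"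
  unfolding hat_def using pp_PG paths_closed by (simp add: PG.m_assoc PG.inv_mult_group)

lemma hat_inject: "\<lbrakk>y \<in> V; y' \<in> V; W \<in> paths y y'; W' \<in> paths y y'; hat y y' W = hat y y' W'\<rbrakk> \<Longrightarrow> W = W'"
  unfolding hat_def using pp_PG paths_closed by simp

lemma hat_pow: "\<lbrakk>y \<in> V; W \<in> paths y y\<rbrakk> \<Longrightarrow> hat y y (W \<up> n) = hat y y W \<up> n"
  unfolding hat_def using PG.conj_int_pow[OF pp_PG paths_closed] by simp

definition Len :: "'v \<Rightarrow> 'v \<Rightarrow> ('v, 'e, 'a) letter list set \<Rightarrow> int" where
  "Len y y' W = fl (hat y y' W)"

lemma Len_mult:
  "\<lbrakk>y \<in> V; y' \<in> V; y'' \<in> V; W \<in> paths y y'; W' \<in> paths y' y''\<rbrakk> \<Longrightarrow>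
    Len y y'' (W \<cdot> W') \<le> Len y y' W + Len y' y'' W'"
  unfolding Len_def using fl_mult hat_C by (simp add: hat_mult)

lemma Len_inv: "\<lbrakk>y \<in> V; y' \<in> V; W \<in> paths y y'\<rbrakk> \<Longrightarrow> Len y' y (iv W) = Len y y' W"
  unfolding Len_def using fl_inv hat_C by (simp add: hat_inv)

lemma Len_nonneg: "\<lbrakk>y \<in> V; y' \<in> V; W \<in> paths y y'\<rbrakk> \<Longrightarrow> 0 \<le> Len y y' W"
  unfolding Len_def using fl_nonneg hat_C by simp

definition hv :: "'v \<Rightarrow> 'a \<Rightarrow> ('v, 'e, 'a) letter list set" where "hv y r = hat y y (El y r)"
definition Lv :: "'v \<Rightarrow> 'a \<Rightarrow> int" where "Lv y r = fl (hv y r)"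

lemma hv_C: "\<lbrakk>y \<in> V; r \<in> carrier (VG y)\<rbrakk> \<Longrightarrow> hv y r \<in> C"
  unfolding hv_def by (rule hat_C[OF _ _ El_paths])

lemma hv_mult: "\<lbrakk>y \<in> V; r \<in> carrier (VG y); s \<in> carrier (VG y)\<rbrakk> \<Longrightarrow>
    hv y (r \<otimes>\<^bsub>VG y\<^esub> s) = hv y r \<cdot> hv y s"
  unfolding hv_def by (simp add: hat_mult[symmetric] El_paths El_mult)

lemma hv_one: "y \<in> V \<Longrightarrow> hv y \<one>\<^bsub>VG y\<^esub> = \<one>\<^bsub>PG\<^esub>"
  unfolding hv_def by (simp add: El_one hat_one)

lemma hv_inv: "\<lbrakk>y \<in> V; r \<in> carrier (VG y)\<rbrakk> \<Longrightarrow> hv y (inv\<^bsub>VG y\<^esub> r) = iv (hv y r)"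
  unfolding hv_def by (simp add: El_inv hat_inv El_paths)

lemma hv_pow: "\<lbrakk>y \<in> V; r \<in> carrier (VG y)\<rbrakk> \<Longrightarrow> hv y (r [^]\<^bsub>VG y\<^esub> (n::int)) = hv y r \<up> n"
  unfolding hv_def by (simp add: El_pow hat_pow El_paths)

lemma hv_inject: "\<lbrakk>y \<in> V; r \<in> carrier (VG y); s \<in> carrier (VG y); hv y r = hv y s\<rbrakk> \<Longrightarrow> r = s"
  unfolding hv_def using hat_inject[of y y "El y r" "El y s"] El_inject El_paths by blast

lemma hv_eq_one: "\<lbrakk>y \<in> V; r \<in> carrier (VG y); hv y r = \<one>\<^bsub>PG\<^esub>\<rbrakk> \<Longrightarrow> r = \<one>\<^bsub>VG y\<^esub>"
  using hv_inject[of y r "\<one>\<^bsub>VG y\<^esub>"] hv_one monoid.one_closed[OF VG_monoid] by simp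

lemma Lv_nonneg: "\<lbrakk>y \<in> V; r \<in> carrier (VG y)\<rbrakk> \<Longrightarrow> 0 \<le> Lv y r"
  unfolding Lv_def using fl_nonneg hv_C by simp

lemma Lv_mult: "\<lbrakk>y \<in> V; r \<in> carrier (VG y); s \<in> carrier (VG y)\<rbrakk> \<Longrightarrow> Lv y (r \<otimes>\<^bsub>VG y\<^esub> s) \<le> Lv y r + Lv y s"
  unfolding Lv_def using fl_mult hv_C by (simp add: hv_mult)

text \<open>Transferred from the free group at \<open>u\<close> along the injective homomorphism
  \<open>hv\<close>.\<close>

lemma vg_commens:
  assumes "y \<in> V" "a \<in> carrier (VG y)" "b \<in> carrier (VG y)" "b \<noteq> \<one>\<^bsub>VG y\<^esub>"
    and "a \<otimes>\<^bsub>VG y\<^esub> b = b \<otimes>\<^bsub>VG y\<^esub> a"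
  shows "\<exists>(p::int) (q::int). p > 0 \<and> a [^]\<^bsub>VG y\<^esub> p = b [^]\<^bsub>VG y\<^esub> q"
proof -
  have "hv y b \<noteq> \<one>\<^bsub>PG\<^esub>" using hv_eq_one assms by blast
  moreover have "hv y a \<cdot> hv y b = hv y b \<cdot> hv y a" using assms hv_mult by metis
  ultimately obtain p q where "p > 0" "hv y a \<up> p = hv y b \<up> q"
    using fl_commens[of "hv y a" "hv y b"] hv_C assms by blast
  then have "hv y (a [^]\<^bsub>VG y\<^esub> p) = hv y (b [^]\<^bsub>VG y\<^esub> q)" using assms by (simp add: hv_pow)
  then have "a [^]\<^bsub>VG y\<^esub> p = b [^]\<^bsub>VG y\<^esub> q"
    using hv_inject assms group.int_pow_closed[OF VG_group] by meson
  then show ?thesis using \<open>p > 0\<close> by blast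
qed

lemma vg_pow_inj:
  assumes "y \<in> V" "b \<in> carrier (VG y)" "b \<noteq> \<one>\<^bsub>VG y\<^esub>" "b [^]\<^bsub>VG y\<^esub> (p::int) = b [^]\<^bsub>VG y\<^esub> q"
  shows "p = q"
proof -
  have "hv y b \<up> p = hv y b \<up> q" using assms by (metis hv_pow)
  then show ?thesis using fl_pow_inj[of "hv y b"] hv_C hv_eq_one assms by blast
qed

text \<open>The growth estimate will hold for every reduced expression of a path. Building up some
  expression letter by letter from a word gives an upper bound for its cost, which turns that
  estimate into a lower bound for word length.\<close>

definition costle :: "'v \<Rightarrow> 'v \<Rightarrow> ('v, 'e, 'a) letter list set \<Rightarrow> int \<Rightarrow> bool" where
  "costle x y g c \<longleftrightarrow> (\<exists>r0 xs. r0 \<in> carrier (VG x) \<and> ep x xs y \<and> red xs \<and> g = El x r0 \<cdot> val xs \<and>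
     Lv x r0 + (\<Sum>(e, r)\<leftarrow>xs. Lv (\<tau> e) r) \<le> c)"

lemma costle_mono: "costle x y g c \<Longrightarrow> c \<le> c' \<Longrightarrow> costle x y g c'"
  unfolding costle_def by (blast intro: order_trans)

lemma costle_one: "x \<in> V \<Longrightarrow> costle x x \<one>\<^bsub>PG\<^esub> 0"
  unfolding costle_def
  by (intro exI[of _ "\<one>\<^bsub>VG x\<^esub>"] exI[of _ "[]"])
    (simp add: monoid.one_closed El_one val_Nil red_def Lv_def hv_one fl_one)

lemma costle_Elt:
  assumes "costle x y g c" "x \<in> V" "s \<in> carrier (VG x)"
  shows "costle x y (El x s \<cdot> g) (c + Lv x s)"
proof -
  obtain r0 xs where h: "r0 \<in> carrier (VG x)" "ep x xs y" "red xs" "g = El x r0 \<cdot> val xs"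
     "Lv x r0 + (\<Sum>(e, r)\<leftarrow>xs. Lv (\<tau> e) r) \<le> c" using assms unfolding costle_def by blast
  have "El x s \<cdot> g = El x (s \<otimes>\<^bsub>VG x\<^esub> r0) \<cdot> val xs"
    using h assms val_closed[OF h(2)] by (simp add: El_mult[symmetric] PG.m_assoc)
  then show ?thesis unfolding costle_def
    using h assms Lv_mult[of x s r0]
    by (intro exI[of _ "s \<otimes>\<^bsub>VG x\<^esub> r0"] exI[of _ xs]) (auto intro: monoid.m_closed)
qed

text \<open>If the new letter cancels the first edge, the edge group element between them is moved
  across the edge. There it is conjugated by the closed-up stable letter, which costs at most twice
  the length of the latter. If nothing cancels, the expression becomes longer by one edge and its
  leading element is trivial.\<close>

lemma costle_Stable:
  assumes "costle (\<tau> e) y g c" "e \<in> E"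
  shows "costle (\<tau> (bar e)) y (St e \<cdot> g) (c + 2 * Len (\<tau> (bar e)) (\<tau> e) (St e))"
proof -
  define M where "M = Len (\<tau> (bar e)) (\<tau> e) (St e)"
  have M: "0 \<le> M" unfolding M_def using assms by (intro Len_nonneg St_paths) auto
  obtain b xs where h: "b \<in> carrier (VG (\<tau> e))" "ep (\<tau> e) xs y" "red xs" "g = El (\<tau> e) b \<cdot> val xs"
     "Lv (\<tau> e) b + (\<Sum>(e, r)\<leftarrow>xs. Lv (\<tau> e) r) \<le> c" using assms unfolding costle_def by blast
  show ?thesis
  proof (cases "xs \<noteq> [] \<and> fst (hd xs) = bar e \<and> b \<in> f e ` carrier (EG e)")
    case True
    then obtain r1 ys where xs: "xs = (bar e, r1) # ys" by (cases xs) auto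
    obtain k where k: "k \<in> carrier (EG e)" "b = f e k" using True by blast
    have ep: "r1 \<in> carrier (VG (\<tau> (bar e)))" "ep (\<tau> (bar e)) ys y" using h(2) xs by auto
    have fk: "f (bar e) k \<in> carrier (VG (\<tau> (bar e)))" using k assms f_closed[of "bar e" k] by simp
    have rel: "El (\<tau> (bar e)) (f (bar e) k) = St e \<cdot> El (\<tau> e) b \<cdot> iv (St e)"
      using St_rel[OF assms(2) k(1)] assms k fk by (simp add: PG.m_assoc)
    have "St e \<cdot> g = St e \<cdot> El (\<tau> e) b \<cdot> (iv (St e) \<cdot> (El (\<tau> (bar e)) r1 \<cdot> val ys))"
      using h(2,4) val_Cons[of "\<tau> e" "bar e" r1 ys y] assms val_closed[OF ep(2)] ep h(1)
      by (simp add: xs St_bar PG.m_assoc)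
    also have "\<dots> = El (\<tau> (bar e)) (f (bar e) k) \<cdot> (El (\<tau> (bar e)) r1 \<cdot> val ys)"
      unfolding rel using assms val_closed[OF ep(2)] ep h(1) by (simp add: PG.m_assoc)
    also have "\<dots> = El (\<tau> (bar e)) (f (bar e) k \<otimes>\<^bsub>VG (\<tau> (bar e))\<^esub> r1) \<cdot> val ys"
      using assms val_closed[OF ep(2)] ep fk by (simp add: El_mult[symmetric] PG.m_assoc)
    finally have eq: "St e \<cdot> g = El (\<tau> (bar e)) (f (bar e) k \<otimes>\<^bsub>VG (\<tau> (bar e))\<^esub> r1) \<cdot> val ys" .
    have "Lv (\<tau> (bar e)) (f (bar e) k) = Len (\<tau> (bar e)) (\<tau> (bar e)) (St e \<cdot> El (\<tau> e) b \<cdot> iv (St e))"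
      unfolding rel[symmetric] by (simp add: Lv_def hv_def Len_def)
    also have "\<dots> \<le> Len (\<tau> (bar e)) (\<tau> e) (St e \<cdot> El (\<tau> e) b) + Len (\<tau> e) (\<tau> (bar e)) (iv (St e))"
      using assms h(1) by (intro Len_mult paths_mult[OF St_paths El_paths] paths_inv St_paths) auto
    also have "Len (\<tau> (bar e)) (\<tau> e) (St e \<cdot> El (\<tau> e) b) \<le> M + Len (\<tau> e) (\<tau> e) (El (\<tau> e) b)"
      unfolding M_def using assms h(1) by (intro Len_mult St_paths El_paths) auto
    also have "Len (\<tau> e) (\<tau> (bar e)) (iv (St e)) = M"
      unfolding M_def using assms by (intro Len_inv St_paths) auto
    also have "Len (\<tau> e) (\<tau> e) (El (\<tau> e) b) = Lv (\<tau> e) b" by (simp add: Lv_def hv_def Len_def)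
    finally have "Lv (\<tau> (bar e)) (f (bar e) k \<otimes>\<^bsub>VG (\<tau> (bar e))\<^esub> r1) \<le> 2 * M + Lv (\<tau> e) b + Lv (\<tau> (bar e)) r1"
      using Lv_mult[of "\<tau> (bar e)" "f (bar e) k" r1] fk ep assms by simp
    then have "Lv (\<tau> (bar e)) (f (bar e) k \<otimes>\<^bsub>VG (\<tau> (bar e))\<^esub> r1) + (\<Sum>(e, r)\<leftarrow>ys. Lv (\<tau> e) r) \<le> c + 2 * M"
      using h(5) xs by simp
    then show ?thesis unfolding costle_def M_def[symmetric]
      using eq ep fk assms h(3) red_Cons xs
      by (intro exI[of _ "f (bar e) k \<otimes>\<^bsub>VG (\<tau> (bar e))\<^esub> r1"] exI[of _ ys]) (auto intro: monoid.m_closed)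
  next
    case False
    have ep: "ep (\<tau> (bar e)) ((e, b) # xs) y" using assms h by simp
    have "red ((e, b) # xs)" using False h(3) by (cases xs) (auto simp: red_def)
    moreover have "St e \<cdot> g = El (\<tau> (bar e)) \<one>\<^bsub>VG (\<tau> (bar e))\<^esub> \<cdot> val ((e, b) # xs)"
      using val_Cons[OF ep] h assms val_closed[OF h(2)] by (simp add: El_one)
    moreover have "Lv (\<tau> (bar e)) \<one>\<^bsub>VG (\<tau> (bar e))\<^esub> = 0" using assms by (simp add: Lv_def hv_one fl_one)
    ultimately show ?thesis unfolding costle_def M_def[symmetric]
      using ep h(5) M assms
      by (intro exI[of _ "\<one>\<^bsub>VG (\<tau> (bar e))\<^esub>"] exI[of _ "(e, b) # xs"]) (auto intro: monoid.one_closed)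
  qed
qed

lemma costle_path:
  assumes "p \<in> paths x y" "x \<in> V"
  shows "\<exists>K\<ge>0. \<forall>z g c. g \<in> paths y z \<longrightarrow> costle y z g c \<longrightarrow> costle x z (p \<cdot> g) (c + K)"
proof -
  obtain w where "w \<in> lists L" "path_word \<GG> x w y" "p = cls w" using assms by (auto simp: paths_def)
  then show ?thesis using assms(2)
  proof (induction w arbitrary: x p rule: list.induct)
    case Nil
    then show ?case using paths_closed by (intro exI[of _ 0]) (auto simp: cls_Nil)
  next
    case (Cons a w)
    have w: "w \<in> lists L" using Cons.prems by simp
    show ?case
    proof (cases a)
      case (Elt x' s)
      then have s: "x' = x" "s \<in> carrier (VG x)" "path_word \<GG> x w y" using Cons.prems by auto
      obtain K where K: "K \<ge> 0" "\<And>z g c. g \<in> paths y z \<Longrightarrow> costle y z g c \<Longrightarrow> costle x z (cls w \<cdot> g) (c + K)"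
        using Cons.IH[OF w s(3) _ Cons.prems(4)] by blast
      have p: "p = El x s \<cdot> cls w" using Cons.prems s Elt w cls_Elt[of x s w] by simp
      have "costle x z (p \<cdot> g) (c + (K + Lv x s))" if "g \<in> paths y z" "costle y z g c" for z g c
        using costle_Elt[OF K(2)[OF that] Cons.prems(4) s(2)] p that(1) paths_closed cls_closed[OF w] Cons.prems(4) s(2)
        by (simp add: PG.m_assoc add.assoc)
      then show ?thesis using K(1) Lv_nonneg[OF Cons.prems(4) s(2)] by (intro exI[of _ "K + Lv x s"]) auto
    next
      case (Stable e)
      then have e: "e \<in> E" "x = \<tau> (bar e)" "path_word \<GG> (\<tau> e) w y" using Cons.prems by auto
      obtain K where K: "K \<ge> 0" "\<And>z g c. g \<in> paths y z \<Longrightarrow> costle y z g c \<Longrightarrow> costle (\<tau> e) z (cls w \<cdot> g) (c + K)"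
        using Cons.IH[OF w e(3) _ \<tau>_closed[OF e(1)]] by blast
      have p: "p = St e \<cdot> cls w" using Cons.prems e Stable w cls_Stable[of e w] by simp
      have "costle x z (p \<cdot> g) (c + (K + 2 * Len (\<tau> (bar e)) (\<tau> e) (St e)))" if "g \<in> paths y z" "costle y z g c" for z g c
        using costle_Stable[OF K(2)[OF that] e(1)] p that(1) paths_closed cls_closed[OF w] e
        by (simp add: PG.m_assoc add.assoc)
      moreover have "0 \<le> Len (\<tau> (bar e)) (\<tau> e) (St e)" using e by (intro Len_nonneg St_paths) auto
      ultimately show ?thesis using K(1) by (intro exI[of _ "K + 2 * Len (\<tau> (bar e)) (\<tau> e) (St e)"]) auto
    qed
  qed
qed

lemma ex_expr:
  assumes "p \<in> paths x y" "x \<in> V" "y \<in> V"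
  shows "\<exists>r0 xs. r0 \<in> carrier (VG x) \<and> ep x xs y \<and> red xs \<and> p = El x r0 \<cdot> val xs"
proof -
  obtain K where "\<And>z g c. g \<in> paths y z \<Longrightarrow> costle y z g c \<Longrightarrow> costle x z (p \<cdot> g) (c + K)"
    using costle_path[OF assms(1,2)] by blast
  from this[OF paths_one costle_one[OF assms(3)]] show ?thesis
    using paths_closed[OF assms(1)] unfolding costle_def by auto
qed

text \<open>Multiplication by one fixed loop has a fixed price, and there are only finitely many
  basis elements and inverses to be paid for.\<close>

lemma costle_word:
  "\<exists>K\<ge>0. \<forall>w. fst ` set w \<subseteq> X \<longrightarrow> (\<forall>z g c. g \<in> paths u z \<longrightarrow> costle u z g c \<longrightarrow>
     costle u z (word_value (pi1 \<GG> u) w \<cdot> g) (c + K * int (length w)))"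
proof -
  have XC: "X \<subseteq> C" using FG.X_carrier by (simp add: pi1_carrier)
  have "\<forall>s \<in> C. \<exists>K\<ge>0. \<forall>z g c. g \<in> paths u z \<longrightarrow> costle u z g c \<longrightarrow> costle u z (s \<cdot> g) (c + K)"
    using costle_path u by blast
  then obtain k where k: "\<And>s. s \<in> C \<Longrightarrow> k s \<ge> 0"
    "\<And>s z g c. s \<in> C \<Longrightarrow> g \<in> paths u z \<Longrightarrow> costle u z g c \<Longrightarrow> costle u z (s \<cdot> g) (c + k s)"
    by metis
  define K where "K = (\<Sum>s\<in>X. k s + k (iv s))"
  have K0: "K \<ge> 0" unfolding K_def using k(1) XC C_inv by (intro sum_nonneg) (metis add_nonneg_nonneg subsetD)
  have Ks: "k s + k (iv s) \<le> K" if "s \<in> X" for s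
    unfolding K_def using finX that k(1) XC C_inv
    by (intro member_le_sum[where f = "\<lambda>s. k s + k (iv s)"]) (auto intro!: add_nonneg_nonneg)
  have "costle u z (word_value (pi1 \<GG> u) w \<cdot> g) (c + K * int (length w)) \<and> word_value (pi1 \<GG> u) w \<in> C"
    if "fst ` set w \<subseteq> X" "g \<in> paths u z" "costle u z g c" for w z g c
    using that(1)
  proof (induction w)
    case Nil
    then show ?case using that paths_closed paths_one by simp
  next
    case (Cons t w)
    define s where "s = (if snd t then fst t else iv (fst t))"
    have tX: "fst t \<in> X" using Cons.prems by simp
    have s: "s \<in> C" using tX XC C_inv by (auto simp: s_def)
    have ks: "k s \<le> K" using Ks[OF tX] k(1)[of "fst t"] k(1)[of "iv (fst t)"] tX XC C_inv by (auto simp: s_def)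
    have wv: "word_value (pi1 \<GG> u) (t # w) = s \<cdot> word_value (pi1 \<GG> u) w"
      using tX XC by (auto simp: FG.word_value_Cons s_def pi1_inv)
    have IH: "costle u z (word_value (pi1 \<GG> u) w \<cdot> g) (c + K * int (length w))" "word_value (pi1 \<GG> u) w \<in> C"
      using Cons by auto
    have "costle u z (s \<cdot> (word_value (pi1 \<GG> u) w \<cdot> g)) (c + K * int (length w) + k s)"
      by (rule k(2)[OF s paths_mult[OF IH(2) that(2)] IH(1)])
    then have "costle u z (s \<cdot> (word_value (pi1 \<GG> u) w \<cdot> g)) (c + K * int (length (t # w)))"
      by (rule costle_mono) (use ks in \<open>simp add: algebra_simps\<close>)
    then show ?case using wv s IH(2) that(2) paths_closed C_mult by (simp add: PG.m_assoc)
  qed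
  then show ?thesis using K0 by blast
qed

text \<open>Conjugation by \<open>p\<close> carries a loop at \<open>u\<close> to the vertex
  \<open>x\<close> at which the expression is to start, and changes the cost only by a
  constant.\<close>

lemma costle_flen:
  assumes p: "p \<in> paths x u" "x \<in> V"
  shows "\<exists>K\<ge>0. \<forall>y \<in> C. costle x x (p \<cdot> y \<cdot> iv p) (K * fl y + K)"
proof -
  obtain K1 where K1: "K1 \<ge> 0" "\<And>z g c. g \<in> paths u z \<Longrightarrow> costle u z g c \<Longrightarrow> costle x z (p \<cdot> g) (c + K1)"
    using costle_path[OF p] by blast
  obtain K2 where K2: "K2 \<ge> 0" "\<And>z g c. g \<in> paths x z \<Longrightarrow> costle x z g c \<Longrightarrow> costle u z (iv p \<cdot> g) (c + K2)"
    using costle_path[OF paths_inv[OF p(1)] u] by blast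
  obtain K3 where K3: "K3 \<ge> 0" "\<And>w z g c. fst ` set w \<subseteq> X \<Longrightarrow> g \<in> paths u z \<Longrightarrow> costle u z g c \<Longrightarrow>
     costle u z (word_value (pi1 \<GG> u) w \<cdot> g) (c + K3 * int (length w))"
    using costle_word by blast
  have "costle x x (p \<cdot> y \<cdot> iv p) ((K1 + K2 + K3) * fl y + (K1 + K2 + K3))" if y: "y \<in> C" for y
  proof -
    have ip: "iv p \<in> paths u x" using paths_inv p by blast
    have "costle u x (iv p) K2" using K2(2)[OF paths_one costle_one[OF p(2)]] paths_closed[OF ip] by simp
    then have "costle u x (word_value (pi1 \<GG> u) (FG.nfw y) \<cdot> iv p) (K2 + K3 * int (length (FG.nfw y)))"
      using FG.nfw(1)[of y] y ip by (intro K3(2)) (auto simp: pi1_carrier)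
    then have "costle u x (y \<cdot> iv p) (K2 + K3 * fl y)"
      using FG.nfw(3)[of y] y by (simp add: pi1_carrier FG.flen_def)
    then have "costle x x (p \<cdot> (y \<cdot> iv p)) (K2 + K3 * fl y + K1)"
      by (intro K1(2) paths_mult[OF y ip])
    then have "costle x x (p \<cdot> y \<cdot> iv p) (K2 + K3 * fl y + K1)"
      using paths_closed[OF ip] paths_closed[OF p(1)] paths_closed[OF y] by (simp add: PG.m_assoc)
    then show ?thesis
      by (rule costle_mono) (use K1(1) K2(1) K3(1) fl_nonneg[OF y] in \<open>simp add: distrib_right\<close>)
  qed
  then show ?thesis using K1(1) K2(1) K3(1) by (intro exI[of _ "K1 + K2 + K3"]) auto
qed

end

section \<open>Quadratic growth along a hyperbolic loop\<close>

text \<open>Just after a cut index \<open>m\<close> is bounded by \<open>X\<close>, and at the next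
  one it has to have reached the number of the block, up to \<open>X\<close>. In between it is
  multiplied by at most \<open>\<Lambda>\<close> per step unless \<open>X\<close> pays. Hence each
  block costs at least its number, up to the factor \<open>\<Lambda> ^ q\<close>. The sum of
  \<open>X\<close> is doubled since the value at a cut index is charged both to the block that ends
  there and to the one that begins there.\<close>

lemma block_growth:
  fixes m X :: "nat \<Rightarrow> int" and \<Lambda> :: int and q i0 N :: nat
  assumes i0: "i0 < q" and L: "1 \<le> \<Lambda>"
    and X: "\<And>j. j < N \<Longrightarrow> 0 \<le> X j"
    and step: "\<And>j. j < N \<Longrightarrow> max 0 (m (Suc j)) \<le> \<Lambda> * max 0 (m j) + X j"
    and cut: "\<And>j. j < N \<Longrightarrow> j mod q = i0 \<Longrightarrow> max 0 (m (Suc j)) \<le> X j \<and> int (j div q) - m j \<le> X j"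
  shows "M * q + i0 < N \<Longrightarrow>
    (\<Sum>k\<le>M. int k) \<le> \<Lambda> ^ q * (2 * (\<Sum>j<M * q + i0. X j) + X (M * q + i0))"
proof (induction M)
  case 0
  have "0 \<le> (\<Sum>j<i0. X j)" using 0 X by (intro sum_nonneg) auto
  then show ?case using 0 X[of i0] L by simp
next
  case (Suc M)
  define j0 where "j0 = M * q + i0"
  have j1: "Suc M * q + i0 = j0 + q" by (simp add: j0_def)
  have N: "j0 + q < N" using Suc.prems by (simp add: j0_def algebra_simps)
  have mod: "j0 mod q = i0" "(j0 + q) mod q = i0" "(j0 + q) div q = Suc M" using i0 by (simp_all add: j0_def)
  have run: "max 0 (m (Suc (j0 + s))) \<le> \<Lambda> ^ s * (\<Sum>j=j0..j0+s. X j)" if "j0 + s < N" for s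
    using that
  proof (induction s)
    case 0
    then show ?case using cut[of j0] mod by simp
  next
    case (Suc s)
    let ?S = "\<Sum>j=j0..j0+s. X j"
    have "max 0 (m (Suc (j0 + Suc s))) \<le> \<Lambda> * max 0 (m (Suc (j0 + s))) + X (Suc (j0 + s))"
      using step[of "Suc (j0 + s)"] Suc.prems by simp
    also have "\<dots> \<le> \<Lambda> * (\<Lambda> ^ s * ?S) + \<Lambda> ^ Suc s * X (Suc (j0 + s))"
    proof (rule add_mono)
      show "\<Lambda> * max 0 (m (Suc (j0 + s))) \<le> \<Lambda> * (\<Lambda> ^ s * ?S)"
        using Suc L by (intro mult_left_mono) auto
      have "1 * X (Suc (j0 + s)) \<le> \<Lambda> ^ Suc s * X (Suc (j0 + s))"
        using L X[of "Suc (j0 + s)"] Suc.prems one_le_power[OF L, of "Suc s"] by (intro mult_right_mono) auto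
      then show "X (Suc (j0 + s)) \<le> \<Lambda> ^ Suc s * X (Suc (j0 + s))" by simp
    qed
    also have "\<dots> = \<Lambda> ^ Suc s * (\<Sum>j=j0..j0+Suc s. X j)"
      by (simp add: algebra_simps)
    finally show ?case .
  qed
  obtain q' where q': "q = Suc q'" using i0 by (cases q) auto
  have S: "(\<Sum>j=j0..j0+q'. X j) = (\<Sum>j=j0..<j0+q. X j)"
    by (simp add: q' atLeastLessThanSuc_atLeastAtMost)
  have S0: "0 \<le> (\<Sum>j=j0..<j0+q. X j)" using X N by (intro sum_nonneg) auto
  have "int (Suc M) \<le> m (j0 + q) + X (j0 + q)" using cut[OF N] mod by simp
  also have "m (j0 + q) \<le> \<Lambda> ^ q' * (\<Sum>j=j0..<j0+q. X j)"
    using run[of q'] N q' S by simp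
  also have "\<dots> \<le> \<Lambda> ^ q * (\<Sum>j=j0..<j0+q. X j)"
    using L S0 power_increasing[of q' q \<Lambda>] q' by (intro mult_right_mono) auto
  also have "X (j0 + q) \<le> \<Lambda> ^ q * X (j0 + q)"
    using mult_right_mono[of 1 "\<Lambda> ^ q" "X (j0 + q)"] one_le_power[OF L, of q] X[OF N] by simp
  finally have k: "int (Suc M) \<le> \<Lambda> ^ q * (\<Sum>j=j0..<j0+q. X j) + \<Lambda> ^ q * X (j0 + q)" by simp
  have split: "(\<Sum>j<j0+q. X j) = (\<Sum>j<j0. X j) + (\<Sum>j=j0..<j0+q. X j)"
    by (metis lessThan_atLeast0 le_add1 sum.atLeastLessThan_concat zero_le)
  have "X j0 \<le> (\<Sum>j=j0..<j0+q. X j)"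
    using X N q' by (intro member_le_sum) auto
  then have "2 * (\<Sum>j<j0. X j) + X j0 + ((\<Sum>j=j0..<j0+q. X j) + X (j0 + q)) \<le> 2 * (\<Sum>j<j0+q. X j) + X (j0 + q)"
    unfolding split by (simp add: distrib_left)
  then have "\<Lambda> ^ q * (2 * (\<Sum>j<j0. X j) + X j0 + ((\<Sum>j=j0..<j0+q. X j) + X (j0 + q)))
      \<le> \<Lambda> ^ q * (2 * (\<Sum>j<j0+q. X j) + X (j0 + q))"
    using L by (intro mult_left_mono) auto
  moreover have "(\<Sum>k\<le>M. int k) \<le> \<Lambda> ^ q * (2 * (\<Sum>j<j0. X j) + X j0)"
    using Suc.IH N by (simp add: j0_def)
  ultimately show ?case unfolding j1 using k by (simp add: distrib_left)
qed

lemma (in group) comm_inv: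
  assumes "a \<in> carrier G" "g \<in> carrier G" "a \<otimes> g = g \<otimes> a"
  shows "inv a \<otimes> g = g \<otimes> inv a"
proof -
  have "inv a \<otimes> (a \<otimes> g) \<otimes> inv a = inv a \<otimes> (g \<otimes> a) \<otimes> inv a" using assms by simp
  then show ?thesis using assms(1,2) by (simp add: m_assoc)
qed

context gog
begin

lemma ep_nth:
  "ep x xs y \<Longrightarrow> i < length xs \<Longrightarrow> fst (xs ! i) \<in> E \<and> snd (xs ! i) \<in> carrier (VG (\<tau> (fst (xs ! i)))) \<and>
     \<tau> (bar (fst (xs ! i))) = (if i = 0 then x else \<tau> (fst (xs ! (i - 1))))"
proof (induction x xs y arbitrary: i rule: ep.induct)
  case (2 x e r xs y)
  then show ?case using "2.IH"[of "i - 1"] by (cases i) (auto simp: nth_Cons')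
qed simp

lemma ep_last: "ep x xs y \<Longrightarrow> xs \<noteq> [] \<Longrightarrow> y = \<tau> (fst (last xs))"
  by (induction x xs y rule: ep.induct) (auto split: if_splits)

lemma f_img_subgroup: "e \<in> E \<Longrightarrow> subgroup (f e ` carrier (EG e)) (VG (\<tau> e))"
  by (rule group_hom.img_is_subgroup[OF f_hom])

lemma f_img_mult_iff:
  assumes "e \<in> E" "a \<in> f e ` carrier (EG e)" "r \<in> carrier (VG (\<tau> e))"
  shows "a \<otimes>\<^bsub>VG (\<tau> e)\<^esub> r \<in> f e ` carrier (EG e) \<longleftrightarrow> r \<in> f e ` carrier (EG e)"
proof -
  interpret G: group "VG (\<tau> e)" using assms by simp
  interpret S: subgroup "f e ` carrier (EG e)" "VG (\<tau> e)" by (rule f_img_subgroup[OF assms(1)])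
  have a: "a \<in> carrier (VG (\<tau> e))" using assms(2) S.mem_carrier by blast
  have "r \<in> f e ` carrier (EG e)" if "a \<otimes>\<^bsub>VG (\<tau> e)\<^esub> r \<in> f e ` carrier (EG e)"
    using S.m_closed[OF S.m_inv_closed[OF assms(2)] that] a assms(3) by simp
  then show ?thesis using S.m_closed assms(2) by blast
qed

lemma f_pow: "\<lbrakk>e \<in> E; g \<in> carrier (EG e)\<rbrakk> \<Longrightarrow> f e (g [^]\<^bsub>EG e\<^esub> (n::int)) = f e g [^]\<^bsub>VG (\<tau> e)\<^esub> n"
  using group_hom.hom_int_pow[OF f_hom] by blast

end

section \<open>Twistors of an efficient Dehn twist\<close>

context eff_dehn
begin

lemma dt: "dehn_twist \<GG> H" using eff by (simp add: efficient_def)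

abbreviation "\<gamma> \<equiv> gam \<GG> H"
abbreviation "z \<equiv> twistor \<GG> H"

lemma gam:
  assumes "e \<in> E"
  shows "\<gamma> e \<in> carrier (EG e)" "f e (\<gamma> e) = corr H e" "\<And>g. g \<in> carrier (EG e) \<Longrightarrow> \<gamma> e \<otimes>\<^bsub>EG e\<^esub> g = g \<otimes>\<^bsub>EG e\<^esub> \<gamma> e"
proof -
  obtain c where c: "c \<in> center (EG e)" "corr H e = f e c" using dt assms by (auto simp: dehn_twist_def)
  then have cc: "c \<in> carrier (EG e)" by (simp add: center_def)
  have "inj_on (f e) (carrier (EG e))" using f_mon[OF assms] by (simp add: mon_def)
  then have "\<gamma> e = c" unfolding gam_def c(2) using cc by (rule inv_into_f_f)
  then show "\<gamma> e \<in> carrier (EG e)" "f e (\<gamma> e) = corr H e"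
    "\<And>g. g \<in> carrier (EG e) \<Longrightarrow> \<gamma> e \<otimes>\<^bsub>EG e\<^esub> g = g \<otimes>\<^bsub>EG e\<^esub> \<gamma> e"
    using c cc by (auto simp: center_def)
qed

lemma z_closed [simp]: "e \<in> E \<Longrightarrow> z e \<in> carrier (EG e)"
  unfolding twistor_def using gam(1)[of e] gam(1)[of "bar e"] by (auto intro!: monoid.m_closed group.inv_closed)

lemma z_central:
  assumes "e \<in> E" "g \<in> carrier (EG e)"
  shows "g \<otimes>\<^bsub>EG e\<^esub> z e = z e \<otimes>\<^bsub>EG e\<^esub> g"
proof -
  interpret group "EG e" using assms by simp
  have a: "\<gamma> e \<in> carrier (EG e)" "\<gamma> (bar e) \<in> carrier (EG e)" using gam(1)[of e] gam(1)[of "bar e"] assms by auto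
  have 1: "inv\<^bsub>EG e\<^esub> \<gamma> e \<otimes>\<^bsub>EG e\<^esub> g = g \<otimes>\<^bsub>EG e\<^esub> inv\<^bsub>EG e\<^esub> \<gamma> e"
    by (rule comm_inv) (use a assms gam(3) in auto)
  have 2: "\<gamma> (bar e) \<otimes>\<^bsub>EG e\<^esub> g = g \<otimes>\<^bsub>EG e\<^esub> \<gamma> (bar e)" using gam(3)[of "bar e" g] assms by simp
  have "z e \<otimes>\<^bsub>EG e\<^esub> g = \<gamma> (bar e) \<otimes>\<^bsub>EG e\<^esub> (g \<otimes>\<^bsub>EG e\<^esub> inv\<^bsub>EG e\<^esub> \<gamma> e)"
    using a assms by (simp add: twistor_def m_assoc 1)
  also have "\<dots> = g \<otimes>\<^bsub>EG e\<^esub> z e" using a assms by (simp add: twistor_def m_assoc[symmetric] 2)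
  finally show ?thesis ..
qed

lemma z_bar: "e \<in> E \<Longrightarrow> z (bar e) = inv\<^bsub>EG e\<^esub> z e"
proof -
  assume e: "e \<in> E"
  interpret group "EG e" using e by simp
  have a: "\<gamma> e \<in> carrier (EG e)" "\<gamma> (bar e) \<in> carrier (EG e)" using gam(1)[of e] gam(1)[of "bar e"] e by auto
  then show ?thesis using e by (simp add: twistor_def inv_mult_group)
qed

lemma z_neq: "e \<in> E \<Longrightarrow> z e \<noteq> \<one>\<^bsub>EG e\<^esub>"
  using eff by (auto simp: efficient_def)

definition zz :: "'e \<Rightarrow> 'a" where "zz e = f e (z e)"

lemma zz_closed [simp]: "e \<in> E \<Longrightarrow> zz e \<in> carrier (VG (\<tau> e))" by (simp add: zz_def)

lemma zz_pow_closed [simp]: "e \<in> E \<Longrightarrow> zz e [^]\<^bsub>VG (\<tau> e)\<^esub> (k::int) \<in> carrier (VG (\<tau> e))"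
  by (simp add: group.int_pow_closed)

lemma zz_neq: "e \<in> E \<Longrightarrow> zz e \<noteq> \<one>\<^bsub>VG (\<tau> e)\<^esub>"
  using f_inj[of e "z e" "\<one>\<^bsub>EG e\<^esub>"] z_neq[of e] monoid.one_closed[OF EG_monoid[of e]] by (auto simp: zz_def)

lemma zz_pow: "e \<in> E \<Longrightarrow> zz e [^]\<^bsub>VG (\<tau> e)\<^esub> (k::int) = f e (z e [^]\<^bsub>EG e\<^esub> k)"
  by (simp add: zz_def f_pow)

lemma zz_pow_img: "e \<in> E \<Longrightarrow> zz e [^]\<^bsub>VG (\<tau> e)\<^esub> (k::int) \<in> f e ` carrier (EG e)"
  unfolding zz_pow by (intro imageI) (simp add: group.int_pow_closed)

lemma zz_comm: "e \<in> E \<Longrightarrow> a \<in> f e ` carrier (EG e) \<Longrightarrow> a \<otimes>\<^bsub>VG (\<tau> e)\<^esub> zz e = zz e \<otimes>\<^bsub>VG (\<tau> e)\<^esub> a"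
  using z_central by (auto simp: zz_def f_mult[symmetric])

lemma vhom_id: "\<lbrakk>x \<in> V; g \<in> carrier (VG x)\<rbrakk> \<Longrightarrow> vhom H x g = g"
  using dt by (auto simp: dehn_twist_def)

lemma ind_El_id: "\<lbrakk>x \<in> V; g \<in> carrier (VG x)\<rbrakk> \<Longrightarrow> ind (El x g) = El x g"
  by (simp add: ind_El vhom_id)

text \<open>The correction term on the left crosses the stable letter and meets the inverse of the
  one on the right; their quotient is the twistor. The whole effect of the twist is thus
  concentrated behind the edge.\<close>

lemma ind_St_tw: "e \<in> E \<Longrightarrow> ind (St e) = St e \<cdot> El (\<tau> e) (zz e)"
proof -
  assume e: "e \<in> E"
  interpret group "EG e" using e by simp
  have a: "\<gamma> e \<in> carrier (EG e)" "\<gamma> (bar e) \<in> carrier (EG e)" using gam(1)[of e] gam(1)[of "bar e"] e by auto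
  have "ind (St e) = El (\<tau> (bar e)) (f (bar e) (\<gamma> (bar e))) \<cdot> St e \<cdot> iv (El (\<tau> e) (f e (\<gamma> e)))"
    using e gam(2)[of e] gam(2)[of "bar e"] by (simp add: ind_St)
  also have "El (\<tau> (bar e)) (f (bar e) (\<gamma> (bar e))) \<cdot> St e = St e \<cdot> El (\<tau> e) (f e (\<gamma> (bar e)))"
    using St_rel[OF e a(2)] by simp
  finally show ?thesis using e a
    by (simp add: PG.m_assoc El_inv[symmetric] El_mult f_inv[symmetric] f_mult[symmetric] zz_def twistor_def group.inv_closed)
qed

lemma root_closed: "\<lbrakk>e \<in> E; r \<in> carrier (VG (\<tau> e)); (p::int) \<noteq> 0; r [^]\<^bsub>VG (\<tau> e)\<^esub> p \<in> f e ` carrier (EG e)\<rbrakk>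
    \<Longrightarrow> r \<in> f e ` carrier (EG e)"
  using eff unfolding efficient_def by blast

lemma not_bonded: "\<lbrakk>e1 \<in> E; e2 \<in> E; e1 \<noteq> e2\<rbrakk> \<Longrightarrow> \<not> positively_bonded \<GG> H e1 e2"
  using eff unfolding efficient_def by blast

lemma not_bonded_pow:
  assumes e: "e1 \<in> E" "e2 \<in> E" "e1 \<noteq> e2" "\<tau> e1 = \<tau> e2" and h: "h \<in> carrier (VG (\<tau> e1))"
    and AB: "A > 0" "B > 0"
    and eq: "h \<otimes>\<^bsub>VG (\<tau> e1)\<^esub> zz e1 [^]\<^bsub>VG (\<tau> e1)\<^esub> (A::int) \<otimes>\<^bsub>VG (\<tau> e1)\<^esub> inv\<^bsub>VG (\<tau> e1)\<^esub> h = zz e2 [^]\<^bsub>VG (\<tau> e1)\<^esub> (B::int)"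
  shows False
proof -
  obtain a b where ab: "A = int a" "B = int b" "a \<ge> 1" "b \<ge> 1"
    using AB by (metis One_nat_def Suc_leI of_nat_0_less_iff zero_less_imp_eq_int)
  have "f e1 (z e1 [^]\<^bsub>EG e1\<^esub> a) = zz e1 [^]\<^bsub>VG (\<tau> e1)\<^esub> A" "f e2 (z e2 [^]\<^bsub>EG e2\<^esub> b) = zz e2 [^]\<^bsub>VG (\<tau> e1)\<^esub> B"
    using zz_pow[OF e(1), of A] zz_pow[OF e(2), of B] e(4) by (simp_all add: ab int_pow_int)
  then have "ad (VG (\<tau> e1)) h (f e1 (z e1 [^]\<^bsub>EG e1\<^esub> a)) = f e2 (z e2 [^]\<^bsub>EG e2\<^esub> b)"
    using eq by (simp add: ad_def)
  then have "positively_bonded \<GG> H e1 e2"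
    unfolding positively_bonded_def using ab(3,4) e(4) h by blast
  then show False using not_bonded e by blast
qed

text \<open>If \<open>f\<^sub>e\<close> were onto, all edges ending at that vertex would have commensurable, hence
  surjective, edge groups; among three of them two would be positively bonded.\<close>

lemma not_surj:
  assumes e: "e \<in> E"
  shows "f e ` carrier (EG e) \<noteq> carrier (VG (\<tau> e))"
proof
  assume sur: "f e ` carrier (EG e) = carrier (VG (\<tau> e))"
  define y where "y = \<tau> e"
  have y: "y \<in> V" using e by (simp add: y_def)
  interpret G: group "VG y" using y by simp
  have comm: "\<exists>(p::int) (r::int). p > 0 \<and> r \<noteq> 0 \<and> zz e' [^]\<^bsub>VG y\<^esub> p = zz e [^]\<^bsub>VG y\<^esub> r" if e': "e' \<in> E" "\<tau> e' = y" for e'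
  proof -
    have "zz e' \<in> carrier (VG y)" "zz e' \<noteq> \<one>\<^bsub>VG y\<^esub>" using zz_closed[OF e'(1)] zz_neq[OF e'(1)] e' by auto
    moreover have "zz e \<in> carrier (VG y)" "zz e \<noteq> \<one>\<^bsub>VG y\<^esub>" using zz_closed[OF e] zz_neq[OF e] by (auto simp: y_def)
    moreover have "zz e' \<otimes>\<^bsub>VG y\<^esub> zz e = zz e \<otimes>\<^bsub>VG y\<^esub> zz e'"
      using zz_comm[OF e, of "zz e'"] calculation sur by (simp add: y_def)
    ultimately obtain p r :: int where pr: "p > 0" "zz e' [^]\<^bsub>VG y\<^esub> p = zz e [^]\<^bsub>VG y\<^esub> r"
      using vg_commens[OF y] by blast
    moreover have "r \<noteq> 0"
    proof
      assume "r = 0"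
      then have "zz e' [^]\<^bsub>VG y\<^esub> p = zz e' [^]\<^bsub>VG y\<^esub> (0::int)" using pr by simp
      then have "p = 0" using vg_pow_inj[OF y] \<open>zz e' \<in> _\<close> \<open>zz e' \<noteq> _\<close> by blast
      then show False using pr by simp
    qed
    ultimately show ?thesis by blast
  qed
  have sur': "edge_surj \<GG> e'" if e': "e' \<in> E" "\<tau> e' = y" for e'
  proof -
    obtain p r :: int where pr: "p > 0" "r \<noteq> 0" "zz e' [^]\<^bsub>VG y\<^esub> p = zz e [^]\<^bsub>VG y\<^esub> r" using comm e' by blast
    \<comment> \<open>Since \<open>f e\<close> is onto, \<open>a\<close> commutes with the twistor
      of \<open>e\<close>. Some power of \<open>a\<close> is therefore a power of the twistor of
      \<open>e'\<close>, and the image of \<open>f e'\<close> is closed under roots.\<close>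
    have "a \<in> f e' ` carrier (EG e')" if a: "a \<in> carrier (VG y)" for a
    proof -
      have ze: "zz e \<in> carrier (VG y)" "zz e \<noteq> \<one>\<^bsub>VG y\<^esub>" using zz_closed[OF e] zz_neq[OF e] by (auto simp: y_def)
      have "a \<otimes>\<^bsub>VG y\<^esub> zz e = zz e \<otimes>\<^bsub>VG y\<^esub> a" using zz_comm[OF e, of a] a sur by (simp add: y_def)
      then obtain s t :: int where st: "s > 0" "a [^]\<^bsub>VG y\<^esub> s = zz e [^]\<^bsub>VG y\<^esub> t"
        using vg_commens[OF y a ze] by blast
      have "a [^]\<^bsub>VG y\<^esub> (s * r) = (zz e [^]\<^bsub>VG y\<^esub> r) [^]\<^bsub>VG y\<^esub> t"
        using st a ze by (simp add: G.int_pow_pow[symmetric]) (simp add: G.int_pow_pow mult.commute)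
      also have "\<dots> = zz e' [^]\<^bsub>VG y\<^esub> (p * t)"
        using zz_closed[OF e'(1)] e' by (simp add: pr(3)[symmetric] G.int_pow_pow)
      finally have "a [^]\<^bsub>VG y\<^esub> (s * r) \<in> f e' ` carrier (EG e')" using zz_pow_img[OF e'(1)] e' by simp
      then show ?thesis using root_closed[OF e'(1), of a "s * r"] a st pr e' by auto
    qed
    then show ?thesis using f_closed[OF e'(1)] e' by auto
  qed
  have in_arcs: "in_arcs (graph \<GG>) y = {e' \<in> E. \<tau> e' = y}" by (auto simp: in_arcs_def)
  have fin: "finite {e' \<in> E. \<tau> e' = y}" using finite_E by simp
  have d1: "in_degree (graph \<GG>) y \<noteq> 1"
    using eff e sur unfolding efficient_def y_def by blast
  then have "card {e' \<in> E. \<tau> e' = y} \<noteq> 1" by (simp add: in_degree_def in_arcs)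
  then obtain e2 where e2: "e2 \<in> E" "\<tau> e2 = y" "e2 \<noteq> e"
  proof -
    have "{e' \<in> E. \<tau> e' = y} \<noteq> {e}" using \<open>card {e' \<in> E. \<tau> e' = y} \<noteq> 1\<close> by (metis card_1_singleton_iff One_nat_def)
    then show ?thesis using that e y_def by blast
  qed
  have "in_degree (graph \<GG>) y \<noteq> 2"
    using eff e e2 sur sur'[OF e2(1,2)] unfolding efficient_def y_def by metis
  then have "card {e' \<in> E. \<tau> e' = y} \<noteq> 2" by (simp add: in_degree_def in_arcs)
  then have "{e' \<in> E. \<tau> e' = y} \<noteq> {e, e2}" using e2(3) by (auto simp: card_2_iff)
  moreover have "{e, e2} \<subseteq> {e' \<in> E. \<tau> e' = y}" using e e2 by (simp add: y_def)
  ultimately have "\<not> {e' \<in> E. \<tau> e' = y} \<subseteq> {e, e2}" by (meson subset_antisym)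
  then obtain e3 where e3: "e3 \<in> E" "\<tau> e3 = y" "e3 \<noteq> e" "e3 \<noteq> e2" by auto
  have one: "\<one>\<^bsub>VG y\<^esub> \<otimes>\<^bsub>VG y\<^esub> a \<otimes>\<^bsub>VG y\<^esub> inv\<^bsub>VG y\<^esub> \<one>\<^bsub>VG y\<^esub> = a" if "a \<in> carrier (VG y)" for a using that by simp
  \<comment> \<open>Without positive bonds, any other edge at \<open>y\<close> is related to
    \<open>e\<close> by exponents of opposite sign. Two such edges are then related to each other by
    exponents of equal sign.\<close>
  have neg: "\<exists>(p::int) (r::int). p > 0 \<and> r < 0 \<and> zz e' [^]\<^bsub>VG y\<^esub> p = zz e [^]\<^bsub>VG y\<^esub> r"
    if e': "e' \<in> E" "\<tau> e' = y" "e' \<noteq> e" for e'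
  proof -
    obtain p r :: int where pr: "p > 0" "r \<noteq> 0" "zz e' [^]\<^bsub>VG y\<^esub> p = zz e [^]\<^bsub>VG y\<^esub> r" using comm e' by blast
    have "\<not> r > 0"
      using not_bonded_pow[of e' e "\<one>\<^bsub>VG y\<^esub>" p r] e' e pr one zz_pow_closed[OF e'(1), of p] by (auto simp: y_def)
    then show ?thesis using pr by (metis linorder_neqE_linordered_idom)
  qed
  obtain p r :: int where pr: "p > 0" "r < 0" "zz e2 [^]\<^bsub>VG y\<^esub> p = zz e [^]\<^bsub>VG y\<^esub> r" using neg e2 by blast
  obtain p' r' :: int where pr': "p' > 0" "r' < 0" "zz e3 [^]\<^bsub>VG y\<^esub> p' = zz e [^]\<^bsub>VG y\<^esub> r'" using neg e3 by blast
  have c: "zz e \<in> carrier (VG y)" "zz e2 \<in> carrier (VG y)" "zz e3 \<in> carrier (VG y)"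
    using zz_closed[OF e] zz_closed[OF e2(1)] zz_closed[OF e3(1)] e2 e3 by (auto simp: y_def)
  have "zz e2 [^]\<^bsub>VG y\<^esub> (p * (- r')) = (zz e [^]\<^bsub>VG y\<^esub> r) [^]\<^bsub>VG y\<^esub> (- r')"
    using c pr by (simp only: G.int_pow_pow[symmetric])
  also have "\<dots> = (zz e [^]\<^bsub>VG y\<^esub> r') [^]\<^bsub>VG y\<^esub> (- r)"
    using c by (simp only: G.int_pow_pow) (simp add: mult.commute)
  also have "\<dots> = zz e3 [^]\<^bsub>VG y\<^esub> (p' * (- r))" using c pr' by (simp only: G.int_pow_pow[symmetric])
  finally have eq: "zz e2 [^]\<^bsub>VG y\<^esub> (p * (- r')) = zz e3 [^]\<^bsub>VG y\<^esub> (p' * (- r))" .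
  have pos: "p * (- r') > 0" "p' * (- r) > 0" using pr pr' by (simp_all add: mult_pos_neg)
  show False
  proof (rule not_bonded_pow[OF e2(1) e3(1) _ _ _ pos])
    show "\<one>\<^bsub>VG y\<^esub> \<in> carrier (VG (\<tau> e2))" using e2 by simp
    show "\<one>\<^bsub>VG y\<^esub> \<otimes>\<^bsub>VG (\<tau> e2)\<^esub> zz e2 [^]\<^bsub>VG (\<tau> e2)\<^esub> (p * - r') \<otimes>\<^bsub>VG (\<tau> e2)\<^esub> inv\<^bsub>VG (\<tau> e2)\<^esub> \<one>\<^bsub>VG y\<^esub> =
      zz e3 [^]\<^bsub>VG (\<tau> e2)\<^esub> (p' * - r)"
      unfolding e2(2) eq[symmetric] using one c by simp
  qed (use e2 e3 in auto)
qed

lemma hv_bar: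
  assumes "e \<in> E" "g \<in> carrier (EG e)"
  defines "t \<equiv> hat (\<tau> (bar e)) (\<tau> e) (St e)"
  shows "hv (\<tau> (bar e)) (f (bar e) g) = t \<cdot> hv (\<tau> e) (f e g) \<cdot> iv t"
proof -
  have fk: "f (bar e) g \<in> carrier (VG (\<tau> (bar e)))" using assms f_closed[of "bar e" g] by simp
  have "El (\<tau> (bar e)) (f (bar e) g) = St e \<cdot> El (\<tau> e) (f e g) \<cdot> iv (St e)"
    using St_rel[OF assms(1,2)] assms fk by (simp add: PG.m_assoc)
  moreover have "hat (\<tau> (bar e)) (\<tau> (bar e)) (St e \<cdot> El (\<tau> e) (f e g) \<cdot> iv (St e)) =
      hat (\<tau> (bar e)) (\<tau> e) (St e \<cdot> El (\<tau> e) (f e g)) \<cdot> hat (\<tau> e) (\<tau> (bar e)) (iv (St e))"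
    using assms by (intro hat_mult paths_mult[OF St_paths El_paths] paths_inv St_paths) auto
  moreover have "hat (\<tau> (bar e)) (\<tau> e) (St e \<cdot> El (\<tau> e) (f e g)) = t \<cdot> hv (\<tau> e) (f e g)"
    unfolding t_def hv_def using assms by (intro hat_mult St_paths El_paths) auto
  moreover have "hat (\<tau> e) (\<tau> (bar e)) (iv (St e)) = iv t"
    unfolding t_def using assms by (intro hat_inv St_paths) auto
  ultimately show ?thesis by (simp add: hv_def)
qed

lemma t_C: "e \<in> E \<Longrightarrow> hat (\<tau> (bar e)) (\<tau> e) (St e) \<in> C"
  by (intro hat_C St_paths) auto

text \<open>With \<open>a'\<close> the quotient of \<open>a\<close> by \<open>A\<close>, the product
  \<open>c \<up> a \<cdot> d \<up> b\<close> is a bounded factor times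
  \<open>d \<up> (B * a' + b)\<close>. As \<open>B\<close> is positive, a large positive
  \<open>b\<close> is either visible in the length or cancelled by a negative
  \<open>a\<close>.\<close>

lemma commens_step:
  assumes c: "c \<in> C" "c \<noteq> \<one>\<^bsub>PG\<^esub>" and d: "d \<in> C" "d \<noteq> \<one>\<^bsub>PG\<^esub>"
    and AB: "c \<up> A = d \<up> B" "A > 0" "B > 0"
  shows "\<exists>K\<ge>0. \<forall>a b. max 0 b \<le> B * max 0 (- a) + fl (c \<up> a \<cdot> d \<up> b) + K"
proof -
  define K where "K = (\<Sum>s\<in>{0..<A}. fl (c \<up> s))"
  have K0: "0 \<le> K" unfolding K_def using fl_nonneg C_pow c by (intro sum_nonneg) auto
  have "max 0 b \<le> B * max 0 (- a) + fl (c \<up> a \<cdot> d \<up> b) + K" for a b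
  proof -
    define s where "s = a mod A"
    define a' where "a' = a div A"
    have a: "a = s + A * a'" by (simp add: s_def a'_def)
    have s: "s \<in> {0..<A}" using AB by (simp add: s_def)
    have cP: "c \<in> carrier PG" "d \<in> carrier PG" using c d C_PG by auto
    have "c \<up> a = c \<up> s \<cdot> d \<up> (B * a')"
      unfolding a using cP AB(1) by (metis PG.int_pow_mult PG.int_pow_pow)
    then have eq: "c \<up> a \<cdot> d \<up> b = c \<up> s \<cdot> d \<up> (B * a' + b)"
      using cP by (simp add: PG.m_assoc PG.int_pow_mult)
    have "fl (c \<up> s) \<le> K"
      unfolding K_def using s fl_nonneg C_pow c by (intro member_le_sum) auto
    moreover have "fl (d \<up> (B * a' + b)) - fl (c \<up> s) \<le> fl (c \<up> a \<cdot> d \<up> b)"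
      unfolding eq using C_pow c d by (intro fl_mult_ge2) auto
    moreover have "\<bar>B * a' + b\<bar> \<le> fl (d \<up> (B * a' + b))" using d by (rule fl_pow_ge)
    ultimately have le: "b \<le> - (B * a') + fl (c \<up> a \<cdot> d \<up> b) + K" by linarith
    have "- (B * a') \<le> B * max 0 (- a)"
    proof (cases "a \<ge> 0")
      case True
      then have "0 \<le> B * a'" using AB by (simp add: a'_def pos_imp_zdiv_nonneg_iff)
      moreover have "0 \<le> B * max 0 (- a)" using AB by simp
      ultimately show ?thesis by linarith
    next
      case False
      have "- a' \<le> - a"
      proof -
        have "a' < 0" using False AB by (simp add: a'_def pos_imp_zdiv_neg_iff)
        then have "A * (a' + 1) \<le> 1 * (a' + 1)" using AB by (intro mult_right_mono_neg) auto
        then show ?thesis using s a by (simp add: distrib_left)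
      qed
      then have "B * (- a') \<le> B * (- a)" using AB by (intro mult_left_mono) auto
      then show ?thesis using False by simp
    qed
    moreover have "0 \<le> fl (c \<up> a \<cdot> d \<up> b)" using C_pow C_mult c d fl_nonneg by blast
    moreover have "0 \<le> B * max 0 (- a)" using AB by simp
    ultimately show ?thesis using le K0 by simp
  qed
  then show ?thesis using K0 by blast
qed

end

section \<open>The periodic line of a cyclically reduced loop\<close>

locale cyc_dehn = eff_dehn +
  fixes x :: 'a and xs :: "('b \<times> 'c) list"
  assumes epx: "ep x xs x" and ne: "xs \<noteq> []" and red2: "red (xs @ xs)"
begin

definition "q = length xs"
definition "ee j = fst (xs ! (j mod q))"
definition "rr j = snd (xs ! (j mod q))"

lemma q_pos: "0 < q" using ne by (simp add: q_def)

lemma per [simp]: "ee (j mod q) = ee j" "rr (j mod q) = rr j" "ee (Suc (j mod q)) = ee (Suc j)" 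
  by (simp_all add: ee_def rr_def mod_Suc_eq)

lemma per_mult [simp]: "ee (n * q) = ee 0" "ee (q * n) = ee 0" "ee q = ee 0"
  by (simp_all add: ee_def)

lemma ee [simp]: "ee j \<in> E" and rr [simp]: "rr j \<in> carrier (VG (\<tau> (ee j)))"
  using ep_nth[OF epx, of "j mod q"] q_pos by (auto simp: ee_def rr_def q_def)

lemma ee_Suc [simp]: "\<tau> (bar (ee (Suc j))) = \<tau> (ee j)"
proof -
  have e2: "ep x (xs @ xs) x" using epx ep_append by blast
  let ?i = "j mod q"
  have i: "?i < q" using q_pos by simp
  have "(xs @ xs) ! Suc ?i = xs ! (Suc ?i mod q)" "(xs @ xs) ! ?i = xs ! ?i"
    using i by (auto simp: nth_append q_def mod_Suc not_less)
  moreover have "Suc ?i < length (xs @ xs)" using i by (simp add: q_def)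
  ultimately have "\<tau> (bar (fst (xs ! (Suc ?i mod q)))) = \<tau> (fst (xs ! ?i))"
    using ep_nth[OF e2, of "Suc ?i"] by simp
  then show ?thesis by (simp add: ee_def mod_Suc_eq)
qed

lemma x_ee0: "\<tau> (bar (ee 0)) = x" and xV: "x \<in> V"
proof -
  show 1: "\<tau> (bar (ee 0)) = x" using ep_nth[OF epx, of 0] q_pos by (simp add: ee_def q_def)
  show "x \<in> V" using \<tau>_closed[OF bar_closed[OF ee], of 0] 1 by simp
qed

lemma no_pinch: "\<not> (ee (Suc j) = bar (ee j) \<and> rr j \<in> f (ee j) ` carrier (EG (ee j)))"
proof -
  let ?i = "j mod q"
  have i: "?i < q" using q_pos by simp
  have "(xs @ xs) ! Suc ?i = xs ! (Suc ?i mod q)" "(xs @ xs) ! ?i = xs ! ?i"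
    using i by (auto simp: nth_append q_def mod_Suc not_less)
  moreover have "Suc ?i < length (xs @ xs)" using i by (simp add: q_def)
  ultimately show ?thesis
    using red2 unfolding red_def successively_conv_nth ee_def rr_def by (auto simp: mod_Suc_eq case_prod_beta)
qed

lemma ep_map:
  assumes "\<And>j. s j \<in> carrier (VG (\<tau> (ee j)))"
  shows "ep x (map (\<lambda>j. (ee j, s j)) [0..<m]) (\<tau> (bar (ee m)))"
proof (induction m)
  case 0
  then show ?case by (simp add: x_ee0)
next
  case (Suc m)
  then show ?case using assms ep_append by auto
qed

lemma red_map:
  assumes "\<And>j. s j \<in> f (ee j) ` carrier (EG (ee j)) \<Longrightarrow> rr j \<in> f (ee j) ` carrier (EG (ee j))"
  shows "red (map (\<lambda>j. (ee j, s j)) [0..<m])"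
  using assms no_pinch by (auto simp: red_def successively_conv_nth)

lemma xs_map: "xs = map (\<lambda>j. (ee j, rr j)) [0..<q]"
  by (rule nth_equalityI) (simp_all add: q_def ee_def rr_def)

definition c where "c j = hv (\<tau> (ee j)) (zz (ee j))"
definition R where "R j = hv (\<tau> (ee j)) (rr j)"
definition t where "t j = hat (\<tau> (bar (ee j))) (\<tau> (ee j)) (St (ee j))"
text \<open>The twistor of the edge that follows, moved back across its stable letter and conjugated
  by the vertex element in between. Thus \<open>c j\<close> and \<open>d j\<close> both come from
  the vertex group where edge \<open>j\<close> ends, and the twists on either side of the syllable
  \<open>rr j\<close> can be compared there.\<close>

definition d where "d j = R j \<cdot> (t (Suc j) \<cdot> c (Suc j) \<cdot> iv (t (Suc j))) \<cdot> iv (R j)"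

lemma cC: "c j \<in> C" and RC: "R j \<in> C" and tC: "t j \<in> C"
  by (simp_all add: c_def R_def t_def hv_C t_C)

lemma cP: "c j \<in> carrier PG" and RP: "R j \<in> carrier PG" and tP: "t j \<in> carrier PG"
  using cC RC tC C_PG by auto

lemma dC: "d j \<in> C"
  unfolding d_def by (intro C_mult C_inv cC RC tC)

lemma c_ne: "c j \<noteq> \<one>\<^bsub>PG\<^esub>"
  using hv_eq_one[of "\<tau> (ee j)" "zz (ee j)"] zz_neq by (auto simp: c_def)

lemma d_pow: "d j \<up> n = R j \<cdot> (t (Suc j) \<cdot> c (Suc j) \<up> n \<cdot> iv (t (Suc j))) \<cdot> iv (R j)"
  unfolding d_def using cP RP tP by (simp add: PG.conj_int_pow)

lemma d_ne: "d j \<noteq> \<one>\<^bsub>PG\<^esub>"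
proof
  assume "d j = \<one>\<^bsub>PG\<^esub>"
  then have "iv (t (Suc j)) \<cdot> (iv (R j) \<cdot> d j \<cdot> R j) \<cdot> t (Suc j) = \<one>\<^bsub>PG\<^esub>" using RP tP by simp
  then have "c (Suc j) = \<one>\<^bsub>PG\<^esub>" unfolding d_def using cP RP tP by (simp add: PG.m_assoc)
  then show False using c_ne by blast
qed

lemma per_cd: "c (j mod q) = c j" "d (j mod q) = d j" "R (j mod q) = R j" "t (Suc (j mod q)) = t (Suc j)"
    "c (Suc (j mod q)) = c (Suc j)"
  by (simp_all add: c_def d_def R_def t_def)

text \<open>Reversing an edge inverts its twistor, so \<open>d j\<close> is conjugate to the inverse
  of the twistor of \<open>bar (ee (Suc j))\<close>, an edge that ends where \<open>ee j\<close>
  does. Opposite signs would bond these two edges positively. If they are one and the same edge, the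
  exponents agree in absolute value and \<open>rr j\<close> commutes with a power of the twistor; by
  closure under roots it lies in the image of the edge group, and the path is pinched.\<close>

lemma same_sign:
  assumes eq: "c j \<up> A = d j \<up> B" and A: "A > 0" and B: "B \<noteq> 0"
  shows "B > 0"
proof (rule ccontr)
  assume "\<not> B > 0"
  then have B0: "- B > 0" using B by simp
  define e where "e = ee j"
  define e2 where "e2 = ee (Suc j)"
  define e' where "e' = bar e2"
  define r where "r = rr j"
  have e: "e \<in> E" "e' \<in> E" "e2 \<in> E" "\<tau> e' = \<tau> e" "bar e' = e2" by (simp_all add: e_def e'_def e2_def)
  define y where "y = \<tau> e"
  have y: "y \<in> V" and r: "r \<in> carrier (VG y)" using e by (simp_all add: y_def r_def e_def)
  interpret G: group "VG y" using y by simp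
  interpret GE: group "EG e2" using e by simp
  have ze: "zz e \<in> carrier (VG y)" "zz e' \<in> carrier (VG y)" using zz_closed[OF e(1)] zz_closed[OF e(2)] e by (simp_all add: y_def)
  have "z e' = inv\<^bsub>EG e2\<^esub> z e2" using z_bar[OF e(3)] by (simp add: e'_def)
  then have ze': "f (bar e2) (z e2) = inv\<^bsub>VG y\<^esub> zz e'"
    using e f_inv[of e' "z e2"] f_closed[of e' "z e2"] by (simp add: zz_def e'_def y_def[symmetric])
  then have hvd: "t (Suc j) \<cdot> c (Suc j) \<cdot> iv (t (Suc j)) = iv (hv y (zz e'))"
    using hv_bar[OF e(3) z_closed[OF e(3)]] ze y hv_inv[of y "zz e'"] e
    by (simp add: t_def c_def e2_def[symmetric] zz_def[of e2] e'_def[symmetric] y_def)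
  have hc: "hv y (zz e') \<in> carrier PG" using hv_C[OF y ze(2)] C_PG by blast
  have "d j = R j \<cdot> iv (hv y (zz e')) \<cdot> iv (R j)" by (simp add: d_def hvd)
  then have "d j \<up> B = R j \<cdot> (iv (hv y (zz e')) \<up> B) \<cdot> iv (R j)" using hc RP by (simp add: PG.conj_int_pow)
  also have "iv (hv y (zz e')) \<up> B = hv y (zz e') \<up> (- B)" using hc by (simp add: PG.int_pow_inv PG.int_pow_neg)
  finally have eq1: "c j \<up> A = R j \<cdot> hv y (zz e') \<up> (- B) \<cdot> iv (R j)" using eq by simp
  also have "\<dots> = hv y (r \<otimes>\<^bsub>VG y\<^esub> zz e' [^]\<^bsub>VG y\<^esub> (- B) \<otimes>\<^bsub>VG y\<^esub> inv\<^bsub>VG y\<^esub> r)"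
    using y r ze by (simp only: R_def e_def[symmetric] r_def[symmetric] y_def[symmetric] hv_mult hv_pow hv_inv
        G.int_pow_closed G.inv_closed G.m_closed)
  finally have "hv y (zz e [^]\<^bsub>VG y\<^esub> A) = hv y (r \<otimes>\<^bsub>VG y\<^esub> zz e' [^]\<^bsub>VG y\<^esub> (- B) \<otimes>\<^bsub>VG y\<^esub> inv\<^bsub>VG y\<^esub> r)"
    using hv_pow[OF y ze(1)] by (simp add: c_def e_def[symmetric] y_def[symmetric])
  then have veq: "zz e [^]\<^bsub>VG y\<^esub> A = r \<otimes>\<^bsub>VG y\<^esub> zz e' [^]\<^bsub>VG y\<^esub> (- B) \<otimes>\<^bsub>VG y\<^esub> inv\<^bsub>VG y\<^esub> r"
    by (rule hv_inject[OF y, rotated -1]) (use r ze in simp_all)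
  show False
  proof (cases "e = e'")
    case False
    have "inv\<^bsub>VG y\<^esub> r \<otimes>\<^bsub>VG y\<^esub> zz e [^]\<^bsub>VG y\<^esub> A \<otimes>\<^bsub>VG y\<^esub> inv\<^bsub>VG y\<^esub> (inv\<^bsub>VG y\<^esub> r) = zz e' [^]\<^bsub>VG y\<^esub> (- B)"
      unfolding veq using r ze by (simp add: G.m_assoc)
    then show False
      using not_bonded_pow[OF e(1,2) False _ _ A B0, of "inv\<^bsub>VG y\<^esub> r"] e r by (simp add: y_def)
  next
    case True
    then have "R j \<cdot> c j \<up> (- B) \<cdot> iv (R j) = c j \<up> A"
      using eq1 by (simp add: c_def e_def[symmetric] y_def)
    then have "\<bar>- B\<bar> = \<bar>A\<bar>" by (rule fl_conj_abs[OF RC cC c_ne])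
    then have AB: "- B = A" using A B0 by simp
    have "zz e [^]\<^bsub>VG y\<^esub> A = r \<otimes>\<^bsub>VG y\<^esub> zz e [^]\<^bsub>VG y\<^esub> A \<otimes>\<^bsub>VG y\<^esub> inv\<^bsub>VG y\<^esub> r" using veq AB True by simp
    then have "zz e [^]\<^bsub>VG y\<^esub> A \<otimes>\<^bsub>VG y\<^esub> r = r \<otimes>\<^bsub>VG y\<^esub> zz e [^]\<^bsub>VG y\<^esub> A \<otimes>\<^bsub>VG y\<^esub> inv\<^bsub>VG y\<^esub> r \<otimes>\<^bsub>VG y\<^esub> r" by simp
    then have comm: "r \<otimes>\<^bsub>VG y\<^esub> zz e [^]\<^bsub>VG y\<^esub> A = zz e [^]\<^bsub>VG y\<^esub> A \<otimes>\<^bsub>VG y\<^esub> r"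
      using r ze by (simp add: G.m_assoc)
    have "zz e [^]\<^bsub>VG y\<^esub> A \<noteq> \<one>\<^bsub>VG y\<^esub>"
    proof
      assume "zz e [^]\<^bsub>VG y\<^esub> A = \<one>\<^bsub>VG y\<^esub>"
      then have "zz e [^]\<^bsub>VG y\<^esub> A = zz e [^]\<^bsub>VG y\<^esub> (0::int)" by simp
      moreover have "zz e \<noteq> \<one>\<^bsub>VG y\<^esub>" using zz_neq[OF e(1)] by (simp add: y_def)
      ultimately have "A = 0" by (intro vg_pow_inj[OF y ze(1)])
      then show False using A by simp
    qed
    then obtain p k :: int where pk: "p > 0" "r [^]\<^bsub>VG y\<^esub> p = (zz e [^]\<^bsub>VG y\<^esub> A) [^]\<^bsub>VG y\<^esub> k"
      using vg_commens[OF y r _ _ comm] ze by auto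
    have "r [^]\<^bsub>VG y\<^esub> p \<in> f e ` carrier (EG e)"
    proof -
      have "r [^]\<^bsub>VG y\<^esub> p = zz e [^]\<^bsub>VG y\<^esub> (A * k)" using pk(2) ze by (simp add: G.int_pow_pow)
      then show ?thesis using zz_pow_img[OF e(1), of "A * k", folded y_def] by (simp only:)
    qed
    then have "r \<in> f e ` carrier (EG e)" using root_closed[OF e(1), of r p] r pk(1) by (simp add: y_def)
    moreover have "e2 = bar e" using True by (simp add: e'_def)
    ultimately show False using no_pinch[of j] by (simp add: e_def e2_def r_def)
  qed
qed

lemma val_map_Suc:
  assumes "\<And>j. s j \<in> carrier (VG (\<tau> (ee j)))"
  shows "val (map (\<lambda>j. (ee j, s j)) [0..<Suc m]) = val (map (\<lambda>j. (ee j, s j)) [0..<m]) \<cdot> (St (ee m) \<cdot> El (\<tau> (ee m)) (s m))"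
proof -
  have "ep (\<tau> (bar (ee m))) [(ee m, s m)] (\<tau> (ee m))" using assms by simp
  from val_append[OF ep_map[OF assms] this] val_Cons[OF this] show ?thesis
    using assms by (simp add: val_Nil)
qed

text \<open>The edges are periodic, so the part after \<open>n\<close> periods can be numbered from
  zero again; only its vertex elements have to be renamed.\<close>

lemma val_map_add:
  assumes s: "\<And>j. s j \<in> carrier (VG (\<tau> (ee j)))" and s': "\<And>j. s' j \<in> carrier (VG (\<tau> (ee j)))"
    and eq: "\<And>j. s (n * q + j) = s' j"
  shows "val (map (\<lambda>j. (ee j, s j)) [0..<n * q + m]) =
    val (map (\<lambda>j. (ee j, s j)) [0..<n * q]) \<cdot> val (map (\<lambda>j. (ee j, s' j)) [0..<m])"
proof -
  have md: "(i - n * q) mod q = i mod q" if "\<not> i < n * q" for i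
    using that by (metis le_add_diff_inverse mod_mult_self3 not_less)
  have "map (\<lambda>j. (ee j, s j)) [0..<n * q + m] =
      map (\<lambda>j. (ee j, s j)) [0..<n * q] @ map (\<lambda>j. (ee j, s' j)) [0..<m]"
    by (rule nth_equalityI) (auto simp: nth_append eq[symmetric] ee_def md)
  moreover have "ep x (map (\<lambda>j. (ee j, s j)) [0..<n * q]) x" using ep_map[OF s, of "n * q"] x_ee0 by simp
  ultimately show ?thesis using val_append[OF _ ep_map[OF s']] by simp
qed

lemma val_xs_pow: "val (map (\<lambda>j. (ee j, rr j)) [0..<m * q]) = val xs [^]\<^bsub>PG\<^esub> m"
proof (induction m)
  case (Suc m)
  have "val (map (\<lambda>j. (ee j, rr j)) [0..<m * q + q]) =
    val (map (\<lambda>j. (ee j, rr j)) [0..<m * q]) \<cdot> val (map (\<lambda>j. (ee j, rr j)) [0..<q])"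
    by (rule val_map_add[OF rr rr]) (simp add: rr_def)
  then show ?case using Suc xs_map by (simp add: add.commute)
qed (simp add: val_Nil)

text \<open>The loop is hyperbolic, so its edges cannot all have commensurable stabilisers.\<close>

lemma ex_incommensurable: "\<exists>i<q. \<forall>A B. A \<noteq> 0 \<longrightarrow> B \<noteq> 0 \<longrightarrow> c i \<up> A \<noteq> d i \<up> B"
proof (rule ccontr)
  assume "\<not> ?thesis"
  then have all: "\<exists>A B. A \<noteq> 0 \<and> B \<noteq> 0 \<and> c i \<up> A = d i \<up> B" if "i < q" for i using that by blast
  have pos: "\<exists>A B. A > 0 \<and> B > 0 \<and> c j \<up> A = d j \<up> B" for j
  proof -
    obtain A B where AB: "A \<noteq> 0" "B \<noteq> 0" "c j \<up> A = d j \<up> B"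
      using all[of "j mod q"] q_pos per_cd by auto
    have P: "c j \<in> carrier PG" "d j \<in> carrier PG" using cC dC C_PG by blast+
    have "c j \<up> (- A) = d j \<up> (- B)" using AB(3) P by (simp add: PG.int_pow_neg)
    then show ?thesis using same_sign[of j A B] same_sign[of j "- A" "- B"] AB by (cases "A > 0") (auto, force)
  qed
  define W where "W j = val (map (\<lambda>j. (ee j, rr j)) [0..<j])" for j
  have Wp: "W j \<in> paths x (\<tau> (bar (ee j)))" for j unfolding W_def by (rule val_paths[OF ep_map]) simp
  have WP: "W j \<in> carrier PG" for j using Wp paths_closed by blast
  have Stp: "St (ee j) \<in> paths (\<tau> (bar (ee j))) (\<tau> (ee j))" for j by (rule St_paths) simp
  have Sti: "iv (St (ee 0)) \<in> paths (\<tau> (ee 0)) x" using paths_inv[OF Stp[of 0]] x_ee0 by simp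
  \<comment> \<open>The path from the end of edge \<open>0\<close> to the end of edge
    \<open>j\<close>, closed up at \<open>u\<close>.\<close>
  define U where "U j = hat (\<tau> (ee 0)) (\<tau> (ee j)) (iv (St (ee 0)) \<cdot> W j \<cdot> St (ee j))" for j
  have Up: "iv (St (ee 0)) \<cdot> W j \<cdot> St (ee j) \<in> paths (\<tau> (ee 0)) (\<tau> (ee j))" for j
    using paths_mult[OF paths_mult[OF Sti Wp] Stp] .
  have UC: "U j \<in> C" for j unfolding U_def by (rule hat_C[OF _ _ Up]) simp_all
  have UP: "U j \<in> carrier PG" for j using UC C_PG by blast
  have USuc: "U (Suc j) = U j \<cdot> R j \<cdot> t (Suc j)" for j
  proof -
    have "iv (St (ee 0)) \<cdot> W (Suc j) \<cdot> St (ee (Suc j)) =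
        (iv (St (ee 0)) \<cdot> W j \<cdot> St (ee j)) \<cdot> El (\<tau> (ee j)) (rr j) \<cdot> St (ee (Suc j))"
      unfolding W_def val_map_Suc[OF rr] using WP[of j] by (simp add: PG.m_assoc W_def)
    moreover have "hat (\<tau> (ee 0)) (\<tau> (ee (Suc j)))
        ((iv (St (ee 0)) \<cdot> W j \<cdot> St (ee j)) \<cdot> El (\<tau> (ee j)) (rr j) \<cdot> St (ee (Suc j))) =
      hat (\<tau> (ee 0)) (\<tau> (ee j)) ((iv (St (ee 0)) \<cdot> W j \<cdot> St (ee j)) \<cdot> El (\<tau> (ee j)) (rr j)) \<cdot> t (Suc j)"
      unfolding t_def ee_Suc
      using Stp[of "Suc j"] by (intro hat_mult paths_mult[OF Up El_paths]) simp_all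
    moreover have "hat (\<tau> (ee 0)) (\<tau> (ee j)) ((iv (St (ee 0)) \<cdot> W j \<cdot> St (ee j)) \<cdot> El (\<tau> (ee j)) (rr j)) = U j \<cdot> R j"
      unfolding U_def R_def hv_def by (intro hat_mult Up El_paths) simp_all
    ultimately show ?thesis by (simp add: U_def)
  qed
  \<comment> \<open>Commensurability is transported along the line, so the first twistor is
    commensurable with each later one after conjugation by \<open>U j\<close>.\<close>
  have U: "\<exists>A B. A > 0 \<and> B > 0 \<and> c 0 \<up> A = U j \<cdot> c j \<up> B \<cdot> iv (U j)" for j
  proof (induction j)
    case 0
    have "U 0 = \<one>\<^bsub>PG\<^esub>" by (simp add: U_def W_def val_Nil hat_one)
    then show ?case using cP by (intro exI[of _ 1]) simp
  next
    case (Suc j)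
    then obtain A B where AB: "A > 0" "B > 0" "c 0 \<up> A = U j \<cdot> c j \<up> B \<cdot> iv (U j)" by blast
    obtain A' B' where AB': "A' > 0" "B' > 0" "c j \<up> A' = d j \<up> B'" using pos by blast
    have "c 0 \<up> (A * A') = U j \<cdot> c j \<up> (B * A') \<cdot> iv (U j)"
      using AB(3) UP cP by (simp add: PG.int_pow_pow[symmetric] PG.conj_int_pow)
    also have "c j \<up> (B * A') = (d j \<up> B') \<up> B"
      unfolding AB'(3)[symmetric] using cP by (simp add: PG.int_pow_pow mult.commute)
    also have "\<dots> = d j \<up> (B' * B)" using dC C_PG by (simp add: PG.int_pow_pow)
    also have "U j \<cdot> d j \<up> (B' * B) \<cdot> iv (U j) = U (Suc j) \<cdot> c (Suc j) \<up> (B' * B) \<cdot> iv (U (Suc j))"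
      unfolding d_pow USuc using cP UP RP tP by (simp add: PG.m_assoc PG.inv_mult_group)
    finally show ?case using AB AB' by (intro exI[of _ "A * A'"] exI[of _ "B' * B"]) simp
  qed
  \<comment> \<open>After a full period the exponents must coincide, so \<open>U q\<close> commutes
    with a power of the first twistor and has itself a power among the powers of that twistor. A
    positive power of the loop \<open>val xs\<close> would then be an edge group element, although
    its reduced expression contains edges.\<close>
  obtain A B where AB: "A > 0" "B > 0" "c 0 \<up> A = U q \<cdot> c q \<up> B \<cdot> iv (U q)" using U by blast
  have cq: "c q = c 0" by (simp add: c_def)
  have "\<bar>B\<bar> = \<bar>A\<bar>" by (rule fl_conj_abs[of "U q" "c 0" B A, OF UC cC c_ne]) (use AB cq in simp)
  then have "U q \<cdot> c 0 \<up> A \<cdot> iv (U q) = c 0 \<up> A" using AB cq by simp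
  then have "U q \<cdot> c 0 \<up> A \<cdot> iv (U q) \<cdot> U q = c 0 \<up> A \<cdot> U q" by simp
  then have comm: "U q \<cdot> c 0 \<up> A = c 0 \<up> A \<cdot> U q" using UP cP by (simp add: PG.m_assoc)
  have cA1: "c 0 \<up> A \<in> C" by (rule C_pow[OF cC])
  have cA2: "c 0 \<up> A \<noteq> \<one>\<^bsub>PG\<^esub>"
  proof
    assume "c 0 \<up> A = \<one>\<^bsub>PG\<^esub>"
    then have "c 0 \<up> A = c 0 \<up> 0" by simp
    then show False using fl_pow_inj[OF cC c_ne] AB(1) by blast
  qed
  obtain p k where pk: "p > 0" "U q \<up> p = (c 0 \<up> A) \<up> k" using fl_commens[OF UC cA1 cA2 comm] by blast
  have hx: "hat x x (val xs) = t 0 \<cdot> U q \<cdot> iv (t 0)"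
  proof -
    have Pq: "iv (St (ee 0)) \<cdot> W q \<cdot> St (ee q) \<in> paths (\<tau> (ee 0)) (\<tau> (ee 0))" using Up[of q] by simp
    have S0: "St (ee 0) \<in> paths x (\<tau> (ee 0))" using Stp[of 0] x_ee0 by simp
    have t0: "t 0 = hat x (\<tau> (ee 0)) (St (ee 0))" by (simp add: t_def x_ee0)
    have Uq: "U q = hat (\<tau> (ee 0)) (\<tau> (ee 0)) (iv (St (ee 0)) \<cdot> W q \<cdot> St (ee q))"
      unfolding U_def by simp
    have "val xs = W q" by (subst xs_map) (simp add: W_def)
    then have v: "val xs = St (ee 0) \<cdot> (iv (St (ee 0)) \<cdot> W q \<cdot> St (ee q)) \<cdot> iv (St (ee 0))"
      using WP[of q] by (simp add: PG.m_assoc)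
    have "hat x x (St (ee 0) \<cdot> (iv (St (ee 0)) \<cdot> W q \<cdot> St (ee q)) \<cdot> iv (St (ee 0))) =
        hat x (\<tau> (ee 0)) (St (ee 0) \<cdot> (iv (St (ee 0)) \<cdot> W q \<cdot> St (ee q))) \<cdot> hat (\<tau> (ee 0)) x (iv (St (ee 0)))"
      by (rule hat_mult[OF xV _ xV paths_mult[OF S0 Pq] Sti]) simp
    moreover have "hat x (\<tau> (ee 0)) (St (ee 0) \<cdot> (iv (St (ee 0)) \<cdot> W q \<cdot> St (ee q))) = t 0 \<cdot> U q"
      unfolding t0 Uq by (rule hat_mult[OF xV _ _ S0 Pq]) simp_all
    moreover have "hat (\<tau> (ee 0)) x (iv (St (ee 0))) = iv (t 0)"
      unfolding t0 by (rule hat_inv[OF xV _ S0]) simp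
    ultimately show ?thesis unfolding v by (simp only:)
  qed
  have vP: "val xs \<in> paths x x" using epx by (rule val_paths)
  define e where "e = ee 0"
  have e: "e \<in> E" "\<tau> (bar e) = x" using x_ee0 by (simp_all add: e_def)
  define g where "g = z e [^]\<^bsub>EG e\<^esub> (A * k)"
  have g: "g \<in> carrier (EG e)" using e by (simp add: g_def group.int_pow_closed)
  have fg: "f (bar e) g \<in> carrier (VG x)" using f_closed[of "bar e" g] e g by simp
  have "hat x x (val xs \<up> p) = t 0 \<cdot> (c 0 \<up> A) \<up> k \<cdot> iv (t 0)"
    unfolding hat_pow[OF xV vP] hx using UP tP by (simp add: PG.conj_int_pow pk(2))
  also have "(c 0 \<up> A) \<up> k = hv (\<tau> e) (f e g)"
    unfolding PG.int_pow_pow[OF cP]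
    using hv_pow[OF \<tau>_closed[OF e(1)] zz_closed[OF e(1)], of "A * k"] zz_pow[OF e(1), of "A * k"]
    by (simp add: c_def e_def[symmetric] g_def)
  also have "t 0 \<cdot> hv (\<tau> e) (f e g) \<cdot> iv (t 0) = hat x x (El x (f (bar e) g))"
    using hv_bar[OF e(1) g] e(2) by (simp add: t_def e_def[symmetric] hv_def)
  finally have "hat x x (val xs \<up> p) = hat x x (El x (f (bar e) g))" .
  moreover have "val xs \<up> p = val (map (\<lambda>j. (ee j, rr j)) [0..<nat p * q])"
    unfolding val_xs_pow using pk(1) by simp
  moreover have ep: "ep x (map (\<lambda>j. (ee j, rr j)) [0..<nat p * q]) (\<tau> (bar (ee (nat p * q))))" by (rule ep_map) simp
  moreover have "\<tau> (bar (ee (nat p * q))) = x" using x_ee0 by simp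
  ultimately have "val (map (\<lambda>j. (ee j, rr j)) [0..<nat p * q]) = El x (f (bar e) g)"
    using hat_inject[OF xV xV] val_paths[OF ep] El_paths[OF xV fg] by simp
  then have "El x (f (bar e) g) \<cdot> val [] = El x \<one>\<^bsub>VG x\<^esub> \<cdot> val (map (\<lambda>j. (ee j, rr j)) [0..<nat p * q])"
    using xV fg by (simp add: val_Nil El_one)
  moreover have "ep x [] x" "red []" by (simp_all add: red_def)
  ultimately have "map fst (map (\<lambda>j. (ee j, rr j)) [0..<nat p * q]) = map fst ([] :: ('b \<times> 'c) list)"
    using expr_unique[of x "[]" x "map (\<lambda>j. (ee j, rr j)) [0..<nat p * q]" _ "f (bar e) g" "\<one>\<^bsub>VG x\<^esub>"]
      ep red_map[of rr "nat p * q"] xV fg by (simp add: monoid.one_closed)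
  then show False using pk(1) q_pos by simp
qed

end

section \<open>Growth of twisted powers along the line\<close>

context cyc_dehn
begin

text \<open>The vertex elements of the twisted power of the loop: applying the twist multiplies each
  of them from the left by the twistor of the preceding edge, and period number \<open>i\<close>,
  counted from zero, has been twisted \<open>i\<close> times.\<close>

definition "tws j = zz (ee j) [^]\<^bsub>VG (\<tau> (ee j))\<^esub> int (j div q) \<otimes>\<^bsub>VG (\<tau> (ee j))\<^esub> rr j"

lemma tws_closed [simp]: "tws j \<in> carrier (VG (\<tau> (ee j)))"
  by (simp add: tws_def monoid.m_closed)

text \<open>In the commensurable case both exponents can be taken positive, because signs agree. In
  the incommensurable case the length bounds both exponents, and the factor \<open>1\<close>
  suffices.\<close>

lemma step_bound: "\<exists>\<Lambda>\<ge>1. \<exists>K\<ge>0. \<forall>a b. max 0 b \<le> \<Lambda> * max 0 (- a) + fl (c j \<up> a \<cdot> d j \<up> b) + K"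
proof (cases "\<exists>A B. A \<noteq> 0 \<and> B \<noteq> 0 \<and> c j \<up> A = d j \<up> B")
  case True
  then obtain A B where AB: "A \<noteq> 0" "B \<noteq> 0" "c j \<up> A = d j \<up> B" by blast
  have P: "c j \<in> carrier PG" "d j \<in> carrier PG" using cC dC C_PG by blast+
  have "c j \<up> (- A) = d j \<up> (- B)" using AB(3) P by (simp add: PG.int_pow_neg)
  then obtain A' B' where AB': "A' > 0" "B' > 0" "c j \<up> A' = d j \<up> B'"
    using same_sign[of j A B] same_sign[of j "- A" "- B"] AB by (cases "A > 0") (auto, force)
  obtain K where "K \<ge> 0" "\<forall>a b. max 0 b \<le> B' * max 0 (- a) + fl (c j \<up> a \<cdot> d j \<up> b) + K"
    using commens_step[OF cC c_ne dC d_ne AB'(3,1,2)] by blast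
  moreover have "B' \<ge> 1" using AB' by simp
  ultimately show ?thesis by blast
next
  case False
  then obtain K where K: "\<And>a b. \<bar>a\<bar> + \<bar>b\<bar> - K \<le> fl (c j \<up> a \<cdot> d j \<up> b)"
    using fl_incomm[OF cC c_ne dC d_ne] by blast
  have "max 0 b \<le> 1 * max 0 (- a) + fl (c j \<up> a \<cdot> d j \<up> b) + \<bar>K\<bar>" for a b
  proof -
    have "0 \<le> fl (c j \<up> a \<cdot> d j \<up> b)" by (intro fl_nonneg C_mult C_pow cC dC)
    then show ?thesis using K[of a b] by simp
  qed
  then have "\<exists>K\<ge>0. \<forall>a b. max 0 b \<le> 1 * max 0 (- a) + fl (c j \<up> a \<cdot> d j \<up> b) + K"
    by (metis abs_ge_zero)
  moreover have "(1::int) \<le> 1" by simp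
  ultimately show ?thesis by blast
qed

text \<open>An edge group element \<open>h\<close> is, up to bounded error, a power of the twistor, so the ambiguity of a
  reduced expression is recorded by integers \<open>m\<close>.\<close>

lemma syllable_bound:
  assumes h: "h \<in> carrier (EG (ee j))" and h': "h' \<in> carrier (EG (ee (Suc j)))"
    and m: "fl (c j \<up> (- m) \<cdot> hv (\<tau> (ee j)) (f (ee j) h)) \<le> fl (c j)"
    and m': "fl (c (Suc j) \<up> (- m') \<cdot> hv (\<tau> (ee (Suc j))) (f (ee (Suc j)) h')) \<le> fl (c (Suc j))"
  shows "fl (c j \<up> (int (j div q) - m) \<cdot> d j \<up> m') \<le>
    Lv (\<tau> (ee j)) (inv\<^bsub>VG (\<tau> (ee j))\<^esub> f (ee j) h \<otimes>\<^bsub>VG (\<tau> (ee j))\<^esub> tws j \<otimes>\<^bsub>VG (\<tau> (ee j))\<^esub> f (bar (ee (Suc j))) h')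
     + (fl (c j) + fl (R j) + 2 * fl (t (Suc j)) + fl (c (Suc j)))"
proof -
  define k where "k = int (j div q)"
  define Y where "Y = hv (\<tau> (ee j)) (f (ee j) h)"
  define Y' where "Y' = hv (\<tau> (ee (Suc j))) (f (ee (Suc j)) h')"
  let ?V = "VG (\<tau> (ee j))"
  define s where "s = inv\<^bsub>?V\<^esub> f (ee j) h \<otimes>\<^bsub>?V\<^esub> tws j \<otimes>\<^bsub>?V\<^esub> f (bar (ee (Suc j))) h'"
  have YC: "Y \<in> C" "Y' \<in> C" unfolding Y_def Y'_def using h h' by (intro hv_C; simp)+
  interpret G: group ?V by simp
  have fh: "f (ee j) h \<in> carrier ?V" "f (bar (ee (Suc j))) h' \<in> carrier ?V"
    using h h' f_closed[of "bar (ee (Suc j))" h'] by auto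
  have hs: "hv (\<tau> (ee j)) s = iv Y \<cdot> (c j \<up> k \<cdot> R j) \<cdot> (t (Suc j) \<cdot> Y' \<cdot> iv (t (Suc j)))"
    using fh hv_bar[OF ee h'] by (simp add: s_def tws_def hv_mult hv_inv hv_pow Y_def Y'_def c_def R_def t_def k_def)
  have sC: "hv (\<tau> (ee j)) s \<in> C" unfolding s_def using fh by (intro hv_C) simp_all
  \<comment> \<open>\<open>P\<close> and \<open>P'\<close> are the bounded remainders after
    \<open>h\<close> and \<open>h'\<close> have been replaced by twistor powers with exponents
    \<open>m\<close> and \<open>m'\<close>.\<close>
  define P where "P = c j \<up> (- m) \<cdot> Y"
  define P' where "P' = c (Suc j) \<up> (- m') \<cdot> Y'"
  have PC: "P \<in> C" "P' \<in> C" unfolding P_def P'_def by (intro C_mult C_pow cC YC)+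
  have PGs: "Y \<in> carrier PG" "Y' \<in> carrier PG" "c j \<in> carrier PG" "c (Suc j) \<in> carrier PG" "R j \<in> carrier PG"
    "t (Suc j) \<in> carrier PG" using YC cP RP tP C_PG by auto
  have "c j \<up> (k - m) \<cdot> d j \<up> m' = c j \<up> (- m) \<cdot> (c j \<up> k \<cdot> d j \<up> m')"
  proof -
    have "c j \<up> (k - m) = c j \<up> (- m) \<cdot> c j \<up> k" using PGs by (simp add: PG.int_pow_mult[symmetric])
    then show ?thesis using PGs dC[of j] C_PG by (simp add: PG.m_assoc)
  qed
  also have "\<dots> = P \<cdot> hv (\<tau> (ee j)) s \<cdot> (t (Suc j) \<cdot> iv P' \<cdot> iv (t (Suc j)) \<cdot> iv (R j))"
    unfolding hs P_def P'_def d_pow using PGs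
    by (simp add: PG.m_assoc PG.inv_mult_group PG.int_pow_neg)
  finally have eq: "c j \<up> (k - m) \<cdot> d j \<up> m' = P \<cdot> hv (\<tau> (ee j)) s \<cdot> (t (Suc j) \<cdot> iv P' \<cdot> iv (t (Suc j)) \<cdot> iv (R j))" .
  have "fl (P \<cdot> hv (\<tau> (ee j)) s \<cdot> (t (Suc j) \<cdot> iv P' \<cdot> iv (t (Suc j)) \<cdot> iv (R j))) \<le>
      fl (P \<cdot> hv (\<tau> (ee j)) s) + fl (t (Suc j) \<cdot> iv P' \<cdot> iv (t (Suc j)) \<cdot> iv (R j))"
    by (intro fl_mult C_mult C_inv PC sC tC RC)
  also have "fl (P \<cdot> hv (\<tau> (ee j)) s) \<le> fl P + fl (hv (\<tau> (ee j)) s)" by (intro fl_mult PC sC)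
  also have "fl (t (Suc j) \<cdot> iv P' \<cdot> iv (t (Suc j)) \<cdot> iv (R j)) \<le> fl (t (Suc j) \<cdot> iv P' \<cdot> iv (t (Suc j))) + fl (iv (R j))"
    by (intro fl_mult C_mult C_inv PC tC RC)
  also have "fl (t (Suc j) \<cdot> iv P' \<cdot> iv (t (Suc j))) \<le> fl (t (Suc j) \<cdot> iv P') + fl (iv (t (Suc j)))"
    by (intro fl_mult C_mult C_inv PC tC)
  also have "fl (t (Suc j) \<cdot> iv P') \<le> fl (t (Suc j)) + fl (iv P')" by (intro fl_mult C_inv PC tC)
  finally have "fl (c j \<up> (k - m) \<cdot> d j \<up> m') \<le>
      fl P + fl (hv (\<tau> (ee j)) s) + (fl (t (Suc j)) + fl P' + fl (t (Suc j)) + fl (R j))"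
    unfolding eq using fl_inv PC tC RC by simp
  moreover have "fl P \<le> fl (c j)" "fl P' \<le> fl (c (Suc j))" using m m' by (simp_all add: P_def P'_def Y_def Y'_def)
  ultimately show ?thesis unfolding s_def[symmetric] k_def[symmetric] Lv_def by linarith
qed

lemma uniform_bound:
  fixes F :: "nat \<Rightarrow> int"
  assumes "\<And>i. 0 \<le> F i"
  shows "F (j mod q) \<le> (\<Sum>i<q. F i)"
  using assms q_pos by (intro member_le_sum) auto

text \<open>In the application the path turns back after \<open>n\<close> periods. Hence
  \<open>zs\<close> may continue beyond them, and the vertex element at the turning point is left
  arbitrary.\<close>

lemma growth:
  "\<exists>A B. A > 0 \<and> B \<ge> 0 \<and> (\<forall>n zs ys s0 y. ep x zs y \<longrightarrow> red zs \<longrightarrow> n * q \<le> length zs \<longrightarrow>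
     (\<forall>j<n * q. fst (zs ! j) = ee j) \<longrightarrow> (\<forall>j. Suc j < n * q \<longrightarrow> snd (zs ! j) = tws j) \<longrightarrow>
     ep x ys y \<longrightarrow> red ys \<longrightarrow> s0 \<in> carrier (VG x) \<longrightarrow> val zs = El x s0 \<cdot> val ys \<longrightarrow>
     int n * int n \<le> A * (\<Sum>(e, r)\<leftarrow>ys. Lv (\<tau> e) r) + B * int n + B)"
proof -
  obtain i0 where i0: "i0 < q" "\<And>A B. A \<noteq> 0 \<Longrightarrow> B \<noteq> 0 \<Longrightarrow> c i0 \<up> A \<noteq> d i0 \<up> B"
    using ex_incommensurable by blast
  obtain K0 where K0: "\<And>a b. \<bar>a\<bar> + \<bar>b\<bar> - K0 \<le> fl (c i0 \<up> a \<cdot> d i0 \<up> b)"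
    using fl_incomm[OF cC c_ne dC d_ne i0(2)] by blast
  obtain \<Lambda>f Kf where Lf: "\<And>j. \<Lambda>f j \<ge> (1::int)" and Kf: "\<And>j. Kf j \<ge> (0::int)"
    and stepf: "\<And>j a b. max 0 b \<le> \<Lambda>f j * max 0 (- a) + fl (c j \<up> a \<cdot> d j \<up> b) + Kf j"
    using step_bound by metis
  define \<Lambda> where "\<Lambda> = 1 + (\<Sum>i<q. \<Lambda>f i)"
  have L0: "0 \<le> \<Lambda>f i" for i using Lf[of i] by simp
  have L1: "1 \<le> \<Lambda>" unfolding \<Lambda>_def using sum_nonneg[of "{..<q}" \<Lambda>f] L0 by simp
  define Ef where "Ef j = fl (c j) + fl (R j) + 2 * fl (t (Suc j)) + fl (c (Suc j))" for j
  have E0: "0 \<le> Ef j" for j unfolding Ef_def using fl_nonneg cC RC tC by (simp add: add_nonneg_nonneg)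
  \<comment> \<open>Collects all additive errors: of a step, of the cut at \<open>i0\<close>, and of
    replacing edge group elements by twistor powers.\<close>
  define T where "T = (\<Sum>i<q. Kf i) + \<bar>K0\<bar> + (\<Sum>i<q. Ef i)"
  have T0: "0 \<le> T" unfolding T_def using Kf E0 by (simp add: sum_nonneg add_nonneg_nonneg)
  have ET: "Ef j \<le> (\<Sum>i<q. Ef i)" for j
    using uniform_bound[of Ef j] E0 per_cd[of j] by (simp add: Ef_def)
  have step: "max 0 b \<le> \<Lambda> * max 0 (- a) + fl (c j \<up> a \<cdot> d j \<up> b) + (\<Sum>i<q. Kf i)" for j a b
  proof -
    have "\<Lambda>f (j mod q) * max 0 (- a) \<le> \<Lambda> * max 0 (- a)"
      using uniform_bound[of \<Lambda>f j] L0 by (intro mult_right_mono) (simp_all add: \<Lambda>_def)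
    then show ?thesis using stepf[of b "j mod q" a] uniform_bound[of Kf j] Kf per_cd[of j] by simp
  qed
  \<comment> \<open>One factor 2 comes from \<open>block_growth\<close>, the other from doubling the
    sum of the first \<open>M\<close> integers. In \<open>B\<close> the first summand pays for the
    error \<open>T\<close> at each of the \<open>n * q\<close> edges, and the 3 for the passage from
    \<open>M\<close> to \<open>n = M + 2\<close>.\<close>
  define A where "A = 4 * \<Lambda> ^ q"
  define B where "B = 4 * \<Lambda> ^ q * int q * T + 3"
  have LP: "1 \<le> \<Lambda> ^ q" using L1 by (rule one_le_power)
  have A: "A > 0" using LP by (simp add: A_def)
  have B: "B \<ge> 3" using LP T0 by (simp add: B_def)
  have "int n * int n \<le> A * (\<Sum>(e, r)\<leftarrow>ys. Lv (\<tau> e) r) + B * int n + B"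
    if zs: "ep x zs y" "red zs" "n * q \<le> length zs" "\<And>j. j < n * q \<Longrightarrow> fst (zs ! j) = ee j"
      "\<And>j. Suc j < n * q \<Longrightarrow> snd (zs ! j) = tws j"
    and ys: "ep x ys y" "red ys" "s0 \<in> carrier (VG x)" "val zs = El x s0 \<cdot> val ys" for n zs ys s0 y
  proof -
    define S where "S = (\<Sum>(e, r)\<leftarrow>ys. Lv (\<tau> e) r)"
    have Sn: "S = (\<Sum>j<length ys. Lv (\<tau> (fst (ys ! j))) (snd (ys ! j)))"
      by (simp add: S_def sum_list_sum_nth case_prod_beta atLeast0LessThan)
    have Lnn: "0 \<le> Lv (\<tau> (fst (ys ! j))) (snd (ys ! j))" if "j < length ys" for j
      using ep_nth[OF ys(1) that] by (intro Lv_nonneg) auto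
    have S0: "0 \<le> S" unfolding Sn using Lnn by (intro sum_nonneg) auto
    show ?thesis
    proof (cases "n < 2")
      case True
      then have "int n * int n \<le> int n" by (cases n) (auto simp: less_Suc_eq)
      moreover have "1 * int n \<le> B * int n" using B by (intro mult_right_mono) auto
      moreover have "0 \<le> A * S" using A S0 by simp
      ultimately show ?thesis using B unfolding S_def by linarith
    next
      case False
      \<comment> \<open>The syllables inside the first \<open>n\<close> periods whose vertex element
        is prescribed: the last one of these periods is excluded.\<close>
      define N where "N = n * q - 1"
      have NS: "j < N \<longleftrightarrow> Suc j < n * q" for j by (auto simp: N_def)
      have "El x \<one>\<^bsub>VG x\<^esub> \<cdot> val zs = El x s0 \<cdot> val ys"
        using ys(4) xV val_closed[OF zs(1)] by (simp add: El_one)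
      from expr_unique[OF zs(1,2) ys(1,2) xV monoid.one_closed[OF VG_monoid[OF xV]] ys(3) this]
      obtain h where mf: "map fst ys = map fst zs" and h: "\<And>j. j < length zs \<Longrightarrow> h j \<in> carrier (EG (fst (zs ! j)))"
        and hs: "\<And>j. Suc j < length zs \<Longrightarrow> snd (ys ! j) =
         inv\<^bsub>VG (\<tau> (fst (zs ! j)))\<^esub> f (fst (zs ! j)) (h j) \<otimes>\<^bsub>VG (\<tau> (fst (zs ! j)))\<^esub> snd (zs ! j)
           \<otimes>\<^bsub>VG (\<tau> (fst (zs ! j)))\<^esub> f (bar (fst (zs ! Suc j))) (h (Suc j))" by blast
      have len: "length ys = length zs" using mf by (metis length_map)
      have fy: "fst (ys ! j) = ee j" if "j < n * q" for j
        using mf len zs(3,4) that by (metis nth_map less_le_trans)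
      have hE: "h j \<in> carrier (EG (ee j))" if "j < n * q" for j using h[of j] zs(3,4) that by simp
      \<comment> \<open>An edge group element commutes with the twistor of its edge and hence is
        within bounded error of a power of it. The exponent, called \<open>m j\<close> below, is the
        shift at the \<open>j\<close>-th edge.\<close>
      have "\<exists>i. j < n * q \<longrightarrow> fl (c j \<up> i \<cdot> hv (\<tau> (ee j)) (f (ee j) (h j))) \<le> fl (c j)" for j
      proof (cases "j < n * q")
        case True
        have X: "f (ee j) (h j) \<in> carrier (VG (\<tau> (ee j)))" using hE[OF True] by simp
        have "f (ee j) (h j) \<otimes>\<^bsub>VG (\<tau> (ee j))\<^esub> zz (ee j) = zz (ee j) \<otimes>\<^bsub>VG (\<tau> (ee j))\<^esub> f (ee j) (h j)"
          using zz_comm[of "ee j"] hE[OF True] by simp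
        then have "hv (\<tau> (ee j)) (f (ee j) (h j)) \<cdot> c j = c j \<cdot> hv (\<tau> (ee j)) (f (ee j) (h j))"
          unfolding c_def using X by (simp add: hv_mult[symmetric])
        then show ?thesis using fl_near[OF hv_C cC c_ne] X by simp
      qed simp
      then obtain i where i: "\<And>j. j < n * q \<Longrightarrow> fl (c j \<up> i j \<cdot> hv (\<tau> (ee j)) (f (ee j) (h j))) \<le> fl (c j)" by metis
      define m where "m j = - i j" for j
      have key: "fl (c j \<up> (int (j div q) - m j) \<cdot> d j \<up> m (Suc j)) \<le> Lv (\<tau> (ee j)) (snd (ys ! j)) + Ef j"
        if j: "j < N" for j
      proof -
        have j': "j < n * q" "Suc j < n * q" using j NS by auto
        have "snd (ys ! j) = inv\<^bsub>VG (\<tau> (ee j))\<^esub> f (ee j) (h j) \<otimes>\<^bsub>VG (\<tau> (ee j))\<^esub> tws j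
            \<otimes>\<^bsub>VG (\<tau> (ee j))\<^esub> f (bar (ee (Suc j))) (h (Suc j))"
          using hs[of j] zs(3,4,5) j' by simp
        then show ?thesis
          using syllable_bound[OF hE[OF j'(1)] hE[OF j'(2)], of "m j" "m (Suc j)"] i[OF j'(1)] i[OF j'(2)]
          by (simp add: m_def Ef_def)
      qed
      define X where "X j = Lv (\<tau> (ee j)) (snd (ys ! j)) + T" for j
      have X: "0 \<le> X j" if "j < N" for j
        using Lnn[of j] fy[of j] that NS len zs(3) T0 by (simp add: X_def)
      have bg: "M * q + i0 < N \<Longrightarrow> (\<Sum>k\<le>M. int k) \<le> \<Lambda> ^ q * (2 * (\<Sum>j<M * q + i0. X j) + X (M * q + i0))" for M
      proof (rule block_growth[where m = m and N = N, OF i0(1) L1])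
        fix j assume j: "j < N"
        show "0 \<le> X j" using X j .
        have "\<Lambda> * max 0 (- (int (j div q) - m j)) \<le> \<Lambda> * max 0 (m j)"
          using L1 by (intro mult_left_mono) auto
        then show "max 0 (m (Suc j)) \<le> \<Lambda> * max 0 (m j) + X j"
          using step[of "m (Suc j)" "int (j div q) - m j" j] key[OF j] ET[of j] unfolding X_def T_def by linarith
        assume "j mod q = i0"
        then have "c j = c i0" "d j = d i0" using per_cd(1,2)[of j] by simp_all
        then have "\<bar>int (j div q) - m j\<bar> + \<bar>m (Suc j)\<bar> - K0 \<le> Lv (\<tau> (ee j)) (snd (ys ! j)) + Ef j"
          using K0[of "int (j div q) - m j" "m (Suc j)"] key[OF j] by simp
        then have le: "\<bar>int (j div q) - m j\<bar> + \<bar>m (Suc j)\<bar> \<le> X j"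
          using ET[of j] sum_nonneg[of "{..<q}" Kf] Kf by (simp add: X_def T_def)
        then show "max 0 (m (Suc j)) \<le> X j \<and> int (j div q) - m j \<le> X j" using X[OF j] by linarith
      qed
      \<comment> \<open>One block less than might be expected, so that the cut index
        \<open>M * q + i0\<close> is smaller than \<open>N\<close> even for
        \<open>i0 = q - 1\<close>.\<close>
      define M where "M = n - 2"
      have n: "n = M + 2" using False by (simp add: M_def)
      have MN: "M * q + i0 < N" using i0(1) by (simp add: N_def n)
      have "(\<Sum>j<M * q + i0. X j) \<le> (\<Sum>j<N. X j) - X (M * q + i0)"
      proof -
        have "(\<Sum>j<Suc (M * q + i0). X j) \<le> (\<Sum>j<N. X j)" using MN X by (intro sum_mono2) auto
        then show ?thesis by simp
      qed
      moreover have "0 \<le> X (M * q + i0)" using X MN by blast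
      ultimately have "2 * (\<Sum>j<M * q + i0. X j) + X (M * q + i0) \<le> 2 * (\<Sum>j<N. X j)" by linarith
      then have "\<Lambda> ^ q * (2 * (\<Sum>j<M * q + i0. X j) + X (M * q + i0)) \<le> \<Lambda> ^ q * (2 * (\<Sum>j<N. X j))"
        using LP by (intro mult_left_mono) auto
      then have b1: "(\<Sum>k\<le>M. int k) \<le> \<Lambda> ^ q * (2 * (\<Sum>j<N. X j))" using bg[OF MN] by linarith
      have "(\<Sum>j<N. Lv (\<tau> (ee j)) (snd (ys ! j))) = (\<Sum>j<N. Lv (\<tau> (fst (ys ! j))) (snd (ys ! j)))"
        using fy NS by (intro sum.cong) auto
      also have "\<dots> \<le> S" unfolding Sn using Lnn len zs(3) by (intro sum_mono2) (auto simp: N_def)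
      finally have "(\<Sum>j<N. X j) \<le> S + int N * T" by (simp add: X_def sum.distrib)
      also have "int N * T \<le> int (n * q) * T"
      proof (rule mult_right_mono[OF _ T0])
        show "int N \<le> int (n * q)" unfolding N_def by (intro of_nat_mono) simp
      qed
      finally have "\<Lambda> ^ q * (2 * (\<Sum>j<N. X j)) \<le> \<Lambda> ^ q * (2 * (S + int (n * q) * T))"
        using LP by (intro mult_left_mono) auto
      then have b2: "2 * (\<Sum>k\<le>M. int k) \<le> A * S + 4 * \<Lambda> ^ q * int q * T * int n"
        using b1 by (simp add: A_def algebra_simps)
      have gauss: "2 * (\<Sum>k\<le>M. int k) = int M * int M + int M" by (induction M) (auto simp: algebra_simps)
      have "int n * int n = (int M * int M + int M) + 3 * int n - 2" by (simp add: n algebra_simps)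
      also have "\<dots> \<le> A * S + 4 * \<Lambda> ^ q * int q * T * int n + 3 * int n" using b2 gauss by linarith
      also have "\<dots> = A * S + B * int n" by (simp add: B_def algebra_simps)
      finally show ?thesis using B by (simp add: S_def)
    qed
  qed
  then show ?thesis using A B by (intro exI[of _ A] exI[of _ B] conjI allI impI) auto
qed

lemma ind_val_map:
  assumes s: "\<And>j. s j \<in> carrier (VG (\<tau> (ee j)))"
  shows "ind (val (map (\<lambda>j. (ee j, s j)) [0..<m])) = val (map (\<lambda>j. (ee j, zz (ee j) \<otimes>\<^bsub>VG (\<tau> (ee j))\<^esub> s j)) [0..<m])"
proof (induction m)
  case 0
  then show ?case by (simp add: val_Nil)
next
  case (Suc m)
  have s': "zz (ee j) \<otimes>\<^bsub>VG (\<tau> (ee j))\<^esub> s j \<in> carrier (VG (\<tau> (ee j)))" for j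
    using s by (simp add: monoid.m_closed)
  have "val (map (\<lambda>j. (ee j, s j)) [0..<m]) \<in> carrier PG" using val_closed[OF ep_map[OF s]] .
  then show ?case
    unfolding val_map_Suc[OF s] val_map_Suc[OF s'] using Suc s
    by (simp add: ind_mult ind_St_tw ind_El_id El_mult[symmetric] PG.m_assoc)
qed

text \<open>A shift by one period multiplies every vertex element by one more twistor, which is
  exactly the effect of the twist on the previous product.\<close>

lemma val_tws_Suc: "val (map (\<lambda>j. (ee j, tws j)) [0..<Suc n * q]) = val xs \<cdot> ind (val (map (\<lambda>j. (ee j, tws j)) [0..<n * q]))"
proof -
  have s': "zz (ee j) \<otimes>\<^bsub>VG (\<tau> (ee j))\<^esub> tws j \<in> carrier (VG (\<tau> (ee j)))" for j
    by (simp add: monoid.m_closed)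
  have eq: "tws (1 * q + j) = zz (ee j) \<otimes>\<^bsub>VG (\<tau> (ee j))\<^esub> tws j" for j
  proof -
    interpret G: group "VG (\<tau> (ee j))" by simp
    have "zz (ee j) [^]\<^bsub>VG (\<tau> (ee j))\<^esub> (1 + int (j div q)) = zz (ee j) \<otimes>\<^bsub>VG (\<tau> (ee j))\<^esub> zz (ee j) [^]\<^bsub>VG (\<tau> (ee j))\<^esub> int (j div q)"
      by (subst G.int_pow_mult) simp_all
    moreover have "ee (q + j) = ee j" "rr (q + j) = rr j" "(q + j) div q = Suc (j div q)"
      using q_pos by (simp_all add: ee_def rr_def)
    ultimately show ?thesis by (simp add: tws_def G.m_assoc)
  qed
  have "val (map (\<lambda>j. (ee j, tws j)) [0..<1 * q + n * q]) =
    val (map (\<lambda>j. (ee j, tws j)) [0..<1 * q]) \<cdot> val (map (\<lambda>j. (ee j, zz (ee j) \<otimes>\<^bsub>VG (\<tau> (ee j))\<^esub> tws j)) [0..<n * q])"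
    by (rule val_map_add[OF tws_closed s' eq])
  moreover have "map (\<lambda>j. (ee j, tws j)) [0..<1 * q] = xs"
    by (subst xs_map) (simp add: tws_def monoid.l_one)
  ultimately show ?thesis unfolding ind_val_map[OF tws_closed] by (simp add: add.commute)
qed

lemma red_tws: "red (map (\<lambda>j. (ee j, tws j)) [0..<m])"
  by (rule red_map) (simp add: tws_def f_img_mult_iff zz_pow_img)

end

section \<open>Shortening and reversing edge paths\<close>

context gog
begin

lemma val_addlast:
  assumes "ep x xs y" "xs \<noteq> []" "g \<in> carrier (VG y)"
  shows "\<exists>xs'. ep x xs' y \<and> length xs' = length xs \<and> val xs' = val xs \<otimes>\<^bsub>PG\<^esub> El y g"
  using assms(1,2)
proof (induction xs arbitrary: x rule: list.induct)
  case (Cons p xs)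
  obtain e r where p: "p = (e, r)" by force
  have e: "e \<in> E" "r \<in> carrier (VG (\<tau> e))" "ep (\<tau> e) xs y" "x = \<tau> (bar e)" using Cons.prems p by auto
  show ?case
  proof (cases "xs = []")
    case True
    then have y: "y = \<tau> e" using e by simp
    have rg: "r \<otimes>\<^bsub>VG (\<tau> e)\<^esub> g \<in> carrier (VG (\<tau> e))" using e assms(3) y by (simp add: monoid.m_closed)
    then have ep': "ep x [(e, r \<otimes>\<^bsub>VG (\<tau> e)\<^esub> g)] y" "ep x [(e, r)] y" using e y by simp_all
    have "val [(e, r \<otimes>\<^bsub>VG (\<tau> e)\<^esub> g)] = val [(e, r)] \<otimes>\<^bsub>PG\<^esub> El y g"
      unfolding val_Cons[OF ep'(1)] val_Cons[OF ep'(2)]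
      using e assms(3) y by (simp add: val_Nil El_mult[symmetric] PG.m_assoc)
    then show ?thesis using ep' True p rg unfolding y by (intro exI[of _ "[(e, r \<otimes>\<^bsub>VG (\<tau> e)\<^esub> g)]"]) simp
  next
    case False
    then obtain xs' where xs': "ep (\<tau> e) xs' y" "length xs' = length xs" "val xs' = val xs \<otimes>\<^bsub>PG\<^esub> El y g"
      using Cons.IH[OF e(3)] by blast
    have y: "y \<in> V" using ep_last[OF e(3) False] ep_nth[OF e(3), of "length xs - 1"] False
      by (simp add: last_conv_nth)
    have ep': "ep x ((e, r) # xs') y" "ep x ((e, r) # xs) y" using e xs' by auto
    have "val ((e, r) # xs') = val ((e, r) # xs) \<otimes>\<^bsub>PG\<^esub> El y g"
      unfolding val_Cons[OF ep'(1)] val_Cons[OF ep'(2)] xs'(3)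
      using e y assms(3) val_closed[OF e(3)] by (simp add: PG.m_assoc)
    then show ?thesis using ep' xs' p by (intro exI[of _ "(e, r) # xs'"]) simp
  qed
qed simp

lemma not_successively:
  "\<not> successively P xs \<Longrightarrow> \<exists>us a b vs. xs = us @ a # b # vs \<and> \<not> P a b"
proof (induction xs)
  case (Cons a xs)
  show ?case
  proof (cases "successively P xs")
    case True
    then obtain b vs where "xs = b # vs" "\<not> P a b" using Cons.prems by (cases xs) auto
    then show ?thesis by (intro exI[of _ "[]"] exI[of _ a] exI[of _ b] exI[of _ vs]) simp
  next
    case False
    then obtain us a' b vs where "xs = us @ a' # b # vs \<and> \<not> P a' b" using Cons.IH by blast
    then show ?thesis by (intro exI[of _ "a # us"] exI[of _ a'] exI[of _ b] exI[of _ vs]) simp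
  qed
qed simp

lemma val_pinch:
  assumes e: "e \<in> E" "g \<in> carrier (EG e)" "r' \<in> carrier (VG (\<tau> (bar e)))" "ep (\<tau> (bar e)) vs y"
  shows "val ((e, f e g) # (bar e, r') # vs) = El (\<tau> (bar e)) (f (bar e) g \<otimes>\<^bsub>VG (\<tau> (bar e))\<^esub> r') \<otimes>\<^bsub>PG\<^esub> val vs"
proof -
  have ep1: "ep (\<tau> e) ((bar e, r') # vs) y" and ep0: "ep (\<tau> (bar e)) ((e, f e g) # (bar e, r') # vs) y"
    using e by simp_all
  have fb: "f (bar e) g \<in> carrier (VG (\<tau> (bar e)))" using f_closed[of "bar e" g] e by simp
  have "val ((e, f e g) # (bar e, r') # vs) = St e \<otimes>\<^bsub>PG\<^esub> El (\<tau> e) (f e g) \<otimes>\<^bsub>PG\<^esub> (inv\<^bsub>PG\<^esub> St e \<otimes>\<^bsub>PG\<^esub> (El (\<tau> (bar e)) r' \<otimes>\<^bsub>PG\<^esub> val vs))"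
    unfolding val_Cons[OF ep0] val_Cons[OF ep1] using e val_closed[OF e(4)] by (simp add: St_bar PG.m_assoc)
  also have "\<dots> = El (\<tau> (bar e)) (f (bar e) g) \<otimes>\<^bsub>PG\<^esub> (El (\<tau> (bar e)) r' \<otimes>\<^bsub>PG\<^esub> val vs)"
    unfolding St_rel[OF e(1,2)] using e fb val_closed[OF e(4)] by (simp add: PG.m_assoc)
  finally show ?thesis using e fb val_closed[OF e(4)] by (simp add: El_mult[symmetric] PG.m_assoc)
qed

text \<open>A pinch is replaced by a vertex element, which is absorbed by the vertex element before
  it, or becomes the leading factor if no edge precedes.\<close>

lemma shorten:
  assumes "ep x xs y" "\<not> red xs"
  shows "\<exists>r0 xs'. r0 \<in> carrier (VG x) \<and> ep x xs' y \<and> length xs' < length xs \<and> val xs = El x r0 \<otimes>\<^bsub>PG\<^esub> val xs'"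
proof -
  obtain us a b vs where s: "xs = us @ a # b # vs" "\<not> (\<lambda>(e, r) (e', r'). \<not> (e' = bar e \<and> r \<in> f e ` carrier (EG e))) a b"
    using not_successively[OF assms(2)[unfolded red_def]] by blast
  then obtain e g r' where ab: "a = (e, f e g)" "b = (bar e, r')" "g \<in> carrier (EG e)" by (cases a; cases b) auto
  obtain x' where x': "ep x us x'" "ep x' ((e, f e g) # (bar e, r') # vs) y"
    using assms(1) s(1) ab ep_append by auto
  then have e: "e \<in> E" "x' = \<tau> (bar e)" "r' \<in> carrier (VG (\<tau> (bar e)))" "ep (\<tau> (bar e)) vs y" by auto
  define k where "k = f (bar e) g \<otimes>\<^bsub>VG (\<tau> (bar e))\<^esub> r'"
  have k: "k \<in> carrier (VG x')" using e ab(3) f_closed[of "bar e" g] by (simp add: k_def monoid.m_closed)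
  have v: "val xs = val us \<otimes>\<^bsub>PG\<^esub> (El x' k \<otimes>\<^bsub>PG\<^esub> val vs)"
    using val_append[OF x'] val_pinch[OF e(1) ab(3) e(3,4)] s(1) ab e(2) by (simp add: k_def)
  have xV: "x' \<in> V" using e by simp
  show ?thesis
  proof (cases "us = []")
    case True
    then have "x' = x" using x' by simp
    then show ?thesis using v k e True s(1) val_closed[OF e(4)] xV
      by (intro exI[of _ k] exI[of _ vs]) (simp add: val_Nil)
  next
    case False
    then obtain us' where us': "ep x us' x'" "length us' = length us" "val us' = val us \<otimes>\<^bsub>PG\<^esub> El x' k"
      using val_addlast[OF x'(1) False k] by blast
    have "x \<in> V" using ep_nth[OF x'(1), of 0] False \<tau>_closed[OF bar_closed] by (metis length_greater_0_conv)
    moreover have ep': "ep x (us' @ vs) y" using us' e ep_append by blast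
    moreover have "val (us' @ vs) = val xs"
      using val_append[OF us'(1), of vs y] e us' v val_closed[OF x'(1)] val_closed[OF e(4)] k xV by (simp add: PG.m_assoc)
    ultimately show ?thesis using us' s(1) val_closed[OF ep']
      by (intro exI[of _ "\<one>\<^bsub>VG x\<^esub>"] exI[of _ "us' @ vs"]) (simp add: El_one monoid.one_closed)
  qed
qed

text \<open>The path traversed backwards. As each edge is paired with the element behind it, the
  inverted elements shift by one place: that of the last pair drops out and has to be supplied in
  front, and \<open>s\<close> fills the free place at the end.\<close>

fun rv :: "'a \<Rightarrow> ('e \<times> 'a) list \<Rightarrow> ('e \<times> 'a) list" where
  "rv s [] = []"
| "rv s ((e, r) # ys) = rv (inv\<^bsub>VG (\<tau> e)\<^esub> r) ys @ [(bar e, s)]"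

lemma rv:
  assumes "ep x ys y" "ys \<noteq> []" "s \<in> carrier (VG x)"
  shows "ep y (rv s ys) x \<and> rv s ys \<noteq> [] \<and> fst (hd (rv s ys)) = bar (fst (last ys)) \<and>
    last (rv s ys) = (bar (fst (hd ys)), s) \<and> (red ys \<longrightarrow> red (rv s ys)) \<and>
    val ys \<otimes>\<^bsub>PG\<^esub> (El y (inv\<^bsub>VG y\<^esub> snd (last ys)) \<otimes>\<^bsub>PG\<^esub> val (rv s ys)) = El x s"
  using assms
proof (induction ys arbitrary: x s rule: list.induct)
  case (Cons p ys)
  obtain e r where p: "p = (e, r)" by force
  have e: "e \<in> E" "r \<in> carrier (VG (\<tau> e))" "ep (\<tau> e) ys y" "x = \<tau> (bar e)" using Cons.prems p by auto
  have ir: "inv\<^bsub>VG (\<tau> e)\<^esub> r \<in> carrier (VG (\<tau> e))" using e by (simp add: group.inv_closed)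
  have ep1: "ep (\<tau> e) [(bar e, s)] x" using e Cons.prems(3) by simp
  have v1: "val [(bar e, s)] = inv\<^bsub>PG\<^esub> St e \<otimes>\<^bsub>PG\<^esub> El x s"
    using val_Cons[OF ep1] e Cons.prems(3) by (simp add: val_Nil St_bar)
  have epp: "ep x ((e, r) # ys) y" using Cons.prems p by simp
  show ?case
  proof (cases "ys = []")
    case True
    then have y: "y = \<tau> e" using e by simp
    have "val [(e, r)] = St e \<otimes>\<^bsub>PG\<^esub> El (\<tau> e) r"
      using val_Cons[OF epp] True e by (simp add: val_Nil)
    then show ?thesis using True p ep1 y v1 e Cons.prems(3)
      by (simp add: red_def El_inv PG.m_assoc)
  next
    case False
    note IH = Cons.IH[OF e(3) False ir]
    let ?w = "rv (inv\<^bsub>VG (\<tau> e)\<^esub> r) ys"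
    have w: "ep y ?w (\<tau> e)" "?w \<noteq> []" using IH by auto
    have y: "y \<in> V" using ep_last[OF e(3) False] ep_nth[OF e(3), of "length ys - 1"] False
      by (simp add: last_conv_nth)
    have lr: "snd (last ys) \<in> carrier (VG y)" using ep_last[OF e(3) False] ep_nth[OF e(3), of "length ys - 1"] False
      by (simp add: last_conv_nth)
    have c: "val ys \<in> carrier PG" "val ?w \<in> carrier PG" "El y (inv\<^bsub>VG y\<^esub> snd (last ys)) \<in> carrier PG"
      using val_closed[OF e(3)] val_closed[OF w(1)] y lr by (auto simp: group.inv_closed)
    have v: "val (rv s (p # ys)) = val ?w \<otimes>\<^bsub>PG\<^esub> (inv\<^bsub>PG\<^esub> St e \<otimes>\<^bsub>PG\<^esub> El x s)"
      using val_append[OF w(1) ep1] v1 p by simp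
    have "val (p # ys) \<otimes>\<^bsub>PG\<^esub> (El y (inv\<^bsub>VG y\<^esub> snd (last ys)) \<otimes>\<^bsub>PG\<^esub> val (rv s (p # ys))) =
       St e \<otimes>\<^bsub>PG\<^esub> (El (\<tau> e) r \<otimes>\<^bsub>PG\<^esub> ((val ys \<otimes>\<^bsub>PG\<^esub> (El y (inv\<^bsub>VG y\<^esub> snd (last ys)) \<otimes>\<^bsub>PG\<^esub> val ?w)) \<otimes>\<^bsub>PG\<^esub> (inv\<^bsub>PG\<^esub> St e \<otimes>\<^bsub>PG\<^esub> El x s)))"
      unfolding v using val_Cons[OF epp] p c e Cons.prems(3) by (simp add: PG.m_assoc)
    also have "\<dots> = St e \<otimes>\<^bsub>PG\<^esub> (El (\<tau> e) r \<otimes>\<^bsub>PG\<^esub> (El (\<tau> e) (inv\<^bsub>VG (\<tau> e)\<^esub> r) \<otimes>\<^bsub>PG\<^esub> (inv\<^bsub>PG\<^esub> St e \<otimes>\<^bsub>PG\<^esub> El x s)))"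
      using IH by simp
    also have "\<dots> = El x s" using e Cons.prems(3) by (simp add: El_inv PG.m_assoc)
    finally have val: "val (p # ys) \<otimes>\<^bsub>PG\<^esub> (El y (inv\<^bsub>VG y\<^esub> snd (last (p # ys))) \<otimes>\<^bsub>PG\<^esub> val (rv s (p # ys))) = El x s"
      using False by simp
    have "red (rv s (p # ys))" if "red (p # ys)"
    proof -
      have r1: "red ?w" using IH red_Cons[OF that] by blast
      obtain e1 r1 ys' where ys: "ys = (e1, r1) # ys'" using False by (cases ys) auto
      have e1: "e1 \<in> E" using e(3) ys by simp
      have nc: "\<not> (e1 = bar e \<and> r \<in> f e ` carrier (EG e))" using that p ys by (simp add: red_def)
      have "\<not> (bar e = bar (bar e1) \<and> inv\<^bsub>VG (\<tau> e)\<^esub> r \<in> f (bar e1) ` carrier (EG (bar e1)))"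
      proof
        assume A: "bar e = bar (bar e1) \<and> inv\<^bsub>VG (\<tau> e)\<^esub> r \<in> f (bar e1) ` carrier (EG (bar e1))"
        then have e1': "e1 = bar e" by simp
        then have be: "bar e1 = e" by simp
        have "inv\<^bsub>VG (\<tau> e)\<^esub> r \<in> f e ` carrier (EG e)" using A unfolding be by blast
        then have "inv\<^bsub>VG (\<tau> e)\<^esub> (inv\<^bsub>VG (\<tau> e)\<^esub> r) \<in> f e ` carrier (EG e)"
          by (rule subgroup.m_inv_closed[OF group_hom.img_is_subgroup[OF f_hom[OF e(1)]]])
        then have "r \<in> f e ` carrier (EG e)" using e by (simp add: group.inv_inv)
        then show False using nc e1' by blast
      qed
      then show ?thesis using r1 IH p ys w(2) by (simp add: red_def successively_append_iff)
    qed
    moreover have "ep y (rv s (p # ys)) x" using w(1) ep1 p ep_append by auto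
    ultimately show ?thesis using val w(2) IH p False by simp
  qed
qed simp

end

section \<open>Cyclic reduction and growth for an efficient twist\<close>

context eff_dehn
begin

lemma nonzero_not_elliptic:
  assumes nz: "\<not> zero_element \<GG> H w" and "p \<in> paths x u" "x \<in> V" "r0 \<in> carrier (VG x)"
  shows "p \<cdot> w \<cdot> iv (ind p) \<noteq> El x r0"
proof
  assume "p \<cdot> w \<cdot> iv (ind p) = El x r0"
  then have "0 = path_length \<GG> (p \<cdot> w \<cdot> iv (ind p))" using path_length_El[OF assms(3,4)] by simp
  then have "\<exists>g \<in> carrier PG. 0 = path_length \<GG> (g \<cdot> w \<cdot> iv (ind g))" using assms paths_closed by blast
  then have "zero_element \<GG> H w" unfolding zero_element_def by (intro Least_eq_0)
  then show False using nz by blast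
qed

text \<open>A conjugate of minimal path length is cyclically reduced.\<close>

lemma cyclic_reduction:
  assumes w: "w \<in> C" and nz: "\<not> zero_element \<GG> H w"
  shows "\<exists>x p xs. x \<in> V \<and> p \<in> paths x u \<and> ep x xs x \<and> xs \<noteq> [] \<and> red (xs @ xs) \<and> p \<cdot> w \<cdot> iv (ind p) = val xs"
proof -
  \<comment> \<open>The conjugating path may start at any vertex: zero elements are defined by
    twisted conjugation in the whole path group, so the hypothesis \<open>nz\<close> covers all such
    conjugates.\<close>
  define Q where "Q n \<longleftrightarrow> (\<exists>x p r0 xs. x \<in> V \<and> p \<in> paths x u \<and> r0 \<in> carrier (VG x) \<and> ep x xs x \<and>
     length xs = n \<and> p \<cdot> w \<cdot> iv (ind p) = El x r0 \<cdot> val xs)" for n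
  have wP: "w \<in> carrier PG" using w C_PG by blast
  have "\<exists>n. Q n"
  proof -
    obtain r0 xs where "r0 \<in> carrier (VG u)" "ep u xs u" "w = El u r0 \<cdot> val xs" using ex_expr[OF w u u] by blast
    then show ?thesis unfolding Q_def using u paths_one wP by (intro exI[of _ "length xs"] exI[of _ u] exI[of _ "\<one>\<^bsub>PG\<^esub>"] exI[of _ r0] exI[of _ xs]) simp
  qed
  define n where "n = (LEAST n. Q n)"
  have Qn: "Q n" unfolding n_def using \<open>\<exists>n. Q n\<close> by (rule LeastI_ex)
  have min: "\<not> Q m" if "m < n" for m using that not_less_Least unfolding n_def by blast
  obtain x p r0 xs0 where x: "x \<in> V" and p0: "p \<in> paths x u" and r0: "r0 \<in> carrier (VG x)" and xs0: "ep x xs0 x" "length xs0 = n"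
    and eq0: "p \<cdot> w \<cdot> iv (ind p) = El x r0 \<cdot> val xs0" using Qn unfolding Q_def by blast
  have ne0: "xs0 \<noteq> []"
  proof
    assume "xs0 = []"
    then show False using nonzero_not_elliptic[OF nz p0 x r0] eq0 x r0 by (simp add: val_Nil)
  qed
  obtain xs where xs: "ep x xs x" "length xs = n" "val xs = val xs0 \<cdot> El x r0"
    using val_addlast[OF xs0(1) ne0 r0] xs0(2) by blast
  \<comment> \<open>A further conjugation moves the leading element to the end, where it has been
    absorbed into \<open>xs\<close>; the twist fixes it.\<close>
  define p' where "p' = iv (El x r0) \<cdot> p"
  have ip: "iv (El x r0) \<in> paths x x" using paths_inv[OF El_paths[OF x r0]] .
  have p': "p' \<in> paths x u" unfolding p'_def using paths_mult[OF ip p0] .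
  have pP: "p \<in> carrier PG" "p' \<in> carrier PG" "ind p \<in> carrier PG" using p0 p' paths_closed by auto
  have "p' \<cdot> w \<cdot> iv (ind p') = iv (El x r0) \<cdot> (p \<cdot> w \<cdot> iv (ind p)) \<cdot> El x r0"
    unfolding p'_def using pP x r0 wP ind_El_id[OF x r0]
    by (simp add: ind_mult ind_inv PG.inv_mult_group PG.m_assoc)
  also have "\<dots> = val xs" unfolding eq0 xs(3) using x r0 val_closed[OF xs0(1)] by (simp add: PG.m_assoc)
  finally have eq: "p' \<cdot> w \<cdot> iv (ind p') = val xs" .
  have ne: "xs \<noteq> []" using ne0 xs xs0 by auto
  have redxs: "red xs"
  proof (rule ccontr)
    assume "\<not> red xs"
    then obtain s0 xs' where "s0 \<in> carrier (VG x)" "ep x xs' x" "length xs' < length xs" "val xs = El x s0 \<cdot> val xs'"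
      using shorten[OF xs(1)] by blast
    then have "Q (length xs')" unfolding Q_def using x p' eq by metis
    then show False using min \<open>length xs' < length xs\<close> xs(2) by blast
  qed
  have "red (xs @ xs)"
  proof (rule ccontr)
    assume nr: "\<not> red (xs @ xs)"
    obtain e r where l: "last xs = (e, r)" by force
    obtain e1 r1 where hd: "hd xs = (e1, r1)" by force
    have pin: "e1 = bar e" "r \<in> f e ` carrier (EG e)"
      using nr redxs ne l hd by (auto simp: red_def successively_append_iff)
    obtain g where g: "g \<in> carrier (EG e)" "r = f e g" using pin by blast
    obtain ys where ys: "xs = (bar e, r1) # ys" using hd pin ne by (cases xs) auto
    have eE: "e \<in> E" using ep_nth[OF xs(1), of "length xs - 1"] l ne by (simp add: last_conv_nth)
    have "ys \<noteq> []"
    proof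
      assume "ys = []"
      then show False using l ys eE by simp
    qed
    then obtain mid where mid: "ys = mid @ [(e, r)]" using l ys by (metis append_butlast_last_id last_ConsR)
    have xe: "x = \<tau> e" and r1: "r1 \<in> carrier (VG (\<tau> (bar e)))" and "ep (\<tau> (bar e)) (mid @ [(e, r)]) x"
      using xs(1) ys mid by auto
    then have epm: "ep (\<tau> (bar e)) mid (\<tau> (bar e))" using ep_append by auto
    define y where "y = \<tau> (bar e)"
    have y: "y \<in> V" using eE by (simp add: y_def)
    have rV: "r \<in> carrier (VG (\<tau> e))" using g eE by simp
    have ep1: "ep y [(e, r)] x" using eE rV xe by (simp add: y_def)
    have vm: "val mid \<in> carrier PG" using val_closed[OF epm] .
    have vxs: "val xs = iv (St e) \<cdot> (El y r1 \<cdot> (val mid \<cdot> (St e \<cdot> El (\<tau> e) r)))"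
    proof -
      have "val xs = St (bar e) \<cdot> (El y r1 \<cdot> val ys)" using val_Cons[of x "bar e" r1 ys x] xs(1) ys by (simp add: y_def)
      moreover have "val [(e, r)] = St e \<cdot> El (\<tau> e) r"
        using val_Cons[OF ep1] PG.r_one[OF El_closed[OF \<tau>_closed[OF eE] rV]] by (simp only: val_Nil)
      then have "val ys = val mid \<cdot> (St e \<cdot> El (\<tau> e) r)"
        using val_append[OF epm ep1[unfolded y_def]] by (simp only: mid)
      ultimately show ?thesis using eE by (simp add: St_bar)
    qed
    \<comment> \<open>Conjugation by the last corner of the path cancels both ends. The twist
      produces an additional twistor next to the stable letter, but this belongs to the edge group
      and can be moved to the other end of \<open>e\<close>. The path loses two edges, contrary to
      minimality.\<close>
    define p2 where "p2 = St e \<cdot> El (\<tau> e) r \<cdot> p'"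
    have p2: "p2 \<in> paths y u"
      unfolding p2_def y_def using paths_mult[OF paths_mult[OF St_paths[OF eE] El_paths[OF _ rV]] p'[unfolded xe]] eE by simp
    have fg: "f (bar e) g \<in> carrier (VG y)" using f_closed[of "bar e" g] eE g by (simp add: y_def)
    have zb: "f (bar e) (inv\<^bsub>EG e\<^esub> z e) \<in> carrier (VG y)"
      using f_closed[of "bar e" "inv\<^bsub>EG e\<^esub> z e"] eE by (simp add: y_def group.inv_closed)
    have zz: "zz e \<in> carrier (VG (\<tau> e))" using eE by simp
    have cl: "St e \<in> carrier PG" "El (\<tau> e) r \<in> carrier PG" "El (\<tau> e) (zz e) \<in> carrier PG" "El y r1 \<in> carrier PG"
      using eE rV zz r1 y by (auto simp: y_def)
    have "p2 \<cdot> w \<cdot> iv (ind p2) = St e \<cdot> El (\<tau> e) r \<cdot> (p' \<cdot> w \<cdot> iv (ind p')) \<cdot> iv (El (\<tau> e) r) \<cdot> iv (El (\<tau> e) (zz e)) \<cdot> iv (St e)"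
      unfolding p2_def using pP cl wP eE rV ind_El_id[OF _ rV]
      by (simp add: ind_mult ind_St_tw PG.inv_mult_group PG.m_assoc)
    also have "\<dots> = (St e \<cdot> El (\<tau> e) r) \<cdot> (iv (St e) \<cdot> (El y r1 \<cdot> (val mid \<cdot> (St e \<cdot> (iv (El (\<tau> e) (zz e)) \<cdot> iv (St e))))))"
      unfolding eq vxs using cl vm by (simp add: PG.m_assoc)
    also have "St e \<cdot> El (\<tau> e) r = El y (f (bar e) g) \<cdot> St e" using St_rel[OF eE g(1)] g(2) by (simp add: y_def)
    also have "St e \<cdot> (iv (El (\<tau> e) (zz e)) \<cdot> iv (St e)) = El y (f (bar e) (inv\<^bsub>EG e\<^esub> z e))"
    proof -
      have "iv (El (\<tau> e) (zz e)) = El (\<tau> e) (f e (inv\<^bsub>EG e\<^esub> z e))"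
        using eE by (simp add: El_inv[symmetric] zz_def f_inv[symmetric])
      then have "St e \<cdot> iv (El (\<tau> e) (zz e)) = El y (f (bar e) (inv\<^bsub>EG e\<^esub> z e)) \<cdot> St e"
        using St_rel[OF eE, of "inv\<^bsub>EG e\<^esub> z e"] eE by (simp add: group.inv_closed y_def)
      then show ?thesis using cl zb y by (simp add: PG.m_assoc[symmetric]) (simp add: PG.m_assoc)
    qed
    also have "El y (f (bar e) g) \<cdot> St e \<cdot> (iv (St e) \<cdot> (El y r1 \<cdot> (val mid \<cdot> El y (f (bar e) (inv\<^bsub>EG e\<^esub> z e))))) =
       El y (f (bar e) g \<otimes>\<^bsub>VG y\<^esub> r1) \<cdot> (val mid \<cdot> El y (f (bar e) (inv\<^bsub>EG e\<^esub> z e)))"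
      using cl vm fg zb y r1 by (simp add: El_mult[symmetric] PG.m_assoc y_def)
    finally have eq2: "p2 \<cdot> w \<cdot> iv (ind p2) = El y (f (bar e) g \<otimes>\<^bsub>VG y\<^esub> r1) \<cdot> (val mid \<cdot> El y (f (bar e) (inv\<^bsub>EG e\<^esub> z e)))" .
    have k: "f (bar e) g \<otimes>\<^bsub>VG y\<^esub> r1 \<in> carrier (VG y)" using fg r1 y by (simp add: monoid.m_closed y_def)
    show False
    proof (cases "mid = []")
      case True
      have "p2 \<cdot> w \<cdot> iv (ind p2) = El y (f (bar e) g \<otimes>\<^bsub>VG y\<^esub> r1 \<otimes>\<^bsub>VG y\<^esub> f (bar e) (inv\<^bsub>EG e\<^esub> z e))"
        using eq2 True k zb y by (simp add: val_Nil El_mult)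
      then show False using nonzero_not_elliptic[OF nz p2 y] k zb y by (simp add: monoid.m_closed)
    next
      case False
      obtain mid' where m: "ep y mid' y" "length mid' = length mid" "val mid' = val mid \<cdot> El y (f (bar e) (inv\<^bsub>EG e\<^esub> z e))"
        using val_addlast[OF epm False] zb by (auto simp: y_def)
      then have "Q (length mid')" unfolding Q_def using y p2 k eq2 by metis
      moreover have "length mid' < n" using m(2) mid ys xs(2) by simp
      ultimately show False using min by blast
    qed
  qed
  then show ?thesis using x p' xs(1) ne eq by blast
qed

text \<open>The twisted power, that is the product of \<open>w\<close>, \<open>ind w\<close> and so
  on with \<open>n\<close> factors. It is the form in which inverse correction terms accumulate
  under iteration.\<close>

definition twp :: "('v, 'e, 'a) letter list set \<Rightarrow> nat \<Rightarrow> ('v, 'e, 'a) letter list set" where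
  "twp w n = ((\<lambda>y. w \<cdot> ind y) ^^ n) \<one>\<^bsub>PG\<^esub>"

lemma twp_simps [simp]: "twp w 0 = \<one>\<^bsub>PG\<^esub>" "twp w (Suc n) = w \<cdot> ind (twp w n)"
  by (simp_all add: twp_def)

lemma twp_C: "w \<in> C \<Longrightarrow> twp w n \<in> C"
  by (induction n) (auto intro: paths_one C_mult ind_paths)

text \<open>It is the conjugate, not the twisted power itself, that appears as a syllable in the
  ambient graph of groups. The loop \<open>y\<close> is chosen so that the path of the twisted power
  and its reversal do not cancel against each other around it.\<close>

theorem eff_growth:
  assumes w: "w \<in> C" and nz: "\<not> zero_element \<GG> H w"
  shows "\<exists>y \<in> C. \<exists>A B. A > 0 \<and> B \<ge> 0 \<and> (\<forall>n. int n * int n \<le>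
     A * fl (twp w n \<cdot> (ind ^^ n) y \<cdot> iv (twp w n)) + B * int n + B)"
proof -
  obtain x p xs where x: "x \<in> V" and p: "p \<in> paths x u" and xs: "ep x xs x" "xs \<noteq> []" "red (xs @ xs)"
    and eq: "p \<cdot> w \<cdot> iv (ind p) = val xs" using cyclic_reduction[OF w nz] by blast
  interpret Y: cyc_dehn \<GG> H u X x xs
    by (intro cyc_dehn.intro eff_dehn_axioms cyc_dehn_axioms.intro xs)
  define e where "e = Y.ee (Y.q - 1)"
  define r where "r = Y.rr (Y.q - 1)"
  have e: "e \<in> E" "r \<in> carrier (VG (\<tau> e))" by (simp_all add: e_def r_def)
  have xe: "\<tau> e = x"
    using Y.ee_Suc[of "Y.q - 1"] Y.q_pos Y.x_ee0 by (simp add: e_def)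
  interpret G: group "VG x" using x by simp
  \<comment> \<open>A vertex element outside the image of the last edge: the path can turn back on
    it without a pinch.\<close>
  obtain g' where g': "g' \<in> carrier (VG x)" "g' \<notin> f e ` carrier (EG e)"
    using not_surj[OF e(1)] f_closed[OF e(1)] xe by blast
  have rx: "r \<in> carrier (VG x)" using e xe by simp
  \<comment> \<open>The last vertex element of the path is a twistor power times \<open>r\<close>.
    Conjugating \<open>g\<close> by it gives back \<open>g'\<close> up to conjugation by an edge
    group element, for every \<open>n\<close>.\<close>
  define g where "g = inv\<^bsub>VG x\<^esub> r \<otimes>\<^bsub>VG x\<^esub> g' \<otimes>\<^bsub>VG x\<^esub> r"
  have g: "g \<in> carrier (VG x)" using g' rx by (simp add: g_def)
  define y where "y = iv p \<cdot> El x g \<cdot> p"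
  have ip: "iv p \<in> paths u x" using paths_inv p by blast
  have y: "y \<in> C" unfolding y_def using paths_mult[OF paths_mult[OF ip El_paths[OF x g]] p] .
  define XS where "XS n = map (\<lambda>j. (Y.ee j, Y.tws j)) [0..<n * Y.q]" for n
  have epXS: "ep x (XS n) x" for n
    using Y.ep_map[OF Y.tws_closed, of "n * Y.q"] Y.x_ee0 by (simp add: XS_def)
  define PN where "PN n = (ind ^^ n) p" for n
  have PN: "PN n \<in> paths x u" for n unfolding PN_def using p by (induction n) (auto intro: ind_paths)
  have PNP: "PN n \<in> carrier PG" for n using PN paths_closed by blast
  have twP: "twp w n \<in> carrier PG" for n using twp_C[OF w] C_PG by blast
  have wP: "w \<in> carrier PG" and pP: "p \<in> carrier PG" using w p paths_closed by auto
  \<comment> \<open>The inner factors \<open>ind p\<close> cancel between consecutive factors of the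
    twisted power, leaving the twisted power of the cyclically reduced loop.\<close>
  have V: "p \<cdot> twp w n \<cdot> iv (PN n) = val (XS n)" for n
  proof (induction n)
    case 0
    then show ?case using pP by (simp add: PN_def XS_def val_Nil)
  next
    case (Suc n)
    have "p \<cdot> twp w (Suc n) \<cdot> iv (PN (Suc n)) = (p \<cdot> w \<cdot> iv (ind p)) \<cdot> ind (p \<cdot> twp w n \<cdot> iv (PN n))"
      using pP wP twP[of n] PNP[of n] by (simp add: PN_def[of "Suc n"] PN_def[of n, symmetric] ind_mult ind_inv PG.m_assoc)
    then show ?case unfolding eq Suc XS_def Y.val_tws_Suc .
  qed
  have yn: "(ind ^^ n) y = iv (PN n) \<cdot> El x g \<cdot> PN n" for n
  proof (induction n)
    case 0
    then show ?case by (simp add: y_def PN_def)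
  next
    case (Suc n)
    then show ?case using PNP[of n] x g
      by (simp add: PN_def[of "Suc n"] PN_def[of n, symmetric] ind_mult ind_inv ind_El_id)
  qed
  define Yn where "Yn n = twp w n \<cdot> (ind ^^ n) y \<cdot> iv (twp w n)" for n
  have YnC: "Yn n \<in> C" for n
  proof -
    have "(ind ^^ n) y \<in> C" using y by (induction n) (auto intro: ind_paths)
    then show ?thesis unfolding Yn_def using twp_C[OF w] C_mult C_inv by blast
  qed
  have conj: "p \<cdot> Yn n \<cdot> iv p = val (XS n) \<cdot> El x g \<cdot> iv (val (XS n))" for n
    unfolding Yn_def yn V[symmetric] using pP twP[of n] PNP[of n] x g by (simp add: PG.inv_mult_group PG.m_assoc)
  obtain A B where A: "A > 0" and B: "B \<ge> 0" and gr: "\<And>n zs ys s0 y. ep x zs y \<Longrightarrow> red zs \<Longrightarrow> n * Y.q \<le> length zs \<Longrightarrow>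
     (\<forall>j<n * Y.q. fst (zs ! j) = Y.ee j) \<Longrightarrow> (\<forall>j. Suc j < n * Y.q \<longrightarrow> snd (zs ! j) = Y.tws j) \<Longrightarrow>
     ep x ys y \<Longrightarrow> red ys \<Longrightarrow> s0 \<in> carrier (VG x) \<Longrightarrow> val zs = El x s0 \<cdot> val ys \<Longrightarrow>
     int n * int n \<le> A * (\<Sum>(e, r)\<leftarrow>ys. Lv (\<tau> e) r) + B * int n + B"
    using Y.growth by blast
  obtain K where K: "K \<ge> 0" "\<And>y. y \<in> C \<Longrightarrow> costle x x (p \<cdot> y \<cdot> iv p) (K * fl y + K)"
    using costle_flen[OF p x] by blast
  have "int n * int n \<le> (A * K + 1) * fl (Yn n) + (B + A * K) * int n + (B + A * K)" for n
  proof (cases "n = 0")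
    case True
    then show ?thesis using A B K(1) fl_nonneg[OF YnC[of 0]] by simp
  next
    case False
    define m where "m = n * Y.q - 1"
    have m: "n * Y.q = Suc m" using False Y.q_pos by (simp add: m_def)
    have mq: "m mod Y.q = Y.q - 1"
    proof -
      have me: "m = (n - 1) * Y.q + (Y.q - 1)" using False Y.q_pos by (cases n) (auto simp: m_def)
      show ?thesis unfolding me mod_mult_self3 using Y.q_pos by simp
    qed
    have em: "Y.ee m = e" "Y.rr m = r" using Y.per(1)[of m] Y.per(2)[of m] mq by (simp_all add: e_def r_def)
    define sl where "sl = Y.tws m"
    have sl: "sl \<in> carrier (VG x)" using Y.tws_closed[of m] em xe by (simp add: sl_def)
    have conjn: "sl \<otimes>\<^bsub>VG x\<^esub> g \<otimes>\<^bsub>VG x\<^esub> inv\<^bsub>VG x\<^esub> sl \<notin> f e ` carrier (EG e)"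
    proof
      define Z where "Z = zz e [^]\<^bsub>VG x\<^esub> int (m div Y.q)"
      have Z: "Z \<in> f e ` carrier (EG e)" using zz_pow_img[OF e(1)] xe by (simp add: Z_def)
      interpret S: subgroup "f e ` carrier (EG e)" "VG x" using f_img_subgroup[OF e(1)] xe by simp
      have ZV: "Z \<in> carrier (VG x)" using Z S.mem_carrier by blast
      have slZ: "sl = Z \<otimes>\<^bsub>VG x\<^esub> r" using em xe by (simp add: sl_def Y.tws_def Z_def)
      assume "sl \<otimes>\<^bsub>VG x\<^esub> g \<otimes>\<^bsub>VG x\<^esub> inv\<^bsub>VG x\<^esub> sl \<in> f e ` carrier (EG e)"
      moreover have "sl \<otimes>\<^bsub>VG x\<^esub> g \<otimes>\<^bsub>VG x\<^esub> inv\<^bsub>VG x\<^esub> sl = Z \<otimes>\<^bsub>VG x\<^esub> g' \<otimes>\<^bsub>VG x\<^esub> inv\<^bsub>VG x\<^esub> Z"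
        unfolding slZ g_def using ZV rx g' by (simp add: G.m_assoc G.inv_mult_group)
      ultimately have "inv\<^bsub>VG x\<^esub> Z \<otimes>\<^bsub>VG x\<^esub> (Z \<otimes>\<^bsub>VG x\<^esub> g' \<otimes>\<^bsub>VG x\<^esub> inv\<^bsub>VG x\<^esub> Z) \<otimes>\<^bsub>VG x\<^esub> Z \<in> f e ` carrier (EG e)"
        using S.m_closed S.m_inv_closed Z by simp
      then show False using ZV g' by (simp add: G.m_assoc)
    qed
    \<comment> \<open>Only the turning point changes: there the last element \<open>sl\<close> of
      the way out, then \<open>g\<close>, then the inverse of \<open>sl\<close> that opens the way
      back are multiplied together.\<close>
    define s where "s j = (if j = m then sl \<otimes>\<^bsub>VG x\<^esub> g \<otimes>\<^bsub>VG x\<^esub> inv\<^bsub>VG x\<^esub> sl else Y.tws j)" for j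
    have sc: "s j \<in> carrier (VG (\<tau> (Y.ee j)))" for j
      using sl g em xe by (auto simp: s_def)
    define LL where "LL = map (\<lambda>j. (Y.ee j, s j)) [0..<Suc m]"
    have epLL: "ep x LL x" using Y.ep_map[of s "Suc m"] sc xe em by (simp add: LL_def del: upt_Suc)
    have redLL: "red LL"
      unfolding LL_def
    proof (rule Y.red_map)
      fix j assume a: "s j \<in> f (Y.ee j) ` carrier (EG (Y.ee j))"
      then have "j \<noteq> m" using conjn em by (auto simp: s_def)
      then show "Y.rr j \<in> f (Y.ee j) ` carrier (EG (Y.ee j))"
        using a by (simp add: s_def Y.tws_def f_img_mult_iff zz_pow_img)
    qed
    have mapm: "map (\<lambda>j. (Y.ee j, s j)) [0..<m] = map (\<lambda>j. (Y.ee j, Y.tws j)) [0..<m]"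
      by (simp add: s_def)
    have XSm: "XS n = map (\<lambda>j. (Y.ee j, Y.tws j)) [0..<Suc m]" by (simp only: XS_def m)
    have redXS: "red (XS n)" unfolding XSm by (rule Y.red_tws)
    have XSne: "XS n \<noteq> []" unfolding XSm by simp
    have lastXS: "last (XS n) = (e, sl)" unfolding XSm using em by (simp add: sl_def)
    have "val (map (\<lambda>j. (Y.ee j, Y.tws j)) [0..<m]) \<in> carrier PG"
      using val_closed[OF Y.ep_map[OF Y.tws_closed]] .
    then have valLL: "val LL = val (XS n) \<cdot> El x g \<cdot> iv (El x sl)"
      unfolding LL_def XSm Y.val_map_Suc[OF sc] Y.val_map_Suc[OF Y.tws_closed] mapm
      using em xe sl g x e by (simp add: s_def sl_def[symmetric] El_mult[symmetric] El_inv PG.m_assoc)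
    note RV = rv[OF epXS[of n] XSne G.one_closed]
    define zs where "zs = LL @ rv \<one>\<^bsub>VG x\<^esub> (XS n)"
    have epzs: "ep x zs x" unfolding zs_def using epLL RV ep_append by blast
    have redzs: "red zs"
    proof -
      have "last LL = (e, sl \<otimes>\<^bsub>VG x\<^esub> g \<otimes>\<^bsub>VG x\<^esub> inv\<^bsub>VG x\<^esub> sl)" using em by (simp add: LL_def s_def)
      then show ?thesis
        using redLL RV redXS conjn unfolding zs_def red_def successively_append_iff by (auto simp: case_prod_beta)
    qed
    have vrv: "val (rv \<one>\<^bsub>VG x\<^esub> (XS n)) \<in> carrier PG" using RV val_closed by blast
    have vX: "val (XS n) \<in> carrier PG" using val_closed[OF epXS] .
    have "val (XS n) \<cdot> (iv (El x sl) \<cdot> val (rv \<one>\<^bsub>VG x\<^esub> (XS n))) = \<one>\<^bsub>PG\<^esub>"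
      using RV lastXS x sl by (simp add: El_inv El_one)
    then have "iv (El x sl) \<cdot> val (rv \<one>\<^bsub>VG x\<^esub> (XS n)) = iv (val (XS n))"
      using vX vrv x sl by (metis El_closed PG.inv_closed PG.m_closed PG.inv_equality PG.inv_inv)
    moreover have "val zs = val (XS n) \<cdot> El x g \<cdot> (iv (El x sl) \<cdot> val (rv \<one>\<^bsub>VG x\<^esub> (XS n)))"
      unfolding zs_def val_append[OF epLL conjunct1[OF RV]] valLL using vX vrv x sl g by (simp add: PG.m_assoc)
    ultimately have valzs: "val zs = p \<cdot> Yn n \<cdot> iv p" unfolding conj by simp
    have "costle x x (p \<cdot> Yn n \<cdot> iv p) (K * fl (Yn n) + K)" using K(2)[OF YnC] .
    then obtain s0 ys where ys: "s0 \<in> carrier (VG x)" "ep x ys x" "red ys" "val zs = El x s0 \<cdot> val ys"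
      "Lv x s0 + (\<Sum>(e, r)\<leftarrow>ys. Lv (\<tau> e) r) \<le> K * fl (Yn n) + K" unfolding costle_def valzs by blast
    have lenLL: "length LL = n * Y.q" by (simp add: LL_def m)
    have nthLL: "zs ! j = (Y.ee j, s j)" if "j < n * Y.q" for j
    proof -
      have "zs ! j = LL ! j" using that lenLL by (simp add: zs_def nth_append)
      then show ?thesis using that m by (simp add: LL_def del: upt_Suc)
    qed
    have "int n * int n \<le> A * (\<Sum>(e, r)\<leftarrow>ys. Lv (\<tau> e) r) + B * int n + B"
    proof (rule gr[OF epzs redzs _ _ _ ys(2,3,1,4)])
      show "n * Y.q \<le> length zs" using lenLL by (simp add: zs_def)
      show "\<forall>j<n * Y.q. fst (zs ! j) = Y.ee j" using nthLL by simp
      show "\<forall>j. Suc j < n * Y.q \<longrightarrow> snd (zs ! j) = Y.tws j" using nthLL m by (auto simp: s_def)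
    qed
    moreover have "A * (\<Sum>(e, r)\<leftarrow>ys. Lv (\<tau> e) r) \<le> A * (K * fl (Yn n) + K)"
      using ys(5) Lv_nonneg[OF x ys(1)] A by (intro mult_left_mono) auto
    moreover have "A * (K * fl (Yn n) + K) = A * K * fl (Yn n) + A * K" by (simp add: algebra_simps)
    moreover have "0 \<le> A * K * int n" using A K(1) by simp
    moreover have "0 \<le> fl (Yn n)" using fl_nonneg[OF YnC] .
    ultimately show ?thesis by (simp add: distrib_right)
  qed
  moreover have "A * K + 1 > 0" "B + A * K \<ge> 0" using A B K(1) by (simp_all add: add_nonneg_pos)
  ultimately show ?thesis using y unfolding Yn_def
    by (intro bexI[OF _ y] exI[of _ "A * K + 1"] exI[of _ "B + A * K"]) auto
qed

end

section \<open>Reading off a syllable of a partial Dehn twist\<close>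

context gog
begin

text \<open>Spelling each generator by a fixed word turns a shortest product of generators into a
  word whose total weight is linear in word length. A lower bound on the weight of all words for an
  element is therefore a lower bound on its word length.\<close>

lemma word_representative:
  fixes wt :: "('v, 'e, 'a) letter \<Rightarrow> int"
  assumes S: "finite S" "generating_set (pi1 \<GG> u) S" and wt: "\<And>l. 0 \<le> wt l"
  shows "\<exists>M\<ge>0. \<forall>X \<in> paths u u. \<exists>W \<in> lists L. cls W = X \<and> (\<Sum>l\<leftarrow>W. wt l) \<le> M * int (word_length (pi1 \<GG> u) S X)"
proof -
  interpret G: group "pi1 \<GG> u" by (rule pi1_group)
  have SC: "S \<subseteq> paths u u" and gen: "generate (pi1 \<GG> u) S = paths u u"
    using S(2) by (auto simp: generating_set_def pi1_carrier)
  have "\<forall>s \<in> paths u u. \<exists>w \<in> lists L. cls w = s" by (auto simp: paths_def)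
  then obtain \<omega> where \<omega>: "\<And>s. s \<in> paths u u \<Longrightarrow> \<omega> s \<in> lists L \<and> cls (\<omega> s) = s" by metis
  define sw where "sw w = (\<Sum>l\<leftarrow>w. wt l)" for w
  have sw0: "0 \<le> sw w" for w unfolding sw_def using wt by (induction w) auto
  define M where "M = (\<Sum>s\<in>S. sw (\<omega> s) + sw (iw (\<omega> s)))"
  have M0: "0 \<le> M" unfolding M_def using sw0 by (simp add: sum_nonneg add_nonneg_nonneg)
  have Ms: "sw (\<omega> s) + sw (iw (\<omega> s)) \<le> M" if "s \<in> S" for s
    unfolding M_def using S(1) that sw0
    by (intro member_le_sum[where f = "\<lambda>s. sw (\<omega> s) + sw (iw (\<omega> s))"]) (auto intro: add_nonneg_nonneg)
  have rep: "\<exists>W \<in> lists L. cls W = word_value (pi1 \<GG> u) w \<and> sw W \<le> M * int (length w)" if "fst ` set w \<subseteq> S" for w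
    using that
  proof (induction w)
    case Nil
    then show ?case by (intro bexI[of _ "[]"]) (auto simp: cls_Nil sw_def)
  next
    case (Cons t w)
    then obtain W where W: "W \<in> lists L" "cls W = word_value (pi1 \<GG> u) w" "sw W \<le> M * int (length w)" by auto
    have t: "fst t \<in> S" "fst t \<in> paths u u" using Cons.prems SC by auto
    define \<omega>' where "\<omega>' = (if snd t then \<omega> (fst t) else iw (\<omega> (fst t)))"
    have \<omega>': "\<omega>' \<in> lists L" using \<omega>[OF t(2)] P.iw_lists by (simp add: \<omega>'_def)
    have "cls \<omega>' = (if snd t then fst t else inv\<^bsub>pi1 \<GG> u\<^esub> fst t)"
      using \<omega>[OF t(2)] cls_iw pi1_inv[OF t(2)] by (auto simp: \<omega>'_def)
    then have "cls (\<omega>' @ W) = word_value (pi1 \<GG> u) (t # w)"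
      using cls_append[OF \<omega>' W(1)] W(2) by (simp add: G.word_value_Cons)
    moreover have "sw (\<omega>' @ W) \<le> M * int (length (t # w))"
      using W(3) Ms[OF t(1)] sw0[of "\<omega> (fst t)"] sw0[of "iw (\<omega> (fst t))"]
      by (auto simp: sw_def \<omega>'_def distrib_left)
    moreover have "\<omega>' @ W \<in> lists L" using \<omega>' W(1) by simp
    ultimately show ?case by blast
  qed
  have "\<exists>W \<in> lists L. cls W = X \<and> sw W \<le> M * int (word_length (pi1 \<GG> u) S X)" if X: "X \<in> paths u u" for X
  proof -
    have "\<exists>w. fst ` set w \<subseteq> S \<and> word_value (pi1 \<GG> u) w = X"
      using G.generate_word_value[of S X] SC X gen by (auto simp: pi1_carrier)
    then have "\<exists>n w. length w = n \<and> fst ` set w \<subseteq> S \<and> word_value (pi1 \<GG> u) w = X" by blast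
    then have "\<exists>w. length w = word_length (pi1 \<GG> u) S X \<and> fst ` set w \<subseteq> S \<and> word_value (pi1 \<GG> u) w = X"
      unfolding word_length_def by (rule LeastI_ex)
    then show ?thesis using rep by metis
  qed
  then show ?thesis using M0 unfolding sw_def by blast
qed

lemma path_word_in_V: "w \<in> lists L \<Longrightarrow> path_word \<GG> x w y \<Longrightarrow> x \<in> V \<Longrightarrow> y \<in> V"
proof (induction w arbitrary: x rule: list.induct)
  case (Cons a w)
  then show ?case by (cases a) auto
qed simp

text \<open>Generators of the vertex groups and the stable letters, closed up along fixed connecting
  paths, generate the group at the base vertex.\<close>

lemma pi1_finitely_generated:
  assumes u: "u \<in> V"
  shows "finitely_generated (pi1 \<GG> u)"
proof -
  have "\<forall>y \<in> V. \<exists>p. p \<in> paths u y" using ex_path u by blast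
  then obtain p where p: "\<And>y. y \<in> V \<Longrightarrow> p y \<in> paths u y" by metis
  have pP: "p y \<in> carrier PG" if "y \<in> V" for y using p that paths_closed by blast
  define hat where "hat y y' W = p y \<otimes>\<^bsub>PG\<^esub> W \<otimes>\<^bsub>PG\<^esub> inv\<^bsub>PG\<^esub> (p y')" for y y' W
  have hat: "hat y y' W \<in> paths u u" if "y \<in> V" "y' \<in> V" "W \<in> paths y y'" for y y' W
    unfolding hat_def using that by (intro paths_mult[OF paths_mult[OF p] paths_inv[OF p]]) auto
  have "\<forall>y \<in> V. \<exists>S. finite S \<and> generating_set (VG y) S"
    using gog by (auto simp: graph_of_groups_def finitely_generated_def)
  then obtain Sv where Sv: "\<And>y. y \<in> V \<Longrightarrow> finite (Sv y) \<and> Sv y \<subseteq> carrier (VG y) \<and> generate (VG y) (Sv y) = carrier (VG y)"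
    unfolding generating_set_def by metis
  \<comment> \<open>The chosen loop \<open>p u\<close> at the base vertex need not be trivial. It is
    added to undo the conjugation that \<open>hat u u\<close> amounts to.\<close>
  define S where "S = insert (p u) ((\<Union>y\<in>V. (\<lambda>g. hat y y (El y g)) ` Sv y) \<union> (\<lambda>e. hat (\<tau> (bar e)) (\<tau> e) (St e)) ` E)"
  have fin: "finite S" unfolding S_def using finite_V finite_E Sv by simp
  have SC: "S \<subseteq> paths u u"
    unfolding S_def using p[OF u] hat El_paths St_paths Sv by (auto simp: subset_iff)
  interpret G: group "pi1 \<GG> u" by (rule pi1_group)
  have sub: "subgroup (generate (pi1 \<GG> u) S) (pi1 \<GG> u)"
    using SC by (intro G.generate_is_subgroup) (simp add: pi1_carrier)
  define K where "K = generate (pi1 \<GG> u) S"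
  have KC: "K \<subseteq> paths u u" using subgroup.subset[OF sub] by (simp add: K_def pi1_carrier)
  have Km: "a \<otimes>\<^bsub>PG\<^esub> b \<in> K" if "a \<in> K" "b \<in> K" for a b
    using subgroup.m_closed[OF sub] that by (simp add: K_def)
  have Ki: "inv\<^bsub>PG\<^esub> a \<in> K" if "a \<in> K" for a
    using subgroup.m_inv_closed[OF sub, of a] that pi1_inv[of a u] KC by (auto simp: K_def)
  have K1: "\<one>\<^bsub>PG\<^esub> \<in> K" using subgroup.one_closed[OF sub] by (simp add: K_def)
  have KS: "s \<in> K" if "s \<in> S" for s unfolding K_def using that by (rule generate.incl)
  have hatm: "hat y y'' (W \<otimes>\<^bsub>PG\<^esub> W') = hat y y' W \<otimes>\<^bsub>PG\<^esub> hat y' y'' W'"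
    if "y \<in> V" "y' \<in> V" "y'' \<in> V" "W \<in> carrier PG" "W' \<in> carrier PG" for y y' y'' W W'
    unfolding hat_def using that pP by (simp add: PG.m_assoc)
  have KEl: "hat y y (El y g) \<in> K" if y: "y \<in> V" and g: "g \<in> carrier (VG y)" for y g
  proof -
    interpret Gy: group "VG y" using y by simp
    have "g \<in> generate (VG y) (Sv y)" using Sv[OF y] g by simp
    then show ?thesis
    proof induction
      case one
      then show ?case using K1 y pP[OF y] by (simp add: El_one hat_def)
    next
      case (incl h)
      then show ?case using y by (intro KS) (auto simp: S_def)
    next
      case (inv h)
      have h: "h \<in> carrier (VG y)" using Sv[OF y] inv by auto
      have "hat y y (El y h) \<in> K" using y inv by (intro KS) (auto simp: S_def)
      then have "inv\<^bsub>PG\<^esub> hat y y (El y h) \<in> K" using Ki by blast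
      then show ?case using y h pP[OF y] by (simp add: hat_def El_inv PG.inv_mult_group PG.m_assoc)
    next
      case (eng h1 h2)
      then have "h1 \<in> carrier (VG y)" "h2 \<in> carrier (VG y)" using Sv[OF y] by auto
      then show ?case using Km[OF eng.IH] y hatm[of y y y "El y h1" "El y h2"] by (simp add: El_mult)
    qed
  qed
  have Kw: "hat x y (cls w) \<in> K" if "w \<in> lists L" "path_word \<GG> x w y" "x \<in> V" for x y w
    using that
  proof (induction w arbitrary: x rule: list.induct)
    case Nil
    then show ?case using K1 pP by (simp add: cls_Nil hat_def)
  next
    case (Cons a w)
    have w: "w \<in> lists L" using Cons.prems by simp
    show ?case
    proof (cases a)
      case (Elt x' s)
      then have s: "x' = x" "s \<in> carrier (VG x)" "path_word \<GG> x w y" using Cons.prems by auto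
      have y: "y \<in> V" using path_word_in_V[OF w s(3) Cons.prems(3)] .
      have "hat x y (cls (a # w)) = hat x x (El x s) \<otimes>\<^bsub>PG\<^esub> hat x y (cls w)"
        using hatm[of x x y "El x s" "cls w"] Cons.prems s Elt w y cls_Elt[of x s w] cls_closed[OF w] by simp
      then show ?thesis using Km[OF KEl[OF Cons.prems(3) s(2)] Cons.IH[OF w s(3) Cons.prems(3)]] by simp
    next
      case (Stable e)
      then have e: "e \<in> E" "x = \<tau> (bar e)" "path_word \<GG> (\<tau> e) w y" using Cons.prems by auto
      have y: "y \<in> V" using path_word_in_V[OF w e(3)] e(1) by simp
      have "hat x y (cls (a # w)) = hat x (\<tau> e) (St e) \<otimes>\<^bsub>PG\<^esub> hat (\<tau> e) y (cls w)"
        using hatm[of x "\<tau> e" y "St e" "cls w"] Cons.prems e Stable w y cls_Stable[of e w] cls_closed[OF w] by simp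
      moreover have "hat x (\<tau> e) (St e) \<in> K" using e by (intro KS) (auto simp: S_def)
      ultimately show ?thesis using Km Cons.IH[OF w e(3) \<tau>_closed[OF e(1)]] by simp
    qed
  qed
  have "paths u u \<subseteq> K"
  proof
    fix X assume X: "X \<in> paths u u"
    then obtain w where w: "w \<in> lists L" "path_word \<GG> u w u" "X = cls w" by (auto simp: paths_def)
    have "inv\<^bsub>PG\<^esub> p u \<otimes>\<^bsub>PG\<^esub> hat u u X \<otimes>\<^bsub>PG\<^esub> p u = X"
      unfolding hat_def using pP[OF u] paths_closed[OF X] by (simp add: PG.m_assoc)
    moreover have "p u \<in> K" by (rule KS) (simp add: S_def)
    ultimately show "X \<in> K" using Kw[OF w(1,2) u] Km Ki w(3) by metis
  qed
  then have "generate (pi1 \<GG> u) S = paths u u" using KC K_def by blast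
  then show ?thesis unfolding finitely_generated_def generating_set_def using fin SC pi1_carrier[of u] by auto
qed

end

text \<open>An automaton on which the letters from \<open>G\<^sub>v\<close> act trivially.  As the edge groups at \<open>v\<close> are
  trivial, the product of the letters from \<open>G\<^sub>v\<close> read in state \<open>\<beta>\<close> only depends on the element spelled.\<close>

locale counter = gog \<GG> for \<GG> :: "('v, 'e, 'a, 'b) gog" +
  fixes v :: 'v and act :: "('v, 'e, 'a) letter \<Rightarrow> 'q \<Rightarrow> 'q" and Q :: "'q set" and \<beta> :: 'q
  assumes vV: "v \<in> V" and triv: "\<And>e. e \<in> E \<Longrightarrow> \<tau> e = v \<Longrightarrow> carrier (EG e) = {\<one>\<^bsub>EG e\<^esub>}"
    and act_Q: "\<And>a q. a \<in> L \<Longrightarrow> q \<in> Q \<Longrightarrow> act a q \<in> Q"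
    and act_v: "\<And>g q. act (Elt v g) q = q"
    and act_one: "\<And>x q. \<lbrakk>x \<in> V; q \<in> Q\<rbrakk> \<Longrightarrow> act (Elt x \<one>\<^bsub>VG x\<^esub>) q = q"
    and act_mult: "\<And>x g h q. \<lbrakk>x \<in> V; g \<in> carrier (VG x); h \<in> carrier (VG x); q \<in> Q\<rbrakk> \<Longrightarrow>
       act (Elt x h) (act (Elt x g) q) = act (Elt x (g \<otimes>\<^bsub>VG x\<^esub> h)) q"
    and act_bar: "\<And>e q. \<lbrakk>e \<in> E; q \<in> Q\<rbrakk> \<Longrightarrow> act (Stable (bar e)) (act (Stable e) q) = q"
    and act_move: "\<And>e g q. \<lbrakk>e \<in> E; g \<in> carrier (EG e); q \<in> Q\<rbrakk> \<Longrightarrow>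
       act (Stable (bar e)) (act (Elt (\<tau> e) (f e g)) (act (Stable e) q)) = act (Elt (\<tau> (bar e)) (f (bar e) g)) q"
begin

fun run :: "'q \<Rightarrow> ('v, 'e, 'a) letter list \<Rightarrow> 'q" where
  "run q [] = q"
| "run q (a # w) = run (act a q) w"

fun comp :: "'q \<Rightarrow> ('v, 'e, 'a) letter list \<Rightarrow> 'a" where
  "comp q [] = \<one>\<^bsub>VG v\<^esub>"
| "comp q (Elt x g # w) =
    (if x = v \<and> q = \<beta> then g \<otimes>\<^bsub>VG v\<^esub> comp (act (Elt x g) q) w else comp (act (Elt x g) q) w)"
| "comp q (Stable e # w) = comp (act (Stable e) q) w"

lemma run_append: "run q (u @ w) = run (run q u) w"
  by (induction u arbitrary: q) auto

lemma run_Q: "w \<in> lists L \<Longrightarrow> q \<in> Q \<Longrightarrow> run q w \<in> Q"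
  by (induction w arbitrary: q) (auto simp: act_Q)

lemma comp_closed: "w \<in> lists L \<Longrightarrow> comp q w \<in> carrier (VG v)"
proof (induction w arbitrary: q rule: list.induct)
  case (Cons a w)
  then have "w \<in> lists L" by simp
  then show ?case using Cons vV by (cases a) (auto intro: monoid.m_closed)
qed (simp add: vV monoid.one_closed)

lemma comp_append: "u \<in> lists L \<Longrightarrow> w \<in> lists L \<Longrightarrow> comp q (u @ w) = comp q u \<otimes>\<^bsub>VG v\<^esub> comp (run q u) w"
proof (induction u arbitrary: q rule: list.induct)
  case Nil
  then show ?case using comp_closed[of w q] vV by (simp add: monoid.l_one)
next
  case (Cons a u)
  have u: "u \<in> lists L" using Cons.prems by simp
  then show ?case using Cons.IH[OF u Cons.prems(2)] Cons.prems(1) vV comp_closed[OF u] comp_closed[OF Cons.prems(2)]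
    by (cases a) (auto simp: monoid.m_assoc)
qed

lemma f_triv:
  assumes "e \<in> E" "g \<in> carrier (EG e)" "\<tau> e = v"
  shows "f e g = \<one>\<^bsub>VG v\<^esub>"
  using triv[OF assms(1,3)] assms by auto

text \<open>Only in the edge relation could letters from \<open>v\<close> appear on one side and not
  on the other; since the edge groups at \<open>v\<close> are trivial, such letters are trivial
  too.\<close>

lemma comp_rel:
  assumes "(u, w) \<in> vrels \<GG> \<union> erels \<GG>" "q \<in> Q"
  shows "comp q u = comp q w \<and> run q u = run q w"
proof -
  interpret G: group "VG v" using vV by simp
  consider (one) x where "x \<in> V" "u = [Elt x \<one>\<^bsub>VG x\<^esub>]" "w = []"
    | (mul) x g h where "x \<in> V" "g \<in> carrier (VG x)" "h \<in> carrier (VG x)" "u = [Elt x g, Elt x h]" "w = [Elt x (g \<otimes>\<^bsub>VG x\<^esub> h)]"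
    | (st) e where "e \<in> E" "u = [Stable e, Stable (bar e)]" "w = []"
    | (mv) e g where "e \<in> E" "g \<in> carrier (EG e)" "u = [Stable e, Elt (\<tau> e) (f e g), Stable (bar e)]"
        "w = [Elt (\<tau> (bar e)) (f (bar e) g)]"
    using assms unfolding vrels_def erels_def by blast
  then show ?thesis
  proof cases
    case one
    then show ?thesis using act_one assms by simp
  next
    case mul
    then show ?thesis using act_mult[OF mul(1-3) assms(2)] act_v by (auto simp: G.m_assoc)
  next
    case st
    then show ?thesis using act_bar assms by simp
  next
    case mv
    have "comp q u = \<one>\<^bsub>VG v\<^esub>" using mv f_triv[OF mv(1,2)] by auto
    moreover have "comp q w = \<one>\<^bsub>VG v\<^esub>" using mv f_triv[of "bar e" g] by auto
    ultimately show ?thesis using act_move[OF mv(1,2) assms(2)] mv by simp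
  qed
qed

lemma comp_cong:
  assumes "x \<approx> y" "q \<in> Q" shows "comp q x = comp q y"
proof -
  have "(comp q x, run q x) = (comp q y, run q y)"
    using assms(1) unfolding path_cong_def
  proof (rule word_cong_invariant)
    fix u w a b assume h: "(u, w) \<in> vrels \<GG> \<union> erels \<GG>" "a \<in> lists L" "b \<in> lists L"
    have l: "u \<in> lists L" "w \<in> lists L" using h rels_lists by blast+
    have l2: "u @ b \<in> lists L" "w @ b \<in> lists L" using l h by simp_all
    show "(comp q (a @ u @ b), run q (a @ u @ b)) = (comp q (a @ w @ b), run q (a @ w @ b))"
      using comp_rel[OF h(1) run_Q[OF h(2) assms(2)]] comp_append[OF h(2) l2(1)] comp_append[OF h(2) l2(2)]
        comp_append[OF l(1) h(3)] comp_append[OF l(2) h(3)]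
      by (simp only: run_append)
  qed
  then show ?thesis by simp
qed

lemma comp_iw:
  assumes "w \<in> lists L" "q \<in> Q" "comp q w = \<one>\<^bsub>VG v\<^esub>"
  shows "comp (run q w) (iw w) = \<one>\<^bsub>VG v\<^esub>"
proof -
  have l: "iw w \<in> lists L" using P.iw_lists assms by blast
  then have l2: "w @ iw w \<in> lists L" using assms(1) by simp
  have "cls (w @ iw w) = cls []" using cls_append[OF assms(1) l] cls_iw[OF assms(1)] assms(1) by (simp add: cls_Nil)
  then have "w @ iw w \<approx> []" using cls_eq_iff[OF l2] by simp
  then have "comp q (w @ iw w) = \<one>\<^bsub>VG v\<^esub>" using comp_cong[OF _ assms(2)] by fastforce
  then show ?thesis using comp_append[OF assms(1) l] assms(3) comp_closed[OF l] vV by (simp add: monoid.l_one)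
qed

lemma comp_conjugate:
  assumes w: "w \<in> lists L" "q \<in> Q" "comp q w = \<one>\<^bsub>VG v\<^esub>" "run q w = \<beta>"
    and g: "g1 \<in> carrier (VG v)" "g2 \<in> carrier (VG v)" "g3 \<in> carrier (VG v)"
  shows "comp q (w @ [Elt v g1, Elt v g2, Elt v g3] @ iw w) = g1 \<otimes>\<^bsub>VG v\<^esub> g2 \<otimes>\<^bsub>VG v\<^esub> g3"
proof -
  interpret G: group "VG v" using vV by simp
  have l: "iw w \<in> lists L" "[Elt v g1, Elt v g2, Elt v g3] \<in> lists L"
    "[Elt v g1, Elt v g2, Elt v g3] @ iw w \<in> lists L" using P.iw_lists[OF w(1)] g vV by auto
  have "comp q (w @ [Elt v g1, Elt v g2, Elt v g3] @ iw w) = comp \<beta> ([Elt v g1, Elt v g2, Elt v g3] @ iw w)"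
    using comp_append[OF w(1) l(3), of q] w(3,4) comp_closed[OF l(3), of \<beta>] by (simp only: G.l_one)
  also have "\<dots> = g1 \<otimes>\<^bsub>VG v\<^esub> (g2 \<otimes>\<^bsub>VG v\<^esub> (g3 \<otimes>\<^bsub>VG v\<^esub> comp \<beta> (iw w)))"
    by (simp add: act_v)
  finally show ?thesis using comp_iw[OF w(1-3)] w(4) g by (simp add: G.m_assoc)
qed

text \<open>The product consists of some of the letters of the word, so subadditivity bounds its
  length by their weights, whatever the automaton selects.\<close>

lemma comp_weight:
  fixes len :: "'a \<Rightarrow> int"
  assumes "len \<one>\<^bsub>VG v\<^esub> = 0" and sub: "\<And>a b. \<lbrakk>a \<in> carrier (VG v); b \<in> carrier (VG v)\<rbrakk> \<Longrightarrow> len (a \<otimes>\<^bsub>VG v\<^esub> b) \<le> len a + len b"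
    and wt: "\<And>l. 0 \<le> wt l" "\<And>g. g \<in> carrier (VG v) \<Longrightarrow> len g \<le> wt (Elt v g)" and w: "w \<in> lists L"
  shows "len (comp q w) \<le> (\<Sum>l\<leftarrow>w. wt l)"
  using w
proof (induction w arbitrary: q rule: list.induct)
  case (Cons a w)
  have w: "w \<in> lists L" using Cons.prems by simp
  show ?case
  proof (cases a)
    case (Elt x g)
    show ?thesis
    proof (cases "x = v \<and> q = \<beta>")
      case True
      then have g: "g \<in> carrier (VG v)" using Cons.prems Elt by simp
      show ?thesis using sub[OF g comp_closed[OF w, of "act a q"]] wt(2)[OF g] Cons.IH[OF w, of "act a q"] True Elt by auto
    next
      case False
      then show ?thesis using wt(1)[of a] Cons.IH[OF w, of "act a q"] Elt by auto
    qed
  next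
    case (Stable e)
    then show ?thesis using wt(1)[of a] Cons.IH[OF w, of "act a q"] by simp
  qed
qed (simp add: assms)

end

section \<open>Injectivity and powers of the induced map\<close>

context gog_id_aut
begin

text \<open>Introduced to obtain injectivity of \<open>ind\<close> from a left inverse. The
  correction terms are forced by the requirement that the composite fixes every stable
  letter.\<close>

definition inverse_aut :: "('v, 'e, 'a, 'b) gog_aut" where
  "inverse_aut = \<lparr>vmap = (\<lambda>x. x), edgemap = (\<lambda>e. e),
     vhom = (\<lambda>x. inv_into (carrier (VG x)) (vhom H x)), ehom = (\<lambda>e g. g),
     corr = (\<lambda>e. inv_into (carrier (VG (\<tau> e))) (vhom H (\<tau> e)) (inv\<^bsub>VG (\<tau> e)\<^esub> corr H e))\<rparr>"

lemma inverse_aut: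
  assumes eh: "\<And>e g. \<lbrakk>e \<in> E; g \<in> carrier (EG e)\<rbrakk> \<Longrightarrow> ehom H e g = g"
  shows "gog_id_aut \<GG> inverse_aut"
proof
  let ?h = "\<lambda>x. inv_into (carrier (VG x)) (vhom H x)"
  have iso: "?h x \<in> iso (VG x) (VG x)" if "x \<in> V" for x
    using group.iso_set_sym[OF VG_group[OF that] vhom_iso[OF that]] .
  have hom: "group_hom (VG x) (VG x) (?h x)" if "x \<in> V" for x
    using iso[OF that] that by (simp add: group_hom_def group_hom_axioms_def iso_def)
  have left: "?h x (vhom H x g) = g" if "x \<in> V" "g \<in> carrier (VG x)" for x g
    using vhom_iso[OF that(1)] that(2) by (simp add: iso_def bij_betw_def)
  have move: "?h (\<tau> e) (f e g) = ad (VG (\<tau> e)) (?h (\<tau> e) (inv\<^bsub>VG (\<tau> e)\<^esub> corr H e)) (f e g)"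
    if e: "e \<in> E" and g: "g \<in> carrier (EG e)" for e g
  proof -
    interpret G: group "VG (\<tau> e)" using e by simp
    interpret h: group_hom "VG (\<tau> e)" "VG (\<tau> e)" "?h (\<tau> e)" using hom e by simp
    have c: "corr H e \<in> carrier (VG (\<tau> e))" "f e g \<in> carrier (VG (\<tau> e))" using e g by simp_all
    have "f e g = ?h (\<tau> e) (corr H e \<otimes>\<^bsub>VG (\<tau> e)\<^esub> f e g \<otimes>\<^bsub>VG (\<tau> e)\<^esub> inv\<^bsub>VG (\<tau> e)\<^esub> corr H e)"
      using left[of "\<tau> e" "f e g"] vhom_f[OF e g] eh[OF e g] e g by simp
    also have "\<dots> = ?h (\<tau> e) (corr H e) \<otimes>\<^bsub>VG (\<tau> e)\<^esub> ?h (\<tau> e) (f e g) \<otimes>\<^bsub>VG (\<tau> e)\<^esub> inv\<^bsub>VG (\<tau> e)\<^esub> ?h (\<tau> e) (corr H e)"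
      using c by simp
    finally have "f e g = \<dots>" .
    then have "ad (VG (\<tau> e)) (?h (\<tau> e) (inv\<^bsub>VG (\<tau> e)\<^esub> corr H e)) (f e g) =
      ad (VG (\<tau> e)) (?h (\<tau> e) (inv\<^bsub>VG (\<tau> e)\<^esub> corr H e))
       (?h (\<tau> e) (corr H e) \<otimes>\<^bsub>VG (\<tau> e)\<^esub> ?h (\<tau> e) (f e g) \<otimes>\<^bsub>VG (\<tau> e)\<^esub> inv\<^bsub>VG (\<tau> e)\<^esub> ?h (\<tau> e) (corr H e))"
      by (rule arg_cong)
    then show ?thesis using c by (simp add: ad_def G.m_assoc)
  qed
  have bij: "bij_betw (\<lambda>x. x) V V" "bij_betw (\<lambda>e. e) E E" by (simp_all add: bij_betw_def)
  have iso_id: "(\<lambda>g. g) \<in> iso (EG e) (EG e)" for e by (simp add: iso_def hom_def bij_betw_def)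
  show "gog_automorphism \<GG> inverse_aut"
    unfolding gog_automorphism_def inverse_aut_def using gog iso move
      group_hom.hom_closed[OF hom] bij iso_id by (auto simp: group.inv_closed)
  show "identity_on_graph \<GG> inverse_aut" by (simp add: identity_on_graph_def inverse_aut_def)
qed

lemma ind_inj:
  assumes eh: "\<And>e g. \<lbrakk>e \<in> E; g \<in> carrier (EG e)\<rbrakk> \<Longrightarrow> ehom H e g = g"
  shows "inj_on ind (carrier PG)"
proof -
  interpret I: gog_id_aut \<GG> inverse_aut using inverse_aut[OF eh] .
  have left: "vhom inverse_aut x (vhom H x g) = g" if "x \<in> V" "g \<in> carrier (VG x)" for x g
    using vhom_iso[OF that(1)] that(2) by (simp add: iso_def bij_betw_def inverse_aut_def)
  have El: "I.ind (ind (El x g)) = El x g" if "x \<in> V" "g \<in> carrier (VG x)" for x g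
    using that left by (simp add: ind_El I.ind_El)
  have corr: "El (\<tau> e) (corr inverse_aut e) = inv\<^bsub>PG\<^esub> I.ind (El (\<tau> e) (corr H e))" if "e \<in> E" for e
    using that I.vhom_closed group_hom.hom_inv[OF I.vhom_hom, of "\<tau> e" "corr H e"]
    by (simp add: I.ind_El El_inv[symmetric]) (simp add: inverse_aut_def)
  have St: "I.ind (ind (St e)) = St e" if e: "e \<in> E" for e
    using e by (simp add: ind_St I.ind_mult I.ind_inv I.ind_St corr PG.m_assoc)
  have "I.ind (ind (cls w)) = cls w" if "w \<in> lists L" for w
    using that
  proof (induction w rule: list.induct)
    case (Cons a w)
    have w: "w \<in> lists L" and a: "a \<in> L" using Cons.prems by simp_all
    show ?case
    proof (cases a)
      case (Elt x g)
      then have "cls (a # w) = El x g \<otimes>\<^bsub>PG\<^esub> cls w" using cls_Elt a w by blast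
      then show ?thesis using Cons.IH[OF w] El[of x g] a Elt cls_closed[OF w] by (simp add: ind_mult I.ind_mult)
    next
      case (Stable e)
      then have "cls (a # w) = St e \<otimes>\<^bsub>PG\<^esub> cls w" using cls_Stable a w by simp
      then show ?thesis using Cons.IH[OF w] St[of e] a Stable cls_closed[OF w] by (simp add: ind_mult I.ind_mult)
    qed
  qed (simp add: cls_Nil)
  then have "I.ind (ind X) = X" if "X \<in> carrier PG" for X using that by (auto simp: carrier_PG)
  then show ?thesis by (rule inj_on_inverseI)
qed

definition vh :: "nat \<Rightarrow> 'v \<Rightarrow> 'a \<Rightarrow> 'a" where
  "vh n x = (vhom H x ^^ n)"

text \<open>The correction terms of the \<open>n\<close>-th power. For the edge of the theorem, the
  inverse of \<open>cc n e\<close> is the \<delta>_n of the overview.\<close>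

fun cc :: "nat \<Rightarrow> 'e \<Rightarrow> 'a" where
  "cc 0 e = \<one>\<^bsub>VG (\<tau> e)\<^esub>"
| "cc (Suc n) e = vhom H (\<tau> e) (cc n e) \<otimes>\<^bsub>VG (\<tau> e)\<^esub> corr H e"

lemma vh_closed [simp]: "\<lbrakk>x \<in> V; g \<in> carrier (VG x)\<rbrakk> \<Longrightarrow> vh n x g \<in> carrier (VG x)"
  by (induction n) (simp_all add: vh_def)

lemma cc_closed [simp]: "e \<in> E \<Longrightarrow> cc n e \<in> carrier (VG (\<tau> e))"
  by (induction n) (simp_all add: monoid.m_closed)

lemma ind_pow_hom: "group_hom PG PG (ind ^^ n)"
proof (induction n)
  case 0
  then show ?case by (simp add: group_hom_def group_hom_axioms_def PG.is_group hom_def)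
next
  case (Suc n)
  have "ind \<circ> ind ^^ n \<in> hom PG PG"
    by (rule hom_compose) (use Suc ind_hom in \<open>simp_all add: group_hom_def group_hom_axioms_def\<close>)
  then show ?case by (simp only: funpow.simps group_hom_def group_hom_axioms_def PG.is_group simp_thms)
qed

lemma ind_pow_paths: "p \<in> paths x y \<Longrightarrow> (ind ^^ n) p \<in> paths x y"
  by (induction n) (simp_all add: ind_paths)

lemma ind_pow_El: "\<lbrakk>x \<in> V; g \<in> carrier (VG x)\<rbrakk> \<Longrightarrow> (ind ^^ n) (El x g) = El x (vh n x g)"
proof (induction n)
  case (Suc n)
  then show ?case using vh_closed[OF Suc.prems, of n] by (simp add: ind_El) (simp add: vh_def)
qed (simp add: vh_def)

lemma ind_pow_St:
  assumes e: "e \<in> E"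
  shows "(ind ^^ n) (St e) = El (\<tau> (bar e)) (cc n (bar e)) \<otimes>\<^bsub>PG\<^esub> St e \<otimes>\<^bsub>PG\<^esub> inv\<^bsub>PG\<^esub> El (\<tau> e) (cc n e)"
proof (induction n)
  case 0
  then show ?case using e by (simp add: El_one)
next
  case (Suc n)
  have El: "El (\<tau> e) (cc (Suc n) e) = El (\<tau> e) (vhom H (\<tau> e) (cc n e)) \<otimes>\<^bsub>PG\<^esub> El (\<tau> e) (corr H e)" if "e \<in> E" for e
    using that by (simp add: El_mult)
  show ?case using e unfolding El[OF e] El[OF bar_closed[OF e]]
    by (simp add: Suc ind_mult ind_inv ind_El ind_St PG.m_assoc PG.inv_mult_group)
qed

text \<open>With the correction terms of the power the image is written in one go instead of by
  iteration. A path then keeps its sequence of edges, and only vertex letters next to them are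
  inserted.\<close>

fun li :: "nat \<Rightarrow> ('v, 'e, 'a) letter \<Rightarrow> ('v, 'e, 'a) letter list" where
  "li n (Elt x g) = [Elt x (vh n x g)]"
| "li n (Stable e) = [Elt (\<tau> (bar e)) (cc n (bar e)), Stable e, Elt (\<tau> e) (inv\<^bsub>VG (\<tau> e)\<^esub> cc n e)]"

definition LI :: "nat \<Rightarrow> ('v, 'e, 'a) letter list \<Rightarrow> ('v, 'e, 'a) letter list" where
  "LI n w = concat (map (li n) w)"

lemma LI_simps [simp]: "LI n [] = []" "LI n (a # w) = li n a @ LI n w"
  by (simp_all add: LI_def)

lemma li_lists: "a \<in> L \<Longrightarrow> li n a \<in> lists L"
  by (cases a) (auto simp: group.inv_closed)

lemma LI_lists: "w \<in> lists L \<Longrightarrow> LI n w \<in> lists L"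
  using li_lists by (induction w) auto

lemma cls_LI: "w \<in> lists L \<Longrightarrow> cls (LI n w) = (ind ^^ n) (cls w)"
proof (induction w rule: list.induct)
  case Nil
  then show ?case using group_hom.hom_one[OF ind_pow_hom, of n] by (simp add: cls_Nil)
next
  case (Cons a w)
  have w: "w \<in> lists L" and a: "a \<in> L" using Cons.prems by simp_all
  have m: "cls (LI n (a # w)) = cls (li n a) \<otimes>\<^bsub>PG\<^esub> (ind ^^ n) (cls w)"
    using cls_append[OF li_lists[OF a] LI_lists[OF w]] Cons.IH[OF w] by simp
  have "cls (li n a) = (ind ^^ n) (cls [a])"
  proof (cases a)
    case (Elt x g)
    then show ?thesis using a ind_pow_El[of x g n] by (simp add: El_def)
  next
    case (Stable e)
    then show ?thesis using a ind_pow_St[of e n]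
      by (simp add: St_def[symmetric] cls_Elt cls_Stable cls_Nil group.inv_closed El_inv PG.m_assoc)
  qed
  moreover have "(ind ^^ n) (cls (a # w)) = (ind ^^ n) (cls [a]) \<otimes>\<^bsub>PG\<^esub> (ind ^^ n) (cls w)"
    unfolding cls_Cons[OF a w] using a w by (intro group_hom.hom_mult[OF ind_pow_hom]) simp_all
  ultimately show ?case using m by simp
qed

end

section \<open>Access to the edge\<close>

context gog
begin

fun src :: "('v, 'e, 'a) letter \<Rightarrow> 'v" where
  "src (Elt x g) = x"
| "src (Stable e) = \<tau> (bar e)"

lemma first_arrival:
  assumes "path_word \<GG> x w y"
  shows "(\<exists>a b. w = a @ b \<and> path_word \<GG> x a v \<and> path_word \<GG> v b y \<and> (\<forall>l \<in> set a. src l \<noteq> v)) \<or>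
    y \<noteq> v \<and> (\<forall>l \<in> set w. src l \<noteq> v)"
  using assms
proof (induction w arbitrary: x)
  case Nil
  then show ?case by auto
next
  case (Cons l w)
  show ?case
  proof (cases "x = v")
    case True
    then have "l # w = [] @ (l # w) \<and> path_word \<GG> x [] v \<and> path_word \<GG> v (l # w) y \<and> (\<forall>l \<in> set []. src l \<noteq> v)"
      using Cons.prems by simp
    then show ?thesis by blast
  next
    case False
    obtain z where z: "path_word \<GG> x [l] z" "path_word \<GG> z w y" "src l = x"
      using Cons.prems by (cases l) auto
    from Cons.IH[OF z(2)] show ?thesis
    proof (elim disjE exE conjE)
      fix a b assume h: "w = a @ b" "path_word \<GG> z a v" "path_word \<GG> v b y" "\<forall>l \<in> set a. src l \<noteq> v"
      have "path_word \<GG> x (l # a) v" using z(1) h(2) by (cases l) auto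
      then have "l # w = (l # a) @ b \<and> path_word \<GG> x (l # a) v \<and> path_word \<GG> v b y \<and> (\<forall>l \<in> set (l # a). src l \<noteq> v)"
        using h z(3) False by simp
      then show ?thesis by blast
    qed (use z(3) False in auto)
  qed
qed

text \<open>A shortest detour through the edge \<open>e\<close>: either its initial vertex is accessible without
  crossing \<open>e\<close>, or it is only accessible by crossing \<open>e\<close> backwards, and then some essential loop at
  the initial vertex avoids the terminal vertex.\<close>

lemma traverses_cases:
  assumes e: "e \<in> E" and X: "X \<in> paths u u" and tr: "traverses \<GG> u e X"
  shows "(\<exists>a \<in> lists L. path_word \<GG> u a (\<tau> (bar e)) \<and> (\<forall>l \<in> set a. l \<noteq> Stable e \<and> l \<noteq> Stable (bar e))) \<or>
    (\<exists>a \<in> lists L. \<exists>b \<in> lists L. path_word \<GG> u a (\<tau> e) \<and> (\<forall>l \<in> set a. src l \<noteq> \<tau> e) \<and>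
       path_word \<GG> (\<tau> (bar e)) b (\<tau> (bar e)) \<and> (\<forall>l \<in> set b. src l \<noteq> \<tau> e) \<and> \<tau> (bar e) \<noteq> \<tau> e \<and> cls b \<noteq> \<one>\<^bsub>PG\<^esub>)"
    (is "?A \<or> ?B")
proof -
  define P where "P l \<longleftrightarrow> l = Stable e \<or> l = Stable (bar e)" for l :: "('v, 'e, 'a) letter"
  define N where "N w = length (filter P w)" for w
  obtain w0 where w0: "w0 \<in> lists L" "path_word \<GG> u w0 u" "X = cls w0" using X by (auto simp: paths_def)
  define W where "W w \<longleftrightarrow> w \<in> lists L \<and> path_word \<GG> u w u \<and> cls w = X" for w
  have "W w0" using w0 by (simp add: W_def)
  then obtain w where w: "W w" and min: "\<And>w'. W w' \<Longrightarrow> N w \<le> N w'"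
    using ex_has_least_nat[of W w0 N] by blast
  have wl: "w \<in> lists L" "path_word \<GG> u w u" "cls w = X" using w by (simp_all add: W_def)
  have "w \<in> X" using wl(1,3) by (auto simp: path_cong_def intro: word_cong.refl)
  then have ex: "\<exists>l \<in> set w. P l" using tr wl(1,2) unfolding traverses_def loop_words_def P_def by blast
  have Plv: "P (lv l) \<longleftrightarrow> P l" for l by (cases l) (use bar_bar in \<open>auto simp: P_def\<close>, metis bar_bar)
  have Piw: "(\<forall>l \<in> set (iw x). \<not> P l) \<longleftrightarrow> (\<forall>l \<in> set x. \<not> P l)" for x
    by (induction x) (auto simp: Plv)
  have A: ?A if "a \<in> lists L" "path_word \<GG> u a (\<tau> (bar e))" "\<forall>l \<in> set a. \<not> P l" for a
    using that unfolding P_def by blast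
  obtain a l r where s: "w = a @ l # r" "P l" "\<forall>l \<in> set a. \<not> P l"
    using split_list_first_prop[OF ex] by metis
  have al: "a \<in> lists L" "r \<in> lists L" using wl(1) s(1) by auto
  show ?thesis
  proof (cases "l = Stable e")
    case True
    then have "path_word \<GG> u a (\<tau> (bar e))" using wl(2) s(1) by (simp add: path_word_append)
    then show ?thesis using A[OF al(1) _ s(3)] by simp
  next
    case False
    then have l: "l = Stable (bar e)" using s(2) by (simp add: P_def)
    then have pa: "path_word \<GG> u a (\<tau> e)" and pr: "path_word \<GG> (\<tau> (bar e)) r u"
      using wl(2) s(1) by (auto simp: path_word_append)
    show ?thesis
    proof (cases "\<exists>l \<in> set r. P l")
      case False
      \<comment> \<open>With a single crossing, the remainder of the loop read backwards leads from
        \<open>u\<close> to the initial vertex and avoids \<open>e\<close>.\<close>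
      have "path_word \<GG> u (iw r) (\<tau> (bar e))" using path_word_iw[OF al(2) pr] .
      then show ?thesis using A[of "iw r"] P.iw_lists[OF al(2)] False Piw by blast
    next
      case True
      then obtain b l' r' where t: "r = b @ l' # r'" "P l'" "\<forall>l \<in> set b. \<not> P l"
        using split_list_first_prop[OF True] by metis
      have bl: "b \<in> lists L" "r' \<in> lists L" using al(2) t(1) by auto
      \<comment> \<open>As \<open>a\<close> reaches the terminal vertex without crossing
        \<open>e\<close>, any such connection \<open>c\<close> of the two ends, read backwards,
        completes it to the initial vertex.\<close>
      have join: ?A if c: "c \<in> lists L" "path_word \<GG> (\<tau> (bar e)) c (\<tau> e)" "\<forall>l \<in> set c. \<not> P l" for c
      proof (rule A[of "a @ iw c"])
        show "a @ iw c \<in> lists L" using al(1) P.iw_lists[OF c(1)] by simp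
        show "path_word \<GG> u (a @ iw c) (\<tau> (bar e))" using pa path_word_iw[OF c(1,2)] by (auto simp: path_word_append)
        have "\<forall>l \<in> set (iw c). \<not> P l" using Piw c(3) by blast
        then show "\<forall>l \<in> set (a @ iw c). \<not> P l" using s(3) by (auto simp only: set_append)
      qed
      show ?thesis
      proof (cases "l' = Stable e")
        case False
        then have "l' = Stable (bar e)" using t(2) by (simp add: P_def)
        then have "path_word \<GG> (\<tau> (bar e)) b (\<tau> e)" using pr t(1) by (auto simp: path_word_append)
        then show ?thesis using join[OF bl(1) _ t(3)] by simp
      next
        case True
        then have pb: "path_word \<GG> (\<tau> (bar e)) b (\<tau> (bar e))" and pr': "path_word \<GG> (\<tau> e) r' u"
          using pr t(1) by (auto simp: path_word_append)
        have nb: "cls b \<noteq> \<one>\<^bsub>PG\<^esub>"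
        proof
          assume b1: "cls b = \<one>\<^bsub>PG\<^esub>"
          have lr: "Stable e # r' \<in> lists L" "b @ Stable e # r' \<in> lists L" "Stable (bar e) # b @ Stable e # r' \<in> lists L"
            using e bl by simp_all
          have "X = cls a \<otimes>\<^bsub>PG\<^esub> (St (bar e) \<otimes>\<^bsub>PG\<^esub> (cls b \<otimes>\<^bsub>PG\<^esub> (St e \<otimes>\<^bsub>PG\<^esub> cls r')))"
            using wl(3) s(1) l t(1) True cls_append[OF al(1) lr(3)] cls_Stable[OF bar_closed[OF e] lr(2)]
              cls_append[OF bl(1) lr(1)] cls_Stable[OF e bl(2)] by simp
          also have "\<dots> = cls a \<otimes>\<^bsub>PG\<^esub> cls r'"
            using b1 e cls_closed[OF al(1)] cls_closed[OF bl(2)] by (simp add: St_bar)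
          finally have "W (a @ r')" using al(1) bl(2) pa pr' cls_append[OF al(1) bl(2)]
            by (auto simp: W_def path_word_append)
          moreover have "N (a @ r') < N w" using s(1,2) t(1,2) by (simp add: N_def)
          ultimately show False using min by fastforce
        qed
        from first_arrival[OF pb, of "\<tau> e"] show ?thesis
        proof (elim disjE exE conjE)
          fix b1 b2 assume h: "b = b1 @ b2" "path_word \<GG> (\<tau> (bar e)) b1 (\<tau> e)"
          have "b1 \<in> lists L" "\<forall>l \<in> set b1. \<not> P l" using h(1) bl(1) t(3) by auto
          then show ?thesis using join[OF _ h(2)] by blast
        next
          assume h: "\<tau> (bar e) \<noteq> \<tau> e" "\<forall>l \<in> set b. src l \<noteq> \<tau> e"
          from first_arrival[OF pa, of "\<tau> e"] obtain a1 a2 where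
            "a = a1 @ a2" "path_word \<GG> u a1 (\<tau> e)" "\<forall>l \<in> set a1. src l \<noteq> \<tau> e" by blast
          moreover have "a1 \<in> lists L" using calculation(1) al(1) by simp
          ultimately have ?B using bl(1) pb h nb by blast
          then show ?thesis ..
        qed
      qed
    qed
  qed
qed

end

lemma at_least_quadratic_growthI:
  assumes fg: "finitely_generated G" and g: "g \<in> carrier G"
    and AB: "A > 0" "B \<ge> 0" and low: "\<And>n. int n * int n \<le> A * l n + B * int n + B"
    and up: "\<And>S. \<lbrakk>finite S; generating_set G S\<rbrakk> \<Longrightarrow>
      \<exists>M\<ge>0. \<forall>n. l n \<le> M * int (word_length G S ((\<phi> ^^ n) g))"
  shows "at_least_quadratic_growth G \<phi>"
proof -
  have "\<exists>p :: real poly. degree p = 2 \<and> lead_coeff p > 0 \<and>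
      (\<forall>n. poly p (real n) \<le> real (word_length G S ((\<phi> ^^ n) g)))"
    if S: "finite S" "generating_set G S" for S
  proof -
    obtain M where M: "M \<ge> 0" "\<And>n. l n \<le> M * int (word_length G S ((\<phi> ^^ n) g))" using up[OF S] by blast
    \<comment> \<open>The summand 1 keeps \<open>K\<close> positive when \<open>M\<close> is
      zero.\<close>
    define K where "K = real_of_int (A * M + 1)"
    have K: "K > 0" using AB M(1) by (simp add: K_def add_nonneg_pos del: of_int_add)
    define b where "b = real_of_int B"
    \<comment> \<open>The inequality \<open>h\<close> below, solved for the word length.\<close>
    define p where "p = [: - b / K, - b / K, 1 / K :]"
    have "poly p (real n) \<le> real (word_length G S ((\<phi> ^^ n) g))" for n
    proof -
      define k where "k = word_length G S ((\<phi> ^^ n) g)"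
      have "A * l n \<le> A * (M * int k)" using M(2)[of n] AB by (intro mult_left_mono) (simp_all add: k_def)
      then have "int n * int n \<le> (A * M + 1) * int k + B * int n + B" using low[of n] by (simp add: algebra_simps)
      then have "real_of_int (int n * int n) \<le> real_of_int ((A * M + 1) * int k + B * int n + B)"
        by (simp only: of_int_le_iff)
      then have h: "real n * real n \<le> K * real k + b * real n + b" by (simp add: K_def b_def)
      have "poly p (real n) = (real n * real n - b * real n - b) / K"
        by (simp add: p_def diff_divide_distrib add_divide_distrib algebra_simps)
      also have "\<dots> \<le> real k" using h K by (simp add: pos_divide_le_eq algebra_simps)
      finally show ?thesis by (simp add: k_def)
    qed
    moreover have "degree p = 2" "lead_coeff p > 0" using K by (simp_all add: p_def)
    ultimately show ?thesis by blast
  qed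
  then show ?thesis using fg g by (auto simp: at_least_quadratic_growth_def)
qed

section \<open>Detecting the syllable by an automaton\<close>

locale twist_at = gog_id_aut \<GG> H for \<GG> :: "('v, 'e, 'a, 'b) gog" and H +
  fixes e :: 'e
  assumes eE: "e \<in> E" and trivial: "\<And>d. d \<in> E \<Longrightarrow> \<tau> d = \<tau> e \<Longrightarrow> carrier (EG d) = {\<one>\<^bsub>EG d\<^esub>}"
    and inj: "inj_on ind (carrier PG)"
begin

abbreviation "v \<equiv> \<tau> e"

lemma v: "v \<in> V" using eE by simp

text \<open>This is \<psi>_n of the overview, by the relation between \<open>cc n e\<close> and
  \<delta>_n.\<close>

definition syl :: "nat \<Rightarrow> 'a \<Rightarrow> 'a" where
  "syl n y = inv\<^bsub>VG v\<^esub> cc n e \<otimes>\<^bsub>VG v\<^esub> vh n v y \<otimes>\<^bsub>VG v\<^esub> cc n e"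

definition probe :: "('v, 'e, 'a) letter list \<Rightarrow> 'a \<Rightarrow> ('v, 'e, 'a) letter list set" where
  "probe w y = cls w \<otimes>\<^bsub>PG\<^esub> St e \<otimes>\<^bsub>PG\<^esub> El v y \<otimes>\<^bsub>PG\<^esub> inv\<^bsub>PG\<^esub> St e \<otimes>\<^bsub>PG\<^esub> inv\<^bsub>PG\<^esub> cls w"

lemma probe_paths:
  assumes "w \<in> lists L" "path_word \<GG> u w (\<tau> (bar e))" "y \<in> carrier (VG v)"
  shows "probe w y \<in> paths u u"
proof -
  have w: "cls w \<in> paths u (\<tau> (bar e))" using assms by (auto simp: paths_def)
  show ?thesis unfolding probe_def
    by (rule paths_mult[OF paths_mult[OF paths_mult[OF paths_mult[OF w St_paths[OF eE]] El_paths[OF v assms(3)]]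
          paths_inv[OF St_paths[OF eE]]] paths_inv[OF w]])
qed

definition stem :: "nat \<Rightarrow> ('v, 'e, 'a) letter list \<Rightarrow> ('v, 'e, 'a) letter list" where
  "stem n w = LI n w @ [Elt (\<tau> (bar e)) (cc n (bar e)), Stable e]"

lemma stem_lists: "w \<in> lists L \<Longrightarrow> stem n w \<in> lists L"
  using LI_lists[of w n] eE by (simp add: stem_def)

lemma probe_image:
  assumes w: "w \<in> lists L" and y: "y \<in> carrier (VG v)"
  shows "(ind ^^ n) (probe w y) =
    cls (stem n w @ [Elt v (inv\<^bsub>VG v\<^esub> cc n e), Elt v (vh n v y), Elt v (cc n e)] @ iw (stem n w))"
proof -
  interpret h: group_hom PG PG "ind ^^ n" by (rule ind_pow_hom)
  have c: "cls w \<in> carrier PG" "St e \<in> carrier PG" "El v y \<in> carrier PG" "cls (stem n w) \<in> carrier PG"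
    "(ind ^^ n) (cls w) \<in> carrier PG"
    using w y eE v h.hom_closed[of "cls w"] cls_closed[OF w] cls_closed[OF stem_lists[OF w]] by (simp_all del: h.hom_closed)
  have cs: "cls (stem n w) = (ind ^^ n) (cls w) \<otimes>\<^bsub>PG\<^esub> El (\<tau> (bar e)) (cc n (bar e)) \<otimes>\<^bsub>PG\<^esub> St e"
  proof -
    have l: "[Elt (\<tau> (bar e)) (cc n (bar e)), Stable e] \<in> lists L" using eE by simp
    show ?thesis unfolding stem_def cls_append[OF LI_lists[OF w] l] cls_LI[OF w]
      using eE c by (simp add: cls_Elt St_def[symmetric] PG.m_assoc)
  qed
  have l: "iw (stem n w) \<in> lists L" "[Elt v (inv\<^bsub>VG v\<^esub> cc n e), Elt v (vh n v y), Elt v (cc n e)] \<in> lists L"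
    "[Elt v (inv\<^bsub>VG v\<^esub> cc n e), Elt v (vh n v y), Elt v (cc n e)] @ iw (stem n w) \<in> lists L"
    using P.iw_lists[OF stem_lists[OF w, of n]] v y eE by (simp_all add: group.inv_closed)
  have "cls (stem n w @ [Elt v (inv\<^bsub>VG v\<^esub> cc n e), Elt v (vh n v y), Elt v (cc n e)] @ iw (stem n w)) =
    cls (stem n w) \<otimes>\<^bsub>PG\<^esub> (inv\<^bsub>PG\<^esub> El v (cc n e) \<otimes>\<^bsub>PG\<^esub> (El v (vh n v y) \<otimes>\<^bsub>PG\<^esub> El v (cc n e)) \<otimes>\<^bsub>PG\<^esub> inv\<^bsub>PG\<^esub> cls (stem n w))"
    unfolding cls_append[OF stem_lists[OF w] l(3)] cls_append[OF l(2,1)] cls_iw[OF stem_lists[OF w]]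
    using v y eE by (simp add: cls_Elt El_def[symmetric] group.inv_closed El_inv)
  also have "\<dots> = (ind ^^ n) (probe w y)"
    unfolding probe_def cs using c v y eE
    by (simp add: ind_pow_El ind_pow_St PG.m_assoc PG.inv_mult_group)
  finally show ?thesis by simp
qed

text \<open>Length and weights are kept arbitrary so that the automata can be treated without
  reference to the efficient representative that later supplies the length.\<close>

definition detects :: "('v, 'e, 'a) letter list \<Rightarrow> bool" where
  "detects w \<longleftrightarrow> (\<forall>n y (len :: 'a \<Rightarrow> int) (wt :: ('v, 'e, 'a) letter \<Rightarrow> int) W. y \<in> carrier (VG v) \<and> len \<one>\<^bsub>VG v\<^esub> = 0 \<and>
     (\<forall>a \<in> carrier (VG v). \<forall>b \<in> carrier (VG v). len (a \<otimes>\<^bsub>VG v\<^esub> b) \<le> len a + len b) \<and>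
     (\<forall>l. 0 \<le> wt l) \<and> (\<forall>g \<in> carrier (VG v). len g \<le> wt (Elt v g)) \<and>
     W \<in> lists L \<and> cls W = (ind ^^ n) (probe w y) \<longrightarrow> len (syl n y) \<le> (\<Sum>l\<leftarrow>W. wt l))"

text \<open>The state reached after the stem is the observed one. By \<open>cmp\<close> the stem
  contributes nothing in it, hence neither does its inverse, and exactly the syllable between them
  is recorded. Being invariant, the record is the same for every word of that element.\<close>

lemma detectsI:
  assumes cnt: "counter \<GG> v stp Q" and w: "w \<in> lists L" and q: "q \<in> Q"
    and cmp: "\<And>n. counter.comp \<GG> v stp (counter.run stp q (stem n w)) q (stem n w) = \<one>\<^bsub>VG v\<^esub>"
  shows "detects w"
  unfolding detects_def
proof (intro allI impI, elim conjE)
  fix n y and len :: "'a \<Rightarrow> int" and wt :: "('v, 'e, 'a) letter \<Rightarrow> int" and W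
  assume y: "y \<in> carrier (VG v)" and len: "len \<one>\<^bsub>VG v\<^esub> = 0"
    "\<forall>a \<in> carrier (VG v). \<forall>b \<in> carrier (VG v). len (a \<otimes>\<^bsub>VG v\<^esub> b) \<le> len a + len b"
    and wt: "\<forall>l. 0 \<le> wt l" "\<forall>g \<in> carrier (VG v). len g \<le> wt (Elt v g)"
    and W: "W \<in> lists L" "cls W = (ind ^^ n) (probe w y)"
  \<comment> \<open>The observed state may depend on \<open>n\<close>; the automaton and its initial
    state do not.\<close>
  define \<beta> where "\<beta> = counter.run stp q (stem n w)"
  interpret C: counter \<GG> v stp Q \<beta> by (rule cnt)
  let ?U = "stem n w @ [Elt v (inv\<^bsub>VG v\<^esub> cc n e), Elt v (vh n v y), Elt v (cc n e)] @ iw (stem n w)"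
  have U: "?U \<in> lists L"
    using stem_lists[OF w, of n] P.iw_lists[OF stem_lists[OF w, of n]] v y eE by (simp add: group.inv_closed)
  have "W \<approx> ?U" using W(2) probe_image[OF w y] cls_eq_iff[OF W(1) U] by simp
  then have "C.comp q W = C.comp q ?U" using C.comp_cong q by blast
  also have "\<dots> = syl n y"
    unfolding syl_def by (rule C.comp_conjugate)
      (use stem_lists[OF w] q cmp[of n] v y eE in \<open>simp_all add: \<beta>_def group.inv_closed\<close>)
  finally show "len (syl n y) \<le> (\<Sum>l\<leftarrow>W. wt l)"
    using C.comp_weight[of len wt W q] len wt W(1) by simp
qed

lemma Stable_in_LI: "Stable d \<in> set (LI n w) \<longleftrightarrow> Stable d \<in> set w"
proof (induction w)
  case (Cons a w)
  then show ?case by (cases a) auto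
qed simp

text \<open>The state counts the crossings of \<open>e\<close> with signs.\<close>

lemma detects_direct:
  assumes a: "a \<in> lists L" "Stable e \<notin> set a" "Stable (bar e) \<notin> set a"
  shows "detects a"
proof -
  define stp :: "('v, 'e, 'a) letter \<Rightarrow> int \<Rightarrow> int" where
    "stp l q = (if l = Stable e then q + 1 else if l = Stable (bar e) then q - 1 else q)" for l q
  have stp: "stp (Elt x g) q = q" "stp (Stable d) q = (if d = e then q + 1 else if d = bar e then q - 1 else q)" for x g d q
    by (simp_all add: stp_def)
  have eb: "bar d = e \<longleftrightarrow> d = bar e" "bar d = bar e \<longleftrightarrow> d = e" for d by (metis bar_bar)+
  have cnt: "counter \<GG> v stp UNIV"
    by unfold_locales (use v trivial eE in \<open>auto simp: stp eb\<close>)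
  interpret C: counter \<GG> v stp UNIV 1 by (rule cnt)
  have id: "C.run 0 w = 0 \<and> C.comp 0 w = \<one>\<^bsub>VG v\<^esub>"
    if "Stable e \<notin> set w" "Stable (bar e) \<notin> set w" for w
    using that
  proof (induction w)
    case (Cons l w)
    then show ?case by (cases l) (auto simp: stp)
  qed simp
  show ?thesis
  proof (rule detectsI[OF cnt a(1)])
    fix n
    let ?s = "[Elt (\<tau> (bar e)) (cc n (bar e)), Stable e]"
    have LI: "C.run 0 (LI n a) = 0" "C.comp 0 (LI n a) = \<one>\<^bsub>VG v\<^esub>" using id[of "LI n a"] a by (simp_all add: Stable_in_LI)
    have "?s \<in> lists L" using eE by simp
    then have "C.comp 0 (stem n a) = \<one>\<^bsub>VG v\<^esub>"
      using C.comp_append[OF LI_lists[OF a(1)], of ?s 0] LI v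
      by (simp add: stem_def stp monoid.l_one)
    moreover have "C.run 0 (stem n a) = 1" using LI by (simp add: stem_def C.run_append stp)
    ultimately show "counter.comp \<GG> v stp (C.run 0 (stem n a)) 0 (stem n a) = \<one>\<^bsub>VG v\<^esub>" by simp
  qed simp
qed

text \<open>Letters of the image sit at vertices that the path itself visits, and this path never is
  at \<open>v\<close>, not even at its end.\<close>

lemma Elt_in_LI:
  assumes "w \<in> lists L" "path_word \<GG> x w y" "\<forall>l \<in> set w. src l \<noteq> v" "y \<noteq> v" "Elt z g \<in> set (LI n w)"
  shows "z \<noteq> v"
  using assms
proof (induction w arbitrary: x rule: list.induct)
  case (Cons l w)
  show ?case
  proof (cases l)
    case (Elt x' h)
    then show ?thesis using Cons by auto
  next
    case (Stable d)
    have "\<tau> d \<noteq> v"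
    proof
      assume "\<tau> d = v"
      then show False using Cons.prems Stable by (cases w; cases "hd w") auto
    qed
    then show ?thesis using Cons Stable by auto
  qed
qed simp

text \<open>The state multiplies up the path, with the letters from \<open>G\<^sub>v\<close> omitted.\<close>

lemma detects_detour:
  assumes a: "a \<in> lists L" "path_word \<GG> u a v" "\<forall>l \<in> set a. src l \<noteq> v"
    and b: "b \<in> lists L" "path_word \<GG> (\<tau> (bar e)) b (\<tau> (bar e))" "\<forall>l \<in> set b. src l \<noteq> v" "cls b \<noteq> \<one>\<^bsub>PG\<^esub>"
    and ne: "\<tau> (bar e) \<noteq> v"
  shows "detects (a @ Stable (bar e) # b)"
proof -
  define stp where "stp l q = (case l of Elt x g \<Rightarrow> if x = v then q else q \<otimes>\<^bsub>PG\<^esub> El x g | Stable d \<Rightarrow> q \<otimes>\<^bsub>PG\<^esub> St d)"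
    for l :: "('v, 'e, 'a) letter" and q
  have stp: "stp (Elt x g) q = (if x = v then q else q \<otimes>\<^bsub>PG\<^esub> El x g)" "stp (Stable d) q = q \<otimes>\<^bsub>PG\<^esub> St d" for x g d q
    by (simp_all add: stp_def)
  have cnt: "counter \<GG> v stp (carrier PG)"
  proof
    show "stp l q \<in> carrier PG" if "l \<in> L" "q \<in> carrier PG" for l q
      using that by (cases l) (auto simp: stp)
    show "stp (Stable (bar d)) (stp (Elt (\<tau> d) (f d g)) (stp (Stable d) q)) = stp (Elt (\<tau> (bar d)) (f (bar d) g)) q"
      if d: "d \<in> E" and g: "g \<in> carrier (EG d)" and q: "q \<in> carrier PG" for d g q
    \<comment> \<open>For an edge that meets \<open>v\<close> the edge group is trivial, so omitting
      the letters from \<open>v\<close> does not disturb the edge relation.\<close>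
    proof (cases "\<tau> d = v \<or> \<tau> (bar d) = v")
      case True
      then have "g = \<one>\<^bsub>EG d\<^esub>" using trivial[of d] trivial[of "bar d"] d g by auto
      moreover have "f (bar d) \<one>\<^bsub>EG d\<^esub> = \<one>\<^bsub>VG (\<tau> (bar d))\<^esub>" using f_one[of "bar d"] d by simp
      ultimately show ?thesis using d q by (simp add: stp El_one St_bar PG.m_assoc)
    next
      case False
      have fb: "f (bar d) g \<in> carrier (VG (\<tau> (bar d)))" using f_closed[of "bar d" g] d g by simp
      have "q \<otimes>\<^bsub>PG\<^esub> St d \<otimes>\<^bsub>PG\<^esub> El (\<tau> d) (f d g) \<otimes>\<^bsub>PG\<^esub> St (bar d) =
        q \<otimes>\<^bsub>PG\<^esub> (St d \<otimes>\<^bsub>PG\<^esub> El (\<tau> d) (f d g)) \<otimes>\<^bsub>PG\<^esub> St (bar d)" using d g q by (simp add: PG.m_assoc)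
      also have "\<dots> = q \<otimes>\<^bsub>PG\<^esub> El (\<tau> (bar d)) (f (bar d) g)"
        unfolding St_rel[OF d g] using d g q fb by (simp add: PG.m_assoc St_bar)
      finally show ?thesis using False by (simp add: stp)
    qed
  qed (use v trivial in \<open>auto simp: stp El_one El_mult PG.m_assoc St_bar\<close>)
  interpret C0: counter \<GG> v stp "carrier PG" "\<one>\<^bsub>PG\<^esub>" by (rule cnt)
  let ?w = "a @ Stable (bar e) # b"
  have be: "bar e \<in> E" using eE by simp
  have wl: "?w \<in> lists L" using a(1) b(1) be by simp
  show ?thesis
  proof (rule detectsI[OF cnt wl PG.one_closed])
    fix n
    \<comment> \<open>The part of the stem after the vertex letter that the image of
      \<open>Stable (bar e)\<close> contributes at \<open>v\<close>. It represents a conjugate of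
      the image of \<open>b\<close>, and no letter from \<open>v\<close> occurs in it.\<close>
    define M where "M = [Stable (bar e), Elt (\<tau> (bar e)) (inv\<^bsub>VG (\<tau> (bar e))\<^esub> cc n (bar e))] @ LI n b @
      [Elt (\<tau> (bar e)) (cc n (bar e)), Stable e]"
    have stem: "stem n ?w = LI n a @ Elt v (cc n e) # M"
      by (simp add: stem_def M_def LI_def)
    have "cc n (bar e) \<in> carrier (VG (\<tau> (bar e)))" by (rule cc_closed[OF be])
    then have Ml: "M \<in> lists L" and eMl: "Elt v (cc n e) # M \<in> lists L"
      using LI_lists[OF b(1), of n] be eE v by (simp_all add: M_def group.inv_closed)
    define p where "p = C0.run \<one>\<^bsub>PG\<^esub> (LI n a)"
    have p: "p \<in> carrier PG" unfolding p_def by (rule C0.run_Q[OF LI_lists[OF a(1)] PG.one_closed])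
    define \<beta> where "\<beta> = p \<otimes>\<^bsub>PG\<^esub> cls M"
    interpret C: counter \<GG> v stp "carrier PG" \<beta> by (rule cnt)
    \<comment> \<open>This is where \<open>b\<close> being essential and \<open>ind\<close> being
      injective are used. If \<open>M\<close> were trivial, the letter \<open>cc n e\<close> in
      front of it would be read in the observed state as well and spoil the record.\<close>
    have "cls M \<noteq> \<one>\<^bsub>PG\<^esub>"
    proof
      define r where "r = El (\<tau> (bar e)) (cc n (bar e))"
      have r: "r \<in> carrier PG" "El (\<tau> (bar e)) (inv\<^bsub>VG (\<tau> (bar e))\<^esub> cc n (bar e)) = inv\<^bsub>PG\<^esub> r"
        using be cc_closed[OF be, of n] by (simp_all add: r_def El_inv)
      have bc: "cls (LI n b) \<in> carrier PG" using cls_closed[OF LI_lists[OF b(1)]] .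
      have l1: "[Elt (\<tau> (bar e)) (cc n (bar e)), Stable e] \<in> lists L" using be eE by simp
      then have l2: "LI n b @ [Elt (\<tau> (bar e)) (cc n (bar e)), Stable e] \<in> lists L" using LI_lists[OF b(1), of n] by simp
      have l3: "Elt (\<tau> (bar e)) (inv\<^bsub>VG (\<tau> (bar e))\<^esub> cc n (bar e)) \<in> L" using be by (simp add: group.inv_closed)
      have "cls M = inv\<^bsub>PG\<^esub> St e \<otimes>\<^bsub>PG\<^esub> (inv\<^bsub>PG\<^esub> r \<otimes>\<^bsub>PG\<^esub> (cls (LI n b) \<otimes>\<^bsub>PG\<^esub> (r \<otimes>\<^bsub>PG\<^esub> St e)))"
        unfolding M_def using cls_Stable[OF be, of "Elt (\<tau> (bar e)) (inv\<^bsub>VG (\<tau> (bar e))\<^esub> cc n (bar e)) #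
            LI n b @ [Elt (\<tau> (bar e)) (cc n (bar e)), Stable e]"] cls_Elt[OF l3 l2]
          cls_append[OF LI_lists[OF b(1), of n] l1] l3 l2 be eE r
        by (simp add: cls_Elt St_def[symmetric] r_def[symmetric] St_bar)
      moreover assume "cls M = \<one>\<^bsub>PG\<^esub>"
      ultimately have "\<one>\<^bsub>PG\<^esub> = inv\<^bsub>PG\<^esub> (r \<otimes>\<^bsub>PG\<^esub> St e) \<otimes>\<^bsub>PG\<^esub> cls (LI n b) \<otimes>\<^bsub>PG\<^esub> (r \<otimes>\<^bsub>PG\<^esub> St e)"
        using r(1) bc eE by (simp add: PG.m_assoc PG.inv_mult_group)
      then have "(r \<otimes>\<^bsub>PG\<^esub> St e) \<otimes>\<^bsub>PG\<^esub> \<one>\<^bsub>PG\<^esub> \<otimes>\<^bsub>PG\<^esub> inv\<^bsub>PG\<^esub> (r \<otimes>\<^bsub>PG\<^esub> St e) = (r \<otimes>\<^bsub>PG\<^esub> St e) \<otimes>\<^bsub>PG\<^esub>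
        (inv\<^bsub>PG\<^esub> (r \<otimes>\<^bsub>PG\<^esub> St e) \<otimes>\<^bsub>PG\<^esub> cls (LI n b) \<otimes>\<^bsub>PG\<^esub> (r \<otimes>\<^bsub>PG\<^esub> St e)) \<otimes>\<^bsub>PG\<^esub> inv\<^bsub>PG\<^esub> (r \<otimes>\<^bsub>PG\<^esub> St e)"
        by (simp only:)
      then have "(ind ^^ n) (cls b) = \<one>\<^bsub>PG\<^esub>"
        using r(1) bc eE cls_LI[OF b(1)] by (simp add: PG.m_assoc)
      moreover have "inj_on (ind ^^ n) (carrier PG)"
      proof (induction n)
        case (Suc n)
        then have "inj_on (ind \<circ> ind ^^ n) (carrier PG)"
          using group_hom.hom_closed[OF ind_pow_hom, of _ n] by (intro comp_inj_on inj_on_subset[OF inj]) auto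
        then show ?case by (simp only: funpow.simps)
      qed simp
      ultimately show False
        using b(4) inj_onD[of "ind ^^ n" "carrier PG" "cls b" "\<one>\<^bsub>PG\<^esub>"] cls_closed[OF b(1)]
          group_hom.hom_one[OF ind_pow_hom, of n] by simp
    qed
    then have p\<beta>: "p \<noteq> \<beta>" using p cls_closed[OF Ml] PG.r_cancel_one' by (simp add: \<beta>_def)
    \<comment> \<open>Letters from \<open>v\<close> can occur in the image only at its very end.
      They do not change the state, so they are read in the final state, which is assumed to differ
      from \<open>\<beta>\<close>.\<close>
    have LIa: "C.comp q (LI n w) = \<one>\<^bsub>VG v\<^esub>"
      if "w \<in> lists L" "path_word \<GG> x w v" "\<forall>l \<in> set w. src l \<noteq> v" "C.run q (LI n w) \<noteq> \<beta>" for w x q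
      using that
    proof (induction w arbitrary: x q rule: list.induct)
      case (Cons l w)
      show ?case
      proof (cases l)
        case (Elt x' h)
        then show ?thesis using Cons by auto
      next
        case (Stable d)
        show ?thesis
        proof (cases "\<tau> d = v")
          case True
          then have "w = []" using Cons.prems Stable by (cases w; cases "hd w") auto
          then show ?thesis using Cons.prems Stable True by (auto simp: stp)
        next
          case False
          then show ?thesis using Cons Stable by auto
        qed
      qed
    qed simp
    have noV: "C.run q w = q \<otimes>\<^bsub>PG\<^esub> cls w \<and> C.comp q w = \<one>\<^bsub>VG v\<^esub>"
      if "w \<in> lists L" "\<And>g. Elt v g \<notin> set w" "q \<in> carrier PG" for w q
      using that
    proof (induction w arbitrary: q rule: list.induct)
      case (Cons l w)
      have w: "w \<in> lists L" and l: "l \<in> L" using Cons.prems by simp_all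
      show ?case
      proof (cases l)
        case (Elt x g)
        then have "x \<noteq> v" using Cons.prems(2) by auto
        then show ?thesis using Cons.IH[OF w, of "q \<otimes>\<^bsub>PG\<^esub> El x g"] Cons.prems(2,3) l Elt cls_Elt[of x g w] w cls_closed[OF w]
          by (simp add: stp PG.m_assoc)
      next
        case (Stable d)
        then show ?thesis using Cons.IH[OF w, of "q \<otimes>\<^bsub>PG\<^esub> St d"] Cons.prems(2,3) l cls_Stable[of d w] w cls_closed[OF w]
          by (simp add: stp PG.m_assoc)
      qed
    qed (simp add: cls_Nil)
    have M: "C.run p M = \<beta>" "C.comp p M = \<one>\<^bsub>VG v\<^esub>"
      using noV[OF Ml _ p] Elt_in_LI[OF b(1-3) ne, of v _ n] ne by (auto simp: \<beta>_def M_def)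
    have "C.run \<one>\<^bsub>PG\<^esub> (stem n ?w) = \<beta>"
      unfolding stem by (simp add: C.run_append p_def[symmetric] stp M)
    moreover have "C.comp \<one>\<^bsub>PG\<^esub> (stem n ?w) = \<one>\<^bsub>VG v\<^esub>"
      unfolding stem C.comp_append[OF LI_lists[OF a(1)] eMl]
      using LIa[OF a, of "\<one>\<^bsub>PG\<^esub>"] p\<beta> M v by (simp add: p_def[symmetric] stp monoid.l_one)
    ultimately show "counter.comp \<GG> v stp (C.run \<one>\<^bsub>PG\<^esub> (stem n ?w)) \<one>\<^bsub>PG\<^esub> (stem n ?w) = \<one>\<^bsub>VG v\<^esub>" by simp
  qed
qed

lemma detects_quadratic_growth:
  fixes len :: "'a \<Rightarrow> int"
  assumes u: "u \<in> V" and w: "w \<in> lists L" "path_word \<GG> u w (\<tau> (bar e))" "detects w" and y: "y \<in> carrier (VG v)"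
    and len: "len \<one>\<^bsub>VG v\<^esub> = 0" "\<And>a. a \<in> carrier (VG v) \<Longrightarrow> 0 \<le> len a"
      "\<And>a b. \<lbrakk>a \<in> carrier (VG v); b \<in> carrier (VG v)\<rbrakk> \<Longrightarrow> len (a \<otimes>\<^bsub>VG v\<^esub> b) \<le> len a + len b"
    and AB: "A > 0" "B \<ge> 0" "\<And>n. int n * int n \<le> A * len (syl n y) + B * int n + B"
  shows "at_least_quadratic_growth (pi1 \<GG> u) ind"
proof (rule at_least_quadratic_growthI[OF pi1_finitely_generated[OF u] _ AB])
  have Y: "probe w y \<in> paths u u" using probe_paths[OF w(1,2) y] .
  then show "probe w y \<in> carrier (pi1 \<GG> u)" by (simp add: pi1_carrier)
  fix S assume S: "finite S" "generating_set (pi1 \<GG> u) S"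
  \<comment> \<open>Only letters from \<open>v\<close> carry weight. This is the least non-negative
    weight that dominates \<open>len\<close> on the vertex group.\<close>
  define wt where "wt l = (case l of Elt x g \<Rightarrow> if x = v \<and> g \<in> carrier (VG v) then len g else 0 | Stable d \<Rightarrow> 0)"
    for l :: "('v, 'e, 'a) letter"
  have wt0: "0 \<le> wt l" for l using len(2) by (cases l) (auto simp: wt_def)
  obtain M where M: "M \<ge> 0" "\<And>X. X \<in> paths u u \<Longrightarrow>
      \<exists>W \<in> lists L. cls W = X \<and> (\<Sum>l\<leftarrow>W. wt l) \<le> M * int (word_length (pi1 \<GG> u) S X)"
    using word_representative[of S u wt, OF S wt0] by blast
  have "len (syl n y) \<le> M * int (word_length (pi1 \<GG> u) S ((ind ^^ n) (probe w y)))" for n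
  proof -
    obtain W where W: "W \<in> lists L" "cls W = (ind ^^ n) (probe w y)"
      "(\<Sum>l\<leftarrow>W. wt l) \<le> M * int (word_length (pi1 \<GG> u) S ((ind ^^ n) (probe w y)))"
      using M(2)[OF ind_pow_paths[OF Y, of n]] by blast
    have "len (syl n y) \<le> (\<Sum>l\<leftarrow>W. wt l)"
      using w(3) y len(1,3) wt0 W(1,2) unfolding detects_def by (auto simp: wt_def)
    then show ?thesis using W(3) by simp
  qed
  then show "\<exists>M\<ge>0. \<forall>n. len (syl n y) \<le> M * int (word_length (pi1 \<GG> u) S ((ind ^^ n) (probe w y)))"
    using M(1) by blast
qed

end

text \<open>Growth of elements is not invariant under inner automorphisms, so the base vertex
  matters. If no element at \<open>u\<close> traverses \<open>e\<close>, each has a loop avoiding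
  \<open>e\<close>, and the correction term does not enter its image.\<close>

theorem theorem1p1:
  fixes \<GG> :: "('v, 'e, 'a, 'b) gog" and H :: "('v, 'e, 'a, 'b) gog_aut"
    and V :: "'v set" and v :: 'v and e :: 'e
  assumes "graph_of_groups \<GG>"
    and "partial_dehn_twist \<GG> H V"
    and "v \<in> V"
    and "free_group (vgrp \<GG> v)"
    and "dehn_twist_automorphism (vgrp \<GG> v) (vhom H v)"
    and "efficiently_represented (vgrp \<GG> v) (vhom H v)"
    and "e \<in> gedges \<GG>" and "tau \<GG> e = v"
    and "\<not> aut_zero (vgrp \<GG> v) (vhom H v) (inv\<^bsub>vgrp \<GG> v\<^esub> (corr H e))"
  shows "at_least_quadratic_growth (pi1 \<GG> (tau \<GG> (ebar \<GG> e))) (induced \<GG> H) \<and>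
    (\<forall>u \<in> gverts \<GG>. (\<exists>X \<in> carrier (pi1 \<GG> u). traverses \<GG> u e X) \<longrightarrow>
       at_least_quadratic_growth (pi1 \<GG> u) (induced \<GG> H))"
proof -
  note twist = assms(2)[unfolded partial_dehn_twist_def]
  interpret A: gog_id_aut \<GG> H
    using assms(1) twist by unfold_locales auto
  have ehom: "ehom H d g = g" if "d \<in> gedges \<GG>" "g \<in> carrier (egrp \<GG> d)" for d g
    using twist that by blast
  interpret T: twist_at \<GG> H e
    using assms(3,7,8) twist A.ind_inj[OF ehom] by unfold_locales auto
  have v: "v \<in> gverts \<GG>" using T.v assms(8) by simp
  interpret Gv: group "vgrp \<GG> v" using v by simp
  obtain \<HH> :: nat_gog and D u0 \<theta> where eff: "efficient \<HH> D" and rep: "represents \<HH> D u0 \<theta> (vgrp \<GG> v) (vhom H v)"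
    using assms(6) unfolding efficiently_represented_def by blast
  have D: "dehn_twist \<HH> D" and u0: "u0 \<in> gverts \<HH>" and \<theta>: "\<theta> \<in> iso (vgrp \<GG> v) (pi1 \<HH> u0)"
    and \<theta>_vhom: "\<And>x. x \<in> carrier (vgrp \<GG> v) \<Longrightarrow> vhom H v x = inv_into (carrier (vgrp \<GG> v)) \<theta> (induced \<HH> D (\<theta> x))"
    using rep by (auto simp: represents_def)
  have "\<forall>u \<in> gverts \<HH>. free_group_finite_rank_ge2 (pi1 \<HH> u)" using eff[unfolded efficient_def] by (elim conjE)
  then obtain X where X: "free_basis (pi1 \<HH> u0) X" "finite X"
    using u0 unfolding free_group_finite_rank_ge2_def by blast
  interpret F: eff_dehn \<HH> D u0 X
  proof unfold_locales
    show "gog_automorphism \<HH> D" "identity_on_graph \<HH> D" using D[unfolded dehn_twist_def] by - (elim conjE, assumption)+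
    then show "graph_of_groups \<HH>" unfolding gog_automorphism_def by (elim conjE)
  qed (fact eff u0 X)+
  interpret \<theta>: group_hom "vgrp \<GG> v" "pi1 \<HH> u0" \<theta>
    using \<theta> F.pi1_group by unfold_locales (simp add: iso_def)
  have im: "\<theta> ` carrier (vgrp \<GG> v) = F.C"
    using \<theta> by (simp add: iso_def bij_betw_def F.pi1_carrier)
  have \<theta>C: "\<theta> x \<in> F.C" if "x \<in> carrier (vgrp \<GG> v)" for x using im that by blast
  have \<theta>m: "\<theta> (x \<otimes>\<^bsub>vgrp \<GG> v\<^esub> y) = \<theta> x \<otimes>\<^bsub>path_group \<HH>\<^esub> \<theta> y"
    if "x \<in> carrier (vgrp \<GG> v)" "y \<in> carrier (vgrp \<GG> v)" for x y
    using \<theta>.hom_mult[OF that] by simp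
  have \<theta>1: "\<theta> \<one>\<^bsub>vgrp \<GG> v\<^esub> = \<one>\<^bsub>path_group \<HH>\<^esub>" using \<theta>.hom_one by simp
  have \<theta>i: "\<theta> (inv\<^bsub>vgrp \<GG> v\<^esub> x) = inv\<^bsub>path_group \<HH>\<^esub> \<theta> x" if "x \<in> carrier (vgrp \<GG> v)" for x
    using \<theta>.hom_inv[OF that] F.pi1_inv[OF \<theta>C[OF that]] by simp
  have \<theta>v: "\<theta> (vhom H v x) = induced \<HH> D (\<theta> x)" if x: "x \<in> carrier (vgrp \<GG> v)" for x
    unfolding \<theta>_vhom[OF x] using F.ind_paths[OF \<theta>C[OF x]] im by (intro f_inv_into_f) blast
  define \<delta> where "\<delta> = inv\<^bsub>vgrp \<GG> v\<^esub> corr H e"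
  have \<delta>: "\<delta> \<in> carrier (vgrp \<GG> v)" using A.corr_closed[OF assms(7)] assms(8) by (simp add: \<delta>_def)
  have nz: "\<not> zero_element \<HH> D (\<theta> \<delta>)" using assms(9) eff rep unfolding aut_zero_def \<delta>_def by blast
  define P where "P y A B n \<longleftrightarrow> int n * int n \<le> A * F.fl (F.twp (\<theta> \<delta>) n \<otimes>\<^bsub>path_group \<HH>\<^esub> (induced \<HH> D ^^ n) y
      \<otimes>\<^bsub>path_group \<HH>\<^esub> inv\<^bsub>path_group \<HH>\<^esub> F.twp (\<theta> \<delta>) n) + B * int n + B" for y A B n
  have "\<exists>y \<in> F.C. \<exists>A B. A > 0 \<and> B \<ge> 0 \<and> (\<forall>n. P y A B n)"
    unfolding P_def by (rule F.eff_growth[OF \<theta>C[OF \<delta>] nz])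
  then obtain y A B where y: "y \<in> F.C" and AB: "A > 0" "B \<ge> 0" and low: "\<And>n. P y A B n" by blast
  from y obtain y0 where y0: "y0 \<in> carrier (vgrp \<GG> v)" "\<theta> y0 = y" unfolding im[symmetric] by (elim imageE) simp
  have cc: "A.cc n e \<in> carrier (vgrp \<GG> v)" for n using A.cc_closed[OF assms(7), of n] assms(8) by simp
  have vh: "A.vh n v y0 \<in> carrier (vgrp \<GG> v)" for n using A.vh_closed[OF v y0(1)] .
  \<comment> \<open>Both sides obey the same recursion: a factor \<open>\<delta>\<close> on the
    left, then one application of the automorphism to the previous term.\<close>
  have \<theta>cc: "\<theta> (inv\<^bsub>vgrp \<GG> v\<^esub> A.cc n e) = F.twp (\<theta> \<delta>) n" for n
  proof (induction n)
    case (Suc n)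
    have "inv\<^bsub>vgrp \<GG> v\<^esub> A.cc (Suc n) e = \<delta> \<otimes>\<^bsub>vgrp \<GG> v\<^esub> vhom H v (inv\<^bsub>vgrp \<GG> v\<^esub> A.cc n e)"
      using cc[of n] A.corr_closed[OF assms(7)] assms(8) A.vhom_closed[OF v cc, of n]
        group_hom.hom_inv[OF A.vhom_hom[OF v] cc, of n]
      by (simp add: \<delta>_def Gv.inv_mult_group)
    then show ?case using \<theta>m[OF \<delta> A.vhom_closed[OF v Gv.inv_closed[OF cc[of n]]]] \<theta>v[OF Gv.inv_closed[OF cc[of n]]] Suc by simp
  qed (use assms(8) \<theta>1 in simp)
  have \<theta>vh: "\<theta> (A.vh n v y0) = (induced \<HH> D ^^ n) y" for n
  proof (induction n)
    case (Suc n)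
    then show ?case using \<theta>v[OF vh[of n]] by (simp add: A.vh_def)
  qed (simp add: A.vh_def y0(2))
  \<comment> \<open>Elements of the vertex group are measured by word length in the fundamental
    group of the efficient representative, where the quadratic bound is known.\<close>
  define len where "len x = F.fl (\<theta> x)" for x
  have syl: "\<theta> (T.syl n y0) = F.twp (\<theta> \<delta>) n \<otimes>\<^bsub>path_group \<HH>\<^esub> (induced \<HH> D ^^ n) y
      \<otimes>\<^bsub>path_group \<HH>\<^esub> inv\<^bsub>path_group \<HH>\<^esub> F.twp (\<theta> \<delta>) n" for n
  proof -
    have "F.twp (\<theta> \<delta>) n = inv\<^bsub>path_group \<HH>\<^esub> \<theta> (A.cc n e)" using \<theta>cc[of n] \<theta>i[OF cc[of n]] by simp
    then have "\<theta> (A.cc n e) = inv\<^bsub>path_group \<HH>\<^esub> F.twp (\<theta> \<delta>) n" using F.paths_closed[OF \<theta>C[OF cc[of n]]] by simp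
    then show ?thesis unfolding T.syl_def assms(8) using cc[of n] vh[of n] by (simp add: \<theta>m \<theta>cc \<theta>vh)
  qed
  have growth: "at_least_quadratic_growth (pi1 \<GG> u) (induced \<GG> H)"
    if "u \<in> gverts \<GG>" "w \<in> lists (letters \<GG>)" "path_word \<GG> u w (tau \<GG> (ebar \<GG> e))" "T.detects w" for u w
  proof (rule T.detects_quadratic_growth[OF that, where len = len and A = A and B = B and y = y0])
    show "y0 \<in> carrier (vgrp \<GG> (tau \<GG> e))" using y0 assms(8) by simp
    show "len \<one>\<^bsub>vgrp \<GG> (tau \<GG> e)\<^esub> = 0" using \<theta>1 F.fl_one assms(8) by (simp add: len_def)
    show "0 \<le> len a" if "a \<in> carrier (vgrp \<GG> (tau \<GG> e))" for a
      using that F.fl_nonneg \<theta>C assms(8) by (simp add: len_def)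
    show "len (a \<otimes>\<^bsub>vgrp \<GG> (tau \<GG> e)\<^esub> b) \<le> len a + len b"
      if "a \<in> carrier (vgrp \<GG> (tau \<GG> e))" "b \<in> carrier (vgrp \<GG> (tau \<GG> e))" for a b
      using that F.fl_mult \<theta>C \<theta>m assms(8) by (simp add: len_def)
    show "int n * int n \<le> A * len (T.syl n y0) + B * int n + B" for n using low[of n] syl[of n] by (simp add: len_def P_def)
  qed (fact AB)+
  have "T.detects []" by (rule T.detects_direct) simp_all
  then have "at_least_quadratic_growth (pi1 \<GG> (tau \<GG> (ebar \<GG> e))) (induced \<GG> H)"
    using growth[of "tau \<GG> (ebar \<GG> e)" "[]"] assms(7) by simp
  moreover have "at_least_quadratic_growth (pi1 \<GG> u) (induced \<GG> H)"
    if u: "u \<in> gverts \<GG>" and Y: "Y \<in> carrier (pi1 \<GG> u)" "traverses \<GG> u e Y" for u Y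
    using A.traverses_cases[OF assms(7) Y(1)[unfolded A.pi1_carrier] Y(2)]
  proof (elim disjE bexE conjE)
    fix a assume a: "a \<in> lists (letters \<GG>)" "path_word \<GG> u a (tau \<GG> (ebar \<GG> e))"
      "\<forall>l \<in> set a. l \<noteq> Stable e \<and> l \<noteq> Stable (ebar \<GG> e)"
    then have "T.detects a" by (intro T.detects_direct) auto
    then show ?thesis using growth[OF u a(1,2)] by blast
  next
    fix a b assume a: "a \<in> lists (letters \<GG>)" "path_word \<GG> u a (tau \<GG> e)" "\<forall>l \<in> set a. A.src l \<noteq> tau \<GG> e"
      and b: "b \<in> lists (letters \<GG>)" "path_word \<GG> (tau \<GG> (ebar \<GG> e)) b (tau \<GG> (ebar \<GG> e))"
        "\<forall>l \<in> set b. A.src l \<noteq> tau \<GG> e" and ne: "tau \<GG> (ebar \<GG> e) \<noteq> tau \<GG> e"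
      and nb: "path_cong \<GG> `` {b} \<noteq> \<one>\<^bsub>path_group \<GG>\<^esub>"
    have "T.detects (a @ Stable (ebar \<GG> e) # b)" by (rule T.detects_detour[OF a b nb ne])
    moreover have "a @ Stable (ebar \<GG> e) # b \<in> lists (letters \<GG>)" using a(1) b(1) assms(7) by simp
    moreover have "path_word \<GG> u (a @ Stable (ebar \<GG> e) # b) (tau \<GG> (ebar \<GG> e))"
      using a(2) b(2) by (auto simp: A.path_word_append)
    ultimately show ?thesis using growth[OF u] by blast
  qed
  ultimately show ?thesis by blast
qed

end
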